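(* Let $G$ be a finite group and let $k$ be a field-like $G$-Tambara functor. Then there are a subgroup $H\subset G$ and a field-like $H$-Tambara functor $\ell$ such that $\ell(H/e)$ is a field and $k\cong \mathrm{Coind}_H^G \ell$ as $G$-Tambara functors.
   Context: Let $\mathrm{bispan}(G\text{-}\mathrm{Set}^{\mathrm{fin}})$ be the category whose objects are finite $G$-sets and whose morphisms from $X$ to $Y$ are isomorphism classes of diagrams $X\leftarrow A\to B\to Y$ of finite $G$-sets, with the usual composition of bispans (polynomials), defined via pullbacks and exponential diagrams. A $G$-Tambara functor is a product-preserving functor $R:\mathrm{bispan}(G\text{-}\mathrm{Set}^{\mathrm{fin}})\to \mathrm{Set}$ such that the additive monoid $R(X)$ is a group for each finite $G$-set $X$; morphisms are natural transformations. For $f:X\to Y$ the restriction, norm and transfer along $f$ are the images of $Y\xleftarrow{f} X= X= X$, of $X= X\xrightarrow{f} Y= Y$, and of $X= X= X\xrightarrow{f} Y$. Transfer and norm along the fold map $X\sqcup X\to X$ give addition and multiplication, making $R(X)$ a commutative ring. The same definitions apply to every finite group. A (Tambara, or Nakaoka) ideal $I$ of $R$ is a collection of ideals $I(G/K)\subset R(G/K)$ closed under restrictions, conjugations, transfers and norms along maps of transitive $G$-sets (equivalently, a levelwise kernel of a morphism of Tambara functors). $R$ is field-like (also called a Tambara field) if it is nonzero and its only ideals are $0$ and $R$. For $H\subset G$ and an $H$-Tambara functor $T$, $\mathrm{Coind}_H^G T := T\circ \mathrm{res}_H^G$, i.e. $(\mathrm{Coind}_H^G T)(X)=T(\mathrm{res}_H^G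 X)$, where $\mathrm{res}_H^G$ sends a $G$-set to its underlying $H$-set. *)

theory Defs
  imports
    "HOL-Library.FuncSet"
    "HOL-Algebra.Left_Coset"
    "HOL-Algebra.Group_Action"
    "HOL-Algebra.Ideal"
begin

section \<open>Finite G-sets\<close>

text \<open>
  The objects of the bispan category have their points in the following type. It contains the
  cosets of all subgroups and is closed under two tags, so orbits and binary disjoint unions
  can be formed literally; being infinite, it contains a copy of every finite G-set.
\<close>

datatype 'g point = Coset "'g set" | InL "'g point" | InR "'g point"

record ('g, 'p) gset =
  pts :: "'p set"
  act :: "'g \<Rightarrow> 'p \<Rightarrow> 'p"

type_synonym 'g objct = "('g, 'g point) gset"

definition finite_gset :: "('g, 'm) monoid_scheme \<Rightarrow> ('g, 'p) gset \<Rightarrow> bool" where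
  "finite_gset G X \<longleftrightarrow> group_action G (pts X) (act X) \<and> finite (pts X)"

definition gmap :: "('g, 'm) monoid_scheme \<Rightarrow> ('g, 'p) gset \<Rightarrow> ('g, 'q) gset \<Rightarrow> ('p \<Rightarrow> 'q) set" where
  "gmap G X Y = {f \<in> pts X \<rightarrow>\<^sub>E pts Y. \<forall>g\<in>carrier G. \<forall>x\<in>pts X. f (act X g x) = act Y g (f x)}"

definition gset_id :: "('g, 'p) gset \<Rightarrow> 'p \<Rightarrow> 'p" where
  "gset_id X = (\<lambda>x\<in>pts X. x)"

definition empty_gset :: "('g, 'p) gset" where
  "empty_gset = \<lparr>pts = {}, act = (\<lambda>g x. undefined)\<rparr>"

definition sum_gset :: "'g objct \<Rightarrow> 'g objct \<Rightarrow> 'g objct" where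
  "sum_gset X Y =
     \<lparr>pts = InL ` pts X \<union> InR ` pts Y,
      act = (\<lambda>g. \<lambda>z\<in>InL ` pts X \<union> InR ` pts Y.
               case z of InL x \<Rightarrow> InL (act X g x) | InR y \<Rightarrow> InR (act Y g y) | Coset C \<Rightarrow> undefined)\<rparr>"

definition inl_map :: "'g objct \<Rightarrow> 'g point \<Rightarrow> 'g point" where
  "inl_map X = (\<lambda>x\<in>pts X. InL x)"

definition inr_map :: "'g objct \<Rightarrow> 'g point \<Rightarrow> 'g point" where
  "inr_map Y = (\<lambda>y\<in>pts Y. InR y)"

definition fold_map :: "'g objct \<Rightarrow> 'g point \<Rightarrow> 'g point" where
  "fold_map X = (\<lambda>z\<in>pts (sum_gset X X).
     case z of InL x \<Rightarrow> x | InR x \<Rightarrow> x | Coset C \<Rightarrow> undefined)"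

text \<open>The transitive G-set G/K of left cosets.\<close>

definition orbit_gset :: "('g, 'm) monoid_scheme \<Rightarrow> 'g set \<Rightarrow> 'g objct" where
  "orbit_gset G K =
     \<lparr>pts = Coset ` (lcosets\<^bsub>G\<^esub> K),
      act = (\<lambda>g. \<lambda>z\<in>Coset ` (lcosets\<^bsub>G\<^esub> K).
               case z of Coset C \<Rightarrow> Coset (g <#\<^bsub>G\<^esub> C) | InL x \<Rightarrow> undefined | InR x \<Rightarrow> undefined)\<rparr>"

text \<open>The fibre product of f and h.\<close>

definition pullback_gset ::
  "('g, 'p) gset \<Rightarrow> ('p \<Rightarrow> 'r) \<Rightarrow> ('g, 'q) gset \<Rightarrow> ('q \<Rightarrow> 'r) \<Rightarrow> ('g, 'p \<times> 'q) gset" where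
  "pullback_gset X f Y h =
     (let P = {(x, y). x \<in> pts X \<and> y \<in> pts Y \<and> f x = h y}
      in \<lparr>pts = P, act = (\<lambda>g. \<lambda>(x, y)\<in>P. (act X g x, act Y g y))\<rparr>)"

text \<open>
  The dependent product along f: X to Y of a G-set q: A to X over X. Its points over y are the
  sections of q over the fibre of f at y, and G acts on them by conjugation. With E this
  dependent product and F the fibre product of X and E over Y, the exponential diagram of q and f
  is A \<leftarrow> F \<rightarrow> E \<rightarrow> Y, whose first map is evaluation.
\<close>

definition dep_prod_gset ::
  "('g, 'm) monoid_scheme \<Rightarrow> ('g, 'a) gset \<Rightarrow> ('a \<Rightarrow> 'p) \<Rightarrow> ('g, 'p) gset \<Rightarrow> ('p \<Rightarrow> 'q) \<Rightarrow> ('g, 'q) gset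
     \<Rightarrow> ('g, 'q \<times> ('p \<Rightarrow> 'a)) gset" where
  "dep_prod_gset G A q X f Y =
     (let E = {(y, s). y \<in> pts Y \<and> s \<in> {x\<in>pts X. f x = y} \<rightarrow>\<^sub>E pts A \<and>
                       (\<forall>x\<in>pts X. f x = y \<longrightarrow> q (s x) = x)}
      in \<lparr>pts = E,
          act = (\<lambda>g. \<lambda>(y, s)\<in>E.
            (act Y g y,
             \<lambda>x\<in>{x\<in>pts X. f x = act Y g y}. act A g (s (act X (inv\<^bsub>G\<^esub> g) x))))\<rparr>)"


section \<open>The category of bispans\<close>

text \<open>
  A bispan src \<leftarrow> lmid \<rightarrow> rmid \<rightarrow> tgt. The two inner G-sets may have points in arbitrary types,
  which is needed for composites; a morphism of the category is an isomorphism class of bispans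
  whose inner G-sets are again objects.
\<close>

record ('g, 'a, 'b) bispan =
  src :: "'g objct"
  lmid :: "('g, 'a) gset"
  rmid :: "('g, 'b) gset"
  tgt :: "'g objct"
  rleg :: "'a \<Rightarrow> 'g point"
  nleg :: "'a \<Rightarrow> 'b"
  tleg :: "'b \<Rightarrow> 'g point"

type_synonym 'g mor = "('g, 'g point, 'g point) bispan set"

definition is_bispan :: "('g, 'm) monoid_scheme \<Rightarrow> ('g, 'a, 'b) bispan \<Rightarrow> bool" where
  "is_bispan G S \<longleftrightarrow>
     finite_gset G (src S) \<and> finite_gset G (lmid S) \<and> finite_gset G (rmid S) \<and> finite_gset G (tgt S) \<and>
     rleg S \<in> gmap G (lmid S) (src S) \<and> nleg S \<in> gmap G (lmid S) (rmid S) \<and>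
     tleg S \<in> gmap G (rmid S) (tgt S)"

definition bispan_iso ::
  "('g, 'm) monoid_scheme \<Rightarrow> ('g, 'a, 'b) bispan \<Rightarrow> ('g, 'c, 'd) bispan \<Rightarrow> bool" where
  "bispan_iso G S S' \<longleftrightarrow>
     src S = src S' \<and> tgt S = tgt S' \<and>
     (\<exists>\<alpha>\<in>gmap G (lmid S) (lmid S'). \<exists>\<beta>\<in>gmap G (rmid S) (rmid S').
        bij_betw \<alpha> (pts (lmid S)) (pts (lmid S')) \<and>
        bij_betw \<beta> (pts (rmid S)) (pts (rmid S')) \<and>
        (\<forall>a\<in>pts (lmid S). rleg S' (\<alpha> a) = rleg S a \<and> nleg S' (\<alpha> a) = \<beta> (nleg S a)) \<and>
        (\<forall>b\<in>pts (rmid S). tleg S' (\<beta> b) = tleg S b))"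

definition bispan_class :: "('g, 'm) monoid_scheme \<Rightarrow> ('g, 'a, 'b) bispan \<Rightarrow> 'g mor" where
  "bispan_class G S = {S'. is_bispan G S' \<and> bispan_iso G S' S}"

definition bispan_hom :: "('g, 'm) monoid_scheme \<Rightarrow> 'g objct \<Rightarrow> 'g objct \<Rightarrow> 'g mor set" where
  "bispan_hom G X Y =
     {bispan_class G S | S :: ('g, 'g point, 'g point) bispan.
        is_bispan G S \<and> src S = X \<and> tgt S = Y}"

text \<open>
  The composite of P = (X \<leftarrow> A \<rightarrow> B \<rightarrow> Y) followed by Q = (Y \<leftarrow> C \<rightarrow> D \<rightarrow> Z). Here B' is the
  pullback of B and C over Y, A' the pullback of A and B' over B, E the dependent product of
  B' \<rightarrow> C along C \<rightarrow> D, C' the pullback of C and E over D with its evaluation map ev to B', and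
  A'' the pullback of A' and C' over B'. The composite is X \<leftarrow> A'' \<rightarrow> E \<rightarrow> Z.
\<close>

definition bispan_comp ::
  "('g, 'm) monoid_scheme \<Rightarrow> ('g, 'c, 'd) bispan \<Rightarrow> ('g, 'a, 'b) bispan
     \<Rightarrow> ('g, ('a \<times> 'b \<times> 'c) \<times> 'c \<times> 'd \<times> ('c \<Rightarrow> 'b \<times> 'c), 'd \<times> ('c \<Rightarrow> 'b \<times> 'c)) bispan" where
  "bispan_comp G Q P =
     (let B' = pullback_gset (rmid P) (tleg P) (lmid Q) (rleg Q);
          A' = pullback_gset (lmid P) (nleg P) B' fst;
          E = dep_prod_gset G B' snd (lmid Q) (nleg Q) (rmid Q);
          C' = pullback_gset (lmid Q) (nleg Q) E fst;
          ev = (\<lambda>(c, d, s). s c);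
          A'' = pullback_gset A' snd C' ev
      in \<lparr>src = src P, lmid = A'', rmid = E, tgt = tgt Q,
          rleg = (\<lambda>w\<in>pts A''. rleg P (fst (fst w))),
          nleg = (\<lambda>w\<in>pts A''. snd (snd w)),
          tleg = (\<lambda>e\<in>pts E. tleg Q (fst e))\<rparr>)"

definition mor_comp :: "('g, 'm) monoid_scheme \<Rightarrow> 'g mor \<Rightarrow> 'g mor \<Rightarrow> 'g mor" where
  "mor_comp G d c = (\<Union>Q\<in>d. \<Union>P\<in>c. bispan_class G (bispan_comp G Q P))"

text \<open>For f: X to Y, the bispans Y \<leftarrow> X = X = X, X = X \<rightarrow> Y = Y and X = X = X \<rightarrow> Y.\<close>

definition res_bispan :: "'g objct \<Rightarrow> 'g objct \<Rightarrow> ('g point \<Rightarrow> 'g point) \<Rightarrow> ('g, 'g point, 'g point) bispan" where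
  "res_bispan X Y f = \<lparr>src = Y, lmid = X, rmid = X, tgt = X,
     rleg = f, nleg = gset_id X, tleg = gset_id X\<rparr>"

definition norm_bispan :: "'g objct \<Rightarrow> 'g objct \<Rightarrow> ('g point \<Rightarrow> 'g point) \<Rightarrow> ('g, 'g point, 'g point) bispan" where
  "norm_bispan X Y f = \<lparr>src = X, lmid = X, rmid = Y, tgt = Y,
     rleg = gset_id X, nleg = f, tleg = gset_id Y\<rparr>"

definition tr_bispan :: "'g objct \<Rightarrow> 'g objct \<Rightarrow> ('g point \<Rightarrow> 'g point) \<Rightarrow> ('g, 'g point, 'g point) bispan" where
  "tr_bispan X Y f = \<lparr>src = X, lmid = X, rmid = X, tgt = Y,
     rleg = gset_id X, nleg = gset_id X, tleg = f\<rparr>"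

definition mor_id :: "('g, 'm) monoid_scheme \<Rightarrow> 'g objct \<Rightarrow> 'g mor" where
  "mor_id G X = bispan_class G (res_bispan X X (gset_id X))"


section \<open>Tambara functors\<close>

text \<open>Set-valued functors on bispans; the values are subsets of one type.\<close>

record ('g, 'r) bfunctor =
  ob :: "'g objct \<Rightarrow> 'r set"
  ar :: "'g mor \<Rightarrow> 'r \<Rightarrow> 'r"

definition bispan_functor :: "('g, 'm) monoid_scheme \<Rightarrow> ('g, 'r) bfunctor \<Rightarrow> bool" where
  "bispan_functor G R \<longleftrightarrow>
     (\<forall>X Y. \<forall>c\<in>bispan_hom G X Y. ar R c \<in> ob R X \<rightarrow>\<^sub>E ob R Y) \<and>
     (\<forall>X. finite_gset G X \<longrightarrow> ar R (mor_id G X) = (\<lambda>x\<in>ob R X. x)) \<and>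
     (\<forall>X Y Z. \<forall>c\<in>bispan_hom G X Y. \<forall>d\<in>bispan_hom G Y Z.
        ar R (mor_comp G d c) = compose (ob R X) (ar R d) (ar R c))"

definition Res :: "('g, 'm) monoid_scheme \<Rightarrow> ('g, 'r) bfunctor \<Rightarrow> 'g objct \<Rightarrow> 'g objct
     \<Rightarrow> ('g point \<Rightarrow> 'g point) \<Rightarrow> 'r \<Rightarrow> 'r" where
  "Res G R X Y f = ar R (bispan_class G (res_bispan X Y f))"

definition Nm :: "('g, 'm) monoid_scheme \<Rightarrow> ('g, 'r) bfunctor \<Rightarrow> 'g objct \<Rightarrow> 'g objct
     \<Rightarrow> ('g point \<Rightarrow> 'g point) \<Rightarrow> 'r \<Rightarrow> 'r" where
  "Nm G R X Y f = ar R (bispan_class G (norm_bispan X Y f))"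

definition Tr :: "('g, 'm) monoid_scheme \<Rightarrow> ('g, 'r) bfunctor \<Rightarrow> 'g objct \<Rightarrow> 'g objct
     \<Rightarrow> ('g point \<Rightarrow> 'g point) \<Rightarrow> 'r \<Rightarrow> 'r" where
  "Tr G R X Y f = ar R (bispan_class G (tr_bispan X Y f))"

text \<open>
  The product of X and Y in the category of bispans is their disjoint union, with the restrictions
  along the two inclusions as projections, and the empty G-set is terminal. Both universal
  properties are proved below (sum_gset_product, empty_gset_terminal).
\<close>

definition split_map :: "('g, 'm) monoid_scheme \<Rightarrow> ('g, 'r) bfunctor \<Rightarrow> 'g objct \<Rightarrow> 'g objct
     \<Rightarrow> 'r \<Rightarrow> 'r \<times> 'r" where
  "split_map G R X Y z =
     (Res G R X (sum_gset X Y) (inl_map X) z, Res G R Y (sum_gset X Y) (inr_map Y) z)"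

definition product_preserving :: "('g, 'm) monoid_scheme \<Rightarrow> ('g, 'r) bfunctor \<Rightarrow> bool" where
  "product_preserving G R \<longleftrightarrow>
     (\<forall>X Y. finite_gset G X \<longrightarrow> finite_gset G Y \<longrightarrow>
        bij_betw (split_map G R X Y) (ob R (sum_gset X Y)) (ob R X \<times> ob R Y)) \<and>
     is_singleton (ob R empty_gset)"

definition pair_elt :: "('g, 'm) monoid_scheme \<Rightarrow> ('g, 'r) bfunctor \<Rightarrow> 'g objct \<Rightarrow> 'r \<Rightarrow> 'r \<Rightarrow> 'r" where
  "pair_elt G R X a b = the_inv_into (ob R (sum_gset X X)) (split_map G R X X) (a, b)"

text \<open>
  Addition and multiplication are transfer and norm along the fold map; zero and one are their
  nullary versions, transfer and norm of the unique element along the map from the empty G-set.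
\<close>

definition level :: "('g, 'm) monoid_scheme \<Rightarrow> ('g, 'r) bfunctor \<Rightarrow> 'g objct \<Rightarrow> 'r ring" where
  "level G R X =
     \<lparr>carrier = ob R X,
      mult = (\<lambda>a b. Nm G R (sum_gset X X) X (fold_map X) (pair_elt G R X a b)),
      one = Nm G R empty_gset X (\<lambda>_. undefined) (the_elem (ob R empty_gset)),
      zero = Tr G R empty_gset X (\<lambda>_. undefined) (the_elem (ob R empty_gset)),
      add = (\<lambda>a b. Tr G R (sum_gset X X) X (fold_map X) (pair_elt G R X a b))\<rparr>"

definition tambara_functor :: "('g, 'm) monoid_scheme \<Rightarrow> ('g, 'r) bfunctor \<Rightarrow> bool" where
  "tambara_functor G R \<longleftrightarrow>
     bispan_functor G R \<and> product_preserving G R \<and>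
     (\<forall>X. finite_gset G X \<longrightarrow> group (add_monoid (level G R X)))"

definition tambara_hom :: "('g, 'm) monoid_scheme \<Rightarrow> ('g, 'r) bfunctor \<Rightarrow> ('g, 's) bfunctor
     \<Rightarrow> ('g objct \<Rightarrow> 'r \<Rightarrow> 's) \<Rightarrow> bool" where
  "tambara_hom G R S \<eta> \<longleftrightarrow>
     (\<forall>X. finite_gset G X \<longrightarrow> \<eta> X \<in> ob R X \<rightarrow>\<^sub>E ob S X) \<and>
     (\<forall>X Y. \<forall>c\<in>bispan_hom G X Y. \<forall>x\<in>ob R X. \<eta> Y (ar R c x) = ar S c (\<eta> X x))"

definition tambara_iso :: "('g, 'm) monoid_scheme \<Rightarrow> ('g, 'r) bfunctor \<Rightarrow> ('g, 's) bfunctor \<Rightarrow> bool" where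
  "tambara_iso G R S \<longleftrightarrow>
     (\<exists>\<eta> \<theta>. tambara_hom G R S \<eta> \<and> tambara_hom G S R \<theta> \<and>
        (\<forall>X. finite_gset G X \<longrightarrow>
           (\<forall>x\<in>ob R X. \<theta> X (\<eta> X x) = x) \<and> (\<forall>y\<in>ob S X. \<eta> X (\<theta> X y) = y)))"

text \<open>Conjugations are among the restrictions, along isomorphisms of orbits.\<close>

definition tambara_ideal :: "('g, 'm) monoid_scheme \<Rightarrow> ('g, 'r) bfunctor \<Rightarrow> ('g set \<Rightarrow> 'r set) \<Rightarrow> bool" where
  "tambara_ideal G R I \<longleftrightarrow>
     (\<forall>K. subgroup K G \<longrightarrow> ideal (I K) (level G R (orbit_gset G K))) \<and>
     (\<forall>K L. subgroup K G \<longrightarrow> subgroup L G \<longrightarrow>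
        (\<forall>f\<in>gmap G (orbit_gset G K) (orbit_gset G L).
           Res G R (orbit_gset G K) (orbit_gset G L) f ` I L \<subseteq> I K \<and>
           Nm G R (orbit_gset G K) (orbit_gset G L) f ` I K \<subseteq> I L \<and>
           Tr G R (orbit_gset G K) (orbit_gset G L) f ` I K \<subseteq> I L))"

definition field_like :: "('g, 'm) monoid_scheme \<Rightarrow> ('g, 'r) bfunctor \<Rightarrow> bool" where
  "field_like G R \<longleftrightarrow>
     tambara_functor G R \<and>
     (\<exists>X. finite_gset G X \<and> ob R X \<noteq> {\<zero>\<^bsub>level G R X\<^esub>}) \<and>
     (\<forall>I. tambara_ideal G R I \<longrightarrow>
        (\<forall>K. subgroup K G \<longrightarrow> I K = {\<zero>\<^bsub>level G R (orbit_gset G K)\<^esub>}) \<or>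
        (\<forall>K. subgroup K G \<longrightarrow> I K = ob R (orbit_gset G K)))"

abbreviation sub_group :: "('g, 'm) monoid_scheme \<Rightarrow> 'g set \<Rightarrow> ('g, 'm) monoid_scheme" where
  "sub_group G H \<equiv> G\<lparr>carrier := H\<rparr>"

text \<open>
  A G-set, as a pair of points and action map, is literally also an H-set, because the notion of
  action places no condition on group elements outside the group. So restriction to H does not
  change objects, and sends the isomorphism class of a bispan of G-sets to its isomorphism class
  as a bispan of H-sets.
\<close>

definition res_mor :: "('g, 'm) monoid_scheme \<Rightarrow> 'g set \<Rightarrow> 'g mor \<Rightarrow> 'g mor" where
  "res_mor G H c = (\<Union>S\<in>c. bispan_class (sub_group G H) S)"

definition coind :: "('g, 'm) monoid_scheme \<Rightarrow> 'g set \<Rightarrow> ('g, 'r) bfunctor \<Rightarrow> ('g, 'r) bfunctor" where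
  "coind G H T = \<lparr>ob = ob T, ar = (\<lambda>c. ar T (res_mor G H c))\<rparr>"


section \<open>Composition and finite products of bispans\<close>

text \<open>
  Composition of bispans respects isomorphism (mor_comp_class), and the disjoint union and the
  empty G-set are the binary product and the terminal object.
\<close>

lemma finite_gset_iff:
  assumes "group G"
  shows "finite_gset G X \<longleftrightarrow> finite (pts X) \<and>
    (\<forall>g\<in>carrier G. act X g \<in> pts X \<rightarrow>\<^sub>E pts X) \<and>
    (\<forall>x\<in>pts X. act X \<one>\<^bsub>G\<^esub> x = x) \<and>
    (\<forall>g\<in>carrier G. \<forall>h\<in>carrier G. \<forall>x\<in>pts X. act X (g \<otimes>\<^bsub>G\<^esub> h) x = act X g (act X h x))"
proof -
  interpret group G by fact
  show ?thesis
  proof (intro iffI)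
    assume f: "finite_gset G X"
    then interpret group_action G "pts X" "act X" by (simp add: finite_gset_def)
    show "finite (pts X) \<and>
    (\<forall>g\<in>carrier G. act X g \<in> pts X \<rightarrow>\<^sub>E pts X) \<and>
    (\<forall>x\<in>pts X. act X \<one>\<^bsub>G\<^esub> x = x) \<and>
    (\<forall>g\<in>carrier G. \<forall>h\<in>carrier G. \<forall>x\<in>pts X. act X (g \<otimes>\<^bsub>G\<^esub> h) x = act X g (act X h x))"
      using f bij_prop0 composition_rule id_eq_one[symmetric]
      by (auto simp: finite_gset_def Bij_def bij_betw_def PiE_def)
  next
    assume a: "finite (pts X) \<and>
    (\<forall>g\<in>carrier G. act X g \<in> pts X \<rightarrow>\<^sub>E pts X) \<and>
    (\<forall>x\<in>pts X. act X \<one>\<^bsub>G\<^esub> x = x) \<and>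
    (\<forall>g\<in>carrier G. \<forall>h\<in>carrier G. \<forall>x\<in>pts X. act X (g \<otimes>\<^bsub>G\<^esub> h) x = act X g (act X h x))"
    have b: "act X g \<in> Bij (pts X)" if g: "g \<in> carrier G" for g
    proof -
      have "bij_betw (act X g) (pts X) (pts X)"
      proof (rule bij_betw_byWitness[where f' = "act X (inv\<^bsub>G\<^esub> g)"])
        show "\<forall>x\<in>pts X. act X (inv\<^bsub>G\<^esub> g) (act X g x) = x"
          using a g by (metis inv_closed l_inv)
        show "\<forall>x\<in>pts X. act X g (act X (inv\<^bsub>G\<^esub> g) x) = x"
          using a g by (metis inv_closed r_inv)
      qed (use a g in \<open>auto simp: PiE_def Pi_def image_subset_iff\<close>)
      then show ?thesis using a g by (auto simp: Bij_def PiE_def)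
    qed
    have "act X \<in> hom G (BijGroup (pts X))"
    proof (rule homI)
      fix g h assume gh: "g \<in> carrier G" "h \<in> carrier G"
      show "act X (g \<otimes>\<^bsub>G\<^esub> h) = act X g \<otimes>\<^bsub>BijGroup (pts X)\<^esub> act X h"
        using gh b a b[of "g \<otimes>\<^bsub>G\<^esub> h"]
        by (auto simp: BijGroup_def compose_def Bij_def extensional_def fun_eq_iff)
    qed (use b in \<open>auto simp: BijGroup_def\<close>)
    then show "finite_gset G X"
      using a group_BijGroup by (auto simp: finite_gset_def group_action_def group_hom_def
          group_hom_axioms_def is_group)
  qed
qed

lemma finite_gsetD:
  assumes "group G" "finite_gset G X"
  shows "finite (pts X)"
    "\<And>g x. g \<in> carrier G \<Longrightarrow> x \<in> pts X \<Longrightarrow> act X g x \<in> pts X"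
    "\<And>x. x \<in> pts X \<Longrightarrow> act X \<one>\<^bsub>G\<^esub> x = x"
    "\<And>g h x. g \<in> carrier G \<Longrightarrow> h \<in> carrier G \<Longrightarrow> x \<in> pts X \<Longrightarrow> act X (g \<otimes>\<^bsub>G\<^esub> h) x = act X g (act X h x)"
    "\<And>g x. g \<in> carrier G \<Longrightarrow> x \<in> pts X \<Longrightarrow> act X (inv\<^bsub>G\<^esub> g) (act X g x) = x"
    "\<And>g x. g \<in> carrier G \<Longrightarrow> x \<in> pts X \<Longrightarrow> act X g (act X (inv\<^bsub>G\<^esub> g) x) = x"
    "\<And>g. g \<in> carrier G \<Longrightarrow> act X g \<in> extensional (pts X)"
proof -
  interpret group G by fact
  note * = assms(2)[unfolded finite_gset_iff[OF assms(1)]]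
  show "finite (pts X)"
    "\<And>g x. g \<in> carrier G \<Longrightarrow> x \<in> pts X \<Longrightarrow> act X g x \<in> pts X"
    "\<And>x. x \<in> pts X \<Longrightarrow> act X \<one>\<^bsub>G\<^esub> x = x"
    "\<And>g h x. g \<in> carrier G \<Longrightarrow> h \<in> carrier G \<Longrightarrow> x \<in> pts X \<Longrightarrow> act X (g \<otimes>\<^bsub>G\<^esub> h) x = act X g (act X h x)"
    "\<And>g. g \<in> carrier G \<Longrightarrow> act X g \<in> extensional (pts X)"
    using * by (auto simp: PiE_def Pi_def)
  show "\<And>g x. g \<in> carrier G \<Longrightarrow> x \<in> pts X \<Longrightarrow> act X (inv\<^bsub>G\<^esub> g) (act X g x) = x"
    using * by (metis inv_closed l_inv)
  show "\<And>g x. g \<in> carrier G \<Longrightarrow> x \<in> pts X \<Longrightarrow> act X g (act X (inv\<^bsub>G\<^esub> g) x) = x"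
    using * by (metis inv_closed r_inv)
qed

lemma gmapD:
  assumes "f \<in> gmap G X Y"
  shows "\<And>x. x \<in> pts X \<Longrightarrow> f x \<in> pts Y" "f \<in> extensional (pts X)"
   "\<And>g x. g \<in> carrier G \<Longrightarrow> x \<in> pts X \<Longrightarrow> f (act X g x) = act Y g (f x)"
  using assms by (auto simp: gmap_def PiE_def)

lemma pullback_finite_gset:
  assumes G: "group G" and X: "finite_gset G X" and Y: "finite_gset G Y"
    and f: "\<And>g x. g \<in> carrier G \<Longrightarrow> x \<in> pts X \<Longrightarrow> f (act X g x) = a g (f x)"
    and h: "\<And>g x. g \<in> carrier G \<Longrightarrow> x \<in> pts Y \<Longrightarrow> h (act Y g x) = a g (h x)"
  shows "finite_gset G (pullback_gset X f Y h)"
proof -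
  interpret group G by fact
  note x = finite_gsetD[OF G X] and y = finite_gsetD[OF G Y]
  have "finite {(u, v). u \<in> pts X \<and> v \<in> pts Y \<and> f u = h v}"
    by (rule finite_subset[of _ "pts X \<times> pts Y"]) (use x y in auto)
  then show ?thesis
    unfolding finite_gset_iff[OF G] using x y f h
    by (auto simp: pullback_gset_def Let_def PiE_def Pi_def)
qed

lemma dep_prod_finite_gset:
  assumes G: "group G" and A: "finite_gset G A" and X: "finite_gset G X" and Y: "finite_gset G Y"
    and q: "\<And>g a. g \<in> carrier G \<Longrightarrow> a \<in> pts A \<Longrightarrow> q (act A g a) = act X g (q a)"
    and f: "f \<in> gmap G X Y"
  shows "finite_gset G (dep_prod_gset G A q X f Y)"
proof -
  interpret group G by fact
  note a = finite_gsetD[OF G A] and x = finite_gsetD[OF G X] and y = finite_gsetD[OF G Y]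
   and f = gmapD[OF f]
  define E where "E = {(y, s). y \<in> pts Y \<and> s \<in> {x\<in>pts X. f x = y} \<rightarrow>\<^sub>E pts A \<and>
                       (\<forall>x\<in>pts X. f x = y \<longrightarrow> q (s x) = x)}"
  have p: "pts (dep_prod_gset G A q X f Y) = E" by (simp add: dep_prod_gset_def E_def Let_def)
  have ac: "act (dep_prod_gset G A q X f Y) = (\<lambda>g. \<lambda>(y, s)\<in>E.
            (act Y g y,
             \<lambda>x\<in>{x\<in>pts X. f x = act Y g y}. act A g (s (act X (inv\<^bsub>G\<^esub> g) x))))"
    by (simp add: dep_prod_gset_def E_def Let_def)
  have "finite (pts Y \<times> (\<Union>y\<in>pts Y. {x\<in>pts X. f x = y} \<rightarrow>\<^sub>E pts A))"
    by (intro finite_cartesian_product finite_UN_I finite_PiE) (use a x y in auto)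
  moreover have "E \<subseteq> pts Y \<times> (\<Union>y\<in>pts Y. {x\<in>pts X. f x = y} \<rightarrow>\<^sub>E pts A)"
    by (auto simp: E_def)
  ultimately have fin: "finite E" by (rule finite_subset[rotated])
  have bk: "f (act X (inv\<^bsub>G\<^esub> g) u) = v"
    if "g \<in> carrier G" "u \<in> pts X" "v \<in> pts Y" "f u = act Y g v" for g u v
    using that f(3)[of "inv\<^bsub>G\<^esub> g" u] y(5) by simp
  have cl: "(act Y g v, \<lambda>x\<in>{x\<in>pts X. f x = act Y g v}. act A g (s (act X (inv\<^bsub>G\<^esub> g) x))) \<in> E"
    if g: "g \<in> carrier G" and e: "(v, s) \<in> E" for g v s
  proof -
    have "s u \<in> pts A" "q (s u) = u" if "u \<in> pts X" "f u = v" for u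
      using e that by (auto simp: E_def PiE_def Pi_def)
    then show ?thesis using g e a x y bk[OF g] q[OF g]
      by (auto simp: E_def)
  qed
  have one: "(\<lambda>x\<in>{x\<in>pts X. f x = v}. act A \<one>\<^bsub>G\<^esub> (s (act X (inv\<^bsub>G\<^esub> \<one>\<^bsub>G\<^esub>) x))) = s" if e: "(v, s) \<in> E" for v s
    using e a x by (auto simp: E_def PiE_def extensional_def Pi_def fun_eq_iff)
  show ?thesis
    unfolding finite_gset_iff[OF G] p ac
  proof (intro conjI ballI, goal_cases)
    case 1 then show ?case by (rule fin)
  next
    case (2 g) then show ?case using cl[OF 2] by auto
  next
    case (3 e) then show ?case using one y by (cases e) (auto simp: E_def)
  next
    case (4 g h e)
    obtain v s where e: "e = (v,s)" by (cases e)
    have vs: "v \<in> pts Y" using 4 e by (auto simp: E_def)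
    have s: "s u \<in> pts A" if "u \<in> pts X" "f u = v" for u
      using 4 e that by (auto simp: E_def PiE_def Pi_def)
    show ?case using 4 cl[of h v s] vs s unfolding e
      by (auto simp: restrict_def fun_eq_iff y a x inv_mult_group bk)
  qed
qed

lemma comp_is_bispan:
  fixes P :: "('a,'c,'d) bispan" and Q :: "('a,'e,'f) bispan"
  assumes G: "group G" and P: "is_bispan G P" and Q: "is_bispan G Q" and "tgt P = src Q"
  shows "is_bispan G (bispan_comp G Q P)"
proof -
  interpret group G by fact
  define B' where "B' = pullback_gset (rmid P) (tleg P) (lmid Q) (rleg Q)"
  define A' where "A' = pullback_gset (lmid P) (nleg P) B' fst"
  define E where "E = dep_prod_gset G B' snd (lmid Q) (nleg Q) (rmid Q)"
  define C' where "C' = pullback_gset (lmid Q) (nleg Q) E fst"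
  define ev where "ev = (\<lambda>(c::'e, d::'f, s::'e \<Rightarrow> 'd \<times> 'e). s c)"
  define A'' where "A'' = pullback_gset A' snd C' ev"
  have eq: "bispan_comp G Q P = \<lparr>src = src P, lmid = A'', rmid = E, tgt = tgt Q,
          rleg = (\<lambda>w\<in>pts A''. rleg P (fst (fst w))),
          nleg = (\<lambda>w\<in>pts A''. snd (snd w)),
          tleg = (\<lambda>e\<in>pts E. tleg Q (fst e))\<rparr>"
    unfolding bispan_comp_def Let_def A''_def A'_def B'_def C'_def E_def ev_def ..
  note d = P[unfolded is_bispan_def] Q[unfolded is_bispan_def]
  have f: "finite_gset G (src P)" "finite_gset G (lmid P)" "finite_gset G (rmid P)" "finite_gset G (tgt P)"
     "finite_gset G (lmid Q)" "finite_gset G (rmid Q)" "finite_gset G (tgt Q)"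
    and m: "rleg P \<in> gmap G (lmid P) (src P)" "nleg P \<in> gmap G (lmid P) (rmid P)"
      "tleg P \<in> gmap G (rmid P) (tgt P)" "rleg Q \<in> gmap G (lmid Q) (tgt P)"
      "nleg Q \<in> gmap G (lmid Q) (rmid Q)" "tleg Q \<in> gmap G (rmid Q) (tgt Q)"
    using d assms(4) by auto
  have B': "finite_gset G B'" unfolding B'_def
    by (rule pullback_finite_gset[OF G, where a = "act (tgt P)"]) (use f m in \<open>auto dest: gmapD\<close>)
  have fB: "\<And>g x. g \<in> carrier G \<Longrightarrow> x \<in> pts B' \<Longrightarrow> fst (act B' g x) = act (rmid P) g (fst x)"
    "\<And>g x. g \<in> carrier G \<Longrightarrow> x \<in> pts B' \<Longrightarrow> snd (act B' g x) = act (lmid Q) g (snd x)"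
    by (auto simp: B'_def pullback_gset_def Let_def)
  have A': "finite_gset G A'" unfolding A'_def
    by (rule pullback_finite_gset[OF G, where a = "act (rmid P)"]) (use f m B' fB in \<open>auto dest: gmapD\<close>)
  have fA: "\<And>g x. g \<in> carrier G \<Longrightarrow> x \<in> pts A' \<Longrightarrow> fst (act A' g x) = act (lmid P) g (fst x)"
    "\<And>g x. g \<in> carrier G \<Longrightarrow> x \<in> pts A' \<Longrightarrow> snd (act A' g x) = act B' g (snd x)"
    "\<And>x. x \<in> pts A' \<Longrightarrow> fst x \<in> pts (lmid P)"
    by (auto simp: A'_def pullback_gset_def Let_def)
  have E: "finite_gset G E" unfolding E_def
    by (rule dep_prod_finite_gset[OF G]) (use f m B' fB in \<open>auto dest: gmapD\<close>)
  have fE: "\<And>g x. g \<in> carrier G \<Longrightarrow> x \<in> pts E \<Longrightarrow> fst (act E g x) = act (rmid Q) g (fst x)"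
    "\<And>x. x \<in> pts E \<Longrightarrow> fst x \<in> pts (rmid Q)"
    by (auto simp: E_def dep_prod_gset_def Let_def)
  have C': "finite_gset G C'" unfolding C'_def
    by (rule pullback_finite_gset[OF G, where a = "act (rmid Q)"]) (use f m E fE in \<open>auto dest: gmapD\<close>)
  have fC: "\<And>g x. g \<in> carrier G \<Longrightarrow> x \<in> pts C' \<Longrightarrow> snd (act C' g x) = act E g (snd x)"
    "\<And>x. x \<in> pts C' \<Longrightarrow> snd x \<in> pts E"
    by (auto simp: C'_def pullback_gset_def Let_def)
  have evC: "ev (act C' g x) = act B' g (ev x)" if "g \<in> carrier G" "x \<in> pts C'" for g x
    using that finite_gsetD[OF G f(5)] gmapD[OF m(5)]
    by (auto simp: C'_def pullback_gset_def Let_def ev_def E_def dep_prod_gset_def)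
  have A'': "finite_gset G A''" unfolding A''_def
    by (rule pullback_finite_gset[OF G, where a = "act B'"]) (use f m A' C' fA evC in auto)
  have fA'': "\<And>g x. g \<in> carrier G \<Longrightarrow> x \<in> pts A'' \<Longrightarrow> act A'' g x = (act A' g (fst x), act C' g (snd x))"
    "\<And>x. x \<in> pts A'' \<Longrightarrow> fst x \<in> pts A'" "\<And>x. x \<in> pts A'' \<Longrightarrow> snd x \<in> pts C'"
    by (auto simp: A''_def pullback_gset_def Let_def)
  have "(\<lambda>w\<in>pts A''. rleg P (fst (fst w))) \<in> gmap G A'' (src P)"
    using fA'' fA gmapD[OF m(1)] finite_gsetD(2)[OF G A''] by (auto simp: gmap_def)
  moreover have "(\<lambda>w\<in>pts A''. snd (snd w)) \<in> gmap G A'' E"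
    using fA'' fC  finite_gsetD(2)[OF G A''] by (auto simp: gmap_def)
  moreover have "(\<lambda>e\<in>pts E. tleg Q (fst e)) \<in> gmap G E (tgt Q)"
    using fE gmapD[OF m(6)] finite_gsetD(2)[OF G E] by (auto simp: gmap_def)
  ultimately show ?thesis using f A'' E by (simp add: eq is_bispan_def)
qed

lemma gmap_inv:
  assumes "group G" "finite_gset G X" "f \<in> gmap G X Y" "bij_betw f (pts X) (pts Y)"
  shows "restrict (inv_into (pts X) f) (pts Y) \<in> gmap G Y X"
proof -
  note x = finite_gsetD[OF assms(1,2)] and f = gmapD[OF assms(3)]
  have i: "inv_into (pts X) f (f u) = u" if "u \<in> pts X" for u
    using assms(4) that by (simp add: bij_betw_def)
  have s: "pts Y = f ` pts X" using assms(4) by (simp add: bij_betw_def)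
  have "act Y g (f u) \<in> f ` pts X" if "u \<in> pts X" "g \<in> carrier G" for u g
    using that f(3)[of g u] x(2)[of g u] by (metis imageI)
  then show ?thesis unfolding gmap_def s
    by (auto simp: i) (metis f(3) i x(2))
qed

definition bispan_map where
  "bispan_map G S S' \<alpha> \<beta> \<longleftrightarrow> src S = src S' \<and> tgt S = tgt S' \<and>
   \<alpha>\<in>gmap G (lmid S) (lmid S') \<and> \<beta>\<in>gmap G (rmid S) (rmid S') \<and>
        (\<forall>a\<in>pts (lmid S). rleg S' (\<alpha> a) = rleg S a \<and> nleg S' (\<alpha> a) = \<beta> (nleg S a)) \<and>
        (\<forall>b\<in>pts (rmid S). tleg S' (\<beta> b) = tleg S b)"

definition bispan_maps_inverse where
  "bispan_maps_inverse G S S' \<alpha> \<beta> \<alpha>' \<beta>' \<longleftrightarrow> bispan_map G S S' \<alpha> \<beta> \<and> bispan_map G S' S \<alpha>' \<beta>' \<and>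
    (\<forall>a\<in>pts (lmid S). \<alpha>' (\<alpha> a) = a) \<and> (\<forall>a\<in>pts (lmid S'). \<alpha> (\<alpha>' a) = a) \<and>
    (\<forall>a\<in>pts (rmid S). \<beta>' (\<beta> a) = a) \<and> (\<forall>a\<in>pts (rmid S'). \<beta> (\<beta>' a) = a)"

lemma bispan_isoI:
  assumes "bispan_maps_inverse G S S' \<alpha> \<beta> \<alpha>' \<beta>'" shows "bispan_iso G S S'" 
proof -
  have "bij_betw \<alpha> (pts (lmid S)) (pts (lmid S'))"
    by (rule bij_betw_byWitness[where f' = \<alpha>']) (use assms in \<open>auto simp: bispan_maps_inverse_def bispan_map_def dest: gmapD\<close>)
  moreover have "bij_betw \<beta> (pts (rmid S)) (pts (rmid S'))"
    by (rule bij_betw_byWitness[where f' = \<beta>']) (use assms in \<open>auto simp: bispan_maps_inverse_def bispan_map_def dest: gmapD\<close>)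
  ultimately show ?thesis using assms unfolding bispan_iso_def bispan_maps_inverse_def bispan_map_def by blast
qed

lemma bispan_isoE:
  assumes G: "group G" and S: "is_bispan G S" and "bispan_iso G S S'"
  obtains \<alpha> \<beta> \<alpha>' \<beta>' where "bispan_maps_inverse G S S' \<alpha> \<beta> \<alpha>' \<beta>'"
proof -
  from assms(3) obtain \<alpha> \<beta> where o: "bispan_map G S S' \<alpha> \<beta>"
   and a: "bij_betw \<alpha> (pts (lmid S)) (pts (lmid S'))" and b: "bij_betw \<beta> (pts (rmid S)) (pts (rmid S'))"
    unfolding bispan_iso_def bispan_map_def by blast
  define \<alpha>' where "\<alpha>' = restrict (inv_into (pts (lmid S)) \<alpha>) (pts (lmid S'))"
  define \<beta>' where "\<beta>' = restrict (inv_into (pts (rmid S)) \<beta>) (pts (rmid S'))"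
  have g: "\<alpha>' \<in> gmap G (lmid S') (lmid S)" "\<beta>' \<in> gmap G (rmid S') (rmid S)"
    unfolding \<alpha>'_def \<beta>'_def using gmap_inv[OF G _ _ a] gmap_inv[OF G _ _ b] S o
    by (auto simp: bispan_map_def is_bispan_def)
  have i: "\<forall>x\<in>pts (lmid S). \<alpha>' (\<alpha> x) = x" "\<forall>x\<in>pts (lmid S'). \<alpha> (\<alpha>' x) = x"
    "\<forall>x\<in>pts (rmid S). \<beta>' (\<beta> x) = x" "\<forall>x\<in>pts (rmid S'). \<beta> (\<beta>' x) = x"
    using a b unfolding \<alpha>'_def \<beta>'_def by (auto simp: bij_betw_def f_inv_into_f)
  have n: "\<And>x. x \<in> pts (lmid S) \<Longrightarrow> nleg S x \<in> pts (rmid S)" using S by (auto simp: is_bispan_def dest: gmapD)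
  have "bispan_map G S' S \<alpha>' \<beta>'"
    using o g i n gmapD(1)[OF g(1)] gmapD(1)[OF g(2)] unfolding bispan_map_def by metis
  with o i have "bispan_maps_inverse G S S' \<alpha> \<beta> \<alpha>' \<beta>'" by (simp add: bispan_maps_inverse_def)
  then show ?thesis by (rule that)
qed

lemma bispan_iso_sym: "group G \<Longrightarrow> is_bispan G S \<Longrightarrow> bispan_iso G S S' \<Longrightarrow> bispan_iso G S' S"
  by (erule (2) bispan_isoE) (rule bispan_isoI, auto simp: bispan_maps_inverse_def)

lemma gset_id_gmap: "group G \<Longrightarrow> finite_gset G X \<Longrightarrow> gset_id X \<in> gmap G X X"
  using finite_gsetD[of G X] by (auto simp: gset_id_def gmap_def)

lemma bispan_iso_refl:
  assumes "group G" "is_bispan G S" shows "bispan_iso G S S"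
proof -
  have "bispan_maps_inverse G S S (gset_id (lmid S)) (gset_id (rmid S)) (gset_id (lmid S)) (gset_id (rmid S))"
    using assms gset_id_gmap[OF assms(1), of "lmid S"] gset_id_gmap[OF assms(1), of "rmid S"]
    by (auto simp: bispan_maps_inverse_def bispan_map_def is_bispan_def gset_id_def dest: gmapD)
  then show ?thesis by (rule bispan_isoI)
qed

lemma gmap_comp:
  assumes "f \<in> gmap G X Y" "h \<in> gmap G Y Z" "finite_gset G X" "group G"
  shows "compose (pts X) h f \<in> gmap G X Z"
  using gmapD[OF assms(1)] gmapD[OF assms(2)] finite_gsetD[OF assms(4,3)]
  by (auto simp: gmap_def compose_def)

lemma bispan_iso_trans:
  assumes G: "group G" and S: "is_bispan G S" and i: "bispan_iso G S S'" "bispan_iso G S' S''" 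
  shows "bispan_iso G S S''"
proof -
  from i(1) obtain \<alpha> \<beta> where o: "bispan_map G S S' \<alpha> \<beta>"
   and a: "bij_betw \<alpha> (pts (lmid S)) (pts (lmid S'))" and b: "bij_betw \<beta> (pts (rmid S)) (pts (rmid S'))"
    unfolding bispan_iso_def bispan_map_def by blast
  from i(2) obtain \<alpha>' \<beta>' where o': "bispan_map G S' S'' \<alpha>' \<beta>'"
   and a': "bij_betw \<alpha>' (pts (lmid S')) (pts (lmid S''))" and b': "bij_betw \<beta>' (pts (rmid S')) (pts (rmid S''))"
    unfolding bispan_iso_def bispan_map_def by blast
  have n: "\<And>x. x \<in> pts (lmid S) \<Longrightarrow> nleg S x \<in> pts (rmid S)" using S by (auto simp: is_bispan_def dest: gmapD)
  have "bispan_map G S S'' (compose (pts (lmid S)) \<alpha>' \<alpha>) (compose (pts (rmid S)) \<beta>' \<beta>)"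
    using o o' S G n bij_betw_apply[OF a] bij_betw_apply[OF b]
    unfolding bispan_map_def is_bispan_def by (auto simp: compose_eq intro: gmap_comp)
  moreover have "bij_betw (compose (pts (lmid S)) \<alpha>' \<alpha>) (pts (lmid S)) (pts (lmid S''))"
     "bij_betw (compose (pts (rmid S)) \<beta>' \<beta>) (pts (rmid S)) (pts (rmid S''))"
    using a a' b b' by (auto intro: bij_betw_compose)
  ultimately show ?thesis unfolding bispan_iso_def bispan_map_def by blast
qed

lemma infinite_point: "infinite (UNIV :: 'g point set)"
proof
  assume "finite (UNIV :: 'g point set)"
  moreover have "inj (InL :: 'g point \<Rightarrow> _)" by (auto intro: injI)
  ultimately have "surj (InL :: 'g point \<Rightarrow> _)" by (rule finite_UNIV_inj_surj)
  then have "InR undefined \<in> range (InL :: 'g point \<Rightarrow> _)" by blast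
  then show False by auto
qed

lemma transport_gset:
  assumes G: "group G" and X: "finite_gset G (X :: ('g,'p) gset)"
  obtains Y :: "'g objct" and f where "finite_gset G Y" "f \<in> gmap G X Y" "bij_betw f (pts X) (pts Y)"
proof -
  note x = finite_gsetD[OF G X]
  obtain B :: "'g point set" where B: "finite B" "card B = card (pts X)"
    using infinite_arbitrarily_large[OF infinite_point] by blast
  then obtain f where f: "bij_betw f (pts X) B" using x(1) by (metis finite_same_card_bij)
  define Y where "Y = \<lparr>pts = B, act = (\<lambda>g. \<lambda>b\<in>B. f (act X g (inv_into (pts X) f b)))\<rparr>"
  have B': "B = f ` pts X" and inj: "inj_on f (pts X)" using f by (auto simp: bij_betw_def)
  have 1: "finite_gset G Y" using x group.is_monoid[OF G] monoid.m_closed[of G] 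
    unfolding finite_gset_iff[OF G] by (auto simp: Y_def B' inj)
  have 2: "restrict f (pts X) \<in> gmap G X Y" using x by (auto simp: gmap_def Y_def B' inj)
  have 3: "bij_betw (restrict f (pts X)) (pts X) (pts Y)" using f by (simp add: Y_def)
  show ?thesis using that 1 2 3 by blast
qed

lemma transport_bispan:
  assumes G: "group G" and S: "is_bispan G (S :: ('g,'a,'b) bispan)"
  obtains T :: "('g,'g point,'g point) bispan" where "is_bispan G T" "bispan_iso G T S"
proof -
  have s: "finite_gset G (lmid S)" "finite_gset G (rmid S)" using S by (auto simp: is_bispan_def)
  obtain L :: "'g objct" and f where L: "finite_gset G L" "f \<in> gmap G (lmid S) L" "bij_betw f (pts (lmid S)) (pts L)"
    using transport_gset[OF G s(1)] .
  obtain R :: "'g objct" and h where R: "finite_gset G R" "h \<in> gmap G (rmid S) R" "bij_betw h (pts (rmid S)) (pts R)"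
    using transport_gset[OF G s(2)] .
  define f' where "f' = restrict (inv_into (pts (lmid S)) f) (pts L)"
  define h' where "h' = restrict (inv_into (pts (rmid S)) h) (pts R)"
  have g: "f' \<in> gmap G L (lmid S)" "h' \<in> gmap G R (rmid S)"
    unfolding f'_def h'_def using gmap_inv[OF G] s L R by auto
  have i: "\<And>x. x \<in> pts (lmid S) \<Longrightarrow> f' (f x) = x" "\<And>x. x \<in> pts (rmid S) \<Longrightarrow> h' (h x) = x"
     "\<And>x. x \<in> pts L \<Longrightarrow> f (f' x) = x" "\<And>x. x \<in> pts R \<Longrightarrow> h (h' x) = x"
    using L(3) R(3) unfolding f'_def h'_def by (auto simp: bij_betw_def f_inv_into_f)
  define T where "T = \<lparr>src = src S, lmid = L, rmid = R, tgt = tgt S,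
    rleg = compose (pts L) (rleg S) f', nleg = compose (pts L) (compose (pts (lmid S)) h (nleg S)) f',
    tleg = compose (pts R) (tleg S) h'\<rparr>"
  have T: "is_bispan G T" using S L R g G unfolding T_def is_bispan_def
    by (auto intro!: gmap_comp[where G=G])
  have "bispan_maps_inverse G T S f' h' f h"
    using S L R g i gmapD(1)[OF g(1)] gmapD(1)[OF g(2)] gmapD(1)[OF L(2)] gmapD(1)[OF R(2)]
      gmapD(1)[of "nleg S" G "lmid S" "rmid S"]
    unfolding bispan_maps_inverse_def bispan_map_def T_def is_bispan_def 
    by (auto simp: compose_eq)
  then have "bispan_iso G T S" by (rule bispan_isoI)
  with T show ?thesis by (rule that)
qed

lemma bispan_class_eq:
  assumes G: "group G" and S: "is_bispan G S" and i: "bispan_iso G S S'"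
  shows "bispan_class G S = bispan_class G S'"
  unfolding bispan_class_def using bispan_iso_trans[OF G _ _ i] bispan_iso_trans[OF G _ _ bispan_iso_sym[OF G S i]] by blast

lemma bispan_class_eqD:
  assumes G: "group G" and S: "is_bispan G S" and e: "bispan_class G S = bispan_class G S'"
  shows "bispan_iso G S S'"
proof -
  obtain T :: "('a, 'a point, 'a point) bispan" where "is_bispan G T" "bispan_iso G T S"
    by (rule transport_bispan[OF G S])
  then show ?thesis using e bispan_iso_sym[OF G] bispan_iso_trans[OF G] S unfolding bispan_class_def by blast
qed

lemma bispan_class_self: "group G \<Longrightarrow> is_bispan G S \<Longrightarrow> S \<in> bispan_class G S"
  by (simp add: bispan_class_def bispan_iso_refl)

lemma bispan_class_in_hom:
  assumes "group G" "is_bispan G S" shows "bispan_class G S \<in> bispan_hom G (src S) (tgt S)"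
proof -
  obtain T :: "('a, 'a point, 'a point) bispan" where "is_bispan G T" "bispan_iso G T S"
    by (rule transport_bispan[OF assms])
  then show ?thesis using bispan_class_eq[OF assms(1), of T S] unfolding bispan_hom_def
    by (auto simp: bispan_iso_def)
qed

lemma comp_rmid:
  "pts (rmid (bispan_comp G Q P)) = {(d,s). d\<in>pts(rmid Q) \<and>
     s\<in>{c\<in>pts (lmid Q). nleg Q c = d} \<rightarrow>\<^sub>E {(b,c). b\<in>pts (rmid P) \<and> c\<in>pts (lmid Q) \<and> tleg P b = rleg Q c} \<and>
     (\<forall>c\<in>pts(lmid Q). nleg Q c = d \<longrightarrow> snd (s c) = c)}"
  by (simp add: bispan_comp_def Let_def pullback_gset_def dep_prod_gset_def)

lemma comp_lmid:
  "pts (lmid (bispan_comp G Q P)) = {((a,b,c),(c',e)). a\<in>pts(lmid P) \<and> b\<in>pts(rmid P) \<and> c\<in>pts(lmid Q) \<and>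
     tleg P b = rleg Q c \<and> nleg P a = b \<and> c'\<in>pts(lmid Q) \<and> e \<in> pts (rmid (bispan_comp G Q P)) \<and>
     nleg Q c' = fst e \<and> (b,c) = snd e c'}"
  by (auto simp: bispan_comp_def Let_def pullback_gset_def dep_prod_gset_def) (metis fst_conv)+

lemma comp_lmid_iff:
  "((a,b,c),(c',e)) \<in> pts (lmid (bispan_comp G Q P)) \<longleftrightarrow> a\<in>pts(lmid P) \<and> b\<in>pts(rmid P) \<and> c\<in>pts(lmid Q) \<and>
     tleg P b = rleg Q c \<and> nleg P a = b \<and> c'\<in>pts(lmid Q) \<and> e \<in> pts (rmid (bispan_comp G Q P)) \<and>
     nleg Q c' = fst e \<and> (b,c) = snd e c'"
  by (simp add: comp_lmid)

lemma comp_legs: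
  "src (bispan_comp G Q P) = src P" "tgt (bispan_comp G Q P) = tgt Q"
  "w \<in> pts (lmid (bispan_comp G Q P)) \<Longrightarrow> rleg (bispan_comp G Q P) w = rleg P (fst (fst w))"
  "w \<in> pts (lmid (bispan_comp G Q P)) \<Longrightarrow> nleg (bispan_comp G Q P) w = snd (snd w)"
  "e \<in> pts (rmid (bispan_comp G Q P)) \<Longrightarrow> tleg (bispan_comp G Q P) e = tleg Q (fst e)"
  by (simp_all add: bispan_comp_def Let_def)

lemma pullback_pts: "(x,y) \<in> pts (pullback_gset X f Y h) \<longleftrightarrow> x \<in> pts X \<and> y \<in> pts Y \<and> f x = h y"
  by (simp add: pullback_gset_def Let_def)

lemma pullback_act: "(x,y) \<in> pts (pullback_gset X f Y h) \<Longrightarrow> act (pullback_gset X f Y h) g (x,y) = (act X g x, act Y g y)"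
  by (simp add: pullback_gset_def Let_def)

lemma comp_act:
  "e \<in> pts (rmid (bispan_comp G Q P)) \<Longrightarrow> act (rmid (bispan_comp G Q P)) g e = 
      (act (rmid Q) g (fst e), \<lambda>x\<in>{x\<in>pts (lmid Q). nleg Q x = act (rmid Q) g (fst e)}. 
       act (pullback_gset (rmid P) (tleg P) (lmid Q) (rleg Q)) g (snd e (act (lmid Q) (inv\<^bsub>G\<^esub> g) x)))"
  "((a,b,c),(c',e)) \<in> pts (lmid (bispan_comp G Q P)) \<Longrightarrow> act (lmid (bispan_comp G Q P)) g ((a,b,c),(c',e)) = 
     ((act (lmid P) g a, act (rmid P) g b, act (lmid Q) g c), (act (lmid Q) g c', act (rmid (bispan_comp G Q P)) g e))"
proof -
  show "e \<in> pts (rmid (bispan_comp G Q P)) \<Longrightarrow> act (rmid (bispan_comp G Q P)) g e = 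
      (act (rmid Q) g (fst e), \<lambda>x\<in>{x\<in>pts (lmid Q). nleg Q x = act (rmid Q) g (fst e)}. 
       act (pullback_gset (rmid P) (tleg P) (lmid Q) (rleg Q)) g (snd e (act (lmid Q) (inv\<^bsub>G\<^esub> g) x)))"
    by (cases e, simp add: bispan_comp_def Let_def dep_prod_gset_def)
  let ?B = "pullback_gset (rmid P) (tleg P) (lmid Q) (rleg Q)"
  let ?A = "pullback_gset (lmid P) (nleg P) ?B fst" and ?E = "dep_prod_gset G ?B snd (lmid Q) (nleg Q) (rmid Q)"
  let ?C = "pullback_gset (lmid Q) (nleg Q) ?E fst"
  have L: "lmid (bispan_comp G Q P) = pullback_gset ?A snd ?C (\<lambda>(c,d,s). s c)" "rmid (bispan_comp G Q P) = ?E"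
    by (simp_all add: bispan_comp_def Let_def)
  assume w: "((a,b,c),(c',e)) \<in> pts (lmid (bispan_comp G Q P))"
  have 1: "(a,b,c) \<in> pts ?A" "(c',e) \<in> pts ?C" using w[unfolded L pullback_pts] unfolding pullback_pts by blast+
  have 2: "(b,c) \<in> pts ?B" using 1 unfolding pullback_pts by blast
  show "act (lmid (bispan_comp G Q P)) g ((a,b,c),(c',e)) = 
     ((act (lmid P) g a, act (rmid P) g b, act (lmid Q) g c), (act (lmid Q) g c', act (rmid (bispan_comp G Q P)) g e))"
    unfolding L pullback_act[OF w[unfolded L]] pullback_act[OF 1(1)] pullback_act[OF 1(2)] pullback_act[OF 2] ..
qed

lemma bispan_map_D:
  assumes "bispan_map G S S' \<alpha> \<beta>"
  shows "src S = src S'" "tgt S = tgt S'"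
    "\<And>a. a \<in> pts (lmid S) \<Longrightarrow> \<alpha> a \<in> pts (lmid S')" "\<And>b. b \<in> pts (rmid S) \<Longrightarrow> \<beta> b \<in> pts (rmid S')"
    "\<And>a. a \<in> pts (lmid S) \<Longrightarrow> rleg S' (\<alpha> a) = rleg S a" "\<And>a. a \<in> pts (lmid S) \<Longrightarrow> nleg S' (\<alpha> a) = \<beta> (nleg S a)"
    "\<And>b. b \<in> pts (rmid S) \<Longrightarrow> tleg S' (\<beta> b) = tleg S b"
    "\<And>g a. g \<in> carrier G \<Longrightarrow> a \<in> pts (lmid S) \<Longrightarrow> \<alpha> (act (lmid S) g a) = act (lmid S') g (\<alpha> a)"
    "\<And>g a. g \<in> carrier G \<Longrightarrow> a \<in> pts (rmid S) \<Longrightarrow> \<beta> (act (rmid S) g a) = act (rmid S') g (\<beta> a)"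
  using assms by (auto simp: bispan_map_def dest: gmapD)

lemma bispan_rules:
  assumes "is_bispan G S"
  shows "finite_gset G (lmid S)" "finite_gset G (rmid S)"
    "\<And>a. a \<in> pts (lmid S) \<Longrightarrow> nleg S a \<in> pts (rmid S)"
    "\<And>g a. g \<in> carrier G \<Longrightarrow> a \<in> pts (lmid S) \<Longrightarrow> nleg S (act (lmid S) g a) = act (rmid S) g (nleg S a)"
    "\<And>a. a \<in> pts (lmid S) \<Longrightarrow> rleg S a \<in> pts (src S)"
    "\<And>a. a \<in> pts (rmid S) \<Longrightarrow> tleg S a \<in> pts (tgt S)"
    "\<And>g a. g \<in> carrier G \<Longrightarrow> a \<in> pts (lmid S) \<Longrightarrow> rleg S (act (lmid S) g a) = act (src S) g (rleg S a)"
    "\<And>g a. g \<in> carrier G \<Longrightarrow> a \<in> pts (rmid S) \<Longrightarrow> tleg S (act (rmid S) g a) = act (tgt S) g (tleg S a)"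
  using assms by (auto simp: is_bispan_def dest: gmapD)

definition comp_map_right where
  "comp_map_right G P Q Q' \<beta> \<gamma> \<delta> \<gamma>' = (\<lambda>e\<in>pts (rmid (bispan_comp G Q P)).
     (\<delta> (fst e), \<lambda>c\<in>{c\<in>pts (lmid Q'). nleg Q' c = \<delta> (fst e)}. map_prod \<beta> \<gamma> (snd e (\<gamma>' c))))"

definition comp_map_left where
  "comp_map_left G P Q Q' \<alpha> \<beta> \<gamma> \<delta> \<gamma>' = (\<lambda>w\<in>pts (lmid (bispan_comp G Q P)).
     case w of ((a,b,c),(c',e)) \<Rightarrow> ((\<alpha> a, \<beta> b, \<gamma> c), (\<gamma> c', comp_map_right G P Q Q' \<beta> \<gamma> \<delta> \<gamma>' e)))"

context
  fixes G :: "('g,'m) monoid_scheme" and P :: "('g,'a,'b) bispan" and P' :: "('g,'a1,'b1) bispan"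
    and Q :: "('g,'c,'d) bispan" and Q' :: "('g,'c1,'d1) bispan" and \<alpha> \<beta> \<gamma> \<delta> \<alpha>' \<beta>' \<gamma>' \<delta>'
  assumes G: "group G" and P: "is_bispan G P" and P': "is_bispan G P'"
    and Q: "is_bispan G Q" and Q': "is_bispan G Q'" and T: "tgt P = src Q"
    and p: "bispan_maps_inverse G P P' \<alpha> \<beta> \<alpha>' \<beta>'" and q: "bispan_maps_inverse G Q Q' \<gamma> \<delta> \<gamma>' \<delta>'"
begin

lemma iso_halves: "bispan_map G P P' \<alpha> \<beta>" "bispan_map G P' P \<alpha>' \<beta>'" "bispan_map G Q Q' \<gamma> \<delta>" "bispan_map G Q' Q \<gamma>' \<delta>'"
  using p q by (auto simp: bispan_maps_inverse_def)

lemma iso_inverses: "\<And>x. x \<in> pts (lmid P) \<Longrightarrow> \<alpha>' (\<alpha> x) = x"  "\<And>x. x \<in> pts (rmid P) \<Longrightarrow> \<beta>' (\<beta> x) = x"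
   "\<And>x. x \<in> pts (lmid Q) \<Longrightarrow> \<gamma>' (\<gamma> x) = x"  "\<And>x. x \<in> pts (rmid Q) \<Longrightarrow> \<delta>' (\<delta> x) = x"
   "\<And>x. x \<in> pts (lmid Q') \<Longrightarrow> \<gamma> (\<gamma>' x) = x"  "\<And>x. x \<in> pts (rmid Q') \<Longrightarrow> \<delta> (\<delta>' x) = x"
  using p q by (auto simp: bispan_maps_inverse_def)

lemmas iso_rules = bispan_map_D[OF iso_halves(1)] bispan_map_D[OF iso_halves(2)] bispan_map_D[OF iso_halves(3)] bispan_map_D[OF iso_halves(4)]

lemmas iso_simps = iso_rules(3-9) iso_rules(12-18) iso_rules(21-27) iso_rules(30-36)

lemma fibre_inverse: 
  assumes "c \<in> pts (lmid Q')" "nleg Q' c = \<delta> u" "u \<in> pts (rmid Q)" shows "nleg Q (\<gamma>' c) = u"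
  using assms iso_simps(25)[OF assms(1)] iso_inverses(4)[OF assms(3)] by simp

lemma comp_rmid_D: assumes "e \<in> pts (rmid (bispan_comp G Q P))"
  shows "fst e \<in> pts (rmid Q)" 
    "\<And>c. c \<in> pts (lmid Q) \<Longrightarrow> nleg Q c = fst e \<Longrightarrow> fst (snd e c) \<in> pts (rmid P)"
    "\<And>c. c \<in> pts (lmid Q) \<Longrightarrow> nleg Q c = fst e \<Longrightarrow> snd (snd e c) = c"
    "\<And>c. c \<in> pts (lmid Q) \<Longrightarrow> nleg Q c = fst e \<Longrightarrow> tleg P (fst (snd e c)) = rleg Q c"
    "snd e \<in> extensional {c \<in> pts (lmid Q). nleg Q c = fst e}"
proof -
  obtain u s where e: "e = (u,s)" by (cases e)
  have s: "s \<in> {c\<in>pts (lmid Q). nleg Q c = u} \<rightarrow>\<^sub>E {(b,c). b\<in>pts (rmid P) \<and> c\<in>pts (lmid Q) \<and> tleg P b = rleg Q c}"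
    and sn: "\<forall>c\<in>pts(lmid Q). nleg Q c = u \<longrightarrow> snd (s c) = c"
    using assms unfolding comp_rmid e by simp_all
  have "s c \<in> {(b,c). b\<in>pts (rmid P) \<and> c\<in>pts (lmid Q) \<and> tleg P b = rleg Q c} \<and> snd (s c) = c"
    if "c \<in> pts (lmid Q)" "nleg Q c = u" for c
    using PiE_mem[OF s, of c] sn that by simp
  then show "\<And>c. c \<in> pts (lmid Q) \<Longrightarrow> nleg Q c = fst e \<Longrightarrow> fst (snd e c) \<in> pts (rmid P)"
    "\<And>c. c \<in> pts (lmid Q) \<Longrightarrow> nleg Q c = fst e \<Longrightarrow> snd (snd e c) = c"
    "\<And>c. c \<in> pts (lmid Q) \<Longrightarrow> nleg Q c = fst e \<Longrightarrow> tleg P (fst (snd e c)) = rleg Q c"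
    by (auto simp: e split_beta)
  show "fst e \<in> pts (rmid Q)" "snd e \<in> extensional {c \<in> pts (lmid Q). nleg Q c = fst e}"
    using assms unfolding comp_rmid e by (auto simp: PiE_def)
qed

lemma comp_map_right_in:
  assumes "e \<in> pts (rmid (bispan_comp G Q P))"
  shows "comp_map_right G P Q Q' \<beta> \<gamma> \<delta> \<gamma>' e \<in> pts (rmid (bispan_comp G Q' P'))"
proof -
  note E = comp_rmid_D[OF assms]
  have "map_prod \<beta> \<gamma> (snd e (\<gamma>' c)) \<in> {(b,c). b\<in>pts (rmid P') \<and> c\<in>pts (lmid Q') \<and> tleg P' b = rleg Q' c}
     \<and> snd (map_prod \<beta> \<gamma> (snd e (\<gamma>' c))) = c"
    if c: "c \<in> pts (lmid Q')" "nleg Q' c = \<delta> (fst e)" for c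
  proof -
    have g: "\<gamma>' c \<in> pts (lmid Q)" "nleg Q (\<gamma>' c) = fst e" using iso_rules(30)[OF c(1)] fibre_inverse[OF c E(1)] .
    obtain b where b: "snd e (\<gamma>' c) = (b, \<gamma>' c)" using E(3)[OF g] by (metis prod.collapse)
    have "b \<in> pts (rmid P)" "tleg P b = rleg Q (\<gamma>' c)" using E(2,4)[OF g] b by simp_all
    then show ?thesis using c iso_inverses(5)[OF c(1)] iso_simps g unfolding b by simp
  qed
  then show ?thesis unfolding comp_map_right_def comp_rmid[of G Q' P'] using assms iso_simps(16)[OF E(1)] by simp
qed

lemma comp_map_right_act:
  assumes e: "e \<in> pts (rmid (bispan_comp G Q P))" and g: "g \<in> carrier G"
  shows "comp_map_right G P Q Q' \<beta> \<gamma> \<delta> \<gamma>' (act (rmid (bispan_comp G Q P)) g e)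
    = act (rmid (bispan_comp G Q' P')) g (comp_map_right G P Q Q' \<beta> \<gamma> \<delta> \<gamma>' e)"
proof -
  interpret group G by (rule G)
  note E = comp_rmid_D[OF e]
  have b: "is_bispan G (bispan_comp G Q P)" by (rule comp_is_bispan[OF G P Q T])
  have ge: "act (rmid (bispan_comp G Q P)) g e \<in> pts (rmid (bispan_comp G Q P))"
    using finite_gsetD(2)[OF G bispan_rules(2)[OF b] g e] .
  have f1: "act (lmid Q') (inv\<^bsub>G\<^esub> g) c \<in> pts (lmid Q')" "nleg Q' (act (lmid Q') (inv\<^bsub>G\<^esub> g) c) = \<delta> (fst e)"
       "\<gamma>' (act (lmid Q') (inv\<^bsub>G\<^esub> g) c) = act (lmid Q) (inv\<^bsub>G\<^esub> g) (\<gamma>' c)"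
    if "c \<in> pts (lmid Q')" "nleg Q' c = act (rmid Q') g (\<delta> (fst e))" for c
    using that g finite_gsetD[OF G bispan_rules(1)[OF Q']] bispan_rules(4)[OF Q', of "inv\<^bsub>G\<^esub> g" c]
      finite_gsetD(5)[OF G bispan_rules(2)[OF Q']] iso_simps E by auto
  have f2: "nleg Q (\<gamma>' c) = act (rmid Q) g (fst e)" "nleg Q (act (lmid Q) (inv\<^bsub>G\<^esub> g) (\<gamma>' c)) = fst e"
      "act (lmid Q) (inv\<^bsub>G\<^esub> g) (\<gamma>' c) \<in> pts (lmid Q)"
    if "c \<in> pts (lmid Q')" "nleg Q' c = act (rmid Q') g (\<delta> (fst e))" for c
  proof -
    show "nleg Q (\<gamma>' c) = act (rmid Q) g (fst e)"
      using that fibre_inverse[of c "act (rmid Q) g (fst e)"] iso_rules(27)[OF g E(1)] finite_gsetD(2)[OF G bispan_rules(2)[OF Q] g E(1)] by simp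
    show "nleg Q (act (lmid Q) (inv\<^bsub>G\<^esub> g) (\<gamma>' c)) = fst e" 
      using f1(3)[OF that] f1(1,2)[OF that] fibre_inverse E(1) by metis
    show "act (lmid Q) (inv\<^bsub>G\<^esub> g) (\<gamma>' c) \<in> pts (lmid Q)"
      using f1(3)[OF that] iso_rules(30)[OF f1(1)[OF that]] by simp
  qed
  have m: "map_prod \<beta> \<gamma> (act (pullback_gset (rmid P) (tleg P) (lmid Q) (rleg Q)) g z)
     = act (pullback_gset (rmid P') (tleg P') (lmid Q') (rleg Q')) g (map_prod \<beta> \<gamma> z)"
    if "fst z \<in> pts (rmid P)" "snd z \<in> pts (lmid Q)" "tleg P (fst z) = rleg Q (snd z)" for z
    using that iso_simps g by (auto simp: pullback_gset_def Let_def split_beta)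
  have dg: "\<delta> (act (rmid Q) g (fst e)) = act (rmid Q') g (\<delta> (fst e))" using iso_rules(27)[OF g E(1)] .
  have v: "map_prod \<beta> \<gamma> (snd (act (rmid (bispan_comp G Q P)) g e) (\<gamma>' c)) =
      act (pullback_gset (rmid P') (tleg P') (lmid Q') (rleg Q')) g (snd (comp_map_right G P Q Q' \<beta> \<gamma> \<delta> \<gamma>' e) (act (lmid Q') (inv\<^bsub>G\<^esub> g) c))"
    if c: "c \<in> pts (lmid Q')" "nleg Q' c = act (rmid Q') g (\<delta> (fst e))" for c
  proof -
    let ?u = "act (lmid Q) (inv\<^bsub>G\<^esub> g) (\<gamma>' c)"
    have "snd (act (rmid (bispan_comp G Q P)) g e) (\<gamma>' c) = act (pullback_gset (rmid P) (tleg P) (lmid Q) (rleg Q)) g (snd e ?u)"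
      unfolding comp_act(1)[OF e] using f2(1)[OF c] iso_rules(30)[OF c(1)] by simp
    moreover have "map_prod \<beta> \<gamma> (act (pullback_gset (rmid P) (tleg P) (lmid Q) (rleg Q)) g (snd e ?u))
      = act (pullback_gset (rmid P') (tleg P') (lmid Q') (rleg Q')) g (map_prod \<beta> \<gamma> (snd e ?u))"
      using E(2-4)[OF f2(3)[OF c] f2(2)[OF c]] f2(3)[OF c] by (intro m) simp_all
    moreover have "snd (comp_map_right G P Q Q' \<beta> \<gamma> \<delta> \<gamma>' e) (act (lmid Q') (inv\<^bsub>G\<^esub> g) c) = map_prod \<beta> \<gamma> (snd e ?u)"
      using f1[OF c] e by (simp add: comp_map_right_def)
    ultimately show ?thesis by simp
  qed
  have fe: "fst (act (rmid (bispan_comp G Q P)) g e) = act (rmid Q) g (fst e)"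
    unfolding comp_act(1)[OF e] by simp
  have fP: "fst (comp_map_right G P Q Q' \<beta> \<gamma> \<delta> \<gamma>' e) = \<delta> (fst e)" using e by (simp add: comp_map_right_def)
  have "comp_map_right G P Q Q' \<beta> \<gamma> \<delta> \<gamma>' (act (rmid (bispan_comp G Q P)) g e) =
    (act (rmid Q') g (\<delta> (fst e)), \<lambda>c\<in>{c \<in> pts (lmid Q'). nleg Q' c = act (rmid Q') g (\<delta> (fst e))}.
       map_prod \<beta> \<gamma> (snd (act (rmid (bispan_comp G Q P)) g e) (\<gamma>' c)))"
    unfolding comp_map_right_def using ge by (simp add: fe dg)
  also have "\<dots> = act (rmid (bispan_comp G Q' P')) g (comp_map_right G P Q Q' \<beta> \<gamma> \<delta> \<gamma>' e)"
    unfolding comp_act(1)[OF comp_map_right_in[OF e]] fP using v by (auto intro!: restrict_ext)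
  finally show ?thesis .
qed

lemma comp_bispan_map:
  "bispan_map G (bispan_comp G Q P) (bispan_comp G Q' P') (comp_map_left G P Q Q' \<alpha> \<beta> \<gamma> \<delta> \<gamma>') (comp_map_right G P Q Q' \<beta> \<gamma> \<delta> \<gamma>')"
proof -
  have b: "is_bispan G (bispan_comp G Q P)" by (rule comp_is_bispan[OF G P Q T])
  let ?comp_map_right = "comp_map_right G P Q Q' \<beta> \<gamma> \<delta> \<gamma>'" and ?comp_map_left = "comp_map_left G P Q Q' \<alpha> \<beta> \<gamma> \<delta> \<gamma>'"
  have 1: "?comp_map_right \<in> gmap G (rmid (bispan_comp G Q P)) (rmid (bispan_comp G Q' P'))"
    using comp_map_right_in comp_map_right_act by (auto simp: gmap_def) (simp add: comp_map_right_def)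
  have f: "fst (?comp_map_right e) = \<delta> (fst e)" if "e \<in> pts (rmid (bispan_comp G Q P))" for e
    using that by (simp add: comp_map_right_def)
  have s: "snd (?comp_map_right e) (\<gamma> c) = map_prod \<beta> \<gamma> (snd e c)" if "e \<in> pts (rmid (bispan_comp G Q P))" 
    "c \<in> pts (lmid Q)" "nleg Q c = fst e" for e c
    using that iso_simps iso_inverses by (simp add: comp_map_right_def)
  have 2: "?comp_map_left w \<in> pts (lmid (bispan_comp G Q' P'))" if "w \<in> pts (lmid (bispan_comp G Q P))" for w
  proof -
    obtain a b c c' e where e: "w = ((a,b,c),(c',e))" by (metis prod.exhaust)
    have w: "a\<in>pts(lmid P)" "b\<in>pts(rmid P)" "c\<in>pts(lmid Q)" "tleg P b = rleg Q c" "nleg P a = b"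
       "c'\<in>pts(lmid Q)" "e \<in> pts (rmid (bispan_comp G Q P))" "nleg Q c' = fst e" "(b,c) = snd e c'"
      using that unfolding e comp_lmid_iff by auto
    have s': "(\<beta> b, \<gamma> c) = snd (?comp_map_right e) (\<gamma> c')"
      using s[OF w(7,6,8)] w(9) by (metis map_prod_simp)
    have p: "?comp_map_left w = ((\<alpha> a, \<beta> b, \<gamma> c), (\<gamma> c', ?comp_map_right e))" using that by (simp add: comp_map_left_def e)
    show ?thesis unfolding p comp_lmid_iff using w(1-8) iso_rules(3,4,6,7,21,23,24) f[OF w(7)] s' comp_map_right_in[OF w(7)] by simp
  qed
  have 3: "?comp_map_left (act (lmid (bispan_comp G Q P)) g w) = act (lmid (bispan_comp G Q' P')) g (?comp_map_left w)" 
    if g: "g \<in> carrier G" and w: "w \<in> pts (lmid (bispan_comp G Q P))" for g w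
  proof -
    obtain a b c c' e where e: "w = ((a,b,c),(c',e))" by (metis prod.exhaust)
    have i: "act (lmid (bispan_comp G Q P)) g w \<in> pts (lmid (bispan_comp G Q P))"
      using finite_gsetD(2)[OF G bispan_rules(1)[OF b] g w] .
    have j: "?comp_map_left w = ((\<alpha> a, \<beta> b, \<gamma> c), (\<gamma> c', ?comp_map_right e))" using w by (simp add: comp_map_left_def e)
    have k: "?comp_map_left w \<in> pts (lmid (bispan_comp G Q' P'))" using 2[OF w] .
    have m: "a\<in>pts(lmid P)" "b\<in>pts(rmid P)" "c\<in>pts(lmid Q)" "c'\<in>pts(lmid Q)" "e \<in> pts (rmid (bispan_comp G Q P))"
      using w unfolding e comp_lmid_iff by simp_all
    show ?thesis unfolding j comp_act(2)[OF k[unfolded j]]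
      using i unfolding e comp_act(2)[OF w[unfolded e]]
      by (simp add: comp_map_left_def comp_map_right_act[OF m(5) g] iso_simps m g)
  qed
  have 4: "?comp_map_left \<in> gmap G (lmid (bispan_comp G Q P)) (lmid (bispan_comp G Q' P'))"
    using 2 3 by (auto simp: gmap_def) (simp add: comp_map_left_def)
  have 5: "rleg (bispan_comp G Q' P') (?comp_map_left w) = rleg (bispan_comp G Q P) w \<and>
     nleg (bispan_comp G Q' P') (?comp_map_left w) = ?comp_map_right (nleg (bispan_comp G Q P) w)"
    if w: "w \<in> pts (lmid (bispan_comp G Q P))" for w
  proof -
    obtain a b c c' e where e: "w = ((a,b,c),(c',e))" by (metis prod.exhaust)
    have j: "?comp_map_left w = ((\<alpha> a, \<beta> b, \<gamma> c), (\<gamma> c', ?comp_map_right e))" using w by (simp add: comp_map_left_def e)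
    have m: "a\<in>pts(lmid P)" using w unfolding e comp_lmid_iff by simp
    show ?thesis unfolding comp_legs(3)[OF 2[OF w]] comp_legs(4)[OF 2[OF w]] comp_legs(3)[OF w] comp_legs(4)[OF w]
      unfolding j by (simp add: e iso_simps m)
  qed
  have 6: "tleg (bispan_comp G Q' P') (?comp_map_right w) = tleg (bispan_comp G Q P) w"
    if w: "w \<in> pts (rmid (bispan_comp G Q P))" for w
    unfolding comp_legs(5)[OF comp_map_right_in[OF w]] comp_legs(5)[OF w] f[OF w] using iso_simps(19)[OF comp_rmid_D(1)[OF w]] .
  have 7: "src P = src P'" "tgt Q = tgt Q'" using iso_halves by (auto simp: bispan_map_def)
  show ?thesis unfolding bispan_map_def comp_legs(1,2)
    by (intro conjI ballI 1 4 7 5[THEN conjunct1] 5[THEN conjunct2] 6)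
qed

lemma comp_map_right_inverse:
  assumes e: "e \<in> pts (rmid (bispan_comp G Q P))"
  shows "comp_map_right G P' Q' Q \<beta>' \<gamma>' \<delta>' \<gamma> (comp_map_right G P Q Q' \<beta> \<gamma> \<delta> \<gamma>' e) = e"
proof -
  note E = comp_rmid_D[OF e]
  have 1: "fst (comp_map_right G P Q Q' \<beta> \<gamma> \<delta> \<gamma>' e) = \<delta> (fst e)" using e by (simp add: comp_map_right_def)
  have 2: "map_prod \<beta>' \<gamma>' (snd (comp_map_right G P Q Q' \<beta> \<gamma> \<delta> \<gamma>' e) (\<gamma> c)) = snd e c"
    if c: "c \<in> pts (lmid Q)" "nleg Q c = fst e" for c
  proof -
    have "snd (comp_map_right G P Q Q' \<beta> \<gamma> \<delta> \<gamma>' e) (\<gamma> c) = map_prod \<beta> \<gamma> (snd e c)"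
      using e c iso_simps(15)[OF c(1)] iso_simps(18)[OF c(1)] iso_inverses(3)[OF c(1)] by (simp add: comp_map_right_def)
    moreover obtain b where b: "snd e c = (b, c)" using E(3)[OF c] by (metis prod.collapse)
    ultimately show ?thesis using E(2)[OF c] iso_inverses c by simp
  qed
  have 3: "\<delta>' (\<delta> (fst e)) = fst e" using iso_inverses E by simp
  have "(\<lambda>c\<in>{c \<in> pts (lmid Q). nleg Q c = fst e}. map_prod \<beta>' \<gamma>' (snd (comp_map_right G P Q Q' \<beta> \<gamma> \<delta> \<gamma>' e) (\<gamma> c))) = snd e"
    using 2 E(5) by (auto simp: fun_eq_iff extensional_def restrict_def)
  then show ?thesis using comp_map_right_in[OF e] 1 3 by (simp add: comp_map_right_def[of G P' Q' Q] prod_eq_iff)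
qed

lemma comp_map_left_inverse:
  assumes e: "e \<in> pts (lmid (bispan_comp G Q P))"
  shows "comp_map_left G P' Q' Q \<alpha>' \<beta>' \<gamma>' \<delta>' \<gamma> (comp_map_left G P Q Q' \<alpha> \<beta> \<gamma> \<delta> \<gamma>' e) = e"
proof -
  have "comp_map_left G P Q Q' \<alpha> \<beta> \<gamma> \<delta> \<gamma>' e \<in> pts (lmid (bispan_comp G Q' P'))"
    using bispan_map_D(3)[OF comp_bispan_map e] .
  note 1 = this
  obtain a b c c' u where w: "e = ((a,b,c),(c',u))" by (metis prod.exhaust)
  have "comp_map_left G P Q Q' \<alpha> \<beta> \<gamma> \<delta> \<gamma>' e = ((\<alpha> a, \<beta> b, \<gamma> c), (\<gamma> c', comp_map_right G P Q Q' \<beta> \<gamma> \<delta> \<gamma>' u))"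
    using e by (simp add: comp_map_left_def w)
  then show ?thesis using 1 e iso_inverses by (simp add: comp_map_left_def w) (simp add: comp_lmid_iff comp_map_right_inverse)
qed

end

lemma bispan_maps_inverse_sym: "bispan_maps_inverse G S S' \<alpha> \<beta> \<alpha>' \<beta>' \<Longrightarrow> bispan_maps_inverse G S' S \<alpha>' \<beta>' \<alpha> \<beta>"
  by (auto simp: bispan_maps_inverse_def)

lemma bispan_comp_cong:
  assumes "group G" "is_bispan G P" "is_bispan G P'" "is_bispan G Q" "is_bispan G Q'" "tgt P = src Q"
    and "bispan_iso G P P'" "bispan_iso G Q Q'"
  shows "bispan_iso G (bispan_comp G Q P) (bispan_comp G Q' P')"
proof -
  obtain \<alpha> \<beta> \<alpha>' \<beta>' where p: "bispan_maps_inverse G P P' \<alpha> \<beta> \<alpha>' \<beta>'" by (rule bispan_isoE[OF assms(1,2,7)])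
  obtain \<gamma> \<delta> \<gamma>' \<delta>' where q: "bispan_maps_inverse G Q Q' \<gamma> \<delta> \<gamma>' \<delta>'" by (rule bispan_isoE[OF assms(1,4,8)])
  have t: "tgt P' = src Q'" using assms(6-8) by (simp add: bispan_iso_def)
  note a = assms(1-6) p q and b = assms(1,3,2,5,4) t bispan_maps_inverse_sym[OF p] bispan_maps_inverse_sym[OF q]
  show ?thesis
    by (rule bispan_isoI[of _ _ _ "comp_map_left G P Q Q' \<alpha> \<beta> \<gamma> \<delta> \<gamma>'" "comp_map_right G P Q Q' \<beta> \<gamma> \<delta> \<gamma>'"
        "comp_map_left G P' Q' Q \<alpha>' \<beta>' \<gamma>' \<delta>' \<gamma>" "comp_map_right G P' Q' Q \<beta>' \<gamma>' \<delta>' \<gamma>"])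
      (simp add: bispan_maps_inverse_def comp_bispan_map[OF a] comp_bispan_map[OF b] comp_map_right_inverse[OF a] comp_map_left_inverse[OF a] comp_map_right_inverse[OF b] comp_map_left_inverse[OF b])
qed

lemma mor_comp_class:
  assumes G: "group G" and P: "is_bispan G (P :: ('g,'g point,'g point) bispan)"
    and Q: "is_bispan G (Q :: ('g,'g point,'g point) bispan)" and "tgt P = src Q"
  shows "mor_comp G (bispan_class G Q) (bispan_class G P) = bispan_class G (bispan_comp G Q P)"
proof -
  have "bispan_class G (bispan_comp G Q' P') = bispan_class G (bispan_comp G Q P)"
    if "Q' \<in> bispan_class G Q" "P' \<in> bispan_class G P" for Q' P'
  proof (rule bispan_class_eq[OF G])
    show "is_bispan G (bispan_comp G Q' P')" using that assms(4)
      by (intro comp_is_bispan[OF G]) (auto simp: bispan_class_def bispan_iso_def)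
    show "bispan_iso G (bispan_comp G Q' P') (bispan_comp G Q P)"
      using that P Q assms(4) by (intro bispan_comp_cong[OF G]) (auto simp: bispan_class_def bispan_iso_def)
  qed
  then show ?thesis using bispan_class_self[OF G P] bispan_class_self[OF G Q] unfolding mor_comp_def by blast
qed

definition restrict_gset :: "('g,'p) gset \<Rightarrow> 'p set \<Rightarrow> ('g,'p) gset" where
  "restrict_gset Y U = \<lparr>pts = pts Y \<inter> U, act = (\<lambda>g. restrict (act Y g) (pts Y \<inter> U))\<rparr>"

definition part_bispan where
  "part_bispan S X i = \<lparr>src = src S, lmid = restrict_gset (lmid S) {a. tleg S (nleg S a) \<in> i ` pts X},
    rmid = restrict_gset (rmid S) {b. tleg S b \<in> i ` pts X}, tgt = X,
    rleg = restrict (rleg S) (pts (lmid S) \<inter> {a. tleg S (nleg S a) \<in> i ` pts X}),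
    nleg = restrict (nleg S) (pts (lmid S) \<inter> {a. tleg S (nleg S a) \<in> i ` pts X}),
    tleg = (\<lambda>b\<in>pts (rmid S) \<inter> {b. tleg S b \<in> i ` pts X}. inv_into (pts X) i (tleg S b))\<rparr>"

lemma restrict_finite_gset:
  assumes G: "group G" and Y: "finite_gset G Y" and "\<And>g y. g \<in> carrier G \<Longrightarrow> y \<in> pts Y \<inter> U \<Longrightarrow> act Y g y \<in> U"
  shows "finite_gset G (restrict_gset Y U)"
  using finite_gsetD[OF G Y] assms(3) group.is_monoid[OF G] unfolding finite_gset_iff[OF G]
  by (auto simp: restrict_gset_def monoid.m_closed)

context
  fixes G :: "('g,'m) monoid_scheme" and S :: "('g,'a,'b) bispan" and X :: "'g objct" and i
  assumes G: "group G" and S: "is_bispan G S" and X: "finite_gset G X"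
    and i: "i \<in> gmap G X (tgt S)" "inj_on i (pts X)"
begin

lemma image_act:
  assumes "g \<in> carrier G" "b \<in> pts (rmid S)" "tleg S b \<in> i ` pts X"
  shows "tleg S (act (rmid S) g b) \<in> i ` pts X"
    "inv_into (pts X) i (tleg S (act (rmid S) g b)) = act X g (inv_into (pts X) i (tleg S b))"
    "inv_into (pts X) i (tleg S b) \<in> pts X"
proof -
  obtain x where x: "x \<in> pts X" "tleg S b = i x" using assms by auto
  have y: "act X g x \<in> pts X" using finite_gsetD(2)[OF G X assms(1) x(1)] .
  have z: "tleg S (act (rmid S) g b) = i (act X g x)"
    using assms x bispan_rules(8)[OF S] gmapD(3)[OF i(1)] by simp
  show "tleg S (act (rmid S) g b) \<in> i ` pts X" 
    "inv_into (pts X) i (tleg S (act (rmid S) g b)) = act X g (inv_into (pts X) i (tleg S b))"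
    "inv_into (pts X) i (tleg S b) \<in> pts X"
    using x y z i(2) by simp_all
qed

lemma part_is_bispan: "is_bispan G (part_bispan S X i)"
proof -
  note D = bispan_rules[OF S] and l = finite_gsetD[OF G bispan_rules(1)[OF S]] and r = finite_gsetD[OF G bispan_rules(2)[OF S]]
  have "finite_gset G (restrict_gset (rmid S) {b. tleg S b \<in> i ` pts X})"
    by (rule restrict_finite_gset[OF G D(2)]) (use image_act in auto)
  moreover have "finite_gset G (restrict_gset (lmid S) {a. tleg S (nleg S a) \<in> i ` pts X})"
    by (rule restrict_finite_gset[OF G D(1)]) (use image_act D in auto)
  ultimately show ?thesis
    using X S image_act D l(2) r(2) unfolding is_bispan_def by (auto simp: part_bispan_def gmap_def restrict_gset_def inv_into_f_f[OF i(2)])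
qed

lemma res_is_bispan: "is_bispan G (res_bispan X (tgt S) i)"
  using S X i gset_id_gmap[OF G X] by (simp add: is_bispan_def res_bispan_def)

lemma part_iso_comp: "bispan_iso G (part_bispan S X i) (bispan_comp G (res_bispan X (tgt S) i) S)"
proof -
  let ?C = "bispan_comp G (res_bispan X (tgt S) i) S"
  note D = bispan_rules[OF S] and l = finite_gsetD[OF G bispan_rules(1)[OF S]] and r = finite_gsetD[OF G bispan_rules(2)[OF S]]
  note x = finite_gsetD[OF G X]
  define q where "q b = inv_into (pts X) i (tleg S b)" for b
  have q: "q b \<in> pts X" "tleg S b = i (q b)" if "tleg S b \<in> i ` pts X" for b
    using that by (auto simp: q_def f_inv_into_f inv_into_into)
  have qi: "q b = y" if "y \<in> pts X" "tleg S b = i y" for b y using that i(2) by (simp add: q_def)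
  have qa: "q (act (rmid S) g b) = act X g (q b)" if "g \<in> carrier G" "b \<in> pts (rmid S)" "tleg S b \<in> i ` pts X" for g b
    unfolding q_def using image_act(2)[OF that] .
  define \<beta> where "\<beta> = (\<lambda>b\<in>pts (rmid (part_bispan S X i)). (q b, \<lambda>c\<in>{q b}. (b, q b)))"
  define \<alpha> where "\<alpha> = (\<lambda>a\<in>pts (lmid (part_bispan S X i)). ((a, nleg S a, q (nleg S a)), (q (nleg S a), \<beta> (nleg S a))))"
  have rp: "pts (rmid (part_bispan S X i)) = {b\<in>pts (rmid S). tleg S b \<in> i ` pts X}" by (auto simp: part_bispan_def restrict_gset_def)
  have lp: "pts (lmid (part_bispan S X i)) = {a\<in>pts (lmid S). tleg S (nleg S a) \<in> i ` pts X}" by (auto simp: part_bispan_def restrict_gset_def)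
  have ra: "act (rmid (part_bispan S X i)) g b = act (rmid S) g b" if "b \<in> pts (rmid (part_bispan S X i))" for g b
    using that by (simp add: part_bispan_def restrict_gset_def)
  have la: "act (lmid (part_bispan S X i)) g b = act (lmid S) g b" if "b \<in> pts (lmid (part_bispan S X i))" for g b
    using that by (simp add: part_bispan_def restrict_gset_def)
  have fibq: "{c \<in> pts X. gset_id X c = y} = {y}" if "y \<in> pts X" for y
    using that by (auto simp: gset_id_def)
  have CR: "pts (rmid ?C) = {(d,s). d \<in> pts X \<and> s \<in> {d} \<rightarrow>\<^sub>E {(b,c). b\<in>pts (rmid S) \<and> c\<in>pts X \<and> tleg S b = i c} \<and> snd (s d) = d}"
  proof -
    have "(d \<in> pts X \<and> s \<in> {c\<in>pts X. gset_id X c = d} \<rightarrow>\<^sub>E W \<and> (\<forall>c\<in>pts X. gset_id X c = d \<longrightarrow> snd (s c) = c))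
      = (d \<in> pts X \<and> s \<in> {d} \<rightarrow>\<^sub>E W \<and> snd (s d) = d)" for d and s :: "'g point \<Rightarrow> 'b \<times> 'g point" and W
    proof (cases "d \<in> pts X")
      case True
      have "(\<forall>c\<in>pts X. gset_id X c = d \<longrightarrow> snd (s c) = c) = (snd (s d) = d)"
        using True by (auto simp: gset_id_def)
      then show ?thesis unfolding fibq[OF True] by simp
    qed simp
    then show ?thesis unfolding comp_rmid by (simp add: res_bispan_def)
  qed
  have 1: "\<beta> b \<in> pts (rmid ?C)" if "b \<in> pts (rmid (part_bispan S X i))" for b
    using that q[of b] by (simp add: \<beta>_def CR rp)
  have 2: "\<beta> (act (rmid S) g b) = act (rmid ?C) g (\<beta> b)" if "b \<in> pts (rmid (part_bispan S X i))" "g \<in> carrier G" for b g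
  proof -
    have g: "act (rmid S) g b \<in> pts (rmid (part_bispan S X i))" using that image_act(1) r(2) by (simp add: rp)
    have b: "\<beta> b = (q b, \<lambda>c\<in>{q b}. (b, q b))" using that by (simp add: \<beta>_def)
    have qb: "q b \<in> pts X" "tleg S b = i (q b)" "b \<in> pts (rmid S)" using that q by (simp_all add: rp)
    have gq: "act X g (q b) \<in> pts X" using x(2) that qb by simp
    have "act (rmid ?C) g (\<beta> b) = (act X g (q b), \<lambda>c\<in>{act X g (q b)}. (act (rmid S) g b, act X g (q b)))"
      unfolding comp_act(1)[OF 1[OF that(1)]] unfolding b using that(2) qb gq x(5)
      by (auto simp: res_bispan_def fibq pullback_gset_def fun_eq_iff restrict_def)
    moreover have "\<beta> (act (rmid S) g b) = (act X g (q b), \<lambda>c\<in>{act X g (q b)}. (act (rmid S) g b, act X g (q b)))"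
      using g qa[OF that(2)] that(1) by (simp add: \<beta>_def rp)
    ultimately show ?thesis by simp
  qed
  have nl: "nleg S a \<in> pts (rmid (part_bispan S X i))" if "a \<in> pts (lmid (part_bispan S X i))" for a
    using that D by (simp add: lp rp)
  have 3: "\<alpha> a \<in> pts (lmid ?C)" if "a \<in> pts (lmid (part_bispan S X i))" for a
  proof -
    have "fst (\<beta> (nleg S a)) = q (nleg S a)" "snd (\<beta> (nleg S a)) (q (nleg S a)) = (nleg S a, q (nleg S a))"
      using nl[OF that] by (simp_all add: \<beta>_def)
    then show ?thesis using that 1[OF nl[OF that]] q[of "nleg S a"] D
      by (simp add: \<alpha>_def comp_lmid_iff) (simp add: res_bispan_def lp gset_id_def)
  qed
  have 4: "\<alpha> (act (lmid S) g a) = act (lmid ?C) g (\<alpha> a)" if "a \<in> pts (lmid (part_bispan S X i))" "g \<in> carrier G" for a g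
  proof -
    have m: "a \<in> pts (lmid S)" "nleg S a \<in> pts (rmid S)" "tleg S (nleg S a) \<in> i ` pts X"
       using that D by (simp_all add: lp)
    have n: "nleg S (act (lmid S) g a) = act (rmid S) g (nleg S a)" using that D by (simp add: lp)
    have g: "act (lmid S) g a \<in> pts (lmid (part_bispan S X i))" using that m image_act(1) l(2) by (simp add: lp n)
    have b: "\<alpha> a = ((a, nleg S a, q (nleg S a)), (q (nleg S a), \<beta> (nleg S a)))" using that by (simp add: \<alpha>_def)
    have c: "\<alpha> (act (lmid S) g a) = ((act (lmid S) g a, act (rmid S) g (nleg S a), act X g (q (nleg S a))),
        (act X g (q (nleg S a)), \<beta> (act (rmid S) g (nleg S a))))"
      using g qa[OF that(2) m(2,3)] by (simp add: \<alpha>_def n)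
    show ?thesis using 3[OF that(1)] unfolding c b
      by (simp add: comp_act(2) 2[OF nl[OF that(1)] that(2)]) (simp add: res_bispan_def)
  qed
  have ga: "act (lmid S) g a \<in> pts (lmid (part_bispan S X i))" if "a \<in> pts (lmid (part_bispan S X i))" "g \<in> carrier G" for a g
    using finite_gsetD(2)[OF G bispan_rules(1)[OF part_is_bispan] that(2,1)] la[OF that(1)] by simp
  have gb: "act (rmid S) g a \<in> pts (rmid (part_bispan S X i))" if "a \<in> pts (rmid (part_bispan S X i))" "g \<in> carrier G" for a g
    using finite_gsetD(2)[OF G bispan_rules(2)[OF part_is_bispan] that(2,1)] ra[OF that(1)] by simp
  have "\<alpha> \<in> gmap G (lmid (part_bispan S X i)) (lmid ?C)"
    using 3 4 la ga by (auto simp: gmap_def) (simp add: \<alpha>_def)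
  moreover have "\<beta> \<in> gmap G (rmid (part_bispan S X i)) (rmid ?C)"
    using 1 2 ra gb by (auto simp: gmap_def) (simp add: \<beta>_def)
  moreover have bb: "bij_betw \<beta> (pts (rmid (part_bispan S X i))) (pts (rmid ?C))"
  proof (rule bij_betw_byWitness[where f' = "\<lambda>e. fst (snd e (fst e))"])
    show "\<forall>b\<in>pts (rmid (part_bispan S X i)). fst (snd (\<beta> b) (fst (\<beta> b))) = b" by (simp add: \<beta>_def)
    have *: "\<beta> (fst (s d)) = (d,s) \<and> fst (s d) \<in> pts (rmid (part_bispan S X i))" if "(d,s) \<in> pts (rmid ?C)" for d s
    proof -
      have d: "d \<in> pts X" "snd (s d) = d" and s: "s \<in> {d} \<rightarrow>\<^sub>E {(b,c). b\<in>pts (rmid S) \<and> c\<in>pts X \<and> tleg S b = i c}"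
        using that by (simp_all add: CR)
      obtain b where b: "s d = (b,d)" using d(2) by (metis prod.collapse)
      have bS: "b \<in> pts (rmid S)" "tleg S b = i d" using PiE_mem[OF s, of d] b by auto
      have "s = (\<lambda>c\<in>{d}. (b,d))" using s b by (auto simp: PiE_def extensional_def fun_eq_iff)
      then show ?thesis using b bS d qi[OF d(1) bS(2)] by (simp add: \<beta>_def rp)
    qed
    then show "\<forall>e\<in>pts (rmid ?C). \<beta> (fst (snd e (fst e))) = e" by auto
    show "\<beta> ` pts (rmid (part_bispan S X i)) \<subseteq> pts (rmid ?C)" using 1 by auto
    show "(\<lambda>e. fst (snd e (fst e))) ` pts (rmid ?C) \<subseteq> pts (rmid (part_bispan S X i))" using * by auto
  qed
  moreover have "bij_betw \<alpha> (pts (lmid (part_bispan S X i))) (pts (lmid ?C))"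
  proof (rule bij_betw_byWitness[where f' = "\<lambda>w. fst (fst w)"])
    show "\<forall>b\<in>pts (lmid (part_bispan S X i)). fst (fst (\<alpha> b)) = b" by (simp add: \<alpha>_def)
    have *: "\<alpha> a = ((a,b,c),(c',e)) \<and> a \<in> pts (lmid (part_bispan S X i))" if "((a,b,c),(c',e)) \<in> pts (lmid ?C)" for a b c c' e
    proof -
      have w: "a\<in>pts(lmid S)" "b\<in>pts(rmid S)" "c\<in>pts X" "tleg S b = i c" "nleg S a = b" "c' \<in> pts X"
        "e \<in> pts (rmid ?C)" "c' = fst e" "(b,c) = snd e c'" 
        using that unfolding comp_lmid_iff by (auto simp: res_bispan_def gset_id_def split: if_splits)
      obtain b' where b': "b' \<in> pts (rmid (part_bispan S X i))" "\<beta> b' = e" using bb w(7) by (metis bij_betw_def imageE)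
      then have "fst e = q b'" "snd e (q b') = (b', q b')" by (auto simp: \<beta>_def)
      then have "b' = b" "c = q b" "c' = q b" using w(8,9) by auto
      then show ?thesis using w b' by (simp add: \<alpha>_def lp)
    qed
    then show "\<forall>e\<in>pts (lmid ?C). \<alpha> (fst (fst e)) = e" by (metis prod.collapse)
    show "\<alpha> ` pts (lmid (part_bispan S X i)) \<subseteq> pts (lmid ?C)" using 3 by auto
    show "(\<lambda>e. fst (fst e)) ` pts (lmid ?C) \<subseteq> pts (lmid (part_bispan S X i))" using * by (metis image_subsetI prod.collapse)
  qed
  moreover have "rleg ?C (\<alpha> a) = rleg (part_bispan S X i) a \<and> nleg ?C (\<alpha> a) = \<beta> (nleg (part_bispan S X i) a)" 
    if "a \<in> pts (lmid (part_bispan S X i))" for a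
    using that unfolding comp_legs(3)[OF 3[OF that]] comp_legs(4)[OF 3[OF that]]
    by (simp add: \<alpha>_def) (simp add: part_bispan_def lp restrict_gset_def)
  moreover have "tleg ?C (\<beta> b) = tleg (part_bispan S X i) b" if "b \<in> pts (rmid (part_bispan S X i))" for b
    using that q[of b] unfolding comp_legs(5)[OF 1[OF that]] 
    by (simp add: \<beta>_def) (simp add: part_bispan_def rp restrict_gset_def res_bispan_def gset_id_def q_def)
  moreover have "src (part_bispan S X i) = src ?C" "tgt (part_bispan S X i) = tgt ?C" by (simp_all add: part_bispan_def comp_legs res_bispan_def)
  ultimately show ?thesis unfolding bispan_iso_def by blast
qed

end

lemma sum_simps:
  "pts (sum_gset X Y) = InL ` pts X \<union> InR ` pts Y"
  "x \<in> pts X \<Longrightarrow> act (sum_gset X Y) g (InL x) = InL (act X g x)"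
  "y \<in> pts Y \<Longrightarrow> act (sum_gset X Y) g (InR y) = InR (act Y g y)"
  by (auto simp: sum_gset_def)

lemma sum_finite_gset:
  assumes G: "group G" and X: "finite_gset G X" and Y: "finite_gset G Y"
  shows "finite_gset G (sum_gset X Y)"
  using finite_gsetD[OF G X] finite_gsetD[OF G Y] group.is_monoid[OF G] unfolding finite_gset_iff[OF G]
  by (auto simp: sum_simps monoid.m_closed) (auto simp: sum_gset_def)

lemma inl_gmap: "group G \<Longrightarrow> finite_gset G X \<Longrightarrow> inl_map X \<in> gmap G X (sum_gset X Y)"
  using finite_gsetD(2)[of G X] by (auto simp: gmap_def inl_map_def sum_simps)

lemma inr_gmap: "group G \<Longrightarrow> finite_gset G Y \<Longrightarrow> inr_map Y \<in> gmap G Y (sum_gset X Y)"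
  using finite_gsetD(2)[of G Y] by (auto simp: gmap_def inr_map_def sum_simps)

lemma inclusions_inj: "inj_on (inl_map X) (pts X)" "inj_on (inr_map Y) (pts Y)"
  by (auto simp: inl_map_def inr_map_def intro: inj_onI)

lemma inclusion_images: "inl_map X ` pts X = InL ` pts X" "inr_map Y ` pts Y = InR ` pts Y"
  by (auto simp: inl_map_def inr_map_def)

lemma inclusion_inverses: "x \<in> pts X \<Longrightarrow> inv_into (pts X) (inl_map X) (InL x) = x"
  "y \<in> pts Y \<Longrightarrow> inv_into (pts Y) (inr_map Y) (InR y) = y"
  using inv_into_f_f[OF inclusions_inj(1), of x X] inv_into_f_f[OF inclusions_inj(2), of y Y]
  by (simp_all add: inl_map_def inr_map_def)

definition sum_bispan :: "('g,'g point,'g point) bispan \<Rightarrow> ('g,'g point,'g point) bispan \<Rightarrow> ('g,'g point,'g point) bispan" where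
  "sum_bispan S T = \<lparr>src = src S, lmid = sum_gset (lmid S) (lmid T), rmid = sum_gset (rmid S) (rmid T),
     tgt = sum_gset (tgt S) (tgt T),
     rleg = (\<lambda>z\<in>InL ` pts (lmid S) \<union> InR ` pts (lmid T). case z of InL a \<Rightarrow> rleg S a | InR a \<Rightarrow> rleg T a | Coset _ \<Rightarrow> undefined),
     nleg = (\<lambda>z\<in>InL ` pts (lmid S) \<union> InR ` pts (lmid T). case z of InL a \<Rightarrow> InL (nleg S a) | InR a \<Rightarrow> InR (nleg T a) | Coset _ \<Rightarrow> undefined),
     tleg = (\<lambda>z\<in>InL ` pts (rmid S) \<union> InR ` pts (rmid T). case z of InL a \<Rightarrow> InL (tleg S a) | InR a \<Rightarrow> InR (tleg T a) | Coset _ \<Rightarrow> undefined)\<rparr>"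

lemma sum_is_bispan:
  assumes G: "group G" and S: "is_bispan G S" and T: "is_bispan G T" and "src S = src T"
  shows "is_bispan G (sum_bispan S T)"
proof -
  note s = bispan_rules[OF S] finite_gsetD(2)[OF G bispan_rules(1)[OF S]] finite_gsetD(2)[OF G bispan_rules(2)[OF S]]
   and t = bispan_rules[OF T] finite_gsetD(2)[OF G bispan_rules(1)[OF T]] finite_gsetD(2)[OF G bispan_rules(2)[OF T]]
  have f: "finite_gset G (lmid (sum_bispan S T))" "finite_gset G (rmid (sum_bispan S T))" "finite_gset G (src (sum_bispan S T))"
     "finite_gset G (tgt (sum_bispan S T))"
    using S T sum_finite_gset[OF G] by (auto simp: is_bispan_def sum_bispan_def)
  have "rleg (sum_bispan S T) \<in> gmap G (lmid (sum_bispan S T)) (src (sum_bispan S T))"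
    using s t assms(4) by (auto simp: gmap_def sum_bispan_def sum_simps)
  moreover have "nleg (sum_bispan S T) \<in> gmap G (lmid (sum_bispan S T)) (rmid (sum_bispan S T))"
    using s t by (auto simp: gmap_def sum_bispan_def sum_simps)
  moreover have "tleg (sum_bispan S T) \<in> gmap G (rmid (sum_bispan S T)) (tgt (sum_bispan S T))"
    using s t by (auto simp: gmap_def sum_bispan_def sum_simps)
  ultimately show ?thesis using f by (simp add: is_bispan_def)
qed

lemma part_simps:
  "a \<in> pts (lmid (part_bispan S X i)) \<Longrightarrow> act (lmid (part_bispan S X i)) g a = act (lmid S) g a"
  "a \<in> pts (lmid (part_bispan S X i)) \<Longrightarrow> rleg (part_bispan S X i) a = rleg S a"
  "a \<in> pts (lmid (part_bispan S X i)) \<Longrightarrow> nleg (part_bispan S X i) a = nleg S a"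
  "b \<in> pts (rmid (part_bispan S X i)) \<Longrightarrow> act (rmid (part_bispan S X i)) g b = act (rmid S) g b"
  "b \<in> pts (rmid (part_bispan S X i)) \<Longrightarrow> tleg (part_bispan S X i) b = inv_into (pts X) i (tleg S b)"
  by (simp_all add: part_bispan_def restrict_gset_def)

lemma part_pts:
  "pts (lmid (part_bispan S X i)) = {a\<in>pts (lmid S). tleg S (nleg S a) \<in> i ` pts X}"
  "pts (rmid (part_bispan S X i)) = {b\<in>pts (rmid S). tleg S b \<in> i ` pts X}"
  by (auto simp: part_bispan_def restrict_gset_def)

lemma sum_bispan_pts:
  "pts (lmid (sum_bispan S T)) = InL ` pts (lmid S) \<union> InR ` pts (lmid T)"
  "pts (rmid (sum_bispan S T)) = InL ` pts (rmid S) \<union> InR ` pts (rmid T)"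
  by (simp_all add: sum_bispan_def sum_simps)

lemma sum_bispan_simps:
  "a \<in> pts (lmid S) \<Longrightarrow> act (lmid (sum_bispan S T)) g (InL a) = InL (act (lmid S) g a)"
  "a \<in> pts (lmid S) \<Longrightarrow> rleg (sum_bispan S T) (InL a) = rleg S a"
  "a \<in> pts (lmid S) \<Longrightarrow> nleg (sum_bispan S T) (InL a) = InL (nleg S a)"
  "b \<in> pts (rmid S) \<Longrightarrow> act (rmid (sum_bispan S T)) g (InL b) = InL (act (rmid S) g b)"
  "b \<in> pts (rmid S) \<Longrightarrow> tleg (sum_bispan S T) (InL b) = InL (tleg S b)"
  "a \<in> pts (lmid T) \<Longrightarrow> act (lmid (sum_bispan S T)) g (InR a) = InR (act (lmid T) g a)"
  "a \<in> pts (lmid T) \<Longrightarrow> rleg (sum_bispan S T) (InR a) = rleg T a"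
  "a \<in> pts (lmid T) \<Longrightarrow> nleg (sum_bispan S T) (InR a) = InR (nleg T a)"
  "b \<in> pts (rmid T) \<Longrightarrow> act (rmid (sum_bispan S T)) g (InR b) = InR (act (rmid T) g b)"
  "b \<in> pts (rmid T) \<Longrightarrow> tleg (sum_bispan S T) (InR b) = InR (tleg T b)"
  by (simp_all add: sum_bispan_def sum_simps)

lemma sum_bispan_parts:
  assumes G: "group G" and S: "is_bispan G S" and T: "is_bispan G T" and "src S = src T"
  shows "bispan_iso G S (part_bispan (sum_bispan S T) (tgt S) (inl_map (tgt S)))"
    "bispan_iso G T (part_bispan (sum_bispan S T) (tgt T) (inr_map (tgt T)))"
proof -
  note s = bispan_rules[OF S] finite_gsetD(2)[OF G bispan_rules(1)[OF S]] finite_gsetD(2)[OF G bispan_rules(2)[OF S]]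
   and t = bispan_rules[OF T] finite_gsetD(2)[OF G bispan_rules(1)[OF T]] finite_gsetD(2)[OF G bispan_rules(2)[OF T]]
  let ?C = "part_bispan (sum_bispan S T) (tgt S) (inl_map (tgt S))"
  have p: "pts (lmid ?C) = InL ` pts (lmid S)" "pts (rmid ?C) = InL ` pts (rmid S)"
    unfolding part_pts sum_bispan_pts inclusion_images using s(3,6) t(3,6) by (auto simp: sum_bispan_simps)
  have q: "src ?C = src S" "tgt ?C = tgt S" using assms(4) by (simp_all add: part_bispan_def sum_bispan_def)
  have l: "act (lmid ?C) g (InL a) = InL (act (lmid S) g a)" "rleg ?C (InL a) = rleg S a"
    "nleg ?C (InL a) = InL (nleg S a)" if "a \<in> pts (lmid S)" for a g
  proof -
    have "InL a \<in> pts (lmid ?C)" using that unfolding p by simp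
    then show "act (lmid ?C) g (InL a) = InL (act (lmid S) g a)" "rleg ?C (InL a) = rleg S a"
      "nleg ?C (InL a) = InL (nleg S a)" using that
      by (simp_all add: part_simps sum_bispan_simps)
  qed
  have r: "act (rmid ?C) g (InL a) = InL (act (rmid S) g a)" "tleg ?C (InL a) = tleg S a"
    if "a \<in> pts (rmid S)" for a g
  proof -
    have "InL a \<in> pts (rmid ?C)" using that unfolding p by simp
    then show "act (rmid ?C) g (InL a) = InL (act (rmid S) g a)" "tleg ?C (InL a) = tleg S a"
      using that s(6)[OF that]
      by (simp_all add: part_simps sum_bispan_simps inclusion_inverses)
  qed
  have "inl_map (lmid S) \<in> gmap G (lmid S) (lmid ?C)" "inl_map (rmid S) \<in> gmap G (rmid S) (rmid ?C)"
    using s(9,10) by (auto simp: gmap_def p l r inl_map_def[of "lmid S"] inl_map_def[of "rmid S"])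
  moreover have "bij_betw (inl_map (lmid S)) (pts (lmid S)) (pts (lmid ?C))" 
     "bij_betw (inl_map (rmid S)) (pts (rmid S)) (pts (rmid ?C))"
    unfolding p bij_betw_def by (simp_all add: inclusions_inj inclusion_images)
  moreover have "\<forall>a\<in>pts (lmid S). rleg ?C (inl_map (lmid S) a) = rleg S a \<and> nleg ?C (inl_map (lmid S) a) = inl_map (rmid S) (nleg S a)"
    using l s(3) by (simp add: inl_map_def[of "lmid S"] inl_map_def[of "rmid S"])
  moreover have "\<forall>b\<in>pts (rmid S). tleg ?C (inl_map (rmid S) b) = tleg S b"
    using r by (simp add: inl_map_def[of "lmid S"] inl_map_def[of "rmid S"])
  ultimately show "bispan_iso G S ?C" unfolding bispan_iso_def q
    by (intro conjI refl bexI[of _ "inl_map (lmid S)"] bexI[of _ "inl_map (rmid S)"]) assumption+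
next
  note s = bispan_rules[OF S] finite_gsetD(2)[OF G bispan_rules(1)[OF S]] finite_gsetD(2)[OF G bispan_rules(2)[OF S]]
   and t = bispan_rules[OF T] finite_gsetD(2)[OF G bispan_rules(1)[OF T]] finite_gsetD(2)[OF G bispan_rules(2)[OF T]]
  let ?C = "part_bispan (sum_bispan S T) (tgt T) (inr_map (tgt T))"
  have p: "pts (lmid ?C) = InR ` pts (lmid T)" "pts (rmid ?C) = InR ` pts (rmid T)"
    unfolding part_pts sum_bispan_pts inclusion_images using s(3,6) t(3,6) by (auto simp: sum_bispan_simps)
  have q: "src ?C = src T" "tgt ?C = tgt T" using assms(4) by (simp_all add: part_bispan_def sum_bispan_def)
  have l: "act (lmid ?C) g (InR a) = InR (act (lmid T) g a)" "rleg ?C (InR a) = rleg T a"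
    "nleg ?C (InR a) = InR (nleg T a)" if "a \<in> pts (lmid T)" for a g
  proof -
    have "InR a \<in> pts (lmid ?C)" using that unfolding p by simp
    then show "act (lmid ?C) g (InR a) = InR (act (lmid T) g a)" "rleg ?C (InR a) = rleg T a"
      "nleg ?C (InR a) = InR (nleg T a)" using that
      by (simp_all add: part_simps sum_bispan_simps)
  qed
  have r: "act (rmid ?C) g (InR a) = InR (act (rmid T) g a)" "tleg ?C (InR a) = tleg T a"
    if "a \<in> pts (rmid T)" for a g
  proof -
    have "InR a \<in> pts (rmid ?C)" using that unfolding p by simp
    then show "act (rmid ?C) g (InR a) = InR (act (rmid T) g a)" "tleg ?C (InR a) = tleg T a"
      using that t(6)[OF that]
      by (simp_all add: part_simps sum_bispan_simps inclusion_inverses)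
  qed
  have "inr_map (lmid T) \<in> gmap G (lmid T) (lmid ?C)" "inr_map (rmid T) \<in> gmap G (rmid T) (rmid ?C)"
    using t(9,10) by (auto simp: gmap_def p l r inr_map_def[of "lmid T"] inr_map_def[of "rmid T"])
  moreover have "bij_betw (inr_map (lmid T)) (pts (lmid T)) (pts (lmid ?C))" 
     "bij_betw (inr_map (rmid T)) (pts (rmid T)) (pts (rmid ?C))"
    unfolding p bij_betw_def by (simp_all add: inclusions_inj inclusion_images)
  moreover have "\<forall>a\<in>pts (lmid T). rleg ?C (inr_map (lmid T) a) = rleg T a \<and> nleg ?C (inr_map (lmid T) a) = inr_map (rmid T) (nleg T a)"
    using l t(3) by (simp add: inr_map_def[of "lmid T"] inr_map_def[of "rmid T"])
  moreover have "\<forall>b\<in>pts (rmid T). tleg ?C (inr_map (rmid T) b) = tleg T b"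
    using r by (simp add: inr_map_def[of "lmid T"] inr_map_def[of "rmid T"])
  ultimately show "bispan_iso G T ?C" unfolding bispan_iso_def q
    by (intro conjI refl bexI[of _ "inr_map (lmid T)"] bexI[of _ "inr_map (rmid T)"]) assumption+
qed

lemma part_bispan_map:
  assumes o: "bispan_map G (part_bispan S X i) (part_bispan S' X i) \<alpha> \<beta>" and n: "\<And>a. a \<in> pts (lmid S) \<Longrightarrow> nleg S a \<in> pts (rmid S)"
  shows "\<And>b. b \<in> pts (rmid S) \<Longrightarrow> tleg S b \<in> i ` pts X \<Longrightarrow> \<beta> b \<in> pts (rmid S') \<and> tleg S' (\<beta> b) = tleg S b \<and>
       (\<forall>g\<in>carrier G. \<beta> (act (rmid S) g b) = act (rmid S') g (\<beta> b))"
    "\<And>a. a \<in> pts (lmid S) \<Longrightarrow> tleg S (nleg S a) \<in> i ` pts X \<Longrightarrow> \<alpha> a \<in> pts (lmid S') \<and> rleg S' (\<alpha> a) = rleg S a \<and>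
       nleg S' (\<alpha> a) = \<beta> (nleg S a) \<and>
       (\<forall>g\<in>carrier G. \<alpha> (act (lmid S) g a) = act (lmid S') g (\<alpha> a))"
proof -
  fix b assume b: "b \<in> pts (rmid S)" "tleg S b \<in> i ` pts X"
  then have "b \<in> pts (rmid (part_bispan S X i))" by (simp add: part_bispan_def restrict_gset_def)
  note * = bispan_map_D(4,7,9)[OF o] and c = this
  have 1: "\<beta> b \<in> pts (rmid S')" "tleg S' (\<beta> b) \<in> i ` pts X" using *(1)[OF c] by (simp_all add: part_bispan_def restrict_gset_def)
  have "inv_into (pts X) i (tleg S' (\<beta> b)) = inv_into (pts X) i (tleg S b)"
    using *(2)[OF c] 1 b by (simp add: part_bispan_def restrict_gset_def)
  then have "tleg S' (\<beta> b) = tleg S b" using 1 b by (metis f_inv_into_f)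
  moreover have "\<forall>g\<in>carrier G. \<beta> (act (rmid S) g b) = act (rmid S') g (\<beta> b)"
    using *(3)[OF _ c] 1 b by (simp add: part_bispan_def restrict_gset_def)
  ultimately show "\<beta> b \<in> pts (rmid S') \<and> tleg S' (\<beta> b) = tleg S b \<and>
       (\<forall>g\<in>carrier G. \<beta> (act (rmid S) g b) = act (rmid S') g (\<beta> b))" using 1 by simp
next
  fix a assume a: "a \<in> pts (lmid S)" "tleg S (nleg S a) \<in> i ` pts X"
  then have c: "a \<in> pts (lmid (part_bispan S X i))" by (simp add: part_bispan_def restrict_gset_def)
  note * = bispan_map_D(3,5,6,8)[OF o]
  have 1: "\<alpha> a \<in> pts (lmid S')" "tleg S' (nleg S' (\<alpha> a)) \<in> i ` pts X" using *(1)[OF c] by (simp_all add: part_bispan_def restrict_gset_def)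
  show "\<alpha> a \<in> pts (lmid S') \<and> rleg S' (\<alpha> a) = rleg S a \<and>
       nleg S' (\<alpha> a) = \<beta> (nleg S a) \<and>
       (\<forall>g\<in>carrier G. \<alpha> (act (lmid S) g a) = act (lmid S') g (\<alpha> a))"
    using *(2,3)[OF c] *(4)[OF _ c] 1 a by (simp add: part_bispan_def restrict_gset_def)
qed

definition join_left where "join_left S U f h = (\<lambda>a\<in>pts (lmid S). if tleg S (nleg S a) \<in> U then f a else h a)"
definition join_right where "join_right S U f h = (\<lambda>b\<in>pts (rmid S). if tleg S b \<in> U then f b else h b)"

lemma join_bispan_map:
  assumes G: "group G" and S: "is_bispan G S" and X: "finite_gset G X" and Y: "finite_gset G Y"
    and t: "tgt S = sum_gset X Y" "tgt S' = sum_gset X Y" "src S = src S'"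
    and o: "bispan_map G (part_bispan S X (inl_map X)) (part_bispan S' X (inl_map X)) \<alpha> \<beta>"
    and o': "bispan_map G (part_bispan S Y (inr_map Y)) (part_bispan S' Y (inr_map Y)) \<gamma> \<delta>"
  shows "bispan_map G S S' (join_left S (InL ` pts X) \<alpha> \<gamma>) (join_right S (InL ` pts X) \<beta> \<delta>)"
proof -
  note s = bispan_rules[OF S] finite_gsetD(2)[OF G bispan_rules(1)[OF S]] finite_gsetD(2)[OF G bispan_rules(2)[OF S]]
  note x = finite_gsetD(2)[OF G X] and y = finite_gsetD(2)[OF G Y]
  note c = part_bispan_map[OF o s(3), unfolded inclusion_images] part_bispan_map[OF o' s(3), unfolded inclusion_images]
  have d: "tleg S b \<in> InR ` pts Y" if "b \<in> pts (rmid S)" "tleg S b \<notin> InL ` pts X" for b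
    using s(6)[OF that(1)] that(2) by (auto simp: t sum_simps)
  have ta: "tleg S (act (rmid S) g b) \<in> InL ` pts X \<longleftrightarrow> tleg S b \<in> InL ` pts X"
    if "b \<in> pts (rmid S)" "g \<in> carrier G" for b g
    using s(8)[OF that(2,1)] s(6)[OF that(1)] x y that by (auto simp: t sum_simps)
  have R: "join_right S (InL ` pts X) \<beta> \<delta> \<in> gmap G (rmid S) (rmid S')"
    using c(1,3) d s ta by (auto simp: gmap_def join_right_def)
  have L: "join_left S (InL ` pts X) \<alpha> \<gamma> \<in> gmap G (lmid S) (lmid S')"
    using c(2,4) d s ta by (auto simp: gmap_def join_left_def)
  show ?thesis unfolding bispan_map_def using R L c d s t by (auto simp: join_right_def join_left_def)
qed

lemma join_inverse:
  assumes S: "is_bispan G S" and t: "tgt S = sum_gset X Y"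
    and o: "bispan_maps_inverse G (part_bispan S X (inl_map X)) (part_bispan S' X (inl_map X)) \<alpha> \<beta> \<alpha>' \<beta>'"
    and o': "bispan_maps_inverse G (part_bispan S Y (inr_map Y)) (part_bispan S' Y (inr_map Y)) \<gamma> \<delta> \<gamma>' \<delta>'"
  shows "\<forall>a\<in>pts (lmid S). join_left S' (InL ` pts X) \<alpha>' \<gamma>' (join_left S (InL ` pts X) \<alpha> \<gamma> a) = a"
    "\<forall>a\<in>pts (rmid S). join_right S' (InL ` pts X) \<beta>' \<delta>' (join_right S (InL ` pts X) \<beta> \<delta> a) = a"
proof -
  note s = bispan_rules[OF S]
  have i: "bispan_map G (part_bispan S X (inl_map X)) (part_bispan S' X (inl_map X)) \<alpha> \<beta>" 
    "bispan_map G (part_bispan S Y (inr_map Y)) (part_bispan S' Y (inr_map Y)) \<gamma> \<delta>"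
    using o o' by (auto simp: bispan_maps_inverse_def)
  note c = part_bispan_map[OF i(1) s(3), unfolded inclusion_images] part_bispan_map[OF i(2) s(3), unfolded inclusion_images]
  have e: "\<And>a. a \<in> pts (lmid S) \<Longrightarrow> tleg S (nleg S a) \<in> InL ` pts X \<Longrightarrow> \<alpha>' (\<alpha> a) = a"
     "\<And>a. a \<in> pts (lmid S) \<Longrightarrow> tleg S (nleg S a) \<in> InR ` pts Y \<Longrightarrow> \<gamma>' (\<gamma> a) = a"
     "\<And>a. a \<in> pts (rmid S) \<Longrightarrow> tleg S a \<in> InL ` pts X \<Longrightarrow> \<beta>' (\<beta> a) = a"
     "\<And>a. a \<in> pts (rmid S) \<Longrightarrow> tleg S a \<in> InR ` pts Y \<Longrightarrow> \<delta>' (\<delta> a) = a"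
    using o o' by (simp_all add: bispan_maps_inverse_def part_bispan_def restrict_gset_def inclusion_images)
  have d: "tleg S b \<in> InR ` pts Y" if "b \<in> pts (rmid S)" "tleg S b \<notin> InL ` pts X" for b
    using s(6)[OF that(1)] that(2) by (auto simp: t sum_simps)
  show "\<forall>a\<in>pts (lmid S). join_left S' (InL ` pts X) \<alpha>' \<gamma>' (join_left S (InL ` pts X) \<alpha> \<gamma> a) = a"
    using c d e s(3) by (auto simp: join_left_def)
  show "\<forall>a\<in>pts (rmid S). join_right S' (InL ` pts X) \<beta>' \<delta>' (join_right S (InL ` pts X) \<beta> \<delta> a) = a"
    using c d e by (auto simp: join_right_def)
qed

lemma parts_determine:
  assumes G: "group G" and S: "is_bispan G S" and S': "is_bispan G S'" and X: "finite_gset G X" and Y: "finite_gset G Y"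
    and t: "tgt S = sum_gset X Y" "tgt S' = sum_gset X Y" "src S = src S'"
    and o: "bispan_iso G (part_bispan S X (inl_map X)) (part_bispan S' X (inl_map X))"
    and o': "bispan_iso G (part_bispan S Y (inr_map Y)) (part_bispan S' Y (inr_map Y))"
  shows "bispan_iso G S S'"
proof -
  have b: "is_bispan G (part_bispan S X (inl_map X))" "is_bispan G (part_bispan S Y (inr_map Y))"
    using part_is_bispan[OF G S X, of "inl_map X"] part_is_bispan[OF G S Y, of "inr_map Y"] inl_gmap[OF G X] inr_gmap[OF G Y] inclusions_inj t by auto
  obtain \<alpha> \<beta> \<alpha>' \<beta>' where 1: "bispan_maps_inverse G (part_bispan S X (inl_map X)) (part_bispan S' X (inl_map X)) \<alpha> \<beta> \<alpha>' \<beta>'"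
    by (rule bispan_isoE[OF G b(1) o])
  obtain \<gamma> \<delta> \<gamma>' \<delta>' where 2: "bispan_maps_inverse G (part_bispan S Y (inr_map Y)) (part_bispan S' Y (inr_map Y)) \<gamma> \<delta> \<gamma>' \<delta>'"
    by (rule bispan_isoE[OF G b(2) o'])
  have "bispan_maps_inverse G S S' (join_left S (InL ` pts X) \<alpha> \<gamma>) (join_right S (InL ` pts X) \<beta> \<delta>)
     (join_left S' (InL ` pts X) \<alpha>' \<gamma>') (join_right S' (InL ` pts X) \<beta>' \<delta>')"
    using join_bispan_map[OF G S X Y t, of \<alpha> \<beta> \<gamma> \<delta>] join_bispan_map[OF G S' X Y t(2,1) t(3)[symmetric], of \<alpha>' \<beta>' \<gamma>' \<delta>']
      join_inverse[OF S t(1) 1 2] join_inverse[OF S' t(2) bispan_maps_inverse_sym[OF 1] bispan_maps_inverse_sym[OF 2]] 1 2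
    by (simp add: bispan_maps_inverse_def)
  then show ?thesis by (rule bispan_isoI)
qed

lemma projection_class:
  assumes G: "group G" and S: "is_bispan G (S :: ('g,'g point,'g point) bispan)" and X: "finite_gset G X" and t: "tgt S = P"
    and i: "i \<in> gmap G X P" "inj_on i (pts X)"
  shows "mor_comp G (bispan_class G (res_bispan X P i)) (bispan_class G S) = bispan_class G (part_bispan S X i)"
proof -
  note i' = i(1)[folded t]
  have "mor_comp G (bispan_class G (res_bispan X P i)) (bispan_class G S) = bispan_class G (bispan_comp G (res_bispan X P i) S)"
    using mor_comp_class[OF G S res_is_bispan[OF G S X i' i(2)]] t by (simp add: res_bispan_def)
  then show ?thesis
    using bispan_class_eq[OF G part_is_bispan[OF G S X i' i(2)] part_iso_comp[OF G S X i' i(2)]] t by simp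
qed

theorem sum_gset_product:
  assumes G: "group G" and X: "finite_gset G X" and Y: "finite_gset G Y"
    and c: "c \<in> bispan_hom G Z X" and d: "d \<in> bispan_hom G Z Y"
  shows "\<exists>!m. m \<in> bispan_hom G Z (sum_gset X Y) \<and>
     mor_comp G (bispan_class G (res_bispan X (sum_gset X Y) (inl_map X))) m = c \<and>
     mor_comp G (bispan_class G (res_bispan Y (sum_gset X Y) (inr_map Y))) m = d"
proof -
  note iX = inl_gmap[OF G X] inclusions_inj(1) and iY = inr_gmap[OF G Y] inclusions_inj(2)
  obtain S :: "('a,'a point,'a point) bispan" where S: "is_bispan G S" "src S = Z" "tgt S = X" "c = bispan_class G S"
    using c by (auto simp: bispan_hom_def)
  obtain T :: "('a,'a point,'a point) bispan" where T: "is_bispan G T" "src T = Z" "tgt T = Y" "d = bispan_class G T"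
    using d by (auto simp: bispan_hom_def)
  have st: "src S = src T" using S T by simp
  have g: "is_bispan G (sum_bispan S T)" "tgt (sum_bispan S T) = sum_gset X Y" "src (sum_bispan S T) = Z"
    using sum_is_bispan[OF G S(1) T(1) st] S T by (auto simp: sum_bispan_def)
  have h: "bispan_class G (part_bispan (sum_bispan S T) X (inl_map X)) = c" "bispan_class G (part_bispan (sum_bispan S T) Y (inr_map Y)) = d"
    using bispan_class_eq[OF G S(1) sum_bispan_parts(1)[OF G S(1) T(1) st]] bispan_class_eq[OF G T(1) sum_bispan_parts(2)[OF G S(1) T(1) st]] S T by simp_all
  show ?thesis
  proof (rule ex1I[of _ "bispan_class G (sum_bispan S T)"])
    show "bispan_class G (sum_bispan S T) \<in> bispan_hom G Z (sum_gset X Y) \<and>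
     mor_comp G (bispan_class G (res_bispan X (sum_gset X Y) (inl_map X))) (bispan_class G (sum_bispan S T)) = c \<and>
     mor_comp G (bispan_class G (res_bispan Y (sum_gset X Y) (inr_map Y))) (bispan_class G (sum_bispan S T)) = d"
      using bispan_class_in_hom[OF G g(1)] g projection_class[OF G g(1) X g(2) iX] projection_class[OF G g(1) Y g(2) iY] h by simp
  next
    fix m assume m: "m \<in> bispan_hom G Z (sum_gset X Y) \<and>
     mor_comp G (bispan_class G (res_bispan X (sum_gset X Y) (inl_map X))) m = c \<and>
     mor_comp G (bispan_class G (res_bispan Y (sum_gset X Y) (inr_map Y))) m = d"
    then obtain U :: "('a,'a point,'a point) bispan" where U: "is_bispan G U" "src U = Z" "tgt U = sum_gset X Y" "m = bispan_class G U"
      by (auto simp: bispan_hom_def)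
    have "bispan_class G (part_bispan U X (inl_map X)) = bispan_class G (part_bispan (sum_bispan S T) X (inl_map X))"
      "bispan_class G (part_bispan U Y (inr_map Y)) = bispan_class G (part_bispan (sum_bispan S T) Y (inr_map Y))"
      using m U projection_class[OF G U(1) X U(3) iX] projection_class[OF G U(1) Y U(3) iY] h by simp_all
    moreover have "is_bispan G (part_bispan U X (inl_map X))" "is_bispan G (part_bispan U Y (inr_map Y))"
      using part_is_bispan[OF G U(1) X, of "inl_map X"] part_is_bispan[OF G U(1) Y, of "inr_map Y"] U iX iY by auto
    ultimately have "bispan_iso G (part_bispan U X (inl_map X)) (part_bispan (sum_bispan S T) X (inl_map X))"
       "bispan_iso G (part_bispan U Y (inr_map Y)) (part_bispan (sum_bispan S T) Y (inr_map Y))"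
      using bispan_class_eqD[OF G] by blast+
    then have "bispan_iso G U (sum_bispan S T)"
      using parts_determine[OF G U(1) g(1) X Y U(3) g(2)] U(2) g(3) by simp
    then show "m = bispan_class G (sum_bispan S T)" using bispan_class_eq[OF G U(1)] U(4) by simp
  qed
qed

theorem empty_gset_terminal:
  assumes G: "group G" and Z: "finite_gset G Z"
  shows "\<exists>!m. m \<in> bispan_hom G Z empty_gset"
proof -
  have e: "finite_gset G empty_gset" unfolding finite_gset_iff[OF G] by (simp add: empty_gset_def)
  define S :: "('a,'a point,'a point) bispan" where "S = \<lparr>src = Z, lmid = empty_gset, rmid = empty_gset, tgt = empty_gset,
     rleg = (\<lambda>_. undefined), nleg = (\<lambda>_. undefined), tleg = (\<lambda>_. undefined)\<rparr>"
  have S: "is_bispan G S" using e Z by (simp add: is_bispan_def S_def gmap_def) (simp add: empty_gset_def)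
  show ?thesis
  proof (rule ex1I[of _ "bispan_class G S"])
    show "bispan_class G S \<in> bispan_hom G Z empty_gset" using bispan_class_in_hom[OF G S] by (simp add: S_def)
    fix m assume "m \<in> bispan_hom G Z empty_gset"
    then obtain T :: "('a,'a point,'a point) bispan" where T: "is_bispan G T" "src T = Z" "tgt T = empty_gset" "m = bispan_class G T"
      by (auto simp: bispan_hom_def)
    have p: "pts (rmid T) = {}" using bispan_rules(6)[OF T(1)] T(3) by (auto simp: empty_gset_def)
    then have q: "pts (lmid T) = {}" using bispan_rules(3)[OF T(1)] by auto
    have "bispan_iso G T S" using T p q unfolding bispan_iso_def
      by (auto simp: S_def gmap_def empty_gset_def bij_betw_def)
    then show "m = bispan_class G S" using bispan_class_eq[OF G T(1)] T(4) by simp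
  qed
qed

end

theory Submission
  imports Defs "HOL-Algebra.QuotRing"
begin

text \<open>
  Put F = k(G/e), a commutative ring on which G acts. Restriction along the map g \<mapsto> g p from G/e to X
  evaluates an element x of k(X) at a point p of X, so that x becomes a G-equivariant function
  ev x from X to F. Base change, applied to pullbacks along such maps, shows that a bispan
  X \<leftarrow> A \<rightarrow> B \<rightarrow> Y acts on these functions by summing over the fibres of B \<rightarrow> Y the products over
  the fibres of A \<rightarrow> B (ev_ar). Hence k can be studied inside F as soon as evaluation is injective.

  This is where field-likeness enters. For a G-stable ideal J of F, the elements of the k(G/K) all of
  whose values lie in J form a Tambara ideal (spread_tambara_ideal). For J = 0 this says that
  evaluation is injective (ev_kernel), and for general J that F has no G-stable ideals besides 0 and F
  (F_simple). Decomposing X into orbits, one finds that k(X) is the set of all equivariant functions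
  on X whose value at p comes from k(G/K), where K is the stabilizer of p (ev_bijective).
  So k amounts to F with its action and the subrings Fsub K of elements that come from k(G/K).

  A commutative ring that is simple in this sense is a finite product of fields which G permutes
  transitively. The proof uses one maximal ideal m: if H is its stabilizer, there is an idempotent e,
  congruent to 1 modulo m and lying in all other translates of m; it is fixed by H and orthogonal to
  its translates by elements outside H, and L = eF is a field (exists_splitting_idempotent).

  The field L with its action of H and the subrings Fsub K \<inter> L for K \<subseteq> H yields an H-Tambara functor l
  of equivariant functions (fixed_tambara). It is field-like: its ideals are controlled by their
  value at H/e, since restriction to H/e is injective and norms preserve 1 (fixed_field_like). Finally
  x \<mapsto> e ev x maps k(X) to l(X), naturally in X (comparison_hom). It is injective because the y in F with
  e (g y) = 0 for all g in G form a proper G-stable ideal, which is 0 (projection_determines). It is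
  surjective because an H-equivariant \<psi> on X is e times the G-equivariant function that sends p to the
  sum of the g \<psi>(inv g p) over the cosets g H; its values lie in the required subrings since these are
  closed under transfers (comparison_surjective).
\<close>

section \<open>Recognising composites of bispans\<close>

lemma comp_right_iff:
  "(d, s) \<in> pts (rmid (bispan_comp G Q P)) \<longleftrightarrow> d \<in> pts (rmid Q) \<and>
     s \<in> extensional {c\<in>pts (lmid Q). nleg Q c = d} \<and>
     (\<forall>c\<in>pts (lmid Q). nleg Q c = d \<longrightarrow>
        fst (s c) \<in> pts (rmid P) \<and> tleg P (fst (s c)) = rleg Q c \<and> snd (s c) = c)"
  unfolding comp_rmid by (auto simp: PiE_def Pi_def split_beta)

text \<open>
  The points of the right inner set of a composite are pairs of a point d of rmid Q and a section over
  the fibre of d; those of the left inner set are, in essence, triples of such a pair, a point c in the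
  fibre of d and a point of lmid P over the value of the section at c. A bispan S is therefore the
  composite as soon as its inner sets parametrise these data uniquely and equivariantly: \<pi> and \<sigma>
  read off d and the section, kap and lam the remaining two points. All relations between restrictions, norms
  and transfers are obtained from this criterion.
\<close>

lemma comp_recognition:
  fixes S :: "('g,'a,'b) bispan" and P :: "('g,'c,'d) bispan" and Q :: "('g,'e,'f) bispan"
  assumes G: "group G" and P: "is_bispan G P" and Q: "is_bispan G Q" and S: "is_bispan G S"
    and T: "tgt P = src Q" "src S = src P" "tgt S = tgt Q"
    and left: "\<And>a. a \<in> pts (lmid S) \<Longrightarrow> lam a \<in> pts (lmid P) \<and> kap a \<in> pts (lmid Q) \<and>
        rleg S a = rleg P (lam a) \<and> nleg Q (kap a) = \<pi> (nleg S a) \<and> nleg P (lam a) = \<sigma> (nleg S a) (kap a)"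
    and right: "\<And>b. b \<in> pts (rmid S) \<Longrightarrow> \<pi> b \<in> pts (rmid Q) \<and> tleg S b = tleg Q (\<pi> b)"
    and sec: "\<And>b c. b \<in> pts (rmid S) \<Longrightarrow> c \<in> pts (lmid Q) \<Longrightarrow> nleg Q c = \<pi> b \<Longrightarrow>
        \<sigma> b c \<in> pts (rmid P) \<and> tleg P (\<sigma> b c) = rleg Q c"
    and left_act: "\<And>g a. g \<in> carrier G \<Longrightarrow> a \<in> pts (lmid S) \<Longrightarrow>
        lam (act (lmid S) g a) = act (lmid P) g (lam a) \<and> kap (act (lmid S) g a) = act (lmid Q) g (kap a)"
    and right_act: "\<And>g b. g \<in> carrier G \<Longrightarrow> b \<in> pts (rmid S) \<Longrightarrow> \<pi> (act (rmid S) g b) = act (rmid Q) g (\<pi> b)"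
    and sec_act: "\<And>g b c. g \<in> carrier G \<Longrightarrow> b \<in> pts (rmid S) \<Longrightarrow> c \<in> pts (lmid Q) \<Longrightarrow> nleg Q c = \<pi> b \<Longrightarrow>
        \<sigma> (act (rmid S) g b) (act (lmid Q) g c) = act (rmid P) g (\<sigma> b c)"
    and right_unique: "\<And>d s. d \<in> pts (rmid Q) \<Longrightarrow>
        (\<And>c. c \<in> pts (lmid Q) \<Longrightarrow> nleg Q c = d \<Longrightarrow> s c \<in> pts (rmid P) \<and> tleg P (s c) = rleg Q c) \<Longrightarrow>
        \<exists>!b. b \<in> pts (rmid S) \<and> \<pi> b = d \<and> (\<forall>c\<in>pts (lmid Q). nleg Q c = d \<longrightarrow> \<sigma> b c = s c)"
    and left_unique: "\<And>a b c. b \<in> pts (rmid S) \<Longrightarrow> c \<in> pts (lmid Q) \<Longrightarrow> nleg Q c = \<pi> b \<Longrightarrow>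
        a \<in> pts (lmid P) \<Longrightarrow> nleg P a = \<sigma> b c \<Longrightarrow>
        \<exists>!x. x \<in> pts (lmid S) \<and> nleg S x = b \<and> kap x = c \<and> lam x = a"
  shows "bispan_iso G S (bispan_comp G Q P)"
proof -
  let ?C = "bispan_comp G Q P"
  interpret group G by (rule G)
  note s = bispan_rules[OF S] and q = bispan_rules[OF Q] and p = bispan_rules[OF P]
  note sa = finite_gsetD(2)[OF G s(1)] finite_gsetD(2)[OF G s(2)]
  note qa = finite_gsetD[OF G q(1)]
  define \<beta> where "\<beta> = (\<lambda>b\<in>pts (rmid S). (\<pi> b, \<lambda>c\<in>{c\<in>pts (lmid Q). nleg Q c = \<pi> b}. (\<sigma> b c, c)))"
  define \<alpha> where "\<alpha> = (\<lambda>x\<in>pts (lmid S). ((lam x, nleg P (lam x), kap x), (kap x, \<beta> (nleg S x))))"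
  have \<beta>: "\<beta> b = (\<pi> b, \<lambda>c\<in>{c\<in>pts (lmid Q). nleg Q c = \<pi> b}. (\<sigma> b c, c))" if "b \<in> pts (rmid S)" for b
    using that by (simp add: \<beta>_def)
  have \<alpha>: "\<alpha> x = ((lam x, nleg P (lam x), kap x), (kap x, \<beta> (nleg S x)))" if "x \<in> pts (lmid S)" for x
    using that by (simp add: \<alpha>_def)
  have 1: "\<beta> b \<in> pts (rmid ?C)" if "b \<in> pts (rmid S)" for b
    using right[OF that] sec[OF that] unfolding \<beta>[OF that] comp_right_iff by auto
  have 2: "\<beta> (act (rmid S) g b) = act (rmid ?C) g (\<beta> b)" if b: "b \<in> pts (rmid S)" and g: "g \<in> carrier G" for b g
  proof -
    have *: "(\<sigma> (act (rmid S) g b) c, c) = act (pullback_gset (rmid P) (tleg P) (lmid Q) (rleg Q)) g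
        ((\<lambda>c\<in>{c\<in>pts (lmid Q). nleg Q c = \<pi> b}. (\<sigma> b c, c)) (act (lmid Q) (inv\<^bsub>G\<^esub> g) c))"
      if c: "c \<in> pts (lmid Q)" "nleg Q c = act (rmid Q) g (\<pi> b)" for c
    proof -
      let ?c = "act (lmid Q) (inv\<^bsub>G\<^esub> g) c"
      have c': "?c \<in> pts (lmid Q)" "nleg Q ?c = \<pi> b" "act (lmid Q) g ?c = c"
        using c g b qa(2,6) q(4)[of "inv\<^bsub>G\<^esub> g" c] right[OF b] finite_gsetD(5)[OF G q(2)] by simp_all
      have "(\<sigma> b ?c, ?c) \<in> pts (pullback_gset (rmid P) (tleg P) (lmid Q) (rleg Q))"
        using sec[OF b c'(1,2)] c' by (simp add: pullback_pts)
      then show ?thesis using c' sec_act[OF g b c'(1,2)] by (simp add: pullback_act)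
    qed
    show ?thesis
      unfolding comp_act(1)[OF 1[OF b]] unfolding \<beta>[OF sa(2)[OF g b]] \<beta>[OF b] right_act[OF g b] fst_conv snd_conv
      by (intro arg_cong2[of _ _ _ _ Pair] refl restrict_ext) (use * in simp)
  qed
  have 3: "\<alpha> x \<in> pts (lmid ?C)" if "x \<in> pts (lmid S)" for x
    using left[OF that] sec[OF s(3)[OF that], of "kap x"] 1[OF s(3)[OF that]] p(3)
    unfolding \<alpha>[OF that] comp_lmid_iff by (simp add: \<beta> s(3)[OF that])
  have 4: "\<alpha> (act (lmid S) g x) = act (lmid ?C) g (\<alpha> x)" if x: "x \<in> pts (lmid S)" and g: "g \<in> carrier G" for x g
    unfolding \<alpha>[OF x] comp_act(2)[OF 3[OF x, unfolded \<alpha>[OF x]]] \<alpha>[OF sa(1)[OF g x]]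
    using left_act[OF g x] p(4)[OF g] left[OF x] s(4)[OF g x] 2[OF s(3)[OF x] g] by simp
  have "\<alpha> \<in> gmap G (lmid S) (lmid ?C)" using 3 4 sa by (auto simp: gmap_def) (simp add: \<alpha>_def)
  moreover have "\<beta> \<in> gmap G (rmid S) (rmid ?C)" using 1 2 sa by (auto simp: gmap_def) (simp add: \<beta>_def)
  moreover have bb: "bij_betw \<beta> (pts (rmid S)) (pts (rmid ?C))"
  proof (rule bij_betwI')
    show "\<beta> b \<in> pts (rmid ?C)" if "b \<in> pts (rmid S)" for b using 1[OF that] .
    show "(\<beta> b = \<beta> b') = (b = b')" if b: "b \<in> pts (rmid S)" and b': "b' \<in> pts (rmid S)" for b b'
    proof
      assume e: "\<beta> b = \<beta> b'"
      then have e1: "\<pi> b' = \<pi> b" by (simp add: \<beta> b b')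
      have e2: "\<sigma> b' c = \<sigma> b c" if "c \<in> pts (lmid Q)" "nleg Q c = \<pi> b" for c
        using arg_cong[OF e, of "\<lambda>z. fst (snd z c)"] that by (simp add: \<beta> b b' e1)
      have "\<exists>!x. x \<in> pts (rmid S) \<and> \<pi> x = \<pi> b \<and> (\<forall>c\<in>pts (lmid Q). nleg Q c = \<pi> b \<longrightarrow> \<sigma> x c = \<sigma> b c)"
        by (rule right_unique) (use right[OF b] sec[OF b] in auto)
      then show "b = b'" using b b' e1 e2 by blast
    qed simp
    show "\<exists>b\<in>pts (rmid S). e = \<beta> b" if e: "e \<in> pts (rmid ?C)" for e
    proof -
      obtain d t where dt: "e = (d, t)" by (cases e)
      note * = e[unfolded dt comp_right_iff]
      have "\<exists>!b. b \<in> pts (rmid S) \<and> \<pi> b = d \<and> (\<forall>c\<in>pts (lmid Q). nleg Q c = d \<longrightarrow> \<sigma> b c = fst (t c))"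
        by (rule right_unique) (use * in auto)
      then obtain b where b: "b \<in> pts (rmid S)" "\<pi> b = d" "\<And>c. c\<in>pts (lmid Q) \<Longrightarrow> nleg Q c = d \<Longrightarrow> \<sigma> b c = fst (t c)"
        by blast
      have "(\<lambda>c\<in>{c\<in>pts (lmid Q). nleg Q c = d}. (\<sigma> b c, c)) = t"
        using b * by (auto simp: fun_eq_iff extensional_def restrict_def prod_eq_iff)
      then have "e = \<beta> b" using \<beta>[OF b(1)] b(2) dt by simp
      then show ?thesis using b(1) by blast
    qed
  qed
  moreover have "bij_betw \<alpha> (pts (lmid S)) (pts (lmid ?C))"
  proof (rule bij_betwI')
    show "\<alpha> b \<in> pts (lmid ?C)" if "b \<in> pts (lmid S)" for b using 3[OF that] .
    show "(\<alpha> x = \<alpha> y) = (x = y)" if x: "x \<in> pts (lmid S)" and y: "y \<in> pts (lmid S)" for x y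
    proof
      assume e: "\<alpha> x = \<alpha> y"
      then have "lam y = lam x" "kap y = kap x" "\<beta> (nleg S y) = \<beta> (nleg S x)" by (simp_all add: \<alpha> x y)
      moreover from this(3) have "nleg S y = nleg S x" using bb s(3) x y by (auto simp: bij_betw_def inj_on_def)
      moreover have "\<exists>!z. z \<in> pts (lmid S) \<and> nleg S z = nleg S x \<and> kap z = kap x \<and> lam z = lam x"
        by (rule left_unique) (use left[OF x] s(3)[OF x] in auto)
      ultimately show "x = y" using x y by blast
    qed simp
    show "\<exists>x\<in>pts (lmid S). w = \<alpha> x" if w: "w \<in> pts (lmid ?C)" for w
    proof -
      obtain a b c c' e where e: "w = ((a,b,c),(c',e))" by (metis prod.exhaust)
      note * = w[unfolded e comp_lmid_iff]
      obtain y where y: "y \<in> pts (rmid S)" "e = \<beta> y" using bb * by (auto simp: bij_betw_def)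
      have c': "nleg Q c' = \<pi> y" using * by (simp add: y(2) \<beta>[OF y(1)])
      have "snd e c' = (\<sigma> y c', c')" using * c' by (simp add: y(2) \<beta>[OF y(1)])
      then have bc: "c = c'" "b = \<sigma> y c'" using * by simp_all
      have "\<exists>!z. z \<in> pts (lmid S) \<and> nleg S z = y \<and> kap z = c' \<and> lam z = a"
        by (rule left_unique) (use * y c' bc in auto)
      then obtain z where "z \<in> pts (lmid S)" "nleg S z = y" "kap z = c'" "lam z = a" by blast
      then show ?thesis using * bc y unfolding e by (intro bexI[of _ z]) (auto simp: \<alpha>)
    qed
  qed
  moreover have "rleg ?C (\<alpha> x) = rleg S x \<and> nleg ?C (\<alpha> x) = \<beta> (nleg S x)" if "x \<in> pts (lmid S)" for x
    unfolding comp_legs(3)[OF 3[OF that]] comp_legs(4)[OF 3[OF that]]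
    using left[OF that] by (simp add: \<alpha> that)
  moreover have "tleg ?C (\<beta> b) = tleg S b" if "b \<in> pts (rmid S)" for b
    unfolding comp_legs(5)[OF 1[OF that]] using right[OF that] by (simp add: \<beta> that)
  ultimately show ?thesis unfolding bispan_iso_def using T by (auto simp: comp_legs)
qed

lemma mor_comp_recognized:
  fixes S P Q :: "('g,'g point,'g point) bispan"
  assumes G: "group G" and P: "is_bispan G P" and Q: "is_bispan G Q" and S: "is_bispan G S" and T: "tgt P = src Q"
    and i: "bispan_iso G S (bispan_comp G Q P)"
  shows "mor_comp G (bispan_class G Q) (bispan_class G P) = bispan_class G S"
  using mor_comp_class[OF G P Q T] bispan_class_eq[OF G S i] by simp

section \<open>Relations between restrictions, norms and transfers\<close>

lemma gset_id_simp [simp]: "x \<in> pts X \<Longrightarrow> gset_id X x = x"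
  by (simp add: gset_id_def)

text \<open>
  The composite of a restriction followed by a norm.
\<close>

definition span_bispan :: "'g objct \<Rightarrow> ('g,'a) gset \<Rightarrow> 'g objct \<Rightarrow> ('a \<Rightarrow> 'g point) \<Rightarrow> ('a \<Rightarrow> 'g point) \<Rightarrow> ('g,'a,'g point) bispan" where
  "span_bispan X A B r n = \<lparr>src = X, lmid = A, rmid = B, tgt = B, rleg = r, nleg = n, tleg = gset_id B\<rparr>"

context
  fixes G :: "('g,'m) monoid_scheme"
  assumes G: "group G"
begin

lemma is_bispan_res: "finite_gset G X \<Longrightarrow> finite_gset G Y \<Longrightarrow> f \<in> gmap G X Y \<Longrightarrow> is_bispan G (res_bispan X Y f)"
  and is_bispan_norm: "finite_gset G X \<Longrightarrow> finite_gset G Y \<Longrightarrow> f \<in> gmap G X Y \<Longrightarrow> is_bispan G (norm_bispan X Y f)"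
  and is_bispan_tr: "finite_gset G X \<Longrightarrow> finite_gset G Y \<Longrightarrow> f \<in> gmap G X Y \<Longrightarrow> is_bispan G (tr_bispan X Y f)"
  and is_bispan_span: "finite_gset G X \<Longrightarrow> finite_gset G A \<Longrightarrow> finite_gset G B \<Longrightarrow> r \<in> gmap G A X \<Longrightarrow> n \<in> gmap G A B \<Longrightarrow>
     is_bispan G (span_bispan X A B r n)"
  using gset_id_gmap[OF G] by (auto simp: is_bispan_def res_bispan_def norm_bispan_def tr_bispan_def span_bispan_def)

lemma res_res_class:
  assumes X: "finite_gset G X" and Y: "finite_gset G Y" and Z: "finite_gset G Z"
    and f: "f \<in> gmap G X Y" and g: "g \<in> gmap G Y Z" and h: "h \<in> gmap G X Z" "\<And>x. x \<in> pts X \<Longrightarrow> h x = g (f x)"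
  shows "mor_comp G (bispan_class G (res_bispan X Y f)) (bispan_class G (res_bispan Y Z g)) = bispan_class G (res_bispan X Z h)"
proof (rule mor_comp_recognized[OF G is_bispan_res[OF Y Z g] is_bispan_res[OF X Y f] is_bispan_res[OF X Z h(1)]])
  show "bispan_iso G (res_bispan X Z h) (bispan_comp G (res_bispan X Y f) (res_bispan Y Z g))"
    by (rule comp_recognition[OF G is_bispan_res[OF Y Z g] is_bispan_res[OF X Y f] is_bispan_res[OF X Z h(1)],
       where lam = f and kap = "\<lambda>x. x" and \<pi> = "\<lambda>x. x" and \<sigma> = "\<lambda>b c. f b"])
     (use finite_gsetD(2)[OF G X] gmapD[OF f] gmapD[OF g] h(2) in \<open>auto simp: res_bispan_def\<close>)
qed (simp add: res_bispan_def)

lemma norm_norm_class: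
  assumes X: "finite_gset G X" and Y: "finite_gset G Y" and Z: "finite_gset G Z"
    and f: "f \<in> gmap G X Y" and g: "g \<in> gmap G Y Z" and h: "h \<in> gmap G X Z" "\<And>x. x \<in> pts X \<Longrightarrow> h x = g (f x)"
  shows "mor_comp G (bispan_class G (norm_bispan Y Z g)) (bispan_class G (norm_bispan X Y f)) = bispan_class G (norm_bispan X Z h)"
proof (rule mor_comp_recognized[OF G is_bispan_norm[OF X Y f] is_bispan_norm[OF Y Z g] is_bispan_norm[OF X Z h(1)]])
  show "bispan_iso G (norm_bispan X Z h) (bispan_comp G (norm_bispan Y Z g) (norm_bispan X Y f))"
  proof (rule comp_recognition[OF G is_bispan_norm[OF X Y f] is_bispan_norm[OF Y Z g] is_bispan_norm[OF X Z h(1)],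
       where lam = "\<lambda>x. x" and kap = f and \<pi> = "\<lambda>x. x" and \<sigma> = "\<lambda>b c. c"], goal_cases)
    case (10 d s)
    have "s c = c" if "c \<in> pts Y" "g c = d" for c using 10(2)[of c] that by (auto simp: norm_bispan_def)
    then show ?case using 10(1) by (auto simp: norm_bispan_def)
  qed (use finite_gsetD(2)[OF G X] finite_gsetD(2)[OF G Y] gmapD[OF f] gmapD[OF g] h(2) in \<open>auto simp: norm_bispan_def\<close>)
qed (simp add: norm_bispan_def)

lemma tr_tr_class:
  assumes X: "finite_gset G X" and Y: "finite_gset G Y" and Z: "finite_gset G Z"
    and f: "f \<in> gmap G X Y" and g: "g \<in> gmap G Y Z" and h: "h \<in> gmap G X Z" "\<And>x. x \<in> pts X \<Longrightarrow> h x = g (f x)"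
  shows "mor_comp G (bispan_class G (tr_bispan Y Z g)) (bispan_class G (tr_bispan X Y f)) = bispan_class G (tr_bispan X Z h)"
proof (rule mor_comp_recognized[OF G is_bispan_tr[OF X Y f] is_bispan_tr[OF Y Z g] is_bispan_tr[OF X Z h(1)]])
  show "bispan_iso G (tr_bispan X Z h) (bispan_comp G (tr_bispan Y Z g) (tr_bispan X Y f))"
    by (rule comp_recognition[OF G is_bispan_tr[OF X Y f] is_bispan_tr[OF Y Z g] is_bispan_tr[OF X Z h(1)],
       where lam = "\<lambda>x. x" and kap = f and \<pi> = f and \<sigma> = "\<lambda>b c. b"])
     (use finite_gsetD(2)[OF G X] finite_gsetD(2)[OF G Y] gmapD[OF f] gmapD[OF g] h(2) in \<open>auto simp: tr_bispan_def\<close>)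
qed (simp add: tr_bispan_def)

lemma norm_res_class:
  assumes X: "finite_gset G X" and A: "finite_gset G A" and B: "finite_gset G B"
    and r: "r \<in> gmap G A X" and n: "n \<in> gmap G A B"
  shows "mor_comp G (bispan_class G (norm_bispan A B n)) (bispan_class G (res_bispan A X r)) = bispan_class G (span_bispan X A B r n)"
proof (rule mor_comp_recognized[OF G is_bispan_res[OF A X r] is_bispan_norm[OF A B n] is_bispan_span[OF X A B r n]])
  show "bispan_iso G (span_bispan X A B r n) (bispan_comp G (norm_bispan A B n) (res_bispan A X r))"
  proof (rule comp_recognition[OF G is_bispan_res[OF A X r] is_bispan_norm[OF A B n] is_bispan_span[OF X A B r n],
       where lam = "\<lambda>x. x" and kap = "\<lambda>x. x" and \<pi> = "\<lambda>x. x" and \<sigma> = "\<lambda>b c. c"], goal_cases)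
    case (10 d s)
    have "s c = c" if "c \<in> pts A" "n c = d" for c using 10(2)[of c] that by (auto simp: norm_bispan_def res_bispan_def)
    then show ?case using 10(1) by (auto simp: norm_bispan_def res_bispan_def span_bispan_def)
  qed (use finite_gsetD(2)[OF G A] finite_gsetD(2)[OF G B] gmapD[OF r] gmapD[OF n] in \<open>auto simp: norm_bispan_def res_bispan_def span_bispan_def\<close>)
qed (simp add: norm_bispan_def res_bispan_def)

text \<open>
  This reduces the action of an arbitrary bispan to those of restrictions, norms and transfers.
\<close>

lemma factorization_class:
  fixes S :: "('g,'g point,'g point) bispan"
  assumes S: "is_bispan G S"
  shows "bispan_class G S = mor_comp G (bispan_class G (tr_bispan (rmid S) (tgt S) (tleg S)))
    (mor_comp G (bispan_class G (norm_bispan (lmid S) (rmid S) (nleg S))) (bispan_class G (res_bispan (lmid S) (src S) (rleg S))))"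
proof -
  have s: "finite_gset G (src S)" "finite_gset G (lmid S)" "finite_gset G (rmid S)" "finite_gset G (tgt S)"
    "rleg S \<in> gmap G (lmid S) (src S)" "nleg S \<in> gmap G (lmid S) (rmid S)" "tleg S \<in> gmap G (rmid S) (tgt S)"
    using S by (auto simp: is_bispan_def)
  note p = is_bispan_span[OF s(1,2,3,5,6)] and q = is_bispan_tr[OF s(3,4,7)]
  have "bispan_iso G S (bispan_comp G (tr_bispan (rmid S) (tgt S) (tleg S)) (span_bispan (src S) (lmid S) (rmid S) (rleg S) (nleg S)))"
    by (rule comp_recognition[OF G p q S, where lam = "\<lambda>x. x" and kap = "nleg S" and \<pi> = "\<lambda>x. x" and \<sigma> = "\<lambda>b c. b"])
     (use finite_gsetD(2)[OF G s(2)] finite_gsetD(2)[OF G s(3)] gmapD[OF s(5)] gmapD[OF s(6)] gmapD[OF s(7)] in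
       \<open>auto simp: tr_bispan_def span_bispan_def\<close>)
  from mor_comp_recognized[OF G p q S _ this] show ?thesis
    unfolding norm_res_class[OF s(1,2,3,5,6)] by (simp add: span_bispan_def tr_bispan_def)
qed

end

text \<open>
  Stated by its universal property on points, because a pullback of two objects has its points in a
  product type and so is an object only up to isomorphism.
\<close>

definition pullback_square where
  "pullback_square G X' X Y' Y f f' g g' \<longleftrightarrow>
     f \<in> gmap G X Y \<and> f' \<in> gmap G X' Y' \<and> g \<in> gmap G Y' Y \<and> g' \<in> gmap G X' X \<and>
     (\<forall>x\<in>pts X'. f (g' x) = g (f' x)) \<and>
     (\<forall>x\<in>pts X. \<forall>y\<in>pts Y'. f x = g y \<longrightarrow> (\<exists>!z. z \<in> pts X' \<and> g' z = x \<and> f' z = y))"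

context
  fixes G :: "('g,'m) monoid_scheme" and X' X Y' Y :: "'g objct" and f f' g g'
  assumes G: "group G" and X: "finite_gset G X" and X': "finite_gset G X'" and Y: "finite_gset G Y" and Y': "finite_gset G Y'"
   and sq: "pullback_square G X' X Y' Y f f' g g'"
begin

lemma sq_maps: "f \<in> gmap G X Y" "f' \<in> gmap G X' Y'" "g \<in> gmap G Y' Y" "g' \<in> gmap G X' X"
   "\<And>x. x \<in> pts X' \<Longrightarrow> f (g' x) = g (f' x)"
   "\<And>x y. x \<in> pts X \<Longrightarrow> y \<in> pts Y' \<Longrightarrow> f x = g y \<Longrightarrow> \<exists>!z. z \<in> pts X' \<and> g' z = x \<and> f' z = y"
  using sq by (auto simp: pullback_square_def)

lemmas sq_simps = finite_gsetD(2)[OF G X'] finite_gsetD(2)[OF G X] finite_gsetD(2)[OF G Y] finite_gsetD(2)[OF G Y']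
  gmapD[OF sq_maps(1)] gmapD[OF sq_maps(2)] gmapD[OF sq_maps(3)] gmapD[OF sq_maps(4)] sq_maps(5)

lemma norm_base_change:
  "mor_comp G (bispan_class G (res_bispan Y' Y g)) (bispan_class G (norm_bispan X Y f)) =
   mor_comp G (bispan_class G (norm_bispan X' Y' f')) (bispan_class G (res_bispan X' X g'))"
proof -
  note p = is_bispan_norm[OF G X Y sq_maps(1)] and q = is_bispan_res[OF G Y' Y sq_maps(3)] and s = is_bispan_span[OF G X X' Y' sq_maps(4,2)]
  have "bispan_iso G (span_bispan X X' Y' g' f') (bispan_comp G (res_bispan Y' Y g) (norm_bispan X Y f))"
  proof (rule comp_recognition[OF G p q s, where lam = g' and kap = f' and \<pi> = "\<lambda>x. x" and \<sigma> = "\<lambda>b c. g b"], goal_cases)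
    case (11 a b c)
    then show ?case using sq_maps(6)[of a b] by (auto simp: res_bispan_def norm_bispan_def span_bispan_def)
  qed (use sq_simps in \<open>auto simp: res_bispan_def norm_bispan_def span_bispan_def\<close>)
  from mor_comp_recognized[OF G p q s _ this] norm_res_class[OF G X X' Y' sq_maps(4,2)] show ?thesis
    by (simp add: norm_bispan_def res_bispan_def)
qed

lemma tr_base_change:
  "mor_comp G (bispan_class G (res_bispan Y' Y g)) (bispan_class G (tr_bispan X Y f)) =
   mor_comp G (bispan_class G (tr_bispan X' Y' f')) (bispan_class G (res_bispan X' X g'))"
proof -
  define S where "S = \<lparr>src = X, lmid = X', rmid = X', tgt = Y', rleg = g', nleg = gset_id X', tleg = f'\<rparr>"
  have S: "is_bispan G S" using X X' Y' sq_maps gset_id_gmap[OF G X'] by (simp add: S_def is_bispan_def)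
  note p = is_bispan_tr[OF G X Y sq_maps(1)] and q = is_bispan_res[OF G Y' Y sq_maps(3)]
  have "bispan_iso G S (bispan_comp G (res_bispan Y' Y g) (tr_bispan X Y f))"
  proof (rule comp_recognition[OF G p q S, where lam = g' and kap = f' and \<pi> = f' and \<sigma> = "\<lambda>b c. g' b"], goal_cases)
    case (10 d s)
    then have "\<exists>!z. z \<in> pts X' \<and> g' z = s d \<and> f' z = d" using sq_maps(6)[of "s d" d] by (auto simp: res_bispan_def tr_bispan_def)
    moreover have "(\<forall>c\<in>pts Y'. gset_id Y' c = d \<longrightarrow> g' b = s c) \<longleftrightarrow> g' b = s d" for b
      using 10 by (auto simp: res_bispan_def)
    ultimately show ?case by (simp add: S_def res_bispan_def conj_commute conj_left_commute)
  qed (use sq_simps in \<open>auto simp: res_bispan_def tr_bispan_def S_def\<close>)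
  from mor_comp_recognized[OF G p q S _ this]
  have 1: "mor_comp G (bispan_class G (res_bispan Y' Y g)) (bispan_class G (tr_bispan X Y f)) = bispan_class G S"
    by (simp add: tr_bispan_def res_bispan_def)
  note p = is_bispan_res[OF G X' X sq_maps(4)] and q = is_bispan_tr[OF G X' Y' sq_maps(2)]
  have "bispan_iso G S (bispan_comp G (tr_bispan X' Y' f') (res_bispan X' X g'))"
    by (rule comp_recognition[OF G p q S, where lam = "\<lambda>x. x" and kap = "\<lambda>x. x" and \<pi> = "\<lambda>x. x" and \<sigma> = "\<lambda>b c. b"])
     (use sq_simps in \<open>auto simp: res_bispan_def tr_bispan_def S_def\<close>)
  from mor_comp_recognized[OF G p q S _ this] 1 show ?thesis
    by (simp add: tr_bispan_def res_bispan_def)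
qed

end

text \<open>
  A norm after a transfer is a transfer after a norm. The hypotheses say that D \<rightarrow> E \<rightarrow> Y and ev
  form an exponential diagram: E parametrises the sections of q over the fibres of f, D is the
  pullback of X and E over Y, and ev evaluates the section. This is where distributivity comes from.
\<close>

lemma exponential_class:
  fixes G :: "('g,'m) monoid_scheme" and X Y A E D :: "'g objct"
  assumes G: "group G" and fin: "finite_gset G X" "finite_gset G Y" "finite_gset G A" "finite_gset G E" "finite_gset G D"
    and q: "q \<in> gmap G A X" and f: "f \<in> gmap G X Y" and t: "t \<in> gmap G E Y"
    and ev: "ev \<in> gmap G D A" and pr: "pr \<in> gmap G D E"
    and sq: "\<And>w. w \<in> pts D \<Longrightarrow> f (q (ev w)) = t (pr w)"
    and sec: "\<And>e x. e \<in> pts E \<Longrightarrow> x \<in> pts X \<Longrightarrow> f x = t e \<Longrightarrow> \<exists>!w. w \<in> pts D \<and> pr w = e \<and> q (ev w) = x"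
    and univ: "\<And>y s. y \<in> pts Y \<Longrightarrow> (\<And>x. x \<in> pts X \<Longrightarrow> f x = y \<Longrightarrow> s x \<in> pts A \<and> q (s x) = x) \<Longrightarrow>
      \<exists>!e. e \<in> pts E \<and> t e = y \<and> (\<forall>w\<in>pts D. pr w = e \<longrightarrow> ev w = s (q (ev w)))"
  shows "mor_comp G (bispan_class G (norm_bispan X Y f)) (bispan_class G (tr_bispan A X q)) =
    mor_comp G (bispan_class G (tr_bispan E Y t)) (mor_comp G (bispan_class G (norm_bispan D E pr)) (bispan_class G (res_bispan D A ev)))"
proof -
  define S where "S = \<lparr>src = A, lmid = D, rmid = E, tgt = Y, rleg = ev, nleg = pr, tleg = t\<rparr>"
  have S: "is_bispan G S" using assms by (simp add: S_def is_bispan_def)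
  note p = is_bispan_tr[OF G fin(3,1) q] and qq = is_bispan_norm[OF G fin(1,2) f]
  \<comment> \<open>the point of the pullback D over e and x\<close>
  define \<omega> where "\<omega> e x = (THE w. w \<in> pts D \<and> pr w = e \<and> q (ev w) = x)" for e x
  have \<omega>: "\<omega> e x \<in> pts D" "pr (\<omega> e x) = e" "q (ev (\<omega> e x)) = x" if "e \<in> pts E" "x \<in> pts X" "f x = t e" for e x
    using theI'[OF sec[OF that]] unfolding \<omega>_def by blast+
  have \<omega>_eq: "\<omega> (pr w) (q (ev w)) = w" if "w \<in> pts D" for w
    using sec[of "pr w" "q (ev w)"] \<omega>[of "pr w" "q (ev w)"] that gmapD(1)[OF pr] gmapD(1)[OF q] gmapD(1)[OF ev] sq by metis
  note d = gmapD[OF pr] gmapD[OF q] gmapD[OF ev] gmapD[OF f] gmapD[OF t] finite_gsetD(2)[OF G fin(1)] finite_gsetD(2)[OF G fin(5)]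
     finite_gsetD(2)[OF G fin(4)]
  have \<omega>_act: "\<omega> (act E g e) (act X g x) = act D g (\<omega> e x)" if "e \<in> pts E" "x \<in> pts X" "f x = t e" "g \<in> carrier G" for e x g
    using \<omega>_eq[of "act D g (\<omega> e x)"] \<omega>[OF that(1-3)] that d by simp
  have *: "(\<forall>w\<in>pts D. pr w = e \<longrightarrow> ev w = s (q (ev w))) \<longleftrightarrow> (\<forall>c\<in>pts X. f c = t e \<longrightarrow> ev (\<omega> e c) = s c)"
    if "e \<in> pts E" for e s
  proof (intro iffI ballI impI)
    fix c assume "\<forall>w\<in>pts D. pr w = e \<longrightarrow> ev w = s (q (ev w))" "c \<in> pts X" "f c = t e"
    then show "ev (\<omega> e c) = s c" using \<omega>[OF that] by metis
  next
    fix w assume "\<forall>c\<in>pts X. f c = t e \<longrightarrow> ev (\<omega> e c) = s c" "w \<in> pts D" "pr w = e"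
    then show "ev w = s (q (ev w))" using \<omega>_eq d sq by metis
  qed
  have "bispan_iso G S (bispan_comp G (norm_bispan X Y f) (tr_bispan A X q))"
  proof (rule comp_recognition[OF G p qq S, where lam = ev and kap = "\<lambda>w. q (ev w)" and \<pi> = t and \<sigma> = "\<lambda>e x. ev (\<omega> e x)"], goal_cases)
    case (10 y s)
    then have y: "y \<in> pts Y" and s: "\<And>x. x \<in> pts X \<Longrightarrow> f x = y \<Longrightarrow> s x \<in> pts A \<and> q (s x) = x"
      by (auto simp: norm_bispan_def tr_bispan_def)
    have "e \<in> pts E \<and> t e = y \<and> (\<forall>w\<in>pts D. pr w = e \<longrightarrow> ev w = s (q (ev w))) \<longleftrightarrow>
      e \<in> pts E \<and> t e = y \<and> (\<forall>c\<in>pts X. f c = y \<longrightarrow> ev (\<omega> e c) = s c)" for e using *[of e s] by auto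
    with univ[OF y s] show ?case by (simp add: S_def norm_bispan_def)
  next
    case (11 a b c)
    then have h: "b \<in> pts E" "c \<in> pts X" "f c = t b" "a = ev (\<omega> b c)" by (auto simp: S_def norm_bispan_def tr_bispan_def d)
    then show ?case using \<omega>[OF h(1-3)] \<omega>_eq by (auto simp: S_def norm_bispan_def tr_bispan_def intro!: ex1I[of _ "\<omega> b c"])
  qed (use d sq \<omega> \<omega>_eq \<omega>_act in \<open>auto simp: S_def norm_bispan_def tr_bispan_def\<close>)
  from mor_comp_recognized[OF G p qq S _ this] factorization_class[OF G S] show ?thesis
    by (simp add: S_def norm_bispan_def tr_bispan_def)
qed

section \<open>Values of a Tambara functor\<close>

definition copair :: "'g objct \<Rightarrow> 'g objct \<Rightarrow> ('g point \<Rightarrow> 'g point) \<Rightarrow> ('g point \<Rightarrow> 'g point) \<Rightarrow> 'g point \<Rightarrow> 'g point" where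
  "copair X Y f g = (\<lambda>z\<in>pts (sum_gset X Y). case z of InL x \<Rightarrow> f x | InR y \<Rightarrow> g y | Coset C \<Rightarrow> undefined)"

lemma copair_simps [simp]:
  "x \<in> pts X \<Longrightarrow> copair X Y f g (InL x) = f x" "y \<in> pts Y \<Longrightarrow> copair X Y f g (InR y) = g y"
  by (simp_all add: copair_def sum_simps)

lemma fold_map_simps [simp]: "x \<in> pts X \<Longrightarrow> fold_map X (InL x) = x" "x \<in> pts X \<Longrightarrow> fold_map X (InR x) = x"
  by (simp_all add: fold_map_def sum_simps)

lemma inclusion_simps [simp]: "x \<in> pts X \<Longrightarrow> inl_map X x = InL x" "x \<in> pts X \<Longrightarrow> inr_map X x = InR x"
  by (simp_all add: inl_map_def inr_map_def)

lemma empty_pts [simp]: "pts empty_gset = {}"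
  by (simp add: empty_gset_def)

lemma empty_finite_gset: "group G \<Longrightarrow> finite_gset G empty_gset"
  by (simp add: finite_gset_iff) (simp add: empty_gset_def)

lemma empty_gmap: "(\<lambda>_. undefined) \<in> gmap G empty_gset X"
  by (simp add: gmap_def)

lemma copair_gmap:
  assumes "group G" "finite_gset G X" "finite_gset G Y" "f \<in> gmap G X Z" "g \<in> gmap G Y Z"
  shows "copair X Y f g \<in> gmap G (sum_gset X Y) Z"
  using finite_gsetD(2)[OF assms(1,2)] finite_gsetD(2)[OF assms(1,3)] gmapD[OF assms(4)] gmapD[OF assms(5)]
  by (auto simp: gmap_def sum_simps) (auto simp: copair_def sum_simps)

lemma sum_gmap:
  assumes "group G" "finite_gset G X" "finite_gset G Y" "f \<in> gmap G X Z" "g \<in> gmap G Y W"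
  shows "copair X Y (\<lambda>x. InL (f x)) (\<lambda>y. InR (g y)) \<in> gmap G (sum_gset X Y) (sum_gset Z W)"
  using finite_gsetD(2)[OF assms(1,2)] finite_gsetD(2)[OF assms(1,3)] gmapD[OF assms(4)] gmapD[OF assms(5)]
  by (auto simp: gmap_def sum_simps) (auto simp: copair_def sum_simps)

lemma fold_map_gmap:
  assumes "group G" "finite_gset G X"
  shows "fold_map X \<in> gmap G (sum_gset X X) X"
  using finite_gsetD(2)[OF assms] by (auto simp: gmap_def sum_simps) (auto simp: fold_map_def sum_simps)

lemma pullback_squareI:
  assumes "f \<in> gmap G X Y" "f' \<in> gmap G X' Y'" "g \<in> gmap G Y' Y" "g' \<in> gmap G X' X"
    and "\<And>z. z \<in> pts X' \<Longrightarrow> f (g' z) = g (f' z) \<and> h (g' z) (f' z) = z"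
    and "\<And>x y. x \<in> pts X \<Longrightarrow> y \<in> pts Y' \<Longrightarrow> f x = g y \<Longrightarrow> h x y \<in> pts X' \<and> g' (h x y) = x \<and> f' (h x y) = y"
  shows "pullback_square G X' X Y' Y f f' g g'"
  unfolding pullback_square_def
proof (intro conjI ballI impI)
  fix x y assume "x \<in> pts X" "y \<in> pts Y'" "f x = g y"
  note * = assms(6)[OF this]
  show "\<exists>!z. z \<in> pts X' \<and> g' z = x \<and> f' z = y"
  proof (rule ex1I[of _ "h x y"])
    show "h x y \<in> pts X' \<and> g' (h x y) = x \<and> f' (h x y) = y" by (rule *)
    fix z assume z: "z \<in> pts X' \<and> g' z = x \<and> f' z = y"
    then have "h (g' z) (f' z) = z" using assms(5) by blast
    then show "z = h x y" using z by simp
  qed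
qed (use assms(1-5) in auto)

locale tambara = group G for G :: "('g,'m) monoid_scheme" (structure) +
  fixes k :: "('g,'r) bfunctor"
  assumes finite_group: "finite (carrier G)" and tambara: "tambara_functor G k"
begin

abbreviation "R \<equiv> Res G k"
abbreviation "N \<equiv> Nm G k"
abbreviation "T \<equiv> Tr G k"
abbreviation "Fin \<equiv> finite_gset G"

lemmas fin_sum = sum_finite_gset[OF is_group] and fin_empty = empty_finite_gset[OF is_group]
  and inl_map = inl_gmap[OF is_group] and inr_map = inr_gmap[OF is_group] and id_map = gset_id_gmap[OF is_group]
  and copair_map = copair_gmap[OF is_group] and fold_gmap = fold_map_gmap[OF is_group]
lemmas [simp] = fin_sum fin_empty id_map empty_gmap

lemma ar_closed: "c \<in> bispan_hom G X Y \<Longrightarrow> x \<in> ob k X \<Longrightarrow> ar k c x \<in> ob k Y"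
  using tambara by (fastforce simp: tambara_functor_def bispan_functor_def)

lemma ar_comp: "c \<in> bispan_hom G X Y \<Longrightarrow> d \<in> bispan_hom G Y Z \<Longrightarrow> x \<in> ob k X \<Longrightarrow>
    ar k (mor_comp G d c) x = ar k d (ar k c x)"
  using tambara by (auto simp: tambara_functor_def bispan_functor_def compose_eq)

lemma ar_id: "Fin X \<Longrightarrow> x \<in> ob k X \<Longrightarrow> ar k (mor_id G X) x = x"
  using tambara by (auto simp: tambara_functor_def bispan_functor_def)

lemma ops_in_hom:
  assumes "Fin X" "Fin Y" "f \<in> gmap G X Y"
  shows "bispan_class G (res_bispan X Y f) \<in> bispan_hom G Y X"
    "bispan_class G (norm_bispan X Y f) \<in> bispan_hom G X Y"
    "bispan_class G (tr_bispan X Y f) \<in> bispan_hom G X Y"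
  using bispan_class_in_hom[OF is_group is_bispan_res[OF is_group assms]]
    bispan_class_in_hom[OF is_group is_bispan_norm[OF is_group assms]]
    bispan_class_in_hom[OF is_group is_bispan_tr[OF is_group assms]]
  by (simp_all add: res_bispan_def norm_bispan_def tr_bispan_def)

lemma ops_closed:
  assumes "Fin X" "Fin Y" "f \<in> gmap G X Y"
  shows "y \<in> ob k Y \<Longrightarrow> R X Y f y \<in> ob k X"
    "x \<in> ob k X \<Longrightarrow> N X Y f x \<in> ob k Y"
    "x \<in> ob k X \<Longrightarrow> T X Y f x \<in> ob k Y"
  using ops_in_hom[OF assms] ar_closed by (auto simp: Res_def Nm_def Tr_def)

lemma ops_identity:
  assumes "Fin X" "x \<in> ob k X"
  shows "R X X (gset_id X) x = x" "N X X (gset_id X) x = x" "T X X (gset_id X) x = x"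
  using ar_id[OF assms] by (simp_all add: Res_def Nm_def Tr_def mor_id_def res_bispan_def norm_bispan_def tr_bispan_def)

lemma R_comp:
  assumes "Fin X" "Fin Y" "Fin Z" "f \<in> gmap G X Y" "g \<in> gmap G Y Z" "h \<in> gmap G X Z" "\<And>x. x \<in> pts X \<Longrightarrow> h x = g (f x)"
    "z \<in> ob k Z"
  shows "R X Y f (R Y Z g z) = R X Z h z"
  using ar_comp[OF ops_in_hom(1)[OF assms(2,3,5)] ops_in_hom(1)[OF assms(1,2,4)] assms(8)] res_res_class[OF is_group assms(1-7)]
  by (simp add: Res_def)

lemma N_comp:
  assumes "Fin X" "Fin Y" "Fin Z" "f \<in> gmap G X Y" "g \<in> gmap G Y Z" "h \<in> gmap G X Z" "\<And>x. x \<in> pts X \<Longrightarrow> h x = g (f x)"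
    "x \<in> ob k X"
  shows "N Y Z g (N X Y f x) = N X Z h x"
  using ar_comp[OF ops_in_hom(2)[OF assms(1,2,4)] ops_in_hom(2)[OF assms(2,3,5)] assms(8)] norm_norm_class[OF is_group assms(1-7)]
  by (simp add: Nm_def)

lemma T_comp:
  assumes "Fin X" "Fin Y" "Fin Z" "f \<in> gmap G X Y" "g \<in> gmap G Y Z" "h \<in> gmap G X Z" "\<And>x. x \<in> pts X \<Longrightarrow> h x = g (f x)"
    "x \<in> ob k X"
  shows "T Y Z g (T X Y f x) = T X Z h x"
  using ar_comp[OF ops_in_hom(3)[OF assms(1,2,4)] ops_in_hom(3)[OF assms(2,3,5)] assms(8)] tr_tr_class[OF is_group assms(1-7)]
  by (simp add: Tr_def)

lemma N_base_change:
  assumes "Fin X" "Fin X'" "Fin Y" "Fin Y'" and s: "pullback_square G X' X Y' Y f f' g g'" and x: "x \<in> ob k X"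
  shows "R Y' Y g (N X Y f x) = N X' Y' f' (R X' X g' x)"
  using ar_comp[OF ops_in_hom(2)[OF assms(1,3)] ops_in_hom(1)[OF assms(4,3)] x, of f g] ar_comp[OF ops_in_hom(1)[OF assms(2,1)] ops_in_hom(2)[OF assms(2,4)] x, of g' f']
    norm_base_change[OF is_group assms(1-5)] s by (simp add: Res_def Nm_def pullback_square_def)

lemma T_base_change:
  assumes "Fin X" "Fin X'" "Fin Y" "Fin Y'" and s: "pullback_square G X' X Y' Y f f' g g'" and x: "x \<in> ob k X"
  shows "R Y' Y g (T X Y f x) = T X' Y' f' (R X' X g' x)"
  using ar_comp[OF ops_in_hom(3)[OF assms(1,3)] ops_in_hom(1)[OF assms(4,3)] x, of f g] ar_comp[OF ops_in_hom(1)[OF assms(2,1)] ops_in_hom(3)[OF assms(2,4)] x, of g' f']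
    tr_base_change[OF is_group assms(1-5)] s by (simp add: Res_def Tr_def pullback_square_def)

lemma factorization:
  fixes S :: "('g,'g point,'g point) bispan"
  assumes S: "is_bispan G S" and x: "x \<in> ob k (src S)"
  shows "ar k (bispan_class G S) x = T (rmid S) (tgt S) (tleg S) (N (lmid S) (rmid S) (nleg S) (R (lmid S) (src S) (rleg S) x))"
proof -
  have s: "Fin (src S)" "Fin (lmid S)" "Fin (rmid S)" "Fin (tgt S)"
    "rleg S \<in> gmap G (lmid S) (src S)" "nleg S \<in> gmap G (lmid S) (rmid S)" "tleg S \<in> gmap G (rmid S) (tgt S)"
    using S by (auto simp: is_bispan_def)
  note h = ops_in_hom(1)[OF s(2,1,5)] ops_in_hom(2)[OF s(2,3,6)] ops_in_hom(3)[OF s(3,4,7)]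
  have "mor_comp G (bispan_class G (norm_bispan (lmid S) (rmid S) (nleg S))) (bispan_class G (res_bispan (lmid S) (src S) (rleg S)))
     \<in> bispan_hom G (src S) (rmid S)"
    using norm_res_class[OF is_group s(1,2,3,5,6)] bispan_class_in_hom[OF is_group is_bispan_span[OF is_group s(1,2,3,5,6)]]
    by (simp add: span_bispan_def)
  note 1 = ar_comp[OF this h(3) x] ar_comp[OF h(1,2) x]
  show ?thesis unfolding factorization_class[OF is_group S] 1 by (simp add: Res_def Nm_def Tr_def)
qed

lemma exponential:
  assumes fin: "Fin X" "Fin Y" "Fin A" "Fin E" "Fin D"
    and q: "q \<in> gmap G A X" and f: "f \<in> gmap G X Y" and t: "t \<in> gmap G E Y"
    and ev: "ev \<in> gmap G D A" and pr: "pr \<in> gmap G D E"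
    and sq: "\<And>w. w \<in> pts D \<Longrightarrow> f (q (ev w)) = t (pr w)"
    and sec: "\<And>e x. e \<in> pts E \<Longrightarrow> x \<in> pts X \<Longrightarrow> f x = t e \<Longrightarrow> \<exists>!w. w \<in> pts D \<and> pr w = e \<and> q (ev w) = x"
    and univ: "\<And>y s. y \<in> pts Y \<Longrightarrow> (\<And>x. x \<in> pts X \<Longrightarrow> f x = y \<Longrightarrow> s x \<in> pts A \<and> q (s x) = x) \<Longrightarrow>
      \<exists>!e. e \<in> pts E \<and> t e = y \<and> (\<forall>w\<in>pts D. pr w = e \<longrightarrow> ev w = s (q (ev w)))"
    and x: "x \<in> ob k A"
  shows "N X Y f (T A X q x) = T E Y t (N D E pr (R D A ev x))"
proof -
  note h = ops_in_hom(1)[OF fin(5,3) ev] ops_in_hom(2)[OF fin(5,4) pr] ops_in_hom(3)[OF fin(4,2) t]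
  have "mor_comp G (bispan_class G (norm_bispan D E pr)) (bispan_class G (res_bispan D A ev)) \<in> bispan_hom G A E"
    using norm_res_class[OF is_group fin(3,5,4) ev pr] bispan_class_in_hom[OF is_group is_bispan_span[OF is_group fin(3,5,4) ev pr]]
    by (simp add: span_bispan_def)
  note 1 = ar_comp[OF this h(3) x] ar_comp[OF h(1,2) x]
  have "mor_comp G (bispan_class G (norm_bispan X Y f)) (bispan_class G (tr_bispan A X q)) =
    mor_comp G (bispan_class G (tr_bispan E Y t)) (mor_comp G (bispan_class G (norm_bispan D E pr)) (bispan_class G (res_bispan D A ev)))"
  proof (rule exponential_class[OF is_group fin q f t ev pr], goal_cases)
    case (1 w) then show ?case by (rule sq)
  next
    case (2 e x) then show ?case by (rule sec)
  next
    case (3 y s) show ?case using 3 by (intro univ) auto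
  qed
  then show ?thesis using ar_comp[OF ops_in_hom(3)[OF fin(3,1) q] ops_in_hom(2)[OF fin(1,2) f] x] 1
    by (simp add: Res_def Nm_def Tr_def)
qed

definition pair where
  "pair X Y a b = the_inv_into (ob k (sum_gset X Y)) (split_map G k X Y) (a, b)"

lemma split_bij: "Fin X \<Longrightarrow> Fin Y \<Longrightarrow> bij_betw (split_map G k X Y) (ob k (sum_gset X Y)) (ob k X \<times> ob k Y)"
  using tambara by (simp add: tambara_functor_def product_preserving_def)

lemma pair_components:
  assumes "Fin X" "Fin Y" "a \<in> ob k X" "b \<in> ob k Y"
  shows "pair X Y a b \<in> ob k (sum_gset X Y)" "R X (sum_gset X Y) (inl_map X) (pair X Y a b) = a"
     "R Y (sum_gset X Y) (inr_map Y) (pair X Y a b) = b"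
proof -
  note b = split_bij[OF assms(1,2)]
  show "pair X Y a b \<in> ob k (sum_gset X Y)"
    using b assms(3,4) the_inv_into_into[of "split_map G k X Y" "ob k (sum_gset X Y)" "(a,b)"] by (auto simp: pair_def bij_betw_def)
  have "split_map G k X Y (pair X Y a b) = (a,b)"
    using b assms(3,4) f_the_inv_into_f[of "split_map G k X Y" "ob k (sum_gset X Y)" "(a,b)"] by (auto simp: pair_def bij_betw_def)
  then show "R X (sum_gset X Y) (inl_map X) (pair X Y a b) = a" "R Y (sum_gset X Y) (inr_map Y) (pair X Y a b) = b"
    by (simp_all add: split_map_def)
qed

lemma sum_eqI:
  assumes "Fin X" "Fin Y" "v \<in> ob k (sum_gset X Y)" "w \<in> ob k (sum_gset X Y)"
    "R X (sum_gset X Y) (inl_map X) v = R X (sum_gset X Y) (inl_map X) w"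
    "R Y (sum_gset X Y) (inr_map Y) v = R Y (sum_gset X Y) (inr_map Y) w"
  shows "v = w"
  using split_bij[OF assms(1,2)] assms(3-6) by (auto simp: bij_betw_def inj_on_def split_map_def)

lemma R_copair:
  assumes X: "Fin X" and Y: "Fin Y" and Z: "Fin Z" and f: "f \<in> gmap G X Z" and g: "g \<in> gmap G Y Z" and z: "z \<in> ob k Z"
  shows "R X (sum_gset X Y) (inl_map X) (R (sum_gset X Y) Z (copair X Y f g) z) = R X Z f z"
    "R Y (sum_gset X Y) (inr_map Y) (R (sum_gset X Y) Z (copair X Y f g) z) = R Y Z g z"
  using R_comp[OF X _ Z inl_map[OF X] copair_map[OF X Y f g] f _ z] R_comp[OF Y _ Z inr_map[OF Y] copair_map[OF X Y f g] g _ z] X Y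
  by simp_all

lemma empty_ob: "\<exists>u. ob k empty_gset = {u}"
  using tambara by (auto simp: tambara_functor_def product_preserving_def is_singleton_def)

end

text \<open>
  Transfers and norms obey the same formal laws, and so do the additive and the multiplicative
  structure built from them. The locale collects these laws; M X is the additive or the multiplicative monoid
  of the ring of values at X.
\<close>

locale pushforward = tambara G k for G :: "('g,'m) monoid_scheme" (structure) and k :: "('g,'r) bfunctor" +
  fixes op :: "'g objct \<Rightarrow> 'g objct \<Rightarrow> ('g point \<Rightarrow> 'g point) \<Rightarrow> 'r \<Rightarrow> 'r" and M :: "'g objct \<Rightarrow> ('r,'z) monoid_scheme"
  assumes op_closed: "\<lbrakk>finite_gset G X; finite_gset G Y; f \<in> gmap G X Y; x \<in> ob k X\<rbrakk> \<Longrightarrow> op X Y f x \<in> ob k Y"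
    and op_id: "\<lbrakk>finite_gset G X; x \<in> ob k X\<rbrakk> \<Longrightarrow> op X X (gset_id X) x = x"
    and op_comp: "\<lbrakk>finite_gset G X; finite_gset G Y; finite_gset G Z; f \<in> gmap G X Y; g \<in> gmap G Y Z; h \<in> gmap G X Z;
       \<And>x. x \<in> pts X \<Longrightarrow> h x = g (f x); x \<in> ob k X\<rbrakk> \<Longrightarrow> op Y Z g (op X Y f x) = op X Z h x"
    and op_base_change: "\<lbrakk>finite_gset G X; finite_gset G X'; finite_gset G Y; finite_gset G Y';
       pullback_square G X' X Y' Y f f' g g'; x \<in> ob k X\<rbrakk> \<Longrightarrow> Res G k Y' Y g (op X Y f x) = op X' Y' f' (Res G k X' X g' x)"
    and M_carrier [simp]: "carrier (M X) = ob k X"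
    and M_mult: "mult (M X) a b = op (sum_gset X X) X (fold_map X) (pair X X a b)"
    and M_one: "one (M X) = op empty_gset X (\<lambda>_. undefined) (the_elem (ob k empty_gset))"
begin

text \<open>
  An element over a disjoint union is determined by its two restrictions, and base change
  computes these.
\<close>

lemma op_sum:
  assumes X: "Fin X" and Y: "Fin Y" and Z: "Fin Z" and W: "Fin W" and f: "f \<in> gmap G X Z" and g: "g \<in> gmap G Y W"
    and w: "w \<in> ob k (sum_gset X Y)"
  shows "op (sum_gset X Y) (sum_gset Z W) (copair X Y (\<lambda>x. InL (f x)) (\<lambda>y. InR (g y))) w =
    pair Z W (op X Z f (R X (sum_gset X Y) (inl_map X) w)) (op Y W g (R Y (sum_gset X Y) (inr_map Y) w))"
proof -
  define m where "m = copair X Y (\<lambda>x. InL (f x)) (\<lambda>y. InR (g y))"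
  note xyz = finite_gsetD(2)[OF is_group X] finite_gsetD(2)[OF is_group Y] gmapD[OF f] gmapD[OF g]
  have m: "m \<in> gmap G (sum_gset X Y) (sum_gset Z W)"
    unfolding m_def by (rule sum_gmap[OF is_group X Y f g])
  define v where "v = op (sum_gset X Y) (sum_gset Z W) m w"
  have v: "v \<in> ob k (sum_gset Z W)" unfolding v_def using op_closed[OF _ _ m w] X Y Z W by simp
  have sq: "pullback_square G X (sum_gset X Y) Z (sum_gset Z W) m f (inl_map Z) (inl_map X)"
    by (rule pullback_squareI[OF m f inl_map[OF Z] inl_map[OF X], where h = "\<lambda>w z. case w of InL x \<Rightarrow> x"])
      (use xyz in \<open>auto simp: sum_simps m_def\<close>)
  have sq': "pullback_square G Y (sum_gset X Y) W (sum_gset Z W) m g (inr_map W) (inr_map Y)"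
    by (rule pullback_squareI[OF m g inr_map[OF W] inr_map[OF Y], where h = "\<lambda>w z. case w of InR x \<Rightarrow> x"])
      (use xyz in \<open>auto simp: sum_simps m_def\<close>)
  have l: "R Z (sum_gset Z W) (inl_map Z) v = op X Z f (R X (sum_gset X Y) (inl_map X) w)"
    unfolding v_def by (rule op_base_change[OF _ _ _ _ sq w]) (use X Y Z W in auto)
  have r: "R W (sum_gset Z W) (inr_map W) v = op Y W g (R Y (sum_gset X Y) (inr_map Y) w)"
    unfolding v_def by (rule op_base_change[OF _ _ _ _ sq' w]) (use X Y Z W in auto)
  have lr: "op X Z f (R X (sum_gset X Y) (inl_map X) w) \<in> ob k Z" "op Y W g (R Y (sum_gset X Y) (inr_map Y) w) \<in> ob k W"
    using ops_closed(1)[OF X _ inl_map[OF X] w] ops_closed(1)[OF Y _ inr_map[OF Y] w] op_closed f g X Y Z W by auto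
  show ?thesis unfolding m_def[symmetric] v_def[symmetric]
    using pair_components[OF Z W lr] l r by (intro sum_eqI[OF Z W v]) auto
qed

lemma op_copair:
  assumes X: "Fin X" and Y: "Fin Y" and Z: "Fin Z" and f: "f \<in> gmap G X Z" and g: "g \<in> gmap G Y Z" and w: "w \<in> ob k (sum_gset X Y)"
  shows "op (sum_gset X Y) Z (copair X Y f g) w =
    mult (M Z) (op X Z f (R X (sum_gset X Y) (inl_map X) w)) (op Y Z g (R Y (sum_gset X Y) (inr_map Y) w))"
  unfolding M_mult op_sum[OF X Y Z Z f g w, symmetric]
  by (rule op_comp[symmetric, OF _ _ Z sum_gmap[OF is_group X Y f g] fold_gmap[OF Z] copair_map[OF X Y f g] _ w])
    (use X Y Z gmapD(1)[OF f] gmapD(1)[OF g] in \<open>auto simp: sum_simps\<close>)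

lemma fold_copair: "fold_map X = copair X X (gset_id X) (gset_id X)"
  by (auto simp: fold_map_def copair_def sum_simps fun_eq_iff restrict_def gset_id_def split: point.splits)

lemma op_fold:
  assumes X: "Fin X" and w: "w \<in> ob k (sum_gset X X)"
  shows "op (sum_gset X X) X (fold_map X) w = mult (M X) (R X (sum_gset X X) (inl_map X) w) (R X (sum_gset X X) (inr_map X) w)"
  using op_copair[OF X X X id_map[OF X] id_map[OF X] w] ops_closed(1)[OF X _ inl_map[OF X] w] ops_closed(1)[OF X _ inr_map[OF X] w] X
  by (simp add: fold_copair op_id)

text \<open>
  An isomorphism is a pullback of the identity, so pushing forward commutes with relabelling. The
  monoid laws below follow by relabelling disjoint unions.
\<close>

lemma op_iso:
  assumes X: "Fin X" and X': "Fin X'" and Y: "Fin Y" and f: "f \<in> gmap G X Y" and f': "f' \<in> gmap G X' Y"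
    and i: "i \<in> gmap G X' X" "bij_betw i (pts X') (pts X)" "\<And>x. x \<in> pts X' \<Longrightarrow> f' x = f (i x)" and x: "x \<in> ob k X"
  shows "op X' Y f' (R X' X i x) = op X Y f x"
proof -
  have "pullback_square G X' X Y Y f f' (gset_id Y) i"
    by (rule pullback_squareI[OF f f' id_map[OF Y] i(1), where h = "\<lambda>x y. inv_into (pts X') i x"])
      (use i(2,3) gmapD(1)[OF f'] in \<open>auto simp: bij_betw_def f_inv_into_f inv_into_into\<close>)
  from op_base_change[OF X X' Y Y this x] ops_identity(1)[OF Y op_closed[OF X Y f x]] show ?thesis by simp
qed

lemma M_closed:
  assumes "Fin X" "a \<in> ob k X" "b \<in> ob k X" shows "mult (M X) a b \<in> ob k X"
  unfolding M_mult using op_closed[OF _ assms(1) fold_gmap[OF assms(1)] pair_components(1)[OF assms(1,1,2,3)]] assms(1) by simp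

lemma the_empty: "u \<in> ob k empty_gset \<Longrightarrow> the_elem (ob k empty_gset) = u"
  using empty_ob by force

lemma op_empty: 
  assumes "u \<in> ob k empty_gset" shows "op empty_gset X (\<lambda>_. undefined) u = one (M X)"
  unfolding M_one the_empty[OF assms] ..

lemma M_one_closed: assumes "Fin X" shows "one (M X) \<in> ob k X"
proof -
  obtain u where u: "u \<in> ob k empty_gset" using empty_ob by auto
  show ?thesis using op_closed[OF fin_empty assms empty_gmap u] op_empty[OF u] by simp
qed

lemma M_commute:
  assumes X: "Fin X" and a: "a \<in> ob k X" and b: "b \<in> ob k X"
  shows "mult (M X) a b = mult (M X) b a"
proof -
  let ?XX = "sum_gset X X"
  define s where "s = copair X X (inr_map X) (inl_map X)"
  have s: "s \<in> gmap G ?XX ?XX" unfolding s_def using X by (intro copair_map inr_map inl_map)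
  have sb: "bij_betw s (pts ?XX) (pts ?XX)"
    by (rule bij_betw_byWitness[where f' = s]) (auto simp: s_def sum_simps)
  note p = pair_components[OF X X a b]
  have "mult (M X) a b = op ?XX X (fold_map X) (pair X X a b)" by (simp add: M_mult)
  also have "\<dots> = op ?XX X (fold_map X) (R ?XX ?XX s (pair X X a b))"
    by (rule op_iso[symmetric]) (use X s sb p fold_gmap in \<open>auto simp: s_def sum_simps\<close>)
  also have "\<dots> = mult (M X) b a"
  proof -
    have "R X ?XX (inl_map X) (R ?XX ?XX s (pair X X a b)) = b"
      using R_comp[OF X _ _ inl_map[OF X] s inr_map[OF X] _ p(1)] X p(3) by (simp add: s_def)
    moreover have "R X ?XX (inr_map X) (R ?XX ?XX s (pair X X a b)) = a"
      using R_comp[OF X _ _ inr_map[OF X] s inl_map[OF X] _ p(1)] X p(2) by (simp add: s_def)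
    ultimately show ?thesis using op_fold[OF X ops_closed(1)[OF _ _ s p(1)]] X by simp
  qed
  finally show ?thesis .
qed

lemma M_assoc:
  assumes X: "Fin X" and a: "a \<in> ob k X" and b: "b \<in> ob k X" and c: "c \<in> ob k X"
  shows "mult (M X) (mult (M X) a b) c = mult (M X) a (mult (M X) b c)"
proof -
  let ?XX = "sum_gset X X"
  let ?L = "sum_gset ?XX X" and ?Q = "sum_gset X ?XX"
  have XX: "Fin ?XX" using X by simp
  note f = fold_gmap[OF X] and i = id_map[OF X] and il = inl_map[OF X] and ir = inr_map[OF X]
  \<comment> \<open>the relabelling of X + (X + X) as (X + X) + X\<close>
  define s where "s = copair X ?XX (\<lambda>x. InL (InL x)) (copair X X (\<lambda>x. InL (InR x)) (\<lambda>x. InR x))"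
  have s: "s \<in> gmap G ?Q ?L" using finite_gsetD(2)[OF is_group X]
    by (auto simp: gmap_def sum_simps s_def) (auto simp: copair_def sum_simps)
  have sb: "bij_betw s (pts ?Q) (pts ?L)"
    by (rule bij_betw_byWitness[where f' = "copair ?XX X (copair X X (\<lambda>x. InL x) (\<lambda>x. InR (InL x))) (\<lambda>x. InR (InR x))"])
      (auto simp: s_def sum_simps)
  define w where "w = pair ?XX X (pair X X a b) c"
  note p = pair_components[OF X X a b] and q = pair_components[OF XX X pair_components(1)[OF X X a b] c, folded w_def]
  have "mult (M X) (mult (M X) a b) c = op ?L X (copair ?XX X (fold_map X) (gset_id X)) w"
    using op_copair[OF XX X X f i q(1)] op_fold[OF X p(1)] by (simp add: q p op_id[OF X c])
  also have "\<dots> = op ?Q X (copair X ?XX (gset_id X) (fold_map X)) (R ?Q ?L s w)"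
    by (rule op_iso[symmetric]) (use X s sb q fold_gmap copair_map in \<open>auto simp: s_def sum_simps\<close>)
  also have "\<dots> = mult (M X) a (mult (M X) b c)"
  proof -
    have sw: "R ?Q ?L s w \<in> ob k ?Q" using ops_closed(1)[OF _ _ s q(1)] X by simp
    have 1: "R X ?Q (inl_map X) (R ?Q ?L s w) = a"
    proof -
      have "R X ?Q (inl_map X) (R ?Q ?L s w) = R X ?L (\<lambda>x\<in>pts X. InL (InL x)) w"
        by (rule R_comp[OF _ _ _ inl_map s]) (use X XX q finite_gsetD(2)[OF is_group X] in \<open>auto simp: s_def gmap_def sum_simps\<close>)
      also have "\<dots> = R X ?XX (inl_map X) (R ?XX ?L (inl_map ?XX) w)"
        by (rule R_comp[symmetric, OF _ _ _ inl_map inl_map]) (use X XX q finite_gsetD(2)[OF is_group X] in \<open>auto simp: gmap_def sum_simps\<close>)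
      finally show ?thesis using q p by simp
    qed
    have 2: "R X ?XX (inl_map X) (R ?XX ?Q (inr_map ?XX) (R ?Q ?L s w)) = b"
    proof -
      have "R ?XX ?Q (inr_map ?XX) (R ?Q ?L s w) = R ?XX ?L (copair X X (\<lambda>x. InL (InR x)) (\<lambda>x. InR x)) w"
        by (rule R_comp[OF _ _ _ inr_map s]) (use X XX q finite_gsetD(2)[OF is_group X] in \<open>auto simp: s_def gmap_def sum_simps\<close>, auto simp: copair_def sum_simps)
      also have "R X ?XX (inl_map X) \<dots> = R X ?L (\<lambda>x\<in>pts X. InL (InR x)) w"
        by (rule R_comp[OF _ _ _ inl_map]) (use X XX q finite_gsetD(2)[OF is_group X] in \<open>auto simp: gmap_def sum_simps\<close>, auto simp: copair_def sum_simps)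
      also have "\<dots> = R X ?XX (inr_map X) (R ?XX ?L (inl_map ?XX) w)"
        by (rule R_comp[symmetric, OF _ _ _ inr_map inl_map]) (use X XX q finite_gsetD(2)[OF is_group X] in \<open>auto simp: gmap_def sum_simps\<close>)
      finally show ?thesis using q p by simp
    qed
    have 3: "R X ?XX (inr_map X) (R ?XX ?Q (inr_map ?XX) (R ?Q ?L s w)) = c"
    proof -
      have "R ?XX ?Q (inr_map ?XX) (R ?Q ?L s w) = R ?XX ?L (copair X X (\<lambda>x. InL (InR x)) (\<lambda>x. InR x)) w"
        by (rule R_comp[OF _ _ _ inr_map s]) (use X XX q finite_gsetD(2)[OF is_group X] in \<open>auto simp: s_def gmap_def sum_simps\<close>, auto simp: copair_def sum_simps)
      also have "R X ?XX (inr_map X) \<dots> = R X ?L (inr_map X) w"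
        by (rule R_comp[OF _ _ _ inr_map _ inr_map]) (use X XX q finite_gsetD(2)[OF is_group X] in \<open>auto simp: gmap_def sum_simps\<close>, auto simp: copair_def sum_simps)
      finally show ?thesis using q p by simp
    qed
    have u: "R ?XX ?Q (inr_map ?XX) (R ?Q ?L s w) \<in> ob k ?XX" using ops_closed(1)[OF XX _ inr_map[OF XX] sw] X by simp
    show ?thesis using op_copair[OF X XX X i f sw] op_fold[OF X u] by (simp add: 1 2 3 op_id[OF X a])
  qed
  finally show ?thesis .
qed

lemma M_unit:
  assumes X: "Fin X" and a: "a \<in> ob k X"
  shows "mult (M X) (one (M X)) a = a"
proof -
  let ?E = "sum_gset empty_gset X"
  obtain u where u: "u \<in> ob k empty_gset" using empty_ob by auto
  note p = pair_components[OF fin_empty X u a]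
  have "mult (M X) (one (M X)) a = op ?E X (copair empty_gset X (\<lambda>_. undefined) (gset_id X)) (pair empty_gset X u a)"
    using op_copair[OF fin_empty X X empty_gmap id_map[OF X] p(1)] by (simp add: p op_empty[OF u] op_id[OF X a])
  also have "\<dots> = op X X (gset_id X) (R X ?E (inr_map X) (pair empty_gset X u a))"
    by (rule op_iso[symmetric]) (use X inr_map copair_map p in \<open>auto simp: sum_simps bij_betw_def inclusions_inj inclusion_images\<close>)
  finally show ?thesis using p op_id[OF X a] by simp
qed

lemma M_comm_monoid: "Fin X \<Longrightarrow> comm_monoid (M X)"
  by (rule comm_monoidI) (simp_all add: M_closed M_one_closed M_assoc M_unit, rule M_commute)

lemma R_mult:
  assumes X: "Fin X" and Y: "Fin Y" and f: "f \<in> gmap G X Y" and a: "a \<in> ob k Y" and b: "b \<in> ob k Y"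
  shows "R X Y f (mult (M Y) a b) = mult (M X) (R X Y f a) (R X Y f b)"
proof -
  let ?XX = "sum_gset X X" and ?YY = "sum_gset Y Y"
  define m where "m = copair X X (\<lambda>x. InL (f x)) (\<lambda>y. InR (f y))"
  note xy = finite_gsetD(2)[OF is_group X] finite_gsetD(2)[OF is_group Y] gmapD[OF f]
  have m: "m \<in> gmap G ?XX ?YY"
    unfolding m_def by (rule sum_gmap[OF is_group X X f f])
  note p = pair_components[OF Y Y a b]
  have sq: "pullback_square G ?XX ?YY X Y (fold_map Y) (fold_map X) f m"
    by (rule pullback_squareI[OF fold_gmap[OF Y] fold_gmap[OF X] f m, where h = "\<lambda>w x. case w of InL _ \<Rightarrow> InL x | InR _ \<Rightarrow> InR x"])
      (use xy in \<open>auto simp: sum_simps m_def\<close>)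
  have 1: "R X ?XX (inl_map X) (R ?XX ?YY m (pair Y Y a b)) = R X Y f a"
  proof -
    have "R X ?XX (inl_map X) (R ?XX ?YY m (pair Y Y a b)) = R X ?YY (\<lambda>x\<in>pts X. InL (f x)) (pair Y Y a b)"
      by (rule R_comp[OF _ _ _ inl_map m]) (use X Y p xy in \<open>auto simp: m_def gmap_def sum_simps\<close>)
    also have "\<dots> = R X Y f (R Y ?YY (inl_map Y) (pair Y Y a b))"
      by (rule R_comp[symmetric, OF _ _ _ f inl_map]) (use X Y p xy in \<open>auto simp: gmap_def sum_simps\<close>)
    finally show ?thesis using p by simp
  qed
  have 2: "R X ?XX (inr_map X) (R ?XX ?YY m (pair Y Y a b)) = R X Y f b"
  proof -
    have "R X ?XX (inr_map X) (R ?XX ?YY m (pair Y Y a b)) = R X ?YY (\<lambda>x\<in>pts X. InR (f x)) (pair Y Y a b)"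
      by (rule R_comp[OF _ _ _ inr_map m]) (use X Y p xy in \<open>auto simp: m_def gmap_def sum_simps\<close>)
    also have "\<dots> = R X Y f (R Y ?YY (inr_map Y) (pair Y Y a b))"
      by (rule R_comp[symmetric, OF _ _ _ f inr_map]) (use X Y p xy in \<open>auto simp: gmap_def sum_simps\<close>)
    finally show ?thesis using p by simp
  qed
  have "R ?XX ?YY m (pair Y Y a b) \<in> ob k ?XX" using ops_closed(1)[OF _ _ m p(1)] X Y by simp
  then show ?thesis using op_base_change[OF _ _ Y X sq p(1)] op_fold[OF X] X Y by (simp add: M_mult 1 2 p)
qed

lemma R_one:
  assumes X: "Fin X" and Y: "Fin Y" and f: "f \<in> gmap G X Y"
  shows "R X Y f (one (M Y)) = one (M X)"
proof -
  obtain u where u: "u \<in> ob k empty_gset" using empty_ob by auto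
  have "pullback_square G empty_gset empty_gset X Y (\<lambda>_. undefined) (\<lambda>_. undefined) f (\<lambda>_. undefined)"
    using f empty_gmap by (simp add: pullback_square_def)
  from op_base_change[OF fin_empty fin_empty Y X this u] show ?thesis
    using op_empty[OF ops_closed(1)[OF fin_empty fin_empty empty_gmap u]] op_empty[OF u] by simp
qed

end

section \<open>The rings of a Tambara functor\<close>

sublocale tambara \<subseteq> nm: pushforward G k "Nm G k" "level G k"
  by unfold_locales
    (rule ops_closed(2) ops_identity(2) N_comp N_base_change, assumption+ | simp add: level_def pair_elt_def pair_def)+

sublocale tambara \<subseteq> tr: pushforward G k "Tr G k" "\<lambda>X. add_monoid (level G k X)"
  by unfold_locales
    (rule ops_closed(3) ops_identity(3) T_comp T_base_change, assumption+ | simp add: level_def pair_elt_def pair_def)+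

context tambara begin

lemma level_abelian_group: "Fin X \<Longrightarrow> abelian_group (level G k X)"
  using tr.M_comm_monoid[of X] tambara
  by (simp add: tambara_functor_def abelian_group_def abelian_monoid_def abelian_group_axioms_def comm_group_def)

text \<open>
  The exponential diagram of X + (X + X) \<rightarrow> X + X \<rightarrow> X: a section over the fibre of y chooses the
  first or the second summand of the right copy, whence E = X + X, and its pullback D consists of two
  copies of X + X, one for each of the two products.
\<close>

lemma level_r_distr:
  assumes X: "Fin X" and a: "a \<in> ob k X" and b: "b \<in> ob k X" and c: "c \<in> ob k X"
  shows "a \<otimes>\<^bsub>level G k X\<^esub> (b \<oplus>\<^bsub>level G k X\<^esub> c) = (a \<otimes>\<^bsub>level G k X\<^esub> b) \<oplus>\<^bsub>level G k X\<^esub> (a \<otimes>\<^bsub>level G k X\<^esub> c)"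
proof -
  let ?XX = "sum_gset X X"
  let ?Q = "sum_gset X ?XX" and ?D = "sum_gset ?XX ?XX"
  have XX: "Fin ?XX" and Q: "Fin ?Q" and D: "Fin ?D" using X by simp_all
  note xact = finite_gsetD(2)[OF is_group X]
  note fd = fold_gmap[OF X]
  \<comment> \<open>the transfer of (a, (b, c)) along q is (a, b + c)\<close>
  define q where "q = copair X ?XX (\<lambda>x. InL (gset_id X x)) (\<lambda>z. InR (fold_map X z))"
  have q: "q \<in> gmap G ?Q ?XX" unfolding q_def by (rule sum_gmap[OF is_group X XX id_map[OF X] fd])
  define ff where "ff = copair ?XX ?XX (\<lambda>z. InL (fold_map X z)) (\<lambda>z. InR (fold_map X z))"
  have ff: "ff \<in> gmap G ?D ?XX" unfolding ff_def by (rule sum_gmap[OF is_group XX XX fd fd])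
  define l r where "l = (\<lambda>x\<in>pts X. InR (InL x :: 'g point) :: 'g point)" and "r = (\<lambda>x\<in>pts X. InR (InR x :: 'g point) :: 'g point)"
  have lr: "l \<in> gmap G X ?Q" "r \<in> gmap G X ?Q" using xact by (auto simp: l_def r_def gmap_def sum_simps)
  \<comment> \<open>restriction along e1 and e2 sends (a, (b, c)) to (a, b) and (a, c)\<close>
  define e1 e2 where "e1 = copair X X (inl_map X) l" and "e2 = copair X X (inl_map X) r"
  have e: "e1 \<in> gmap G ?XX ?Q" "e2 \<in> gmap G ?XX ?Q"
    unfolding e1_def e2_def using lr X inl_map[OF X] by (auto intro: copair_map)
  define ev where "ev = copair ?XX ?XX e1 e2"
  have ev: "ev \<in> gmap G ?D ?Q" unfolding ev_def using XX e by (intro copair_map)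
  define w where "w = pair X ?XX a (pair X X b c)"
  note p = pair_components[OF X X b c]
  note w = pair_components[OF X XX a p(1), folded w_def]
  have "N ?XX X (fold_map X) (T ?Q ?XX q w) = T ?XX X (fold_map X) (N ?D ?XX ff (R ?D ?Q ev w))"
  proof (rule exponential[OF XX X Q XX D q fd fd ev ff _ _ _ w(1)], goal_cases)
    case (1 w)
    then show ?case by (auto simp: sum_simps ev_def e1_def e2_def ff_def q_def l_def r_def)
  next
    case (2 e x)
    then show ?case by (intro ex1I[of _ "case e of InL _ \<Rightarrow> InL x | InR _ \<Rightarrow> InR x"])
      (auto simp: sum_simps ev_def e1_def e2_def ff_def q_def l_def r_def)
  next
    case (3 y s)
    have 4: "s (InL y) = InL y" "s (InR y) = InR (InL y) \<or> s (InR y) = InR (InR y)"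
      using 3(2)[of "InL y"] 3(2)[of "InR y"] 3(1) by (auto simp: sum_simps q_def)
    have y: "y \<in> pts X" by (rule 3(1))
    have 5: "e = (if s (InR y) = InR (InL y) then InL y else InR y)"
      if e: "e \<in> pts ?XX" "fold_map X e = y" "\<forall>w\<in>pts ?D. ff w = e \<longrightarrow> ev w = s (q (ev w))" for e
    proof -
      consider "e = InL y" | "e = InR y" using e(1,2) by (auto simp: sum_simps)
      then show ?thesis
      proof cases
        case 1
        with bspec[OF e(3), of "InL (InR y)"] y 4 show ?thesis
          by (auto simp: sum_simps ev_def e1_def e2_def ff_def q_def l_def r_def)
      next
        case 2
        with bspec[OF e(3), of "InR (InR y)"] y 4 show ?thesis
          by (auto simp: sum_simps ev_def e1_def e2_def ff_def q_def l_def r_def)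
      qed
    qed
    show ?case
    proof (rule ex1I[of _ "if s (InR y) = InR (InL y) then InL y else InR y"], goal_cases)
      case 1
      show ?case using 4 y by (auto simp: sum_simps ev_def e1_def e2_def ff_def q_def l_def r_def)
    next
      case (2 e)
      then show ?case by (intro 5) auto
    qed
  qed
  moreover have "T ?Q ?XX q w = pair X X a (b \<oplus>\<^bsub>level G k X\<^esub> c)"
    unfolding q_def using tr.op_sum[OF X XX X X id_map[OF X] fd w(1)] tr.op_fold[OF X p(1)] w p ops_identity(3)[OF X a] by simp
  moreover have "N ?D ?XX ff (R ?D ?Q ev w) = pair X X (a \<otimes>\<^bsub>level G k X\<^esub> b) (a \<otimes>\<^bsub>level G k X\<^esub> c)"
  proof -
    have l: "R X ?Q l w = b" using R_comp[OF X XX Q inl_map[OF X] inr_map[OF XX] lr(1) _ w(1)] w p by (simp add: l_def sum_simps)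
    have r: "R X ?Q r w = c" using R_comp[OF X XX Q inr_map[OF X] inr_map[OF XX] lr(2) _ w(1)] w p by (simp add: r_def sum_simps)
    have 1: "R ?XX ?D (inl_map ?XX) (R ?D ?Q ev w) = R ?XX ?Q e1 w" "R ?XX ?D (inr_map ?XX) (R ?D ?Q ev w) = R ?XX ?Q e2 w"
      unfolding ev_def by (rule R_copair[OF XX XX Q e w(1)])+
    have 2: "R X ?XX (inl_map X) (R ?XX ?Q e1 w) = a" "R X ?XX (inr_map X) (R ?XX ?Q e1 w) = b"
      unfolding e1_def R_copair[OF X X Q inl_map[OF X] lr(1) w(1)] using w l by simp_all
    have 3: "R X ?XX (inl_map X) (R ?XX ?Q e2 w) = a" "R X ?XX (inr_map X) (R ?XX ?Q e2 w) = c"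
      unfolding e2_def R_copair[OF X X Q inl_map[OF X] lr(2) w(1)] using w r by simp_all
    show ?thesis unfolding ff_def nm.op_sum[OF XX XX X X fd fd ops_closed(1)[OF D Q ev w(1)]] 1
       nm.op_fold[OF X ops_closed(1)[OF XX Q e(1) w(1)]] nm.op_fold[OF X ops_closed(1)[OF XX Q e(2) w(1)]] 2 3 ..
  qed
  moreover note nm.M_mult[of X a "b \<oplus>\<^bsub>level G k X\<^esub> c"] tr.M_mult[of X "a \<otimes>\<^bsub>level G k X\<^esub> b" "a \<otimes>\<^bsub>level G k X\<^esub> c"]
  ultimately show ?thesis by simp
qed

lemma level_cring: assumes X: "Fin X" shows "cring (level G k X)"
proof (rule cringI)
  show "abelian_group (level G k X)" using X by (rule level_abelian_group)
  show "comm_monoid (level G k X)" using X by (rule nm.M_comm_monoid)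
  interpret comm_monoid "level G k X" using X by (rule nm.M_comm_monoid)
  interpret abelian_group "level G k X" using X by (rule level_abelian_group)
  fix x y z assume xyz: "x \<in> carrier (level G k X)" "y \<in> carrier (level G k X)" "z \<in> carrier (level G k X)"
  show "(x \<oplus>\<^bsub>level G k X\<^esub> y) \<otimes>\<^bsub>level G k X\<^esub> z = x \<otimes>\<^bsub>level G k X\<^esub> z \<oplus>\<^bsub>level G k X\<^esub> y \<otimes>\<^bsub>level G k X\<^esub> z"
    using level_r_distr[OF X, of z x y] xyz m_comm[OF a_closed[OF xyz(1,2)] xyz(3)] m_comm[OF xyz(1,3)] m_comm[OF xyz(2,3)] by simp
qed

lemma R_ring_hom:
  assumes X: "Fin X" and Y: "Fin Y" and f: "f \<in> gmap G X Y"
  shows "R X Y f \<in> ring_hom (level G k Y) (level G k X)"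
  using nm.R_mult[OF assms] tr.R_mult[OF assms] nm.R_one[OF assms] ops_closed(1)[OF assms]
  by (intro ring_hom_memI) simp_all

text \<open>
  The exponential diagram of the empty set over X: surjectivity leaves no section over any fibre.
\<close>

lemma N_zero:
  assumes X: "Fin X" and Y: "Fin Y" and f: "f \<in> gmap G X Y" and s: "f ` pts X = pts Y"
  shows "N X Y f \<zero>\<^bsub>level G k X\<^esub> = \<zero>\<^bsub>level G k Y\<^esub>"
proof -
  obtain u where u: "u \<in> ob k empty_gset" using empty_ob by auto
  have "N X Y f (T empty_gset X (\<lambda>_. undefined) u) = T empty_gset Y (\<lambda>_. undefined) (N empty_gset empty_gset (\<lambda>_. undefined) (R empty_gset empty_gset (\<lambda>_. undefined) u))"
    by (rule exponential[OF X Y fin_empty fin_empty fin_empty empty_gmap f empty_gmap empty_gmap empty_gmap _ _ _ u]) (use s in force)+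
  then show ?thesis
    using tr.op_empty[OF u, of X] tr.op_empty[OF ops_closed(2)[OF fin_empty fin_empty empty_gmap ops_closed(1)[OF fin_empty fin_empty empty_gmap u]], of Y] by simp
qed

lemma N_one:
  assumes X: "Fin X" and Y: "Fin Y" and f: "f \<in> gmap G X Y"
  shows "N X Y f \<one>\<^bsub>level G k X\<^esub> = \<one>\<^bsub>level G k Y\<^esub>"
proof -
  obtain u where u: "u \<in> ob k empty_gset" using empty_ob by auto
  show ?thesis using N_comp[OF fin_empty X Y empty_gmap f empty_gmap _ u] nm.op_empty[OF u, of X] nm.op_empty[OF u, of Y] by simp
qed

end

section \<open>Evaluation at the points of a G-set\<close>

definition stab :: "('g,'m) monoid_scheme \<Rightarrow> ('g,'p) gset \<Rightarrow> 'p \<Rightarrow> 'g set" where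
  "stab G X p = {g \<in> carrier G. act X g p = p}"

text \<open>
  The map of G-sets from G/K to X that sends the coset K to the point p; it exists if K fixes p.
\<close>

definition orbit_map :: "('g,'m) monoid_scheme \<Rightarrow> 'g set \<Rightarrow> ('g,'p) gset \<Rightarrow> 'p \<Rightarrow> 'g point \<Rightarrow> 'p" where
  "orbit_map G K X p = (\<lambda>z\<in>pts (orbit_gset G K). act X (SOME g. g \<in> carrier G \<and> z = Coset (g <#\<^bsub>G\<^esub> K)) p)"

context group begin

lemma l_coset_eq_iff:
  assumes K: "subgroup K G" and a: "a \<in> carrier G" and b: "b \<in> carrier G"
  shows "a <# K = b <# K \<longleftrightarrow> inv a \<otimes> b \<in> K"
proof
  assume "a <# K = b <# K"
  moreover have "b \<in> b <# K" using b subgroup.one_closed[OF K] by (force simp: l_coset_def)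
  ultimately obtain h where "h \<in> K" "b = a \<otimes> h" by (auto simp: l_coset_def)
  then show "inv a \<otimes> b \<in> K" using a subgroup.mem_carrier[OF K] by (simp add: m_assoc[symmetric])
next
  assume h: "inv a \<otimes> b \<in> K"
  have "a <# K = (a \<otimes> (inv a \<otimes> b)) <# K"
    using lcos_m_assoc[OF subgroup.subset[OF K] a, of "inv a \<otimes> b"] a b coset_join3[OF _ K h] by simp
  then show "a <# K = b <# K" using a b by (simp add: m_assoc[symmetric])
qed

lemma orbit_pts: "pts (orbit_gset G K) = (\<lambda>a. Coset (a <# K)) ` carrier G"
  by (auto simp: orbit_gset_def LCOSETS_def)

lemma orbit_act:
  assumes K: "subgroup K G" and "g \<in> carrier G" "a \<in> carrier G"
  shows "act (orbit_gset G K) g (Coset (a <# K)) = Coset ((g \<otimes> a) <# K)"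
  using assms lcos_m_assoc[OF subgroup.subset[OF K] assms(2,3)] by (auto simp: orbit_gset_def LCOSETS_def)

lemma orbit_base: "subgroup K G \<Longrightarrow> Coset (\<one> <# K) = Coset K"
  using lcos_mult_one[OF subgroup.subset] by simp

lemma orbit_point_in: "a \<in> carrier G \<Longrightarrow> Coset (a <# K) \<in> pts (orbit_gset G K)"
  by (simp add: orbit_pts)

lemma orbit_base_in: "subgroup K G \<Longrightarrow> Coset K \<in> pts (orbit_gset G K)"
  using orbit_point_in[of \<one> K] orbit_base by simp

lemma orbit_act_base: "subgroup K G \<Longrightarrow> g \<in> carrier G \<Longrightarrow> act (orbit_gset G K) g (Coset K) = Coset (g <# K)"
  using orbit_act[of K g \<one>] orbit_base by simp

lemma orbit_finite_gset: 
  assumes "finite (carrier G)" "subgroup K G" shows "finite_gset G (orbit_gset G K)"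
  unfolding finite_gset_iff[OF is_group]
proof (intro conjI ballI)
  show "finite (pts (orbit_gset G K))" using assms by (simp add: orbit_pts)
  show "act (orbit_gset G K) g \<in> pts (orbit_gset G K) \<rightarrow>\<^sub>E pts (orbit_gset G K)" if "g \<in> carrier G" for g
  proof (rule PiE_I)
    show "act (orbit_gset G K) g z \<in> pts (orbit_gset G K)" if "z \<in> pts (orbit_gset G K)" for z
      using that \<open>g \<in> carrier G\<close> orbit_act[OF assms(2) \<open>g \<in> carrier G\<close>] orbit_point_in unfolding orbit_pts[of K] by force
  qed (simp add: orbit_gset_def)
qed (use assms in \<open>auto simp: orbit_pts orbit_act m_assoc\<close>)

lemma stab_subgroup: 
  assumes X: "finite_gset G X" and p: "p \<in> pts X" shows "subgroup (stab G X p) G"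
proof (rule subgroupI)
  show "stab G X p \<noteq> {}" using finite_gsetD(3)[OF is_group X p] by (auto simp: stab_def)
  show "inv a \<in> stab G X p" if "a \<in> stab G X p" for a
    using that finite_gsetD(5)[OF is_group X, of a p] p by (auto simp: stab_def)
  show "a \<otimes> b \<in> stab G X p" if "a \<in> stab G X p" "b \<in> stab G X p" for a b
    using that finite_gsetD(4)[OF is_group X, of a b p] p by (auto simp: stab_def)
qed (auto simp: stab_def)

lemma act_eq_iff:
  assumes X: "finite_gset G X" and p: "p \<in> pts X" and a: "a \<in> carrier G" and b: "b \<in> carrier G"
  shows "act X a p = act X b p \<longleftrightarrow> inv a \<otimes> b \<in> stab G X p"
proof
  assume "act X a p = act X b p"
  then have "act X (inv a) (act X a p) = act X (inv a) (act X b p)" by simp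
  then show "inv a \<otimes> b \<in> stab G X p"
    using finite_gsetD(5)[OF is_group X a p] finite_gsetD(4)[OF is_group X, of "inv a" b p] a b p by (simp add: stab_def)
next
  assume "inv a \<otimes> b \<in> stab G X p"
  then have "act X (inv a) (act X b p) = p"
    using finite_gsetD(4)[OF is_group X, of "inv a" b p] a b p by (simp add: stab_def)
  then show "act X a p = act X b p"
    using finite_gsetD(6)[OF is_group X a, of "act X b p"] finite_gsetD(2)[OF is_group X b p] by simp
qed

lemma orbit_map_simp:
  assumes X: "finite_gset G X" and p: "p \<in> pts X" and K: "subgroup K G" "K \<subseteq> stab G X p" and a: "a \<in> carrier G"
  shows "orbit_map G K X p (Coset (a <# K)) = act X a p"
proof -
  define b where "b = (SOME g. g \<in> carrier G \<and> Coset (a <# K) = Coset (g <# K))"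
  have b: "b \<in> carrier G \<and> Coset (a <# K) = Coset (b <# K)" unfolding b_def by (rule someI[of _ a]) (use a in simp)
  then have "inv a \<otimes> b \<in> K" using l_coset_eq_iff[OF K(1) a] by blast
  then have "act X a p = act X b p" using act_eq_iff[OF X p a] b K(2) by blast
  then show ?thesis using a unfolding orbit_map_def b_def by (simp add: orbit_pts)
qed

lemma orbit_map_base:
  assumes X: "finite_gset G X" and p: "p \<in> pts X" and K: "subgroup K G" "K \<subseteq> stab G X p"
  shows "orbit_map G K X p (Coset K) = p"
  using orbit_map_simp[OF assms one_closed] orbit_base[OF K(1)] finite_gsetD(3)[OF is_group X p] by simp

lemma orbit_map_gmap:
  assumes X: "finite_gset G X" and p: "p \<in> pts X" and K: "subgroup K G" "K \<subseteq> stab G X p"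
  shows "orbit_map G K X p \<in> gmap G (orbit_gset G K) X"
proof -
  note o = orbit_map_simp[OF assms]
  have "orbit_map G K X p \<in> extensional (pts (orbit_gset G K))" by (simp add: orbit_map_def)
  moreover have "orbit_map G K X p z \<in> pts X" if "z \<in> pts (orbit_gset G K)" for z
    using that finite_gsetD(2)[OF is_group X _ p] by (auto simp: orbit_pts o)
  moreover have "orbit_map G K X p (act (orbit_gset G K) g z) = act X g (orbit_map G K X p z)"
    if "g \<in> carrier G" "z \<in> pts (orbit_gset G K)" for g z
    using that finite_gsetD(4)[OF is_group X _ _ p] by (auto simp: orbit_pts o orbit_act[OF K(1)])
  ultimately show ?thesis by (auto simp: gmap_def PiE_def)
qed

lemma trivial_subgroup: "subgroup {\<one>} G" by (rule triv_subgroup)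

lemma trivial_stab: "finite_gset G X \<Longrightarrow> p \<in> pts X \<Longrightarrow> {\<one>} \<subseteq> stab G X p"
  using finite_gsetD(3)[OF is_group, of X p] by (simp add: stab_def)

end

context tambara begin

abbreviation "Ge \<equiv> orbit_gset G {\<one>}"
abbreviation "F \<equiv> level G k Ge"

text \<open>
  The value of x at the point p, as an element of the ring of G/e.
\<close>

definition ev :: "'g objct \<Rightarrow> 'r \<Rightarrow> 'g point \<Rightarrow> 'r" where
  "ev X x p = R Ge X (orbit_map G {\<one>} X p) x"

text \<open>
  The action of h on the ring of G/e. It is the restriction along right multiplication by h, which is
  the automorphism of G/e that sends the coset of 1 to that of h; hence it is itself an evaluation.
\<close>

definition gact :: "'g \<Rightarrow> 'r \<Rightarrow> 'r" where
  "gact h x = ev Ge x (Coset (h <# {\<one>}))"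

lemma fin_orbit: "subgroup K G \<Longrightarrow> Fin (orbit_gset G K)"
  by (rule orbit_finite_gset[OF finite_group])

lemma fin_Ge: "Fin Ge" by (rule fin_orbit[OF trivial_subgroup])

lemma point_map: assumes "Fin X" "p \<in> pts X" shows "orbit_map G {\<one>} X p \<in> gmap G Ge X"
  by (rule orbit_map_gmap[OF assms trivial_subgroup trivial_stab[OF assms]])

lemma point_map_simp: assumes "Fin X" "p \<in> pts X" "a \<in> carrier G" shows "orbit_map G {\<one>} X p (Coset (a <# {\<one>})) = act X a p"
  by (rule orbit_map_simp[OF assms(1,2) trivial_subgroup trivial_stab[OF assms(1,2)] assms(3)])

lemma F_cring: "cring F" by (rule level_cring[OF fin_Ge])

lemma ev_closed: "Fin X \<Longrightarrow> p \<in> pts X \<Longrightarrow> x \<in> ob k X \<Longrightarrow> ev X x p \<in> ob k Ge"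
  unfolding ev_def by (rule ops_closed(1)[OF fin_Ge _ point_map])

lemma ev_ring_hom: "Fin X \<Longrightarrow> p \<in> pts X \<Longrightarrow> (\<lambda>x. ev X x p) \<in> ring_hom (level G k X) F"
  unfolding ev_def by (rule R_ring_hom[OF fin_Ge _ point_map])

lemma ev_R:
  assumes X: "Fin X" and Y: "Fin Y" and f: "f \<in> gmap G X Y" and p: "p \<in> pts X" and y: "y \<in> ob k Y"
  shows "ev X (R X Y f y) p = ev Y y (f p)"
proof -
  have fp: "f p \<in> pts Y" using gmapD(1)[OF f p] .
  show ?thesis unfolding ev_def
    by (rule R_comp[OF fin_Ge X Y point_map[OF X p] f point_map[OF Y fp] _ y])
      (use point_map_simp[OF X p] point_map_simp[OF Y fp] gmapD(3)[OF f _ p] in \<open>auto simp: orbit_pts\<close>)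
qed

lemma ev_act:
  assumes X: "Fin X" and p: "p \<in> pts X" and x: "x \<in> ob k X" and h: "h \<in> carrier G"
  shows "ev X x (act X h p) = gact h (ev X x p)"
  unfolding gact_def
  using ev_R[OF fin_Ge X point_map[OF X p] orbit_point_in[OF h] x] point_map_simp[OF X p h] by (simp add: ev_def[of X x p])

lemma gact_closed: "h \<in> carrier G \<Longrightarrow> x \<in> ob k Ge \<Longrightarrow> gact h x \<in> ob k Ge"
  unfolding gact_def by (rule ev_closed[OF fin_Ge orbit_point_in])

lemma gact_ring_hom: "h \<in> carrier G \<Longrightarrow> gact h \<in> ring_hom F F"
  unfolding gact_def by (rule ev_ring_hom[OF fin_Ge orbit_point_in])

lemma gact_mult: "g \<in> carrier G \<Longrightarrow> h \<in> carrier G \<Longrightarrow> x \<in> ob k Ge \<Longrightarrow> gact (g \<otimes> h) x = gact g (gact h x)"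
  using ev_act[OF fin_Ge orbit_point_in, of h x g] orbit_act[OF trivial_subgroup, of g h] by (simp add: gact_def)

lemma gact_one: assumes "x \<in> ob k Ge" shows "gact \<one> x = x"
proof -
  have "gact \<one> x = R Ge Ge (gset_id Ge) x"
  proof -
    have "orbit_map G {\<one>} Ge (Coset (\<one> <# {\<one>})) = gset_id Ge"
    proof (rule extensionalityI)
      fix z assume "z \<in> pts Ge"
      then obtain a where "a \<in> carrier G" "z = Coset (a <# {\<one>})" by (auto simp: orbit_pts)
      then show "orbit_map G {\<one>} Ge (Coset (\<one> <# {\<one>})) z = gset_id Ge z"
        using point_map_simp[OF fin_Ge orbit_point_in[OF one_closed]] orbit_act[OF trivial_subgroup _ one_closed] orbit_point_in by simp
    qed (auto simp: orbit_map_def gset_id_def)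
    then show ?thesis by (simp add: gact_def ev_def)
  qed
  then show ?thesis using ops_identity(1)[OF fin_Ge assms] by simp
qed

end

context pushforward begin

text \<open>
  The pullback along G/e \<rightarrow> Y of a map to Y is a free G-set, with one free orbit for each point a of
  the fibre. It is built here as an iterated disjoint union, one summand G/e for each a in A, which
  computes the pushforward along its map to G/e as an iterated product.
\<close>

lemma free_cover:
  assumes X: "Fin X" and "finite A" "A \<subseteq> pts X"
  shows "\<exists>W m \<pi>. Fin W \<and> m \<in> gmap G W X \<and> \<pi> \<in> gmap G W Ge \<and>
    bij_betw (\<lambda>u. (m u, \<pi> u)) (pts W) {(orbit_map G {\<one>} X a z, z) | a z. a \<in> A \<and> z \<in> pts Ge} \<and>
    (\<forall>x\<in>ob k X. op W Ge \<pi> (R W X m x) = finprod (M Ge) (ev X x) A)"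
  using assms(2,3)
proof (induction A)
  case empty
  interpret m: comm_monoid "M Ge" by (rule M_comm_monoid[OF fin_Ge])
  have "op empty_gset Ge (\<lambda>_. undefined) (R empty_gset X (\<lambda>_. undefined) x) = one (M Ge)" if "x \<in> ob k X" for x
    by (rule op_empty[OF ops_closed(1)[OF fin_empty X empty_gmap that]])
  then show ?case using fin_empty empty_gmap
    by (intro exI[of _ empty_gset] exI[of _ "\<lambda>_. undefined"]) (simp add: bij_betw_def)
next
  case (insert a A)
  interpret m: comm_monoid "M Ge" by (rule M_comm_monoid[OF fin_Ge])
  have a: "a \<in> pts X" and A: "A \<subseteq> pts X" using insert.prems by auto
  obtain W m \<pi> where W: "Fin W" and m: "m \<in> gmap G W X" and \<pi>: "\<pi> \<in> gmap G W Ge"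
    and b: "bij_betw (\<lambda>u. (m u, \<pi> u)) (pts W) {(orbit_map G {\<one>} X a z, z) | a z. a \<in> A \<and> z \<in> pts Ge}"
    and ih: "\<forall>x\<in>ob k X. op W Ge \<pi> (R W X m x) = finprod (M Ge) (ev X x) A"
    using insert.IH[OF A] by blast
  let ?a = "orbit_map G {\<one>} X a" and ?W = "sum_gset Ge W"
  let ?m = "copair Ge W ?a m" and ?\<pi> = "copair Ge W (gset_id Ge) \<pi>"
  note am = point_map[OF X a]
  have "op ?W Ge ?\<pi> (R ?W X ?m x) = finprod (M Ge) (ev X x) (insert a A)" if x: "x \<in> ob k X" for x
  proof -
    have mx: "R ?W X ?m x \<in> ob k ?W" by (rule ops_closed(1)[OF _ X _ x]) (use fin_Ge W am m in \<open>auto intro: copair_map\<close>)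
    have "op ?W Ge ?\<pi> (R ?W X ?m x) = mult (M Ge) (ev X x a) (finprod (M Ge) (ev X x) A)"
      unfolding op_copair[OF fin_Ge W fin_Ge id_map[OF fin_Ge] \<pi> mx] R_copair[OF fin_Ge W X am m x]
      using ih x op_id[OF fin_Ge ops_closed(1)[OF fin_Ge X am x]] by (simp add: ev_def)
    also have "\<dots> = finprod (M Ge) (ev X x) (insert a A)"
      by (rule m.finprod_insert[symmetric]) (use insert.hyps ev_closed[OF X _ x] a A in \<open>auto simp: Pi_def\<close>)
    finally show ?thesis .
  qed
  moreover have "bij_betw (\<lambda>u. (?m u, ?\<pi> u)) (pts ?W) {(orbit_map G {\<one>} X a' z, z) | a' z. a' \<in> insert a A \<and> z \<in> pts Ge}"
  proof -
    have d: "orbit_map G {\<one>} X b z \<noteq> ?a z" if b: "b \<in> A" and z: "z \<in> pts Ge" for b z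
    proof -
      have bX: "b \<in> pts X" using b A by auto
      obtain g where g: "g \<in> carrier G" "z = Coset (g <# {\<one>})" using z by (auto simp: orbit_pts)
      have "act X g b \<noteq> act X g a" using finite_gsetD(5)[OF is_group X g(1)] bX a b insert.hyps by metis
      then show ?thesis using point_map_simp[OF X a g(1)] point_map_simp[OF X bX g(1)] g(2) by simp
    qed
    let ?f = "\<lambda>u. (?m u, ?\<pi> u)" and ?P = "\<lambda>A. {(orbit_map G {\<one>} X a' z, z) | a' z. a' \<in> A \<and> z \<in> pts Ge}"
    have 1: "bij_betw ?f (InL ` pts Ge) (?P {a})" by (rule bij_betw_byWitness[where f' = "\<lambda>(_,z). InL z"]) auto
    have "bij_betw (?f \<circ> InR) (pts W) (?P A)"
      using b by (rule bij_betw_cong[THEN iffD1, rotated]) auto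
    then have 2: "bij_betw ?f (InR ` pts W) (?P A)"
      unfolding bij_betw_def by (auto simp: inj_on_def image_comp)
    have "bij_betw ?f (InL ` pts Ge \<union> InR ` pts W) (?P {a} \<union> ?P A)"
      by (rule bij_betw_combine[OF 1 2]) (use d in fastforce)
    moreover have "?P {a} \<union> ?P A = ?P (insert a A)" by auto
    ultimately show ?thesis by (simp add: sum_simps)
  qed
  ultimately show ?case
    using W fin_Ge copair_map[OF fin_Ge W am m] copair_map[OF fin_Ge W id_map[OF fin_Ge] \<pi>]
    by (intro exI[of _ ?W] exI[of _ ?m] exI[of _ ?\<pi>]) auto
qed

text \<open>
  Base change along G/e \<rightarrow> Y, g \<mapsto> g q, whose pullback is the free cover of the fibre over q.
\<close>

lemma ev_op:
  assumes X: "Fin X" and Y: "Fin Y" and f: "f \<in> gmap G X Y" and x: "x \<in> ob k X" and q: "q \<in> pts Y"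
  shows "ev Y (op X Y f x) q = finprod (M Ge) (ev X x) {p \<in> pts X. f p = q}"
proof -
  let ?A = "{p \<in> pts X. f p = q}"
  have "finite ?A" using finite_gsetD(1)[OF is_group X] by simp
  then obtain W m \<pi> where W: "Fin W" and m: "m \<in> gmap G W X" and \<pi>: "\<pi> \<in> gmap G W Ge"
    and b: "bij_betw (\<lambda>u. (m u, \<pi> u)) (pts W) {(orbit_map G {\<one>} X a z, z) | a z. a \<in> ?A \<and> z \<in> pts Ge}"
    and e: "\<forall>x\<in>ob k X. op W Ge \<pi> (R W X m x) = finprod (M Ge) (ev X x) ?A"
    using free_cover[OF X, of ?A] by blast
  let ?q = "orbit_map G {\<one>} Y q"
  have 1: "f (orbit_map G {\<one>} X a z) = ?q z" if "a \<in> ?A" "z \<in> pts Ge" for a z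
    using that gmapD(3)[OF f] point_map_simp[OF X, of a] point_map_simp[OF Y q] by (auto simp: orbit_pts)
  have 2: "\<exists>a\<in>?A. x = orbit_map G {\<one>} X a z" if x: "x \<in> pts X" and z: "z \<in> pts Ge" and xz: "f x = ?q z" for x z
  proof -
    obtain g where g: "g \<in> carrier G" "z = Coset (g <# {\<one>})" using z by (auto simp: orbit_pts)
    have a: "act X (inv g) x \<in> pts X" using finite_gsetD(2)[OF is_group X _ x] g by simp
    have "f (act X (inv g) x) = q"
      using gmapD(3)[OF f _ x, of "inv g"] xz g point_map_simp[OF Y q g(1)] finite_gsetD(5)[OF is_group Y g(1) q] by simp
    moreover have "x = orbit_map G {\<one>} X (act X (inv g) x) z"
      using point_map_simp[OF X a g(1)] g(2) finite_gsetD(6)[OF is_group X g(1) x] by simp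
    ultimately show ?thesis using a by blast
  qed
  let ?I = "\<lambda>x z. inv_into (pts W) (\<lambda>u. (m u, \<pi> u)) (x, z)"
  have "pullback_square G W X Ge Y f \<pi> ?q m"
  proof (rule pullback_squareI[OF f \<pi> point_map[OF Y q] m, where h = ?I])
    fix u assume u: "u \<in> pts W"
    have "(m u, \<pi> u) \<in> {(orbit_map G {\<one>} X a z, z) | a z. a \<in> ?A \<and> z \<in> pts Ge}" by (rule bij_betw_apply[OF b u])
    then obtain a z where "a \<in> ?A" "z \<in> pts Ge" "m u = orbit_map G {\<one>} X a z" "\<pi> u = z" by blast
    then have "f (m u) = ?q (\<pi> u)" using 1 by simp
    then show "f (m u) = ?q (\<pi> u) \<and> ?I (m u) (\<pi> u) = u" using inv_into_f_f[OF bij_betw_imp_inj_on[OF b] u] by simp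
  next
    fix x z assume h: "x \<in> pts X" "z \<in> pts Ge" "f x = ?q z"
    then have "(x, z) \<in> (\<lambda>u. (m u, \<pi> u)) ` pts W" using 2[OF h] b by (auto simp: bij_betw_def)
    from f_inv_into_f[OF this] inv_into_into[OF this] show "?I x z \<in> pts W \<and> m (?I x z) = x \<and> \<pi> (?I x z) = z" by simp
  qed
  from op_base_change[OF X W Y fin_Ge this x] e x show ?thesis by (simp add: ev_def[of Y])
qed

end

context tambara begin

lemma ev_ar:
  fixes S :: "('g,'g point,'g point) bispan"
  assumes S: "is_bispan G S" and x: "x \<in> ob k (src S)" and y: "y \<in> pts (tgt S)"
  shows "ev (tgt S) (ar k (bispan_class G S) x) y =
    finsum F (\<lambda>b. finprod F (\<lambda>a. ev (src S) x (rleg S a)) {a \<in> pts (lmid S). nleg S a = b}) {b \<in> pts (rmid S). tleg S b = y}"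
proof -
  interpret F: cring F by (rule F_cring)
  have s: "Fin (src S)" "Fin (lmid S)" "Fin (rmid S)" "Fin (tgt S)"
    "rleg S \<in> gmap G (lmid S) (src S)" "nleg S \<in> gmap G (lmid S) (rmid S)" "tleg S \<in> gmap G (rmid S) (tgt S)"
    using S by (auto simp: is_bispan_def)
  define u where "u = R (lmid S) (src S) (rleg S) x"
  define v where "v = N (lmid S) (rmid S) (nleg S) u"
  have u: "u \<in> ob k (lmid S)" unfolding u_def by (rule ops_closed(1)[OF s(2,1,5) x])
  have v: "v \<in> ob k (rmid S)" unfolding v_def by (rule ops_closed(2)[OF s(2,3,6) u])
  have eu: "ev (lmid S) u a = ev (src S) x (rleg S a)" if "a \<in> pts (lmid S)" for a
    unfolding u_def by (rule ev_R[OF s(2,1,5) that x])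
  have ec: "ev (src S) x (rleg S a) \<in> carrier F" if "a \<in> pts (lmid S)" for a
    using ev_closed[OF s(1) gmapD(1)[OF s(5) that] x] by simp
  have "ev (rmid S) v b = finprod F (\<lambda>a. ev (src S) x (rleg S a)) {a \<in> pts (lmid S). nleg S a = b}"
    if "b \<in> pts (rmid S)" for b
    unfolding v_def nm.ev_op[OF s(2,3,6) u that]
    by (rule F.finprod_cong') (use eu ec in auto)
  note evv = this
  have "finprod F (\<lambda>a. ev (src S) x (rleg S a)) {a \<in> pts (lmid S). nleg S a = b} \<in> carrier F" if "b \<in> pts (rmid S)" for b
    using evv[OF that] ev_closed[OF s(3) that v] by simp
  note fc = this
  have "ev (tgt S) (ar k (bispan_class G S) x) y = finsum F (ev (rmid S) v) {b \<in> pts (rmid S). tleg S b = y}"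
    unfolding factorization[OF S x] u_def[symmetric] v_def[symmetric] tr.ev_op[OF s(3,4,7) v y] finsum_def ..
  also have "\<dots> = finsum F (\<lambda>b. finprod F (\<lambda>a. ev (src S) x (rleg S a)) {a \<in> pts (lmid S). nleg S a = b}) {b \<in> pts (rmid S). tleg S b = y}"
    by (rule F.finsum_cong') (use evv fc in \<open>simp_all add: Pi_def\<close>)
  finally show ?thesis .
qed

end

section \<open>Subrings of values\<close>

lemma bij_betw_images:
  assumes "\<And>x y. x \<in> K \<Longrightarrow> y \<in> K \<Longrightarrow> u x = u y \<longleftrightarrow> v x = v y"
  obtains \<theta> where "bij_betw \<theta> (u ` K) (v ` K)" "\<And>x. x \<in> K \<Longrightarrow> \<theta> (u x) = v x"
proof
  let ?\<theta> = "\<lambda>z. v (inv_into K u z)"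
  show t: "?\<theta> (u x) = v x" if "x \<in> K" for x
    using assms[OF inv_into_into[OF imageI[OF that]] that] f_inv_into_f[OF imageI[OF that]] by metis
  show "bij_betw ?\<theta> (u ` K) (v ` K)"
    unfolding bij_betw_def inj_on_def using t assms by (auto simp: image_iff)
qed

context group begin

lemma stab_orbit_base:
  assumes K: "subgroup K G" shows "stab G (orbit_gset G K) (Coset K) = K"
proof -
  have "a <# K = K \<longleftrightarrow> a \<in> K" if "a \<in> carrier G" for a
    using l_coset_eq_iff[OF K one_closed that] lcos_mult_one[OF subgroup.subset[OF K]] that by auto
  then show ?thesis using subgroup.subset[OF K] by (auto simp: stab_def orbit_act_base[OF K])
qed

text \<open>
  Every finite G-set is obtained from orbits by disjoint unions and isomorphisms: split off the orbit
  of a point.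
\<close>

lemma gset_induct [consumes 2, case_names empty orbit sum iso]:
  fixes X :: "'a objct"
  assumes fin: "finite (carrier G)" and X: "finite_gset G X"
    and empty: "\<Phi> empty_gset" and orbit: "\<And>K. subgroup K G \<Longrightarrow> \<Phi> (orbit_gset G K)"
    and sum: "\<And>X Y. finite_gset G X \<Longrightarrow> finite_gset G Y \<Longrightarrow> \<Phi> X \<Longrightarrow> \<Phi> Y \<Longrightarrow> \<Phi> (sum_gset X Y)"
    and iso: "\<And>X Y i. finite_gset G X \<Longrightarrow> finite_gset G Y \<Longrightarrow> i \<in> gmap G X Y \<Longrightarrow> bij_betw i (pts X) (pts Y) \<Longrightarrow> \<Phi> X \<Longrightarrow> \<Phi> Y"
  shows "\<Phi> X"
  using X
proof (induction "card (pts X)" arbitrary: X rule: less_induct)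
  case (less X)
  note x = finite_gsetD[OF is_group less.prems]
  show ?case
  proof (cases "pts X = {}")
    case True
    show ?thesis
      by (rule iso[OF empty_finite_gset[OF is_group] less.prems empty_gmap _ empty]) (simp add: True bij_betw_def)
  next
    case False
    then obtain p where p: "p \<in> pts X" by auto
    define K where "K = stab G X p"
    note K = stab_subgroup[OF less.prems p, folded K_def]
    define O' where "O' = (\<lambda>g. act X g p) ` carrier G"
    define Y where "Y = restrict_gset X (- O')"
    have Y: "pts Y = pts X - O'" "\<And>g y. y \<in> pts Y \<Longrightarrow> act Y g y = act X g y" by (auto simp: Y_def restrict_gset_def)
    have st: "act X g y \<notin> O'" if g: "g \<in> carrier G" and y: "y \<in> pts X" "y \<notin> O'" for g y
    proof
      assume "act X g y \<in> O'"
      then obtain h where h: "h \<in> carrier G" "act X g y = act X h p" by (auto simp: O'_def)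
      then have "y = act X (inv g \<otimes> h) p" using x(5)[OF g y(1)] x(4)[of "inv g" h p] g p by simp
      then show False using y(2) g h(1) by (auto simp: O'_def)
    qed
    have FY: "finite_gset G Y" unfolding Y_def by (rule restrict_finite_gset[OF is_group less.prems]) (use st in auto)
    have pO: "p \<in> O'" using x(3)[OF p] by (force simp: O'_def)
    have "card (pts Y) < card (pts X)" using x(1) p pO by (intro psubset_card_mono) (auto simp: Y)
    from less.hyps[OF this FY] have PY: "\<Phi> Y" .
    note FK = orbit_finite_gset[OF fin K]
    note om = orbit_map_gmap[OF less.prems p K] orbit_map_simp[OF less.prems p K]
    have inc: "(\<lambda>y\<in>pts Y. y) \<in> gmap G Y X" using finite_gsetD(2)[OF is_group FY] by (auto simp: gmap_def Y)
    define i where "i = copair (orbit_gset G K) Y (orbit_map G K X p) (\<lambda>y\<in>pts Y. y)"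
    have i: "i \<in> gmap G (sum_gset (orbit_gset G K) Y) X"
      unfolding i_def by (rule copair_gmap[OF is_group FK FY om(1) inc]) (simp add: K_def)
    have eq: "act X a p = act X b p \<longleftrightarrow> a <# K = b <# K" if "a \<in> carrier G" "b \<in> carrier G" for a b
      using act_eq_iff[OF less.prems p that] l_coset_eq_iff[OF K that] by (simp add: K_def)
    have "bij_betw i (InL ` pts (orbit_gset G K)) O'"
      unfolding bij_betw_def inj_on_def orbit_pts O'_def i_def
      by (auto simp: orbit_point_in om(2) K_def[symmetric] eq image_image)
    moreover have "bij_betw i (InR ` pts Y) (pts Y)"
      unfolding bij_betw_def inj_on_def i_def by (auto simp: image_image)
    ultimately have "bij_betw i (InL ` pts (orbit_gset G K) \<union> InR ` pts Y) (O' \<union> pts Y)"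
      by (rule bij_betw_combine) (auto simp: Y)
    moreover have "O' \<union> pts Y = pts X" using x(2) p by (auto simp: Y O'_def)
    ultimately have "bij_betw i (pts (sum_gset (orbit_gset G K) Y)) (pts X)" by (simp add: sum_simps)
    from iso[OF sum_finite_gset[OF is_group FK FY] less.prems i this sum[OF FK FY orbit[OF K] PY]] show ?thesis .
  qed
qed

end

context tambara begin

text \<open>
  The image of the ring of G/K in that of G/e under restriction.
\<close>

definition Fsub :: "'g set \<Rightarrow> 'r set" where
  "Fsub K = (\<lambda>x. ev (orbit_gset G K) x (Coset K)) ` ob k (orbit_gset G K)"

lemma FsubE:
  assumes "subgroup K G" "y \<in> Fsub K"
  obtains x where "x \<in> ob k (orbit_gset G K)" "y = ev (orbit_gset G K) x (Coset K)"
  using assms by (auto simp: Fsub_def)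

lemma ev_in_Fsub:
  assumes X: "Fin X" and p: "p \<in> pts X" and x: "x \<in> ob k X" and S: "subgroup S G" "S \<subseteq> stab G X p"
  shows "ev X x p \<in> Fsub S"
proof -
  note m = orbit_map_gmap[OF X p S] and FS = fin_orbit[OF S(1)]
  have "ev X x p = ev (orbit_gset G S) (R (orbit_gset G S) X (orbit_map G S X p) x) (Coset S)"
    using ev_R[OF FS X m orbit_base_in[OF S(1)] x] orbit_map_base[OF X p S] by simp
  then show ?thesis using ops_closed(1)[OF FS X m x] by (auto simp: Fsub_def)
qed

lemma Fsub_closed: "subgroup K G \<Longrightarrow> y \<in> Fsub K \<Longrightarrow> y \<in> ob k Ge"
  using ev_closed[OF fin_orbit orbit_base_in] by (auto simp: Fsub_def)

text \<open>
  Translating by g conjugates stabilizers: the coset g K is fixed by S exactly if S is contained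
  in the conjugate of K by g.
\<close>

lemma Fsub_gact:
  assumes K: "subgroup K G" and S: "subgroup S G" and y: "y \<in> Fsub K" and g: "g \<in> carrier G"
    and c: "\<And>s. s \<in> S \<Longrightarrow> inv g \<otimes> s \<otimes> g \<in> K"
  shows "gact g y \<in> Fsub S"
proof -
  obtain x where x: "x \<in> ob k (orbit_gset G K)" "y = ev (orbit_gset G K) x (Coset K)" using FsubE[OF K y] .
  have "gact g y = ev (orbit_gset G K) x (Coset (g <# K))"
    using ev_act[OF fin_orbit[OF K] orbit_base_in[OF K] x(1) g] x(2) by (simp add: orbit_act_base[OF K g])
  moreover have "S \<subseteq> stab G (orbit_gset G K) (Coset (g <# K))"
  proof
    fix s assume s: "s \<in> S"
    then have sG: "s \<in> carrier G" using subgroup.subset[OF S] by auto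
    have "inv g \<otimes> (s \<otimes> g) \<in> K" using c[OF s] sG g by (simp add: m_assoc)
    then have "g <# K = (s \<otimes> g) <# K" using l_coset_eq_iff[OF K g, of "s \<otimes> g"] sG g by simp
    then have "act (orbit_gset G K) s (Coset (g <# K)) = Coset (g <# K)" unfolding orbit_act[OF K sG g] by simp
    then show "s \<in> stab G (orbit_gset G K) (Coset (g <# K))" using sG by (simp add: stab_def)
  qed
  ultimately show ?thesis using ev_in_Fsub[OF fin_orbit[OF K] orbit_point_in[OF g] x(1) S] by simp
qed

lemma Fsub_mono: "subgroup K G \<Longrightarrow> subgroup S G \<Longrightarrow> S \<subseteq> K \<Longrightarrow> Fsub K \<subseteq> Fsub S"
  using Fsub_gact[of K S _ \<one>] gact_one Fsub_closed subgroup.mem_carrier[of S G] by (auto simp: subset_iff)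

lemma Fsub_trivial: "Fsub {\<one>} = ob k Ge"
proof -
  have "ev Ge x (Coset {\<one>}) = x" if "x \<in> ob k Ge" for x
    using gact_one[OF that] by (simp add: gact_def orbit_base[OF trivial_subgroup])
  then show ?thesis by (auto simp: Fsub_def)
qed

lemma Fsub_ring:
  assumes K: "subgroup K G"
  shows "\<zero>\<^bsub>F\<^esub> \<in> Fsub K" "\<one>\<^bsub>F\<^esub> \<in> Fsub K" "\<And>y z. y \<in> Fsub K \<Longrightarrow> z \<in> Fsub K \<Longrightarrow> y \<oplus>\<^bsub>F\<^esub> z \<in> Fsub K"
    "\<And>y z. y \<in> Fsub K \<Longrightarrow> z \<in> Fsub K \<Longrightarrow> y \<otimes>\<^bsub>F\<^esub> z \<in> Fsub K" "\<And>y. y \<in> Fsub K \<Longrightarrow> \<ominus>\<^bsub>F\<^esub> y \<in> Fsub K"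
proof -
  let ?O = "orbit_gset G K"
  note FK = fin_orbit[OF K]
  interpret L: cring "level G k ?O" by (rule level_cring[OF FK])
  interpret F: cring F by (rule F_cring)
  interpret h: ring_hom_cring "level G k ?O" F "\<lambda>x. ev ?O x (Coset K)"
    by unfold_locales (rule ev_ring_hom[OF FK orbit_base_in[OF K]])
  have i: "x \<in> carrier (level G k ?O) \<Longrightarrow> ev ?O x (Coset K) \<in> Fsub K" for x by (simp add: Fsub_def)
  show "\<zero>\<^bsub>F\<^esub> \<in> Fsub K" using i[OF L.zero_closed] h.hom_zero by simp
  show "\<one>\<^bsub>F\<^esub> \<in> Fsub K" using i[OF L.one_closed] h.hom_one by simp
  fix y assume y: "y \<in> Fsub K"
  then obtain a where a: "a \<in> carrier (level G k ?O)" "y = ev ?O a (Coset K)" by (auto simp: Fsub_def)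
  show "\<ominus>\<^bsub>F\<^esub> y \<in> Fsub K" using i[OF L.a_inv_closed[OF a(1)]] h.hom_a_inv[OF a(1)] a(2) by simp
  fix z assume z: "z \<in> Fsub K"
  then obtain b where b: "b \<in> carrier (level G k ?O)" "z = ev ?O b (Coset K)" by (auto simp: Fsub_def)
  show "y \<oplus>\<^bsub>F\<^esub> z \<in> Fsub K" using i[OF L.a_closed[OF a(1) b(1)]] h.hom_add[OF a(1) b(1)] a(2) b(2) by simp
  show "y \<otimes>\<^bsub>F\<^esub> z \<in> Fsub K" using i[OF L.m_closed[OF a(1) b(1)]] h.hom_mult[OF a(1) b(1)] a(2) b(2) by simp
qed

end

context pushforward begin

text \<open>
  The images Fsub are closed under sums and products over finite K-sets. On an orbit K/S this is the
  pushforward along G/S \<rightarrow> G/K, evaluated at the base point of G/K, whose fibre is K/S; a general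
  K-set is a union of orbits. The statement is about stable subsets W of a fixed Z to make
  the induction over orbits possible.
\<close>

lemma Fsub_finprod:
  assumes K: "subgroup K G" and Z: "finite_gset (sub_group G K) Z"
    and eq: "\<And>g z. g \<in> K \<Longrightarrow> z \<in> pts Z \<Longrightarrow> \<phi> (act Z g z) = gact g (\<phi> z)"
    and val: "\<And>z. z \<in> pts Z \<Longrightarrow> \<phi> z \<in> Fsub (stab (sub_group G K) Z z)"
    and unit: "one (M Ge) \<in> Fsub K" and mult: "\<And>y z. y \<in> Fsub K \<Longrightarrow> z \<in> Fsub K \<Longrightarrow> mult (M Ge) y z \<in> Fsub K"
    and W: "W \<subseteq> pts Z" "\<And>g z. g \<in> K \<Longrightarrow> z \<in> W \<Longrightarrow> act Z g z \<in> W"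
  shows "finprod (M Ge) \<phi> W \<in> Fsub K"
proof -
  interpret m: comm_monoid "M Ge" by (rule M_comm_monoid[OF fin_Ge])
  interpret K: group "sub_group G K" by (rule subgroup.subgroup_is_group[OF K is_group])
  note Kc = subgroup.mem_carrier[OF K]
  note z = finite_gsetD[OF K.is_group Z, simplified]
  have sub: "subgroup (stab (sub_group G K) Z z) G" if "z \<in> pts Z" for z
    using incl_subgroup[OF K K.stab_subgroup[OF Z that]] .
  have \<phi>: "\<phi> z \<in> ob k Ge" if "z \<in> pts Z" for z using Fsub_closed[OF sub val] that by blast
  have "finite W" using W z(1) by (auto intro: finite_subset)
  then show ?thesis using W
  proof (induction W rule: finite_psubset_induct)
    case (psubset W)
    show ?case
    proof (cases "W = {}")
      case True then show ?thesis using unit by simp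
    next
      case False
      then obtain p where p: "p \<in> W" by auto
      have pZ: "p \<in> pts Z" using p psubset.prems by auto
      define O' where "O' = (\<lambda>g. act Z g p) ` K"
      have OW: "O' \<subseteq> W" using p psubset.prems by (auto simp: O'_def)
      have pO: "p \<in> O'" using z(3)[OF pZ] subgroup.one_closed[OF K] by (force simp: O'_def)
      have st: "act Z g y \<in> W - O'" if g: "g \<in> K" and y: "y \<in> W - O'" for g y
      proof -
        have yZ: "y \<in> pts Z" using y psubset.prems by auto
        have "act Z g y \<notin> O'"
        proof
          assume "act Z g y \<in> O'"
          then obtain h where h: "h \<in> K" "act Z g y = act Z h p" by (auto simp: O'_def)
          have gi: "inv g \<in> K" using subgroup.m_inv_closed[OF K g] .
          have "y = act Z (inv g \<otimes> h) p"
            using z(5)[OF g yZ] z(4)[OF gi h(1) pZ] h(2) m_inv_consistent[OF K g] by simp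
          then show False using y subgroup.m_closed[OF K gi h(1)] by (auto simp: O'_def)
        qed
        then show ?thesis using psubset.prems g y by auto
      qed
      have "W - O' \<subset> W" using p pO by auto
      from psubset.IH[OF this] have r: "finprod (M Ge) \<phi> (W - O') \<in> Fsub K" using psubset.prems st by blast
      define S where "S = stab (sub_group G K) Z p"
      have S: "subgroup S G" "S \<subseteq> K" unfolding S_def using sub[OF pZ] by (auto simp: stab_def)
      obtain x where x: "x \<in> ob k (orbit_gset G S)" "\<phi> p = ev (orbit_gset G S) x (Coset S)"
        using FsubE[OF S(1)] val[OF pZ] by (metis S_def)
      note FS = fin_orbit[OF S(1)] and FK = fin_orbit[OF K]
      have SK: "S \<subseteq> stab G (orbit_gset G K) (Coset K)" using S stab_orbit_base[OF K] by simp
      let ?f = "orbit_map G S (orbit_gset G K) (Coset K)"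
      note f = orbit_map_gmap[OF FK orbit_base_in[OF K] S(1) SK] orbit_map_simp[OF FK orbit_base_in[OF K] S(1) SK]
      have fib: "{q \<in> pts (orbit_gset G S). ?f q = Coset K} = (\<lambda>g. Coset (g <# S)) ` K"
      proof -
        have "act (orbit_gset G K) a (Coset K) = Coset K \<longleftrightarrow> a \<in> K" if "a \<in> carrier G" for a
          using that by (subst (3) stab_orbit_base[OF K, symmetric]) (simp add: stab_def)
        then show ?thesis using Kc by (auto simp: orbit_pts f(2))
      qed
      have eqK: "act Z g p = act Z h p \<longleftrightarrow> Coset (g <# S) = Coset (h <# S)" if g: "g \<in> K" and h: "h \<in> K" for g h
        using K.act_eq_iff[OF Z pZ, of g h] g h l_coset_eq_iff[OF S(1) Kc[OF g] Kc[OF h]] m_inv_consistent[OF K g]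
        by (simp add: S_def)
      \<comment> \<open>the orbit of p and the fibre over the base point of G/K are both K/S\<close>
      obtain \<theta> where \<theta>: "bij_betw \<theta> O' ((\<lambda>g. Coset (g <# S)) ` K)" "\<And>g. g \<in> K \<Longrightarrow> \<theta> (act Z g p) = Coset (g <# S)"
        unfolding O'_def using bij_betw_images[of K "\<lambda>g. act Z g p" "\<lambda>g. Coset (g <# S)"] eqK by blast
      have e: "ev (orbit_gset G S) x (\<theta> y) = \<phi> y" if y: "y \<in> O'" for y
      proof -
        obtain g where g: "g \<in> K" "y = act Z g p" using y by (auto simp: O'_def)
        show ?thesis using ev_act[OF FS orbit_base_in[OF S(1)] x(1) Kc[OF g(1)]] orbit_act_base[OF S(1) Kc[OF g(1)]] x(2)
          \<theta>(2)[OF g(1)] eq[OF g(1) pZ] g(2) by simp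
      qed
      have evc: "ev (orbit_gset G S) x q \<in> ob k Ge" if "q \<in> pts (orbit_gset G S)" for q by (rule ev_closed[OF FS that x(1)])
      have "ev (orbit_gset G K) (op (orbit_gset G S) (orbit_gset G K) ?f x) (Coset K) = finprod (M Ge) (ev (orbit_gset G S) x) (\<theta> ` O')"
        using ev_op[OF FS FK f(1) x(1) orbit_base_in[OF K]] fib \<theta>(1) by (simp add: bij_betw_def)
      also have "\<dots> = finprod (M Ge) (\<lambda>y. ev (orbit_gset G S) x (\<theta> y)) O'"
        by (rule m.finprod_reindex) (use \<theta>(1) evc Kc in \<open>auto simp: bij_betw_def orbit_pts\<close>)
      also have "\<dots> = finprod (M Ge) \<phi> O'"
        by (rule m.finprod_cong') (use e \<phi> OW psubset.prems in auto)
      finally have o: "finprod (M Ge) \<phi> O' \<in> Fsub K"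
        using op_closed[OF FS FK f(1) x(1)] by (metis Fsub_def imageI)
      have "finprod (M Ge) \<phi> (O' \<union> (W - O')) = mult (M Ge) (finprod (M Ge) \<phi> O') (finprod (M Ge) \<phi> (W - O'))"
        by (rule m.finprod_Un_disjoint) (use psubset.hyps OW psubset.prems \<phi> in \<open>auto intro: finite_subset\<close>)
      moreover have "O' \<union> (W - O') = W" using OW by auto
      ultimately show ?thesis using mult[OF o r] by simp
    qed
  qed
qed

end

context tambara begin

lemma Fsub_sum_prod:
  assumes K: "subgroup K G" and Z: "finite_gset (sub_group G K) Z"
    and eq: "\<And>g z. g \<in> K \<Longrightarrow> z \<in> pts Z \<Longrightarrow> \<phi> (act Z g z) = gact g (\<phi> z)"
    and val: "\<And>z. z \<in> pts Z \<Longrightarrow> \<phi> z \<in> Fsub (stab (sub_group G K) Z z)"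
  shows "finprod F \<phi> (pts Z) \<in> Fsub K" "finsum F \<phi> (pts Z) \<in> Fsub K"
proof -
  interpret K: group "sub_group G K" by (rule subgroup.subgroup_is_group[OF K is_group])
  note z = finite_gsetD(2)[OF K.is_group Z, simplified]
  show "finprod F \<phi> (pts Z) \<in> Fsub K" by (rule nm.Fsub_finprod[OF K Z eq val]) (use Fsub_ring[OF K] z in auto)
  have "finprod (add_monoid F) \<phi> (pts Z) \<in> Fsub K" by (rule tr.Fsub_finprod[OF K Z eq val]) (use Fsub_ring[OF K] z in auto)
  then show "finsum F \<phi> (pts Z) \<in> Fsub K" by (simp add: finsum_def)
qed

end

section \<open>Splitting idempotents of simple rings with a group action\<close>

lemma (in cring) exists_maximal_ideal:
  assumes "\<one> \<noteq> \<zero>" shows "\<exists>m. maximalideal m R"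
proof -
  let ?A = "{I. ideal I R \<and> \<one> \<notin> I}"
  have "\<exists>m\<in>?A. \<forall>X\<in>?A. m \<subseteq> X \<longrightarrow> X = m"
  proof (rule subset_Zorn_nonempty)
    show "?A \<noteq> {}" using zeroideal assms by auto
    fix C assume C: "C \<noteq> {}" "subset.chain ?A C"
    have i: "ideal I R" "\<one> \<notin> I" if "I \<in> C" for I using C that by (auto simp: subset.chain_def)
    have c: "I \<subseteq> I' \<or> I' \<subseteq> I" if "I \<in> C" "I' \<in> C" for I I' using C that by (auto simp: subset.chain_def)
    have car: "x \<in> carrier R" if "I \<in> C" "x \<in> I" for x I using ideal.Icarr[OF i(1)] that .
    have "ideal (\<Union>C) R"
    proof (rule idealI[OF ring_axioms])
      show "subgroup (\<Union>C) (add_monoid R)"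
      proof (rule add.subgroupI)
        show "\<Union>C \<noteq> {}" using C(1) i(1) additive_subgroup.zero_closed[OF ideal.axioms(1)] by blast
        show "\<ominus> a \<in> \<Union>C" if "a \<in> \<Union>C" for a
          using that additive_subgroup.a_inv_closed[OF ideal.axioms(1)[OF i(1)]] by blast
        fix a b assume "a \<in> \<Union>C" "b \<in> \<Union>C"
        then obtain I where "I \<in> C" "a \<in> I" "b \<in> I" using c by blast
        then show "a \<oplus> b \<in> \<Union>C" using additive_subgroup.a_closed[OF ideal.axioms(1)[OF i(1)]] by blast
      qed (use car in auto)
      show "x \<otimes> a \<in> \<Union>C" if "a \<in> \<Union>C" "x \<in> carrier R" for a x using that ideal.I_l_closed[OF i(1)] by blast
      show "a \<otimes> x \<in> \<Union>C" if "a \<in> \<Union>C" "x \<in> carrier R" for a x using that ideal.I_r_closed[OF i(1)] by blast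
    qed
    then show "\<Union>C \<in> ?A" using i(2) by blast
  qed
  then obtain m where m: "ideal m R" "\<one> \<notin> m" and mx: "\<And>X. ideal X R \<Longrightarrow> \<one> \<notin> X \<Longrightarrow> m \<subseteq> X \<Longrightarrow> X = m" by blast
  have "maximalideal m R"
  proof (rule maximalidealI[OF m(1)])
    show "carrier R \<noteq> m" using m(2) by auto
    fix J assume "ideal J R" "m \<subseteq> J" "J \<subseteq> carrier R"
    then show "J = m \<or> J = carrier R" using mx ideal.one_imp_carrier by blast
  qed
  then show ?thesis ..
qed

text \<open>
  The quotient by a maximal ideal is a field, in terms of elements.
\<close>

lemma (in cring) maximal_ideal_inverse:
  assumes m: "maximalideal m R" and x: "x \<in> carrier R" "x \<notin> m"
  shows "\<exists>y\<in>carrier R. \<one> \<ominus> x \<otimes> y \<in> m"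
proof -
  interpret m: maximalideal m R by (rule m)
  have P: "ideal (PIdl x) R" by (rule cgenideal_ideal[OF x(1)])
  have mP: "ideal (m <+> PIdl x) R" by (rule add_ideals[OF m.is_ideal P])
  have "\<zero> \<in> PIdl x" "\<zero> \<in> m" using additive_subgroup.zero_closed[OF ideal.axioms(1)[OF P]] by auto
  have xP: "x \<in> PIdl x" by (rule cgenideal_self[OF x(1)])
  have mem: "a \<oplus> b \<in> m <+> PIdl x" if "a \<in> m" "b \<in> PIdl x" for a b
    using that by (auto simp: set_add_def')
  have "m \<subseteq> m <+> PIdl x" using mem[OF _ \<open>\<zero> \<in> PIdl x\<close>] m.Icarr by auto
  moreover have "x \<in> m <+> PIdl x" using mem[OF \<open>\<zero> \<in> m\<close> xP] x(1) by simp
  ultimately have "m <+> PIdl x = carrier R"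
    using m.I_maximal[OF mP] x(2) ideal.Icarr[OF mP] by blast
  then have "\<one> \<in> m <+> PIdl x" by simp
  then obtain a b where ab: "a \<in> m" "b \<in> PIdl x" "\<one> = a \<oplus> b" by (auto simp: set_add_def')
  then obtain y where y: "y \<in> carrier R" "b = y \<otimes> x" by (auto simp: cgenideal_def)
  have "a \<in> carrier R" "x \<otimes> y \<in> carrier R" "\<one> = a \<oplus> x \<otimes> y"
    using m.Icarr[OF ab(1)] ab(3) y x(1) by (simp_all add: m_comm)
  then have "\<one> \<ominus> x \<otimes> y = a" by (simp add: minus_eq a_assoc r_neg)
  then show ?thesis using ab(1) y(1) by (intro bexI[of _ y]) simp_all
qed

text \<open>
  Let H be the stabilizer of a maximal ideal m. An element all of whose translates lie in m is 0, by
  simplicity. For g outside H the ideals m and its translate are coprime, so there is an i g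
  congruent to 1 modulo m with \<rho> g (i g) in m; the product e of these is congruent to 1 modulo m, and
  \<rho> g e is in m for all g outside H. Consequently e annihilates m (P): all translates of e x lie in m
  if x does. The remaining assertions apply this to suitable elements of m, among them 1 - e.
\<close>

lemma (in cring) exists_splitting_idempotent:
  fixes G :: "('g,'m) monoid_scheme"
  assumes G: "group G" and fin: "finite (carrier G)"
    and hom: "\<And>g. g \<in> carrier G \<Longrightarrow> \<rho> g \<in> ring_hom R R"
    and act_one: "\<And>x. x \<in> carrier R \<Longrightarrow> \<rho> \<one>\<^bsub>G\<^esub> x = x"
    and act_mult: "\<And>g h x. g \<in> carrier G \<Longrightarrow> h \<in> carrier G \<Longrightarrow> x \<in> carrier R \<Longrightarrow> \<rho> (g \<otimes>\<^bsub>G\<^esub> h) x = \<rho> g (\<rho> h x)"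
    and nonzero: "\<one> \<noteq> \<zero>"
    and simple: "\<And>J. ideal J R \<Longrightarrow> (\<And>g x. g \<in> carrier G \<Longrightarrow> x \<in> J \<Longrightarrow> \<rho> g x \<in> J) \<Longrightarrow> \<one> \<notin> J \<Longrightarrow> J = {\<zero>}"
  obtains H e where "subgroup H G" "e \<in> carrier R" "e \<noteq> \<zero>" "e \<otimes> e = e" "\<And>h. h \<in> H \<Longrightarrow> \<rho> h e = e"
    "\<And>g. g \<in> carrier G \<Longrightarrow> g \<notin> H \<Longrightarrow> e \<otimes> \<rho> g e = \<zero>"
    "\<And>x. x \<in> carrier R \<Longrightarrow> e \<otimes> x \<noteq> \<zero> \<Longrightarrow> \<exists>y\<in>carrier R. e \<otimes> (x \<otimes> y) = e"
proof -
  interpret G: group G by (rule G)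
  have rh: "ring_hom_cring R R (\<rho> g)" if "g \<in> carrier G" for g
    by unfold_locales (rule hom[OF that])
  note h = ring_hom_closed[OF hom] ring_hom_mult[OF hom] ring_hom_add[OF hom] ring_hom_one[OF hom]
    ring_hom_cring.hom_zero[OF rh] ring_hom_cring.hom_a_inv[OF rh]
  obtain m where mm: "maximalideal m R" using exists_maximal_ideal[OF nonzero] ..
  interpret m: maximalideal m R by (rule mm)
  have m1: "\<one> \<notin> m" using m.I_notcarr m.one_imp_carrier by auto
  \<comment> \<open>the elements all of whose translates lie in m form a stable ideal without 1\<close>
  have J0: "x = \<zero>" if "x \<in> carrier R" "\<And>g. g \<in> carrier G \<Longrightarrow> \<rho> g x \<in> m" for x
  proof -
    let ?J = "{x \<in> carrier R. \<forall>g\<in>carrier G. \<rho> g x \<in> m}"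
    have "ideal ?J R"
    proof (rule idealI[OF ring_axioms])
      show "subgroup ?J (add_monoid R)"
        by (rule add.subgroupI) (auto simp: h intro!: exI[of _ \<zero>])
    qed (auto simp: h m.I_l_closed m.I_r_closed)
    moreover have "\<rho> g x \<in> ?J" if "g \<in> carrier G" "x \<in> ?J" for g x
      using that by (auto simp: h act_mult[symmetric])
    moreover have "\<one> \<notin> ?J" using m1 h(4)[OF G.one_closed] by (auto intro!: bexI[of _ "\<one>\<^bsub>G\<^esub>"])
    ultimately have "?J = {\<zero>}" by (rule simple)
    then show ?thesis using that by blast
  qed
  define H where "H = {g \<in> carrier G. \<forall>x\<in>m. \<rho> g x \<in> m}"
  \<comment> \<open>by maximality, m is its own preimage under an element of H, so H is closed under inverses\<close>
  have Hiff: "x \<in> m" if g: "g \<in> H" and x: "x \<in> carrier R" "\<rho> g x \<in> m" for g x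
  proof -
    have gG: "g \<in> carrier G" using g by (simp add: H_def)
    \<comment> \<open>the preimage of m under g is an ideal that contains m\<close>
    let ?J = "{x \<in> carrier R. \<rho> g x \<in> m}"
    have "ideal ?J R"
    proof (rule idealI[OF ring_axioms])
      show "subgroup ?J (add_monoid R)"
        by (rule add.subgroupI) (auto simp: h gG intro!: exI[of _ \<zero>])
    qed (auto simp: h gG m.I_l_closed m.I_r_closed)
    moreover have "m \<subseteq> ?J" using g m.Icarr by (auto simp: H_def)
    moreover have "\<one> \<notin> ?J" using m1 h(4)[OF gG] by simp
    then have "?J \<noteq> carrier R" using one_closed by blast
    ultimately have "?J = m" using m.I_maximal[of ?J] by blast
    then show ?thesis using x by blast
  qed
  have H: "subgroup H G"
  proof (rule G.subgroupI)
    have "\<one>\<^bsub>G\<^esub> \<in> H" using act_one m.Icarr by (simp add: H_def)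
    then show "H \<noteq> {}" by blast
    show "inv\<^bsub>G\<^esub> g \<in> H" if g: "g \<in> H" for g
    proof -
      have gG: "g \<in> carrier G" using g by (simp add: H_def)
      have "\<rho> (inv\<^bsub>G\<^esub> g) x \<in> m" if x: "x \<in> m" for x
        by (rule Hiff[OF g]) (use gG x m.Icarr[OF x] in \<open>simp_all add: h act_mult[symmetric] act_one\<close>)
      then show ?thesis using gG by (simp add: H_def)
    qed
    show "g \<otimes>\<^bsub>G\<^esub> g' \<in> H" if "g \<in> H" "g' \<in> H" for g g'
      using that m.Icarr by (auto simp: H_def act_mult)
  qed (auto simp: H_def)
  have "\<exists>i\<in>carrier R. \<one> \<ominus> i \<in> m \<and> \<rho> g i \<in> m" if g: "g \<in> carrier G - H" for g
  proof -
    have gi: "inv\<^bsub>G\<^esub> g \<in> carrier G" "inv\<^bsub>G\<^esub> g \<notin> H"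
      using g subgroup.m_inv_closed[OF H, of "inv\<^bsub>G\<^esub> g"] by auto
    then obtain x where x: "x \<in> m" "\<rho> (inv\<^bsub>G\<^esub> g) x \<notin> m" by (auto simp: H_def)
    have xc: "x \<in> carrier R" "\<rho> (inv\<^bsub>G\<^esub> g) x \<in> carrier R" using m.Icarr[OF x(1)] h(1)[OF gi(1)] by auto
    obtain y where y: "y \<in> carrier R" "\<one> \<ominus> \<rho> (inv\<^bsub>G\<^esub> g) x \<otimes> y \<in> m"
      using maximal_ideal_inverse[OF mm xc(2) x(2)] by blast
    have "\<rho> g (\<rho> (inv\<^bsub>G\<^esub> g) x) = x" using g gi xc by (simp add: act_mult[symmetric] act_one)
    then have "\<rho> g (\<rho> (inv\<^bsub>G\<^esub> g) x \<otimes> y) \<in> m" using g h(1)[of g y] h(2)[of g _ y] xc y m.I_r_closed[OF x(1)] by simp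
    then show ?thesis using y xc by blast
  qed
  then obtain i where i: "\<And>g. g \<in> carrier G - H \<Longrightarrow> i g \<in> carrier R \<and> \<one> \<ominus> i g \<in> m \<and> \<rho> g (i g) \<in> m" by metis
  define e where "e = finprod R i (carrier G - H)"
  have e: "e \<in> carrier R" unfolding e_def using i by (intro finprod_closed) auto
  have e1: "\<one> \<ominus> e \<in> m"
  proof -
    have "finprod R i A \<in> carrier R \<and> \<one> \<ominus> finprod R i A \<in> m" if "finite A" "A \<subseteq> carrier G - H" for A
      using that
    proof (induction A)
      case empty
      then show ?case by (simp add: minus_eq r_neg)
    next
      case (insert g A)
      have 1: "i g \<in> carrier R" "finprod R i A \<in> carrier R" "\<one> \<ominus> i g \<in> m" "\<one> \<ominus> finprod R i A \<in> m" "i \<in> A \<rightarrow> carrier R"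
        using insert i by auto
      have 2: "finprod R i (insert g A) = i g \<otimes> finprod R i A" using insert 1 by simp
      have "\<one> \<ominus> i g \<otimes> finprod R i A = (\<one> \<ominus> i g) \<oplus> i g \<otimes> (\<one> \<ominus> finprod R i A)"
        using 1(1,2) by (simp add: minus_eq r_distr r_minus) algebra
      then show ?case unfolding 2 using 1 m.I_l_closed[OF 1(4,1)] by simp
    qed
    then show ?thesis unfolding e_def using fin by auto
  qed
  have ge: "\<rho> g e \<in> m" if g: "g \<in> carrier G" "g \<notin> H" for g
  proof -
    have "e = i g \<otimes> finprod R i (carrier G - H - {g})"
      unfolding e_def by (subst finprod_insert[symmetric]) (use i g fin in \<open>auto simp: insert_absorb insert_Diff_if\<close>)
    moreover have "finprod R i (carrier G - H - {g}) \<in> carrier R" using i by (intro finprod_closed) auto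
    ultimately show ?thesis using i[of g] g m.I_r_closed by (simp add: h)
  qed
  have P: "e \<otimes> x = \<zero>" if x: "x \<in> m" for x
  proof (rule J0)
    have xc: "x \<in> carrier R" by (rule m.Icarr[OF x])
    show "e \<otimes> x \<in> carrier R" using e xc by simp
    fix g assume g: "g \<in> carrier G"
    show "\<rho> g (e \<otimes> x) \<in> m"
      using g e xc x ge[OF g] m.I_l_closed m.I_r_closed by (cases "g \<in> H") (auto simp: h H_def)
  qed
  have P1: "e \<otimes> y = e" if y: "y \<in> carrier R" "\<one> \<ominus> y \<in> m" for y
  proof -
    have "e \<ominus> e \<otimes> y = e \<otimes> (\<one> \<ominus> y)" using e y(1) by (simp add: minus_eq r_distr r_minus)
    then have "e \<ominus> e \<otimes> y = \<zero>" using P[OF y(2)] by simp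
    then have "e \<oplus> \<ominus> (e \<otimes> y) = \<zero>" by (simp add: minus_eq)
    then show ?thesis using minus_equality[of "e" "\<ominus> (e \<otimes> y)"] e y(1) by simp
  qed
  have ee: "e \<otimes> e = e" by (rule P1[OF e e1])
  have he: "e \<otimes> \<rho> g e = e" if g: "g \<in> H" for g
  proof (rule P1)
    have gG: "g \<in> carrier G" using g by (simp add: H_def)
    show "\<rho> g e \<in> carrier R" using e gG by (simp add: h)
    have "\<rho> g (\<one> \<ominus> e) \<in> m" using g e1 by (simp add: H_def)
    then show "\<one> \<ominus> \<rho> g e \<in> m" using e gG by (simp add: minus_eq h)
  qed
  show thesis
  proof (rule that[OF H e _ ee])
    show "e \<noteq> \<zero>" using e1 m1 by (auto simp: minus_eq)
    show "\<rho> g e = e" if g: "g \<in> H" for g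
    proof -
      have gG: "g \<in> carrier G" using g by (simp add: H_def)
      have gi: "inv\<^bsub>G\<^esub> g \<in> H" using subgroup.m_inv_closed[OF H g] .
      have "\<rho> g (e \<otimes> \<rho> (inv\<^bsub>G\<^esub> g) e) = \<rho> g e \<otimes> e" using e gG by (simp add: h act_mult[symmetric] act_one)
      then show ?thesis using he[OF g] he[OF gi] e gG m_comm[of e "\<rho> g e"] by (simp add: h)
    qed
    show "e \<otimes> \<rho> g e = \<zero>" if "g \<in> carrier G" "g \<notin> H" for g by (rule P[OF ge[OF that]])
    show "\<exists>y\<in>carrier R. e \<otimes> (x \<otimes> y) = e" if x: "x \<in> carrier R" "e \<otimes> x \<noteq> \<zero>" for x
    proof -
      have "x \<notin> m" using P x(2) by auto
      then obtain y where "y \<in> carrier R" "\<one> \<ominus> x \<otimes> y \<in> m" using maximal_ideal_inverse[OF mm x(1)] by blast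
      then show ?thesis using P1[of "x \<otimes> y"] x(1) by auto
    qed
  qed
qed

section \<open>Field-like Tambara functors\<close>

context group begin

lemma orbit_gmap_surj:
  assumes K: "subgroup K G" and L: "subgroup L G" and f: "f \<in> gmap G (orbit_gset G K) (orbit_gset G L)"
  shows "f ` pts (orbit_gset G K) = pts (orbit_gset G L)"
proof
  show "f ` pts (orbit_gset G K) \<subseteq> pts (orbit_gset G L)" using gmapD(1)[OF f] by auto
  show "pts (orbit_gset G L) \<subseteq> f ` pts (orbit_gset G K)"
  proof
    fix q assume "q \<in> pts (orbit_gset G L)"
    then obtain b where b: "b \<in> carrier G" "q = Coset (b <# L)" by (auto simp: orbit_pts)
    obtain a where a: "a \<in> carrier G" "f (Coset K) = Coset (a <# L)"
      using gmapD(1)[OF f orbit_base_in[OF K]] by (auto simp: orbit_pts)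
    have "f (act (orbit_gset G K) (b \<otimes> inv a) (Coset K)) = q"
      using gmapD(3)[OF f _ orbit_base_in[OF K], of "b \<otimes> inv a"] a b by (simp add: orbit_act[OF L] m_assoc)
    moreover have "act (orbit_gset G K) (b \<otimes> inv a) (Coset K) \<in> pts (orbit_gset G K)"
      using a b by (simp add: orbit_act_base[OF K] orbit_point_in)
    ultimately show "q \<in> f ` pts (orbit_gset G K)" by blast
  qed
qed

end

lemma (in ideal) finsum_in_ideal:
  assumes "finite A" "\<And>a. a \<in> A \<Longrightarrow> f a \<in> I" shows "finsum R f A \<in> I"
  using assms
proof (induction A)
  case (insert a A)
  then have "finsum R f (insert a A) = f a \<oplus> finsum R f A" using Icarr by (intro finsum_insert) auto
  then show ?case using insert by simp
qed simp

lemma (in cring) finprod_in_ideal: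
  assumes I: "ideal I R" and "finite A" "a \<in> A" "f a \<in> I" "\<And>a. a \<in> A \<Longrightarrow> f a \<in> carrier R" shows "finprod R f A \<in> I"
proof -
  have "finprod R f (insert a (A - {a})) = f a \<otimes> finprod R f (A - {a})" using assms by (intro finprod_insert) auto
  moreover have "insert a (A - {a}) = A" using assms(3) by auto
  moreover have "finprod R f (A - {a}) \<in> carrier R" using assms(5) by (intro finprod_closed) auto
  ultimately show ?thesis using ideal.I_r_closed[OF I assms(4)] by simp
qed

locale tambara_field = tambara G k for G :: "('g,'m) monoid_scheme" (structure) and k :: "('g,'r) bfunctor" +
  assumes field_like: "field_like G k"
begin

text \<open>
  The largest Tambara ideal whose value at G/e is contained in J.
\<close>

definition spread :: "'r set \<Rightarrow> 'g set \<Rightarrow> 'r set" where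
  "spread J K = {x \<in> ob k (orbit_gset G K). \<forall>p\<in>pts (orbit_gset G K). ev (orbit_gset G K) x p \<in> J}"

lemma spread_ideal:
  assumes J: "ideal J F" and K: "subgroup K G"
  shows "ideal (spread J K) (level G k (orbit_gset G K))"
proof -
  let ?O = "orbit_gset G K"
  note FK = fin_orbit[OF K]
  interpret L: cring "level G k ?O" by (rule level_cring[OF FK])
  interpret F: cring F by (rule F_cring)
  interpret J: ideal J F by (rule J)
  have h: "ring_hom_cring (level G k ?O) F (\<lambda>x. ev ?O x p)" if "p \<in> pts ?O" for p
    by unfold_locales (rule ev_ring_hom[OF FK that])
  note r = ev_ring_hom[OF FK]
  note h = ring_hom_mult[OF r] ring_hom_add[OF r] ring_hom_cring.hom_a_inv[OF h] ring_hom_cring.hom_zero[OF h] ring_hom_closed[OF r]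
  have s: "spread J K = {x \<in> carrier (level G k ?O). \<forall>p\<in>pts ?O. ev ?O x p \<in> J}" by (simp add: spread_def)
  show ?thesis unfolding s
  proof (rule idealI[OF L.ring_axioms])
    show "subgroup {x \<in> carrier (level G k ?O). \<forall>p\<in>pts ?O. ev ?O x p \<in> J} (add_monoid (level G k ?O))"
    proof (rule L.add.subgroupI)
      have "\<zero>\<^bsub>level G k ?O\<^esub> \<in> {x \<in> carrier (level G k ?O). \<forall>p\<in>pts ?O. ev ?O x p \<in> J}"
        using L.zero_closed by (simp add: h(4) J.zero_closed)
      then show "{x \<in> carrier (level G k ?O). \<forall>p\<in>pts ?O. ev ?O x p \<in> J} \<noteq> {}" by blast
      fix a b assume ab: "a \<in> {x \<in> carrier (level G k ?O). \<forall>p\<in>pts ?O. ev ?O x p \<in> J}" "b \<in> {x \<in> carrier (level G k ?O). \<forall>p\<in>pts ?O. ev ?O x p \<in> J}"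
      have "ev ?O (a \<oplus>\<^bsub>level G k ?O\<^esub> b) p \<in> J" if p: "p \<in> pts ?O" for p
        using ring_hom_add[OF ev_ring_hom[OF FK p], of a b] ab p additive_subgroup.a_closed[OF ideal.axioms(1)[OF J]] by (simp del: nm.M_carrier tr.M_carrier)
      then show "a \<oplus>\<^bsub>level G k ?O\<^esub> b \<in> {x \<in> carrier (level G k ?O). \<forall>p\<in>pts ?O. ev ?O x p \<in> J}"
        using ab L.a_closed by blast
    qed (simp_all del: nm.M_carrier tr.M_carrier add: h L.a_inv_closed additive_subgroup.a_inv_closed[OF ideal.axioms(1)[OF J]])
  qed (simp_all del: nm.M_carrier tr.M_carrier add: h J.I_l_closed J.I_r_closed)
qed

lemma spread_tambara_ideal:
  assumes J: "ideal J F" shows "tambara_ideal G k (spread J)"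
  unfolding tambara_ideal_def
proof (intro conjI allI impI ballI)
  show "ideal (spread J K) (level G k (orbit_gset G K))" if "subgroup K G" for K by (rule spread_ideal[OF J that])
  interpret F: cring F by (rule F_cring)
  interpret J: ideal J F by (rule J)
  fix K L f assume K: "subgroup K G" and L: "subgroup L G" and f: "f \<in> gmap G (orbit_gset G K) (orbit_gset G L)"
  note FK = fin_orbit[OF K] and FL = fin_orbit[OF L]
  show "R (orbit_gset G K) (orbit_gset G L) f ` spread J L \<subseteq> spread J K"
    using ops_closed(1)[OF FK FL f] ev_R[OF FK FL f] gmapD(1)[OF f] by (auto simp: spread_def)
  have fib: "finite {p \<in> pts (orbit_gset G K). f p = q}" for q using finite_gsetD(1)[OF is_group FK] by simp
  have "N (orbit_gset G K) (orbit_gset G L) f x \<in> spread J L" if x: "x \<in> spread J K" for x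
  proof -
    have xo: "x \<in> ob k (orbit_gset G K)" and xJ: "\<And>p. p \<in> pts (orbit_gset G K) \<Longrightarrow> ev (orbit_gset G K) x p \<in> J"
      using x by (auto simp: spread_def)
    have "ev (orbit_gset G L) (N (orbit_gset G K) (orbit_gset G L) f x) q \<in> J" if q: "q \<in> pts (orbit_gset G L)" for q
    proof -
      have "q \<in> f ` pts (orbit_gset G K)" using orbit_gmap_surj[OF K L f] q by simp
      then obtain p where p: "p \<in> pts (orbit_gset G K)" "f p = q" by auto
      show ?thesis unfolding nm.ev_op[OF FK FL f xo q]
        by (rule F.finprod_in_ideal[OF J fib, of p]) (use p xJ J.Icarr in auto)
    qed
    then show ?thesis using ops_closed(2)[OF FK FL f xo] by (simp add: spread_def)
  qed
  then show "N (orbit_gset G K) (orbit_gset G L) f ` spread J K \<subseteq> spread J L" by auto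
  have "T (orbit_gset G K) (orbit_gset G L) f x \<in> spread J L" if x: "x \<in> spread J K" for x
  proof -
    have xo: "x \<in> ob k (orbit_gset G K)" and xJ: "\<And>p. p \<in> pts (orbit_gset G K) \<Longrightarrow> ev (orbit_gset G K) x p \<in> J"
      using x by (auto simp: spread_def)
    have "ev (orbit_gset G L) (T (orbit_gset G K) (orbit_gset G L) f x) q \<in> J" if q: "q \<in> pts (orbit_gset G L)" for q
      unfolding tr.ev_op[OF FK FL f xo q] finsum_def[symmetric] by (rule J.finsum_in_ideal[OF fib]) (use xJ in auto)
    then show ?thesis using ops_closed(3)[OF FK FL f xo] by (simp add: spread_def)
  qed
  then show "T (orbit_gset G K) (orbit_gset G L) f ` spread J K \<subseteq> spread J L" by auto
qed

text \<open>
  If 1 = 0 held at G/e, then taking norms from G/e to G/K would give 1 = 0 at every orbit, since norms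
  along surjections preserve 0; then every value of k would be a singleton.
\<close>

lemma F_nonzero: "\<one>\<^bsub>F\<^esub> \<noteq> \<zero>\<^bsub>F\<^esub>"
proof
  assume F0: "\<one>\<^bsub>F\<^esub> = \<zero>\<^bsub>F\<^esub>"
  have "\<forall>x\<in>ob k X. \<forall>y\<in>ob k X. x = y" if "Fin X" for X
    using finite_group that
  proof (induction X rule: gset_induct)
    case empty
    then show ?case using empty_ob by auto
  next
    case (orbit K)
    interpret L: cring "level G k (orbit_gset G K)" by (rule level_cring[OF fin_orbit[OF orbit]])
    note m = point_map[OF fin_orbit[OF orbit] orbit_base_in[OF orbit]]
    have "\<one>\<^bsub>level G k (orbit_gset G K)\<^esub> = \<zero>\<^bsub>level G k (orbit_gset G K)\<^esub>"
      using N_one[OF fin_Ge fin_orbit[OF orbit] m] N_zero[OF fin_Ge fin_orbit[OF orbit] m orbit_gmap_surj[OF trivial_subgroup orbit m]] F0 by simp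
    then show ?case using L.one_zeroD by simp
  next
    case (sum X Y)
    then show ?case using sum_eqI[OF sum(1,2)] ops_closed(1)[OF sum(1) _ inl_map[OF sum(1)]] ops_closed(1)[OF sum(2) _ inr_map[OF sum(2)]]
      by (metis fin_sum)
  next
    case (iso X Y i)
    show ?case
    proof (intro ballI)
      fix x y assume x: "x \<in> ob k Y" and y: "y \<in> ob k Y"
      have "R X Y i x = R X Y i y" using iso ops_closed(1)[OF iso(1-3)] x y by blast
      moreover have "z = N X Y i (R X Y i z)" if "z \<in> ob k Y" for z
        using nm.op_iso[OF iso(2,1,2) id_map[OF iso(2)] iso(3,3,4) _ that] nm.op_id[OF iso(2) that] gmapD(1)[OF iso(3)] by simp
      ultimately show "x = y" using x y by metis
    qed
  qed
  moreover obtain X where X: "Fin X" "ob k X \<noteq> {\<zero>\<^bsub>level G k X\<^esub>}" using field_like by (auto simp: field_like_def)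
  moreover have "\<zero>\<^bsub>level G k X\<^esub> \<in> ob k X" using cring.cring_simprules(2)[OF level_cring[OF X(1)]] by simp
  ultimately show False by blast
qed

lemma spread_trivial: "spread J {\<one>} = {x \<in> ob k Ge. \<forall>g\<in>carrier G. gact g x \<in> J}"
  by (auto simp: spread_def orbit_pts gact_def)

text \<open>
  For a G-stable ideal J the value of spread J at G/e is J itself.
\<close>

lemma F_simple:
  assumes J: "ideal J F" and inv: "\<And>g x. g \<in> carrier G \<Longrightarrow> x \<in> J \<Longrightarrow> gact g x \<in> J" and one: "\<one>\<^bsub>F\<^esub> \<notin> J"
  shows "J = {\<zero>\<^bsub>F\<^esub>}"
proof -
  interpret F: cring F by (rule F_cring)
  interpret J: ideal J F by (rule J)
  have s: "spread J {\<one>} = J" unfolding spread_trivial using inv gact_one J.Icarr by auto (metis one_closed)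
  have "(\<forall>K. subgroup K G \<longrightarrow> spread J K = {\<zero>\<^bsub>level G k (orbit_gset G K)\<^esub>}) \<or> (\<forall>K. subgroup K G \<longrightarrow> spread J K = ob k (orbit_gset G K))"
    using field_like spread_tambara_ideal[OF J] by (simp add: field_like_def)
  then show ?thesis using s one trivial_subgroup F.one_closed by auto
qed

text \<open>
  The elements with vanishing values form the Tambara ideal of J = 0; it cannot be everything
  because F is not zero.
\<close>

lemma ev_kernel:
  assumes K: "subgroup K G" and x: "x \<in> ob k (orbit_gset G K)"
    and z: "\<And>p. p \<in> pts (orbit_gset G K) \<Longrightarrow> ev (orbit_gset G K) x p = \<zero>\<^bsub>F\<^esub>"
  shows "x = \<zero>\<^bsub>level G k (orbit_gset G K)\<^esub>"
proof -
  interpret F: cring F by (rule F_cring)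
  have "(\<forall>K. subgroup K G \<longrightarrow> spread {\<zero>\<^bsub>F\<^esub>} K = {\<zero>\<^bsub>level G k (orbit_gset G K)\<^esub>}) \<or> (\<forall>K. subgroup K G \<longrightarrow> spread {\<zero>\<^bsub>F\<^esub>} K = ob k (orbit_gset G K))"
    using field_like spread_tambara_ideal[OF F.zeroideal] by (simp add: field_like_def)
  moreover have "\<one>\<^bsub>F\<^esub> \<notin> spread {\<zero>\<^bsub>F\<^esub>} {\<one>}" "\<one>\<^bsub>F\<^esub> \<in> ob k Ge"
    using F.one_closed F_nonzero gact_one[of "\<one>\<^bsub>F\<^esub>"] by (auto simp: spread_trivial intro!: bexI[of _ \<one>])
  moreover have "x \<in> spread {\<zero>\<^bsub>F\<^esub>} K" using x z by (simp add: spread_def)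
  ultimately show ?thesis using K trivial_subgroup by blast
qed

text \<open>
  By decomposition into orbits. On G/K an equivariant function is determined by its value at the coset
  K, which may be any element of Fsub K.
\<close>

lemma ev_bijective:
  assumes X: "Fin X" and \<phi>: "\<And>p. p \<in> pts X \<Longrightarrow> \<phi> p \<in> Fsub (stab G X p)"
    "\<And>g p. g \<in> carrier G \<Longrightarrow> p \<in> pts X \<Longrightarrow> \<phi> (act X g p) = gact g (\<phi> p)"
  shows "\<exists>!x. x \<in> ob k X \<and> (\<forall>p\<in>pts X. ev X x p = \<phi> p)"
  using finite_group X \<phi>
proof (induction X arbitrary: \<phi> rule: gset_induct)
  case empty
  then show ?case using empty_ob by auto
next
  case (orbit K)
  let ?O = "orbit_gset G K"
  note FK = fin_orbit[OF orbit(1)]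
  interpret L: cring "level G k ?O" by (rule level_cring[OF FK])
  interpret F: cring F by (rule F_cring)
  have "\<phi> (Coset K) \<in> Fsub K" using orbit(2)[OF orbit_base_in[OF orbit(1)]] stab_orbit_base[OF orbit(1)] by simp
  then obtain x where x: "x \<in> ob k ?O" "\<phi> (Coset K) = ev ?O x (Coset K)" using FsubE[OF orbit(1)] by blast
  have ex: "ev ?O x p = \<phi> p" if p: "p \<in> pts ?O" for p
  proof -
    obtain a where "a \<in> carrier G" "p = act ?O a (Coset K)" using p orbit_act_base[OF orbit(1)] by (auto simp: orbit_pts)
    then show ?thesis using ev_act[OF FK orbit_base_in[OF orbit(1)] x(1)] orbit(3)[OF _ orbit_base_in[OF orbit(1)]] x(2) by simp
  qed
  have un: "y = x" if y: "y \<in> ob k ?O" "\<And>p. p \<in> pts ?O \<Longrightarrow> ev ?O y p = \<phi> p" for y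
  proof -
    have yx: "y \<in> carrier (level G k ?O)" "x \<in> carrier (level G k ?O)" using y x by auto
    have "ev ?O (y \<ominus>\<^bsub>level G k ?O\<^esub> x) p = \<zero>\<^bsub>F\<^esub>" if p: "p \<in> pts ?O" for p
    proof -
      interpret h: ring_hom_cring "level G k ?O" F "\<lambda>x. ev ?O x p" by unfold_locales (rule ev_ring_hom[OF FK p])
      show ?thesis using h.hom_add[OF yx(1) L.a_inv_closed[OF yx(2)]] h.hom_a_inv[OF yx(2)] ex[OF p] y(2)[OF p]
        F.r_neg[OF h.hom_closed[OF yx(2)]] by (simp add: L.minus_eq)
    qed
    from ev_kernel[OF orbit(1) _ this] have "y \<ominus>\<^bsub>level G k ?O\<^esub> x = \<zero>\<^bsub>level G k ?O\<^esub>" using L.minus_closed[OF yx] by simp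
    then have "y \<oplus>\<^bsub>level G k ?O\<^esub> \<ominus>\<^bsub>level G k ?O\<^esub> x = \<zero>\<^bsub>level G k ?O\<^esub>" by (simp add: L.minus_eq)
    from L.minus_equality[OF this L.a_inv_closed[OF yx(2)] yx(1)] show ?thesis using L.minus_minus[OF yx(2)] by simp
  qed
  show ?case
  proof (rule ex1I[of _ x])
    show "x \<in> ob k ?O \<and> (\<forall>p\<in>pts ?O. ev ?O x p = \<phi> p)" using x(1) ex by blast
    show "y = x" if "y \<in> ob k ?O \<and> (\<forall>p\<in>pts ?O. ev ?O y p = \<phi> p)" for y using that by (intro un) blast+
  qed
next
  case (sum X Y)
  note il = inl_map[OF sum(1), of Y] and ir = inr_map[OF sum(2), of X]
  have stl: "stab G (sum_gset X Y) (InL p) = stab G X p" if "p \<in> pts X" for p using that by (auto simp: stab_def sum_simps)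
  have str: "stab G (sum_gset X Y) (InR p) = stab G Y p" if "p \<in> pts Y" for p using that by (auto simp: stab_def sum_simps)
  have "\<phi> (InL p) \<in> Fsub (stab G X p)" if "p \<in> pts X" for p
    using sum(5)[of "InL p"] stl[OF that] that by (simp add: sum_simps)
  moreover have "\<phi> (InL (act X g p)) = gact g (\<phi> (InL p))" if "g \<in> carrier G" "p \<in> pts X" for g p
    using sum(6)[OF that(1), of "InL p"] that by (simp add: sum_simps)
  ultimately have "\<exists>!x. x \<in> ob k X \<and> (\<forall>p\<in>pts X. ev X x p = \<phi> (InL p))"
    by (rule sum(3))
  then obtain a where a: "a \<in> ob k X" "\<forall>p\<in>pts X. ev X a p = \<phi> (InL p)" and ua: "\<And>x. x \<in> ob k X \<Longrightarrow> \<forall>p\<in>pts X. ev X x p = \<phi> (InL p) \<Longrightarrow> x = a"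
    by blast
  have "\<phi> (InR p) \<in> Fsub (stab G Y p)" if "p \<in> pts Y" for p
    using sum(5)[of "InR p"] str[OF that] that by (simp add: sum_simps)
  moreover have "\<phi> (InR (act Y g p)) = gact g (\<phi> (InR p))" if "g \<in> carrier G" "p \<in> pts Y" for g p
    using sum(6)[OF that(1), of "InR p"] that by (simp add: sum_simps)
  ultimately have "\<exists>!x. x \<in> ob k Y \<and> (\<forall>p\<in>pts Y. ev Y x p = \<phi> (InR p))"
    by (rule sum(4))
  then obtain b where b: "b \<in> ob k Y" "\<forall>p\<in>pts Y. ev Y b p = \<phi> (InR p)" and ub: "\<And>x. x \<in> ob k Y \<Longrightarrow> \<forall>p\<in>pts Y. ev Y x p = \<phi> (InR p) \<Longrightarrow> x = b"
    by blast
  note p = pair_components[OF sum(1,2) a(1) b(1)]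
  have el: "ev X (R X (sum_gset X Y) (inl_map X) w) p = ev (sum_gset X Y) w (InL p)" if "p \<in> pts X" "w \<in> ob k (sum_gset X Y)" for w p
    using ev_R[OF sum(1) _ il that] sum(1,2) that by simp
  have er: "ev Y (R Y (sum_gset X Y) (inr_map Y) w) p = ev (sum_gset X Y) w (InR p)" if "p \<in> pts Y" "w \<in> ob k (sum_gset X Y)" for w p
    using ev_R[OF sum(2) _ ir that] sum(1,2) that by simp
  show ?case
  proof (rule ex1I[of _ "pair X Y a b"])
    show "pair X Y a b \<in> ob k (sum_gset X Y) \<and> (\<forall>q\<in>pts (sum_gset X Y). ev (sum_gset X Y) (pair X Y a b) q = \<phi> q)"
      using p a(2) b(2) el[OF _ p(1)] er[OF _ p(1)] by (auto simp: sum_simps)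
    fix w assume w: "w \<in> ob k (sum_gset X Y) \<and> (\<forall>q\<in>pts (sum_gset X Y). ev (sum_gset X Y) w q = \<phi> q)"
    have "R X (sum_gset X Y) (inl_map X) w = a" using w el sum(1,2) ops_closed(1)[OF sum(1) _ il] by (intro ua) (auto simp: sum_simps)
    moreover have "R Y (sum_gset X Y) (inr_map Y) w = b" using w er sum(1,2) ops_closed(1)[OF sum(2) _ ir] by (intro ub) (auto simp: sum_simps)
    ultimately show "w = pair X Y a b" using p(2,3) by (intro sum_eqI[OF sum(1,2) conjunct1[OF w] p(1)]) simp_all
  qed
next
  case (iso X Y i)
  note i = iso(3,4)
  have st: "stab G Y (i p) = stab G X p" if p: "p \<in> pts X" for p
  proof -
    have "act Y g (i p) = i p \<longleftrightarrow> act X g p = p" if "g \<in> carrier G" for g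
      using gmapD(3)[OF i(1) that p] i(2) p finite_gsetD(2)[OF is_group iso(1) that p] by (auto simp: bij_betw_def inj_on_def)
    then show ?thesis by (auto simp: stab_def)
  qed
  have sur: "\<exists>p\<in>pts X. q = i p" if "q \<in> pts Y" for q using i(2) that by (auto simp: bij_betw_def)
  have "\<exists>!x. x \<in> ob k X \<and> (\<forall>p\<in>pts X. ev X x p = \<phi> (i p))"
    by (rule iso(5)) (use iso(6)[OF gmapD(1)[OF i(1)]] iso(7)[OF _ gmapD(1)[OF i(1)]] st gmapD(3)[OF i(1)] in auto)
  then obtain a where a: "a \<in> ob k X" "\<And>p. p\<in>pts X \<Longrightarrow> ev X a p = \<phi> (i p)"
     and ua: "\<And>x. x \<in> ob k X \<Longrightarrow> \<forall>p\<in>pts X. ev X x p = \<phi> (i p) \<Longrightarrow> x = a" by blast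
  \<comment> \<open>along an isomorphism, the norm inverts the restriction\<close>
  have NR: "N X Y i (R X Y i z) = z" if "z \<in> ob k Y" for z
    using nm.op_iso[OF iso(2,1,2) id_map[OF iso(2)] iso(3,3,4) _ that] nm.op_id[OF iso(2) that] gmapD(1)[OF iso(3)] by simp
  interpret F: cring F by (rule F_cring)
  show ?case
  proof (rule ex1I[of _ "N X Y i a"])
    have "ev Y (N X Y i a) q = \<phi> q" if q: "q \<in> pts Y" for q
    proof -
      obtain p where p: "p \<in> pts X" "q = i p" using sur[OF q] by blast
      have "{u \<in> pts X. i u = q} = {p}" using p i(2) by (auto simp: bij_betw_def inj_on_def)
      then show ?thesis unfolding nm.ev_op[OF iso(1,2) i(1) a(1) q] using a(2)[OF p(1)] ev_closed[OF iso(1) p(1) a(1)] p(2) by simp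
    qed
    then show "N X Y i a \<in> ob k Y \<and> (\<forall>q\<in>pts Y. ev Y (N X Y i a) q = \<phi> q)" using ops_closed(2)[OF iso(1,2) i(1) a(1)] by blast
    fix w assume w: "w \<in> ob k Y \<and> (\<forall>q\<in>pts Y. ev Y w q = \<phi> q)"
    have "R X Y i w = a" using w ops_closed(1)[OF iso(1,2) i(1)] ev_R[OF iso(1,2) i(1)] gmapD(1)[OF i(1)] by (intro ua) auto
    then show "w = N X Y i a" using NR w by force
  qed
qed

end

section \<open>Bispans acting on ring-valued functions\<close>

lemma (in comm_monoid) finprod_Sigma:
  assumes "finite A" "\<And>a. a \<in> A \<Longrightarrow> finite (B a)" "\<And>a b. a \<in> A \<Longrightarrow> b \<in> B a \<Longrightarrow> g a b \<in> carrier G"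
  shows "finprod G (\<lambda>(a,b). g a b) (Sigma A B) = finprod G (\<lambda>a. finprod G (g a) (B a)) A"
proof -
  have "Sigma A B = (\<Union>a\<in>A. Pair a ` B a)" by auto
  then have "finprod G (\<lambda>(a,b). g a b) (Sigma A B) = finprod G (\<lambda>a. finprod G (\<lambda>(a,b). g a b) (Pair a ` B a)) A"
    using assms by (simp only:) (rule finprod_UN_disjoint, auto simp: pairwise_def disjnt_def)
  also have "\<dots> = finprod G (\<lambda>a. finprod G (g a) (B a)) A"
  proof (rule finprod_cong'[OF refl])
    fix a assume a: "a \<in> A"
    have "finprod G (\<lambda>(a,b). g a b) (Pair a ` B a) = finprod G (\<lambda>b. (\<lambda>(a,b). g a b) (a, b)) (B a)"
      by (rule finprod_reindex) (use assms a in \<open>auto simp: inj_on_def\<close>)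
    then show "finprod G (\<lambda>(a,b). g a b) (Pair a ` B a) = finprod G (g a) (B a)" by simp
  qed (use assms in \<open>auto intro!: finprod_closed\<close>)
  finally show ?thesis .
qed

lemma (in abelian_monoid) finsum_Sigma:
  assumes "finite A" "\<And>a. a \<in> A \<Longrightarrow> finite (B a)" "\<And>a b. a \<in> A \<Longrightarrow> b \<in> B a \<Longrightarrow> g a b \<in> carrier G"
  shows "finsum G (\<lambda>(a,b). g a b) (Sigma A B) = finsum G (\<lambda>a. finsum G (g a) (B a)) A"
  using add.finprod_Sigma[of A B g] assms by (simp add: finsum_def)

text \<open>
  Expansion of a product of sums, with one summand for each choice of a term in every factor. It is the
  shadow of the dependent product in the composition of bispans.
\<close>

lemma (in cring) finprod_finsum_distrib:
  assumes "finite C" "\<And>c. c \<in> C \<Longrightarrow> finite (B c)" "\<And>c b. c \<in> C \<Longrightarrow> b \<in> B c \<Longrightarrow> f c b \<in> carrier R"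
  shows "finprod R (\<lambda>c. finsum R (f c) (B c)) C = finsum R (\<lambda>s. finprod R (\<lambda>c. f c (s c)) C) (Pi\<^sub>E C B)"
  using assms
proof (induction C)
  case empty
  then show ?case by simp
next
  case (insert x C)
  let ?P = "Pi\<^sub>E C B"
  have P: "finite ?P" using insert by (intro finite_PiE) auto
  have fx: "f x b \<in> carrier R" if "b \<in> B x" for b using insert that by auto
  have fs: "finprod R (\<lambda>c. f c (s c)) C \<in> carrier R" if "s \<in> ?P" for s
    using insert that by (intro finprod_closed) (auto simp: PiE_def Pi_def)
  have Bx: "finite (B x)" using insert by auto
  have sx: "finsum R (f x) (B x) \<in> carrier R" using fx by (intro finsum_closed) auto
  have "finprod R (\<lambda>c. finsum R (f c) (B c)) (insert x C) = finsum R (f x) (B x) \<otimes> finprod R (\<lambda>c. finsum R (f c) (B c)) C"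
    using insert sx by (intro finprod_insert) (auto intro!: finsum_closed)
  also have "\<dots> = finsum R (f x) (B x) \<otimes> finsum R (\<lambda>s. finprod R (\<lambda>c. f c (s c)) C) ?P"
    using insert by simp
  also have "\<dots> = finsum R (\<lambda>b. f x b \<otimes> finsum R (\<lambda>s. finprod R (\<lambda>c. f c (s c)) C) ?P) (B x)"
    by (rule finsum_ldistr[OF Bx]) (use fx fs in \<open>auto intro!: finsum_closed\<close>)
  also have "\<dots> = finsum R (\<lambda>b. finsum R (\<lambda>s. f x b \<otimes> finprod R (\<lambda>c. f c (s c)) C) ?P) (B x)"
    by (rule finsum_cong'[OF refl]) (use fx fs P in \<open>auto intro!: finsum_closed finsum_rdistr\<close>)
  also have "\<dots> = finsum R (\<lambda>(b, s). f x b \<otimes> finprod R (\<lambda>c. f c (s c)) C) (B x \<times> ?P)"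
    by (rule finsum_Sigma[symmetric]) (use fx fs P Bx in auto)
  also have "\<dots> = finsum R (\<lambda>u. finprod R (\<lambda>c. f c ((\<lambda>(b, s). s(x := b)) u c)) (insert x C)) (B x \<times> ?P)"
  proof (rule finsum_cong'[OF refl])
    fix u assume "u \<in> B x \<times> ?P"
    then obtain b s where u: "u = (b, s)" "b \<in> B x" "s \<in> ?P" by auto
    have "finprod R (\<lambda>c. f c ((s(x := b)) c)) (insert x C) = f x b \<otimes> finprod R (\<lambda>c. f c ((s(x := b)) c)) C"
      using insert u(2,3) by (subst finprod_insert) (auto simp: PiE_def Pi_def)
    also have "finprod R (\<lambda>c. f c ((s(x := b)) c)) C = finprod R (\<lambda>c. f c (s c)) C"
      using insert u(3) by (intro finprod_cong') (auto simp: PiE_def Pi_def)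
    finally show "(\<lambda>(b, s). f x b \<otimes> finprod R (\<lambda>c. f c (s c)) C) u = finprod R (\<lambda>c. f c ((\<lambda>(b, s). s(x := b)) u c)) (insert x C)"
      by (simp add: u(1))
  next
    show "(\<lambda>u. finprod R (\<lambda>c. f c ((\<lambda>(b, s). s(x := b)) u c)) (insert x C)) \<in> B x \<times> ?P \<rightarrow> carrier R"
      using insert by (auto intro!: finprod_closed simp: PiE_def Pi_def split: if_splits)
  qed
  also have "\<dots> = finsum R (\<lambda>s. finprod R (\<lambda>c. f c (s c)) (insert x C)) ((\<lambda>(b, s). s(x := b)) ` (B x \<times> ?P))"
  proof (rule finsum_reindex[symmetric])
    show "inj_on (\<lambda>(b, s). s(x := b)) (B x \<times> ?P)" using inj_combinator[OF insert.hyps(2), of B] .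
    show "(\<lambda>s. finprod R (\<lambda>c. f c (s c)) (insert x C)) \<in> (\<lambda>(b, s). s(x := b)) ` (B x \<times> ?P) \<rightarrow> carrier R"
      using insert by (auto intro!: finprod_closed simp: PiE_def Pi_def split: if_splits)
  qed
  also have "(\<lambda>(b, s). s(x := b)) ` (B x \<times> ?P) = Pi\<^sub>E (insert x C) B" by (simp add: PiE_insert_eq)
  finally show ?case .
qed

text \<open>
  The action of a bispan on functions with values in a commutative ring: pull back to the left inner
  set, multiply over the fibres of the middle map, and sum over the fibres of the last map.
\<close>

definition bispan_eval :: "('r,'z) ring_scheme \<Rightarrow> ('g,'a,'b) bispan \<Rightarrow> ('g point \<Rightarrow> 'r) \<Rightarrow> 'g point \<Rightarrow> 'r" where
  "bispan_eval L S \<phi> = (\<lambda>y\<in>pts (tgt S). finsum L (\<lambda>b. finprod L (\<lambda>a. \<phi> (rleg S a))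
     {a\<in>pts (lmid S). nleg S a = b}) {b\<in>pts (rmid S). tleg S b = y})"

context cring begin

lemma bispan_prod_closed:
  assumes "is_bispan G S" "\<phi> \<in> pts (src S) \<rightarrow> carrier R"
  shows "finprod R (\<lambda>a. \<phi> (rleg S a)) {a\<in>pts (lmid S). nleg S a = b} \<in> carrier R"
  using bispan_rules(5)[OF assms(1)] assms(2) by (intro finprod_closed) auto

lemma bispan_eval_closed:
  assumes "is_bispan G S" "\<phi> \<in> pts (src S) \<rightarrow> carrier R" "y \<in> pts (tgt S)"
  shows "bispan_eval R S \<phi> y \<in> carrier R"
  using bispan_prod_closed[OF assms(1,2)] assms(3) by (auto simp: bispan_eval_def intro!: finsum_closed)

lemma bispan_eval_iso:
  assumes G: "group G" and S: "is_bispan G S" and S': "is_bispan G S'" and i: "bispan_iso G S S'" and \<phi>: "\<phi> \<in> pts (src S) \<rightarrow> carrier R"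
  shows "bispan_eval R S \<phi> = bispan_eval R S' \<phi>"
proof -
  obtain \<alpha> \<beta> \<alpha>' \<beta>' where i: "bispan_maps_inverse G S S' \<alpha> \<beta> \<alpha>' \<beta>'" by (rule bispan_isoE[OF G S i])
  then have m: "bispan_map G S S' \<alpha> \<beta>" "bispan_map G S' S \<alpha>' \<beta>'"
    and inv: "\<And>a. a\<in>pts (lmid S) \<Longrightarrow> \<alpha>' (\<alpha> a) = a" "\<And>a. a\<in>pts (lmid S') \<Longrightarrow> \<alpha> (\<alpha>' a) = a"
    "\<And>a. a\<in>pts (rmid S) \<Longrightarrow> \<beta>' (\<beta> a) = a" "\<And>a. a\<in>pts (rmid S') \<Longrightarrow> \<beta> (\<beta>' a) = a"
    by (auto simp: bispan_maps_inverse_def)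
  note d = bispan_map_D[OF m(1)] and d' = bispan_map_D[OF m(2)]
  note s = bispan_rules[OF S] and s' = bispan_rules[OF S']
  have \<phi>': "\<phi> \<in> pts (src S') \<rightarrow> carrier R" using \<phi> d(1) by simp
  have 1: "{b\<in>pts (rmid S'). tleg S' b = y} = \<beta> ` {b\<in>pts (rmid S). tleg S b = y}" for y
  proof (intro Set.set_eqI iffI)
    fix b assume "b \<in> {b\<in>pts (rmid S'). tleg S' b = y}"
    then show "b \<in> \<beta> ` {b\<in>pts (rmid S). tleg S b = y}" using inv(4)[of b] d'(4,7)[of b] by (intro image_eqI[of _ _ "\<beta>' b"]) auto
  qed (use d in auto)
  have 2: "{a\<in>pts (lmid S'). nleg S' a = \<beta> b} = \<alpha> ` {a\<in>pts (lmid S). nleg S a = b}" if b: "b \<in> pts (rmid S)" for b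
  proof (intro Set.set_eqI iffI)
    fix a assume "a \<in> {a\<in>pts (lmid S'). nleg S' a = \<beta> b}"
    then show "a \<in> \<alpha> ` {a\<in>pts (lmid S). nleg S a = b}" using inv(2)[of a] inv(3)[OF b] d'(3,6)[of a] by (intro image_eqI[of _ _ "\<alpha>' a"]) auto
  qed (use d in auto)
  have i1: "inj_on \<beta> {b\<in>pts (rmid S). tleg S b = y}" for y using inv(3) by (auto intro!: inj_on_inverseI[of _ \<beta>'])
  have i2: "inj_on \<alpha> {b\<in>pts (lmid S). nleg S b = y}" for y using inv(1) by (auto intro!: inj_on_inverseI[of _ \<alpha>'])
  have 3: "finprod R (\<lambda>a. \<phi> (rleg S' a)) {a\<in>pts (lmid S'). nleg S' a = \<beta> b} = finprod R (\<lambda>a. \<phi> (rleg S a)) {a\<in>pts (lmid S). nleg S a = b}"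
    if b: "b \<in> pts (rmid S)" for b
  proof -
    have "finprod R (\<lambda>a. \<phi> (rleg S' a)) (\<alpha> ` {a\<in>pts (lmid S). nleg S a = b}) = finprod R (\<lambda>a. \<phi> (rleg S' (\<alpha> a))) {a\<in>pts (lmid S). nleg S a = b}"
      by (rule finprod_reindex[OF _ i2]) (use \<phi>' s'(5) d(3) in auto)
    also have "\<dots> = finprod R (\<lambda>a. \<phi> (rleg S a)) {a\<in>pts (lmid S). nleg S a = b}"
      by (rule finprod_cong') (use \<phi> s(5) d(5) in auto)
    finally show ?thesis unfolding 2[OF b] .
  qed
  have "finsum R (\<lambda>b. finprod R (\<lambda>a. \<phi> (rleg S' a)) {a\<in>pts (lmid S'). nleg S' a = b}) {b\<in>pts (rmid S'). tleg S' b = y}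
     = finsum R (\<lambda>b. finprod R (\<lambda>a. \<phi> (rleg S a)) {a\<in>pts (lmid S). nleg S a = b}) {b\<in>pts (rmid S). tleg S b = y}" for y
  proof -
    have "finsum R (\<lambda>b. finprod R (\<lambda>a. \<phi> (rleg S' a)) {a\<in>pts (lmid S'). nleg S' a = b}) (\<beta> ` {b\<in>pts (rmid S). tleg S b = y})
      = finsum R (\<lambda>b. finprod R (\<lambda>a. \<phi> (rleg S' a)) {a\<in>pts (lmid S'). nleg S' a = \<beta> b}) {b\<in>pts (rmid S). tleg S b = y}"
      by (rule finsum_reindex[OF _ i1]) (use bispan_prod_closed[OF S' \<phi>'] in auto)
    also have "\<dots> = finsum R (\<lambda>b. finprod R (\<lambda>a. \<phi> (rleg S a)) {a\<in>pts (lmid S). nleg S a = b}) {b\<in>pts (rmid S). tleg S b = y}"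
      by (rule finsum_cong') (use bispan_prod_closed[OF S \<phi>] 3 in auto)
    finally show ?thesis unfolding 1 .
  qed
  then show ?thesis using d(2) by (simp add: bispan_eval_def)
qed

text \<open>
  Over a point d of rmid Q, the right side is a product of sums; expanding it, the summands
  are indexed by the sections that make up the fibre of the composite over d.
\<close>

lemma bispan_eval_comp:
  fixes P :: "('g,'c,'d) bispan" and Q :: "('g,'e,'f) bispan"
  assumes G: "group G" and P: "is_bispan G P" and Q: "is_bispan G Q" and T: "tgt P = src Q" and \<phi>: "\<phi> \<in> pts (src P) \<rightarrow> carrier R"
  shows "bispan_eval R (bispan_comp G Q P) \<phi> = bispan_eval R Q (bispan_eval R P \<phi>)"
proof -
  let ?C = "bispan_comp G Q P"
  have C: "is_bispan G ?C" by (rule comp_is_bispan[OF G P Q T])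
  note p = bispan_rules[OF P] and q = bispan_rules[OF Q]
  have fin: "finite (pts (lmid P))" "finite (pts (rmid P))" "finite (pts (lmid Q))" "finite (pts (rmid Q))"
    using finite_gsetD(1)[OF G] p(1,2) q(1,2) by auto
  define A where "A b = finprod R (\<lambda>a. \<phi> (rleg P a)) {a\<in>pts (lmid P). nleg P a = b}" for b
  have A: "A b \<in> carrier R" for b unfolding A_def by (rule bispan_prod_closed[OF P \<phi>])
  define Cd where "Cd d = {c\<in>pts (lmid Q). nleg Q c = d}" for d
  define B where "B c = {u. fst u \<in> pts (rmid P) \<and> tleg P (fst u) = rleg Q c \<and> snd u = c}" for c
  have fC: "finite (Cd d)" for d using fin by (simp add: Cd_def)
  have fB: "finite (B c)" for c by (rule finite_subset[of _ "pts (rmid P) \<times> {c}"]) (use fin in \<open>auto simp: B_def\<close>)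
  have E: "(d,s) \<in> pts (rmid ?C) \<longleftrightarrow> d \<in> pts (rmid Q) \<and> s \<in> Pi\<^sub>E (Cd d) B" for d s
    unfolding comp_right_iff Cd_def B_def by (auto simp: PiE_def Pi_def)
  have prod: "finprod R (\<lambda>w. \<phi> (rleg ?C w)) {w\<in>pts (lmid ?C). nleg ?C w = (d,s)} = finprod R (\<lambda>c. A (fst (s c))) (Cd d)"
    if d: "d \<in> pts (rmid Q)" and s: "s \<in> Pi\<^sub>E (Cd d) B" for d s
  proof -
    \<comment> \<open>a point of the composite over (d, s) amounts to a point c over d and a point a over s c\<close>
    let ?k = "\<lambda>(c,a). ((a, nleg P a, c), (c, (d,s)))"
    let ?A = "\<lambda>c. {a\<in>pts (lmid P). nleg P a = fst (s c)}"
    have sB: "s c \<in> B c" if "c \<in> Cd d" for c using s that by auto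
    have eqw: "{w\<in>pts (lmid ?C). nleg ?C w = (d,s)} = ?k ` (Sigma (Cd d) ?A)"
    proof (intro Set.set_eqI iffI)
      fix w assume w: "w \<in> {w\<in>pts (lmid ?C). nleg ?C w = (d,s)}"
      obtain a b c c' e where e: "w = ((a,b,c),(c',e))" by (metis prod.exhaust)
      have wC: "w \<in> pts (lmid ?C)" and "e = (d,s)" using w comp_legs(4)[of w G Q P] by (auto simp: e)
      then have *: "a\<in>pts(lmid P)" "nleg P a = b" "c'\<in>pts(lmid Q)" "nleg Q c' = d" "(b,c) = s c'"
        using wC[unfolded e comp_lmid_iff] by auto
      then have c': "c' \<in> Cd d" by (simp add: Cd_def)
      have "snd (s c') = c'" using sB[OF c'] by (simp add: B_def)
      then have "c = c'" "b = fst (s c')" using *(5) by (metis snd_conv, metis fst_conv)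
      then show "w \<in> ?k ` (Sigma (Cd d) ?A)" using * c' e \<open>e = (d,s)\<close> by (intro image_eqI[of _ _ "(c',a)"]) auto
    next
      fix w assume "w \<in> ?k ` (Sigma (Cd d) ?A)"
      then obtain c a where w: "w = ((a, nleg P a, c), (c, (d,s)))" "c \<in> Cd d" "a \<in> pts (lmid P)" "nleg P a = fst (s c)" by auto
      have "w \<in> pts (lmid ?C)" unfolding w(1) comp_lmid_iff E
        using w(2-4) sB[OF w(2)] d s p(3) by (auto simp: Cd_def B_def prod_eq_iff)
      then show "w \<in> {w\<in>pts (lmid ?C). nleg ?C w = (d,s)}" by (simp add: comp_legs(4)) (simp add: w(1))
    qed
    have "finprod R (\<lambda>w. \<phi> (rleg ?C w)) {w\<in>pts (lmid ?C). nleg ?C w = (d,s)} = finprod R (\<lambda>w. \<phi> (rleg P (fst (fst w)))) {w\<in>pts (lmid ?C). nleg ?C w = (d,s)}"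
      by (rule finprod_cong') (use \<phi> p(5) in \<open>auto simp: comp_legs(3) comp_lmid\<close>)
    also have "\<dots> = finprod R (\<lambda>u. \<phi> (rleg P (fst (fst (?k u))))) (Sigma (Cd d) ?A)"
      unfolding eqw by (rule finprod_reindex) (use \<phi> p(5) in \<open>auto simp: inj_on_def\<close>)
    also have "\<dots> = finprod R (\<lambda>(c,a). \<phi> (rleg P a)) (Sigma (Cd d) ?A)"
      by (rule finprod_cong') (use \<phi> p(5) in auto)
    also have "\<dots> = finprod R (\<lambda>c. A (fst (s c))) (Cd d)"
      unfolding A_def by (rule finprod_Sigma) (use \<phi> p(5) fC fin in auto)
    finally show ?thesis .
  qed
  have "bispan_eval R ?C \<phi> z = bispan_eval R Q (bispan_eval R P \<phi>) z" if z: "z \<in> pts (tgt Q)" for z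
  proof -
    let ?D = "{d\<in>pts (rmid Q). tleg Q d = z}"
    have D: "finite ?D" using fin by simp
    have eqE: "{e\<in>pts (rmid ?C). tleg ?C e = z} = Sigma ?D (\<lambda>d. Pi\<^sub>E (Cd d) B)"
      by (auto simp: E comp_legs(5))
    have fP: "finite (Pi\<^sub>E (Cd d) B)" for d using fC fB by (intro finite_PiE) auto
    have "bispan_eval R ?C \<phi> z = finsum R (\<lambda>e. finprod R (\<lambda>w. \<phi> (rleg ?C w)) {w\<in>pts (lmid ?C). nleg ?C w = e}) (Sigma ?D (\<lambda>d. Pi\<^sub>E (Cd d) B))"
      using z by (simp add: bispan_eval_def comp_legs eqE[symmetric])
    also have "\<dots> = finsum R (\<lambda>(d,s). finprod R (\<lambda>c. A (fst (s c))) (Cd d)) (Sigma ?D (\<lambda>d. Pi\<^sub>E (Cd d) B))"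
      by (rule finsum_cong') (use prod A in \<open>auto intro!: finprod_closed\<close>)
    also have "\<dots> = finsum R (\<lambda>d. finsum R (\<lambda>s. finprod R (\<lambda>c. A (fst (s c))) (Cd d)) (Pi\<^sub>E (Cd d) B)) ?D"
      by (rule finsum_Sigma[OF D fP]) (use A in \<open>auto intro!: finprod_closed\<close>)
    also have "\<dots> = finsum R (\<lambda>d. finprod R (\<lambda>c. bispan_eval R P \<phi> (rleg Q c)) (Cd d)) ?D"
    proof (rule finsum_cong'[OF refl])
      show "(\<lambda>d. finprod R (\<lambda>c. bispan_eval R P \<phi> (rleg Q c)) (Cd d)) \<in> ?D \<rightarrow> carrier R"
        using bispan_eval_closed[OF P \<phi>] q(5) T by (auto simp: Cd_def intro!: finprod_closed)
      fix d assume "d \<in> ?D"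
      have "finsum R (\<lambda>s. finprod R (\<lambda>c. A (fst (s c))) (Cd d)) (Pi\<^sub>E (Cd d) B) = finprod R (\<lambda>c. finsum R (\<lambda>u. A (fst u)) (B c)) (Cd d)"
        by (rule finprod_finsum_distrib[symmetric, OF fC fB]) (use A in auto)
      also have "\<dots> = finprod R (\<lambda>c. bispan_eval R P \<phi> (rleg Q c)) (Cd d)"
      proof (rule finprod_cong'[OF refl])
        show "(\<lambda>c. bispan_eval R P \<phi> (rleg Q c)) \<in> Cd d \<rightarrow> carrier R"
          using bispan_eval_closed[OF P \<phi>] q(5) T by (auto simp: Cd_def)
        fix c assume c: "c \<in> Cd d"
        have rc: "rleg Q c \<in> pts (tgt P)" using c q(5) T by (simp add: Cd_def)
        have "B c = (\<lambda>b. (b,c)) ` {b\<in>pts (rmid P). tleg P b = rleg Q c}" by (auto simp: B_def)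
        then have "finsum R (\<lambda>u. A (fst u)) (B c) = finsum R (\<lambda>b. A (fst (b, c))) {b\<in>pts (rmid P). tleg P b = rleg Q c}"
          by (simp only:) (rule finsum_reindex, use A in \<open>auto simp: inj_on_def\<close>)
        then show "finsum R (\<lambda>u. A (fst u)) (B c) = bispan_eval R P \<phi> (rleg Q c)" using rc by (simp add: bispan_eval_def A_def)
      qed
      finally show "finsum R (\<lambda>s. finprod R (\<lambda>c. A (fst (s c))) (Cd d)) (Pi\<^sub>E (Cd d) B) = finprod R (\<lambda>c. bispan_eval R P \<phi> (rleg Q c)) (Cd d)" .
    qed
    also have "\<dots> = bispan_eval R Q (bispan_eval R P \<phi>) z" using z by (simp add: bispan_eval_def[of R Q] Cd_def)
    finally show ?thesis .
  qed
  then show ?thesis by (auto simp: bispan_eval_def comp_legs fun_eq_iff)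
qed

lemma bispan_eval_res:
  assumes "\<phi> \<in> pts Y \<rightarrow> carrier R" "f \<in> gmap G X Y"
  shows "bispan_eval R (res_bispan X Y f) \<phi> = (\<lambda>x\<in>pts X. \<phi> (f x))"
proof -
  have s: "{b \<in> pts X. gset_id X b = y} = {y}" if "y \<in> pts X" for y using that by (auto simp: gset_id_def)
  have "finsum R (\<lambda>b. finprod R (\<lambda>a. \<phi> (f a)) {a\<in>pts X. gset_id X a = b}) {b\<in>pts X. gset_id X b = x} = \<phi> (f x)" if "x \<in> pts X" for x
    using assms(1) gmapD(1)[OF assms(2) that] that by (simp add: s Pi_def)
  then show ?thesis by (auto simp: bispan_eval_def res_bispan_def)
qed

lemma bispan_eval_norm:
  assumes \<phi>: "\<phi> \<in> pts X \<rightarrow> carrier R"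
  shows "bispan_eval R (norm_bispan X Y f) \<phi> = (\<lambda>y\<in>pts Y. finprod R \<phi> {x \<in> pts X. f x = y})"
proof -
  have s: "{b \<in> pts Y. gset_id Y b = y} = {y}" if "y \<in> pts Y" for y using that by (auto simp: gset_id_def)
  have "finprod R (\<lambda>a. \<phi> (gset_id X a)) {a\<in>pts X. f a = y} = finprod R \<phi> {x \<in> pts X. f x = y}" for y
    using \<phi> by (intro finprod_cong') auto
  moreover have "finprod R \<phi> {x \<in> pts X. f x = y} \<in> carrier R" for y using \<phi> by (intro finprod_closed) auto
  ultimately show ?thesis by (auto simp: bispan_eval_def norm_bispan_def s)
qed

lemma bispan_eval_tr:
  assumes \<phi>: "\<phi> \<in> pts X \<rightarrow> carrier R"
  shows "bispan_eval R (tr_bispan X Y f) \<phi> = (\<lambda>y\<in>pts Y. finsum R \<phi> {x \<in> pts X. f x = y})"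
proof -
  have s: "{b \<in> pts X. gset_id X b = y} = {y}" if "y \<in> pts X" for y using that by (auto simp: gset_id_def)
  have "finsum R (\<lambda>b. finprod R (\<lambda>a. \<phi> (gset_id X a)) {a\<in>pts X. gset_id X a = b}) {b\<in>pts X. f b = y} = finsum R \<phi> {x \<in> pts X. f x = y}" for y
  proof (rule finsum_cong'[OF refl])
    fix b assume b: "b \<in> {b\<in>pts X. f b = y}"
    then have "\<phi> b \<in> carrier R" using \<phi> by auto
    then show "finprod R (\<lambda>a. \<phi> (gset_id X a)) {a\<in>pts X. gset_id X a = b} = \<phi> b" using b by (simp add: s)
  qed (use \<phi> in auto)
  then show ?thesis by (auto simp: bispan_eval_def tr_bispan_def)
qed

end

section \<open>Tambara functors of equivariant functions\<close>

lemma restrict_subgroup_gset: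
  assumes G: "group G" and K: "subgroup K G" and X: "finite_gset G X"
  shows "finite_gset (sub_group G K) X"
  using finite_gsetD[OF G X] subgroup.mem_carrier[OF K] unfolding finite_gset_iff[OF subgroup.subgroup_is_group[OF K G]]
  by (auto simp: PiE_def)

lemma stable_part_finite_gset:
  assumes G: "group G" and K: "subgroup K G" and X: "finite_gset G X"
    and U: "\<And>g x. g \<in> K \<Longrightarrow> x \<in> pts X \<Longrightarrow> x \<in> U \<Longrightarrow> act X g x \<in> U"
  shows "finite_gset (sub_group G K) (restrict_gset X U)"
  by (rule restrict_finite_gset[OF subgroup.subgroup_is_group[OF K G] restrict_subgroup_gset[OF G K X]]) (use U in auto)

text \<open>
  A ring L with an action of G and, for each subgroup K, a set of elements that may occur as values
  at points with stabilizer K. The two closure conditions on sums and products over K-sets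
  express closedness under all transfers and norms at once. The maps enc inject the L-valued functions
  on the G-set X into a type of values, because all values of a Tambara functor are elements of one type.
\<close>

locale subring_system = group G + L: cring L
  for G :: "('g,'m) monoid_scheme" (structure) and L :: "('r,'z) ring_scheme" +
  fixes \<rho> :: "'g \<Rightarrow> 'r \<Rightarrow> 'r" and sub :: "'g set \<Rightarrow> 'r set" and enc :: "'g objct \<Rightarrow> ('g point \<Rightarrow> 'r) \<Rightarrow> 's"
  assumes finite_group: "finite (carrier G)"
    and \<rho>_hom: "g \<in> carrier G \<Longrightarrow> \<rho> g \<in> ring_hom L L"
    and \<rho>_one: "x \<in> carrier L \<Longrightarrow> \<rho> \<one> x = x"
    and \<rho>_mult: "\<lbrakk>g \<in> carrier G; h \<in> carrier G; x \<in> carrier L\<rbrakk> \<Longrightarrow> \<rho> (g \<otimes> h) x = \<rho> g (\<rho> h x)"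
    and sub_mono: "\<lbrakk>subgroup K G; subgroup J G; J \<subseteq> K\<rbrakk> \<Longrightarrow> sub K \<subseteq> sub J"
    and sub_trivial: "sub {\<one>} = carrier L"
    and sub_neg: "\<lbrakk>subgroup K G; x \<in> sub K\<rbrakk> \<Longrightarrow> \<ominus>\<^bsub>L\<^esub> x \<in> sub K"
    and sub_finprod: "\<lbrakk>subgroup K G; finite_gset (sub_group G K) (Z :: 'g objct);
      \<And>g z. g \<in> K \<Longrightarrow> z \<in> pts Z \<Longrightarrow> \<phi> (act Z g z) = \<rho> g (\<phi> z);
      \<And>z. z \<in> pts Z \<Longrightarrow> \<phi> z \<in> sub (stab (sub_group G K) Z z)\<rbrakk> \<Longrightarrow> finprod L \<phi> (pts Z) \<in> sub K"
    and sub_finsum: "\<lbrakk>subgroup K G; finite_gset (sub_group G K) (Z :: 'g objct);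
      \<And>g z. g \<in> K \<Longrightarrow> z \<in> pts Z \<Longrightarrow> \<phi> (act Z g z) = \<rho> g (\<phi> z);
      \<And>z. z \<in> pts Z \<Longrightarrow> \<phi> z \<in> sub (stab (sub_group G K) Z z)\<rbrakk> \<Longrightarrow> finsum L \<phi> (pts Z) \<in> sub K"
    and enc_inj: "finite (pts X) \<Longrightarrow> inj_on (enc X) (pts X \<rightarrow>\<^sub>E carrier L)"
begin

abbreviation "Fin \<equiv> finite_gset G"

definition eqfun :: "'g objct \<Rightarrow> ('g point \<Rightarrow> 'r) set" where
  "eqfun X = {\<phi> \<in> pts X \<rightarrow>\<^sub>E carrier L. (\<forall>p\<in>pts X. \<phi> p \<in> sub (stab G X p)) \<and>
     (\<forall>g\<in>carrier G. \<forall>p\<in>pts X. \<phi> (act X g p) = \<rho> g (\<phi> p))}"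

lemma eqfunD:
  assumes "\<phi> \<in> eqfun X"
  shows "\<phi> \<in> pts X \<rightarrow>\<^sub>E carrier L" "\<phi> \<in> pts X \<rightarrow> carrier L" "\<And>p. p \<in> pts X \<Longrightarrow> \<phi> p \<in> carrier L" "\<And>p. p \<in> pts X \<Longrightarrow> \<phi> p \<in> sub (stab G X p)"
    "\<And>g p. g \<in> carrier G \<Longrightarrow> p \<in> pts X \<Longrightarrow> \<phi> (act X g p) = \<rho> g (\<phi> p)"
  using assms by (auto simp: eqfun_def PiE_def)

lemma eqfun_eqI: "\<phi> \<in> eqfun X \<Longrightarrow> \<psi> \<in> eqfun X \<Longrightarrow> (\<And>p. p \<in> pts X \<Longrightarrow> \<phi> p = \<psi> p) \<Longrightarrow> \<phi> = \<psi>"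
  by (rule extensionalityI[of _ "pts X"]) (auto simp: eqfun_def PiE_def)

lemma enc_inj_eqfun: "Fin X \<Longrightarrow> inj_on (enc X) (eqfun X)"
  by (rule inj_on_subset[OF enc_inj[OF finite_gsetD(1)[OF is_group]]]) (auto simp: eqfun_def)

lemma \<rho>_cring_hom: "g \<in> carrier G \<Longrightarrow> ring_hom_cring L L (\<rho> g)"
  by unfold_locales (rule \<rho>_hom)

lemma act_inj: "Fin X \<Longrightarrow> g \<in> carrier G \<Longrightarrow> U \<subseteq> pts X \<Longrightarrow> inj_on (act X g) U"
  by (rule inj_on_inverseI[of _ "act X (inv g)"]) (use finite_gsetD(5)[OF is_group, of X] in auto)

lemma fibre_act:
  assumes X: "Fin X" and Y: "Fin Y" and f: "f \<in> gmap G X Y" and g: "g \<in> carrier G" and y: "y \<in> pts Y"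
  shows "{x\<in>pts X. f x = act Y g y} = act X g ` {x\<in>pts X. f x = y}"
proof (intro Set.set_eqI iffI)
  fix x assume x: "x \<in> {x\<in>pts X. f x = act Y g y}"
  then have "f (act X (inv g) x) = y" using gmapD(3)[OF f, of "inv g" x] finite_gsetD(5)[OF is_group Y g y] g by simp
  then show "x \<in> act X g ` {x\<in>pts X. f x = y}"
    using x finite_gsetD(2)[OF is_group X, of "inv g" x] finite_gsetD(6)[OF is_group X g, of x] g by (intro image_eqI[of _ _ "act X (inv g) x"]) auto
qed (use gmapD(3)[OF f g] finite_gsetD(2)[OF is_group X g] in auto)

text \<open>
  The stabilizer of y acts on the fibre over y, with the same point stabilizers as in the whole G-set.
\<close>

lemma fibre_gset:
  assumes X: "Fin X" and Y: "Fin Y" and f: "f \<in> gmap G X Y" and y: "y \<in> pts Y"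
  shows "finite_gset (sub_group G (stab G Y y)) (restrict_gset X {x. f x = y})"
    "pts (restrict_gset X {x. f x = y}) = {x\<in>pts X. f x = y}"
    "\<And>g x. x \<in> pts X \<Longrightarrow> f x = y \<Longrightarrow> act (restrict_gset X {x. f x = y}) g x = act X g x"
    "\<And>x. x \<in> pts X \<Longrightarrow> f x = y \<Longrightarrow> stab (sub_group G (stab G Y y)) (restrict_gset X {x. f x = y}) x = stab G X x"
proof -
  show "finite_gset (sub_group G (stab G Y y)) (restrict_gset X {x. f x = y})"
    by (rule stable_part_finite_gset[OF is_group stab_subgroup[OF Y y] X]) (use gmapD(3)[OF f] in \<open>auto simp: stab_def\<close>)
  show "pts (restrict_gset X {x. f x = y}) = {x\<in>pts X. f x = y}" by (auto simp: restrict_gset_def)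
  show a: "\<And>g x. x \<in> pts X \<Longrightarrow> f x = y \<Longrightarrow> act (restrict_gset X {x. f x = y}) g x = act X g x" by (simp add: restrict_gset_def)
  fix x assume x: "x \<in> pts X" "f x = y"
  then show "stab (sub_group G (stab G Y y)) (restrict_gset X {x. f x = y}) x = stab G X x"
  proof -
    have "act Y g y = y" if "g \<in> carrier G" "act X g x = x" for g
      using gmapD(3)[OF f that(1) x(1)] that(2) x(2) by simp
    then show ?thesis using x by (auto simp: stab_def a)
  qed
qed

lemma stab_gmap: "f \<in> gmap G X Y \<Longrightarrow> x \<in> pts X \<Longrightarrow> stab G X x \<subseteq> stab G Y (f x)"
  using gmapD(3)[of f G X Y] by (auto simp: stab_def) metis

lemma eqfun_res:
  assumes X: "Fin X" and Y: "Fin Y" and f: "f \<in> gmap G X Y" and \<phi>: "\<phi> \<in> eqfun Y"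
  shows "(\<lambda>x\<in>pts X. \<phi> (f x)) \<in> eqfun X"
proof -
  note s = eqfunD[OF \<phi>] and fD = gmapD[OF f]
  have "\<phi> (f p) \<in> sub (stab G X p)" if p: "p \<in> pts X" for p
    using sub_mono[OF stab_subgroup[OF Y fD(1)[OF p]] stab_subgroup[OF X p] stab_gmap[OF f p]] s(4)[OF fD(1)[OF p]] by blast
  then show ?thesis using s(3,5) fD(1,3) finite_gsetD(2)[OF is_group X] unfolding eqfun_def by simp
qed

lemma eqfun_norm:
  assumes X: "Fin X" and Y: "Fin Y" and f: "f \<in> gmap G X Y" and \<phi>: "\<phi> \<in> eqfun X"
  shows "(\<lambda>y\<in>pts Y. finprod L \<phi> {x\<in>pts X. f x = y}) \<in> eqfun Y"
proof -
  note s = eqfunD[OF \<phi>]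
  have c: "finprod L \<phi> {x\<in>pts X. f x = y} \<in> carrier L" for y using s(3) by (intro L.finprod_closed) auto
  have v: "finprod L \<phi> {x\<in>pts X. f x = y} \<in> sub (stab G Y y)" if y: "y \<in> pts Y" for y
    using sub_finprod[OF stab_subgroup[OF Y y] fibre_gset(1)[OF X Y f y], of \<phi>] fibre_gset(2-4)[OF X Y f y] s(4,5)
    by (auto simp: stab_def[of G Y])
  have e: "finprod L \<phi> {x\<in>pts X. f x = act Y g y} = \<rho> g (finprod L \<phi> {x\<in>pts X. f x = y})" if g: "g \<in> carrier G" and y: "y \<in> pts Y" for g y
  proof -
    have "finprod L \<phi> {x\<in>pts X. f x = act Y g y} = finprod L (\<lambda>x. \<phi> (act X g x)) {x\<in>pts X. f x = y}"
      unfolding fibre_act[OF X Y f g y] by (rule L.finprod_reindex) (use s(3) finite_gsetD(2)[OF is_group X g] act_inj[OF X g] in auto)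
    also have "\<dots> = finprod L (\<rho> g \<circ> \<phi>) {x\<in>pts X. f x = y}"
      by (rule L.finprod_cong') (use s(3,5) g ring_hom_closed[OF \<rho>_hom[OF g]] in auto)
    also have "\<dots> = \<rho> g (finprod L \<phi> {x\<in>pts X. f x = y})"
      by (rule ring_hom_cring.hom_finprod[OF \<rho>_cring_hom[OF g], symmetric]) (use s(3) in auto)
    finally show ?thesis .
  qed
  show ?thesis using c v e finite_gsetD(2)[OF is_group Y] unfolding eqfun_def by simp
qed

lemma eqfun_tr:
  assumes X: "Fin X" and Y: "Fin Y" and f: "f \<in> gmap G X Y" and \<phi>: "\<phi> \<in> eqfun X"
  shows "(\<lambda>y\<in>pts Y. finsum L \<phi> {x\<in>pts X. f x = y}) \<in> eqfun Y"
proof -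
  note s = eqfunD[OF \<phi>]
  have c: "finsum L \<phi> {x\<in>pts X. f x = y} \<in> carrier L" for y using s(3) by (intro L.finsum_closed) auto
  have v: "finsum L \<phi> {x\<in>pts X. f x = y} \<in> sub (stab G Y y)" if y: "y \<in> pts Y" for y
    using sub_finsum[OF stab_subgroup[OF Y y] fibre_gset(1)[OF X Y f y], of \<phi>] fibre_gset(2-4)[OF X Y f y] s(4,5)
    by (auto simp: stab_def[of G Y])
  have e: "finsum L \<phi> {x\<in>pts X. f x = act Y g y} = \<rho> g (finsum L \<phi> {x\<in>pts X. f x = y})" if g: "g \<in> carrier G" and y: "y \<in> pts Y" for g y
  proof -
    have "finsum L \<phi> {x\<in>pts X. f x = act Y g y} = finsum L (\<lambda>x. \<phi> (act X g x)) {x\<in>pts X. f x = y}"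
      unfolding fibre_act[OF X Y f g y] by (rule L.finsum_reindex) (use s(3) finite_gsetD(2)[OF is_group X g] act_inj[OF X g] in auto)
    also have "\<dots> = finsum L (\<rho> g \<circ> \<phi>) {x\<in>pts X. f x = y}"
      by (rule L.finsum_cong') (use s(3,5) g ring_hom_closed[OF \<rho>_hom[OF g]] in auto)
    also have "\<dots> = \<rho> g (finsum L \<phi> {x\<in>pts X. f x = y})"
      by (rule ring_hom_cring.hom_finsum[OF \<rho>_cring_hom[OF g], symmetric]) (use s(3) in auto)
    finally show ?thesis .
  qed
  show ?thesis using c v e finite_gsetD(2)[OF is_group Y] unfolding eqfun_def by simp
qed

lemma eqfun_eval:
  fixes S :: "('g,'g point,'g point) bispan"
  assumes S: "is_bispan G S" and \<phi>: "\<phi> \<in> eqfun (src S)"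
  shows "bispan_eval L S \<phi> \<in> eqfun (tgt S)"
proof -
  have s: "Fin (src S)" "Fin (lmid S)" "Fin (rmid S)" "Fin (tgt S)"
    "rleg S \<in> gmap G (lmid S) (src S)" "nleg S \<in> gmap G (lmid S) (rmid S)" "tleg S \<in> gmap G (rmid S) (tgt S)"
    using S by (auto simp: is_bispan_def)
  note 1 = eqfun_res[OF s(2,1,5) \<phi>]
  note 2 = eqfun_norm[OF s(2,3,6) 1] and 3 = eqfun_tr[OF s(3,4,7) eqfun_norm[OF s(2,3,6) 1]]
  have "finprod L (\<lambda>x\<in>pts (lmid S). \<phi> (rleg S x)) {x \<in> pts (lmid S). nleg S x = b} = finprod L (\<lambda>x. \<phi> (rleg S x)) {x \<in> pts (lmid S). nleg S x = b}" for b
    by (rule L.finprod_cong') (use eqfunD(3)[OF \<phi>] gmapD(1)[OF s(5)] in auto)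
  note e = this
  have "finsum L (\<lambda>y\<in>pts (rmid S). finprod L (\<lambda>x\<in>pts (lmid S). \<phi> (rleg S x)) {x \<in> pts (lmid S). nleg S x = y}) {x \<in> pts (rmid S). tleg S x = y}
    = finsum L (\<lambda>b. finprod L (\<lambda>a. \<phi> (rleg S a)) {a \<in> pts (lmid S). nleg S a = b}) {b \<in> pts (rmid S). tleg S b = y}" for y
    by (rule L.finsum_cong') (use L.bispan_prod_closed[OF S eqfunD(2)[OF \<phi>]] e in auto)
  then show ?thesis using 3 by (simp add: bispan_eval_def)
qed

text \<open>
  A morphism is a class of bispans; any representative may be used, since the action
  of a bispan on functions depends only on its class (bispan_eval_iso).
\<close>

definition fixed_functor :: "('g,'s) bfunctor" where
  "fixed_functor = \<lparr>ob = \<lambda>X. enc X ` eqfun X,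
     ar = (\<lambda>c. let S = (SOME S. S \<in> c) in
       (\<lambda>r\<in>enc (src S) ` eqfun (src S). enc (tgt S) (bispan_eval L S (inv_into (eqfun (src S)) (enc (src S)) r))))\<rparr>"

lemma ob_fixed: "ob fixed_functor X = enc X ` eqfun X"
  by (simp add: fixed_functor_def)

lemma ar_fixed:
  assumes S: "is_bispan G (S :: ('g,'g point,'g point) bispan)"
  shows "ar fixed_functor (bispan_class G S) \<in> extensional (enc (src S) ` eqfun (src S))"
    "\<phi> \<in> eqfun (src S) \<Longrightarrow> ar fixed_functor (bispan_class G S) (enc (src S) \<phi>) = enc (tgt S) (bispan_eval L S \<phi>)"
proof -
  define S' where "S' = (SOME S'. S' \<in> bispan_class G S)"
  have "S' \<in> bispan_class G S" unfolding S'_def using someI[of "\<lambda>T. T \<in> bispan_class G S" S] bispan_class_self[OF is_group S] by simp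
  then have S': "is_bispan G S'" "bispan_iso G S' S" by (auto simp: bispan_class_def)
  then have st: "src S' = src S" "tgt S' = tgt S" by (auto simp: bispan_iso_def)
  have X: "Fin (src S)" using S by (simp add: is_bispan_def)
  have ar: "ar fixed_functor (bispan_class G S) = (\<lambda>r\<in>enc (src S) ` eqfun (src S). enc (tgt S) (bispan_eval L S' (inv_into (eqfun (src S)) (enc (src S)) r)))"
    unfolding fixed_functor_def by (simp add: S'_def[symmetric] st Let_def)
  show "ar fixed_functor (bispan_class G S) \<in> extensional (enc (src S) ` eqfun (src S))" unfolding ar by simp
  show "ar fixed_functor (bispan_class G S) (enc (src S) \<phi>) = enc (tgt S) (bispan_eval L S \<phi>)" if \<phi>: "\<phi> \<in> eqfun (src S)"
    unfolding ar using \<phi> L.bispan_eval_iso[OF is_group S'(1) S S'(2), of \<phi>] eqfunD(2)[OF \<phi>] inv_into_f_f[OF enc_inj_eqfun[OF X] \<phi>] by (simp add: st)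
qed

lemma hom_rep:
  assumes "c \<in> bispan_hom G X Y"
  obtains S :: "('g,'g point,'g point) bispan" where "is_bispan G S" "src S = X" "tgt S = Y" "c = bispan_class G S" "Fin X" "Fin Y"
  using assms by (auto simp: bispan_hom_def is_bispan_def)

lemma fixed_bispan_functor: "bispan_functor G fixed_functor"
  unfolding bispan_functor_def
proof (intro conjI allI impI ballI)
  fix X Y c assume "c \<in> bispan_hom G X Y"
  then obtain S :: "('g,'g point,'g point) bispan" where S: "is_bispan G S" "src S = X" "tgt S = Y" "c = bispan_class G S"
    by (rule hom_rep)
  show "ar fixed_functor c \<in> ob fixed_functor X \<rightarrow>\<^sub>E ob fixed_functor Y"
    using ar_fixed[OF S(1)] eqfun_eval[OF S(1)] unfolding S(2-4) by (auto simp: PiE_def ob_fixed)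
next
  fix X :: "'g objct" assume X: "Fin X"
  let ?I = "res_bispan X X (gset_id X)"
  have I: "is_bispan G ?I" by (rule is_bispan_res[OF is_group X X gset_id_gmap[OF is_group X]])
  note a = ar_fixed[OF I]
  have "bispan_eval L ?I \<phi> = \<phi>" if \<phi>: "\<phi> \<in> eqfun X" for \<phi>
    using L.bispan_eval_res[OF eqfunD(2)[OF \<phi>] gset_id_gmap[OF is_group X]] eqfunD(1)[OF \<phi>]
    by (auto simp: PiE_def extensional_def fun_eq_iff)
  then have "ar fixed_functor (mor_id G X) x = x" if "x \<in> enc X ` eqfun X" for x
    using a(2) that by (auto simp: mor_id_def res_bispan_def)
  then show "ar fixed_functor (mor_id G X) = (\<lambda>x\<in>ob fixed_functor X. x)"
    using a(1) by (intro extensionalityI[of _ "enc X ` eqfun X"]) (auto simp: mor_id_def res_bispan_def ob_fixed)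
next
  fix X Y Z c d assume c: "c \<in> bispan_hom G X Y" and d: "d \<in> bispan_hom G Y Z"
  obtain P :: "('g,'g point,'g point) bispan" where P: "is_bispan G P" "src P = X" "tgt P = Y" "c = bispan_class G P"
    using c by (rule hom_rep)
  obtain Q :: "('g,'g point,'g point) bispan" where Q: "is_bispan G Q" "src Q = Y" "tgt Q = Z" "d = bispan_class G Q"
    using d by (rule hom_rep)
  have t: "tgt P = src Q" using P Q by simp
  have C: "is_bispan G (bispan_comp G Q P)" by (rule comp_is_bispan[OF is_group P(1) Q(1) t])
  obtain T :: "('g,'g point,'g point) bispan" where T: "is_bispan G T" "bispan_iso G T (bispan_comp G Q P)"
    by (rule transport_bispan[OF is_group C])
  have st: "src T = X" "tgt T = Z" using T(2) P Q by (auto simp: bispan_iso_def comp_legs)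
  have cl: "mor_comp G d c = bispan_class G T"
    unfolding P(4) Q(4) by (rule mor_comp_recognized[OF is_group P(1) Q(1) T(1) t T(2)])
  note aT = ar_fixed[OF T(1), unfolded st] and aP = ar_fixed[OF P(1), unfolded P(2,3)] and aQ = ar_fixed[OF Q(1), unfolded Q(2,3)]
  have "ar fixed_functor (mor_comp G d c) (enc X \<phi>) = ar fixed_functor d (ar fixed_functor c (enc X \<phi>))" if \<phi>: "\<phi> \<in> eqfun X" for \<phi>
  proof -
    have \<phi>': "\<phi> \<in> pts (src T) \<rightarrow> carrier L" "\<phi> \<in> pts (src P) \<rightarrow> carrier L" using eqfunD(2)[OF \<phi>] st P by auto
    have "bispan_eval L T \<phi> = bispan_eval L Q (bispan_eval L P \<phi>)"
      using L.bispan_eval_iso[OF is_group T(1) C T(2) \<phi>'(1)] L.bispan_eval_comp[OF is_group P(1) Q(1) t \<phi>'(2)] by simp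
    moreover have "bispan_eval L P \<phi> \<in> eqfun Y" using eqfun_eval[OF P(1)] P \<phi> by simp
    ultimately show ?thesis using aT(2)[OF \<phi>] aP(2)[OF \<phi>] aQ(2) unfolding cl unfolding P(4) Q(4) by simp
  qed
  then show "ar fixed_functor (mor_comp G d c) = compose (ob fixed_functor X) (ar fixed_functor d) (ar fixed_functor c)"
    using aT(1) by (intro extensionalityI[of _ "enc X ` eqfun X"]) (auto simp: cl ob_fixed compose_eq)
qed

lemma Res_fixed:
  assumes X: "Fin X" and Y: "Fin Y" and f: "f \<in> gmap G X Y" and \<phi>: "\<phi> \<in> eqfun Y"
  shows "Res G fixed_functor X Y f (enc Y \<phi>) = enc X (\<lambda>x\<in>pts X. \<phi> (f x))"
  using ar_fixed(2)[OF is_bispan_res[OF is_group X Y f]] L.bispan_eval_res[OF eqfunD(2)[OF \<phi>] f] \<phi> by (simp add: Res_def res_bispan_def)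

lemma Nm_fixed:
  assumes X: "Fin X" and Y: "Fin Y" and f: "f \<in> gmap G X Y" and \<phi>: "\<phi> \<in> eqfun X"
  shows "Nm G fixed_functor X Y f (enc X \<phi>) = enc Y (\<lambda>y\<in>pts Y. finprod L \<phi> {x \<in> pts X. f x = y})"
  using ar_fixed(2)[OF is_bispan_norm[OF is_group X Y f]] L.bispan_eval_norm[OF eqfunD(2)[OF \<phi>], of Y f] \<phi> by (simp add: Nm_def norm_bispan_def)

lemma Tr_fixed:
  assumes X: "Fin X" and Y: "Fin Y" and f: "f \<in> gmap G X Y" and \<phi>: "\<phi> \<in> eqfun X"
  shows "Tr G fixed_functor X Y f (enc X \<phi>) = enc Y (\<lambda>y\<in>pts Y. finsum L \<phi> {x \<in> pts X. f x = y})"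
  using ar_fixed(2)[OF is_bispan_tr[OF is_group X Y f]] L.bispan_eval_tr[OF eqfunD(2)[OF \<phi>], of Y f] \<phi> by (simp add: Tr_def tr_bispan_def)

definition glue :: "'g objct \<Rightarrow> 'g objct \<Rightarrow> ('g point \<Rightarrow> 'r) \<Rightarrow> ('g point \<Rightarrow> 'r) \<Rightarrow> 'g point \<Rightarrow> 'r" where
  "glue X Y \<phi> \<psi> = (\<lambda>z\<in>pts (sum_gset X Y). case z of InL x \<Rightarrow> \<phi> x | InR y \<Rightarrow> \<psi> y | Coset C \<Rightarrow> undefined)"

lemma glue_simps [simp]:
  "x \<in> pts X \<Longrightarrow> glue X Y \<phi> \<psi> (InL x) = \<phi> x" "y \<in> pts Y \<Longrightarrow> glue X Y \<phi> \<psi> (InR y) = \<psi> y"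
  by (simp_all add: glue_def sum_simps)

lemma glue_eqfun:
  assumes X: "Fin X" and Y: "Fin Y" and \<phi>: "\<phi> \<in> eqfun X" and \<psi>: "\<psi> \<in> eqfun Y"
  shows "glue X Y \<phi> \<psi> \<in> eqfun (sum_gset X Y)"
proof -
  note f = eqfunD[OF \<phi>] and p = eqfunD[OF \<psi>] and x = finite_gsetD(2)[OF is_group X] and y = finite_gsetD(2)[OF is_group Y]
  have stl: "stab G (sum_gset X Y) (InL p) = stab G X p" if "p \<in> pts X" for p using that by (auto simp: stab_def sum_simps)
  have str: "stab G (sum_gset X Y) (InR p) = stab G Y p" if "p \<in> pts Y" for p using that by (auto simp: stab_def sum_simps)
  have "glue X Y \<phi> \<psi> \<in> pts (sum_gset X Y) \<rightarrow>\<^sub>E carrier L"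
    using f(3) p(3) by (auto simp: sum_simps PiE_def Pi_def) (auto simp: glue_def sum_simps)
  then show ?thesis using f(4,5) p(4,5) x y stl str unfolding eqfun_def by (auto simp: sum_simps)
qed

lemma split_fixed:
  assumes X: "Fin X" and Y: "Fin Y" and \<chi>: "\<chi> \<in> eqfun (sum_gset X Y)"
  shows "split_map G fixed_functor X Y (enc (sum_gset X Y) \<chi>) = (enc X (\<lambda>x\<in>pts X. \<chi> (InL x)), enc Y (\<lambda>y\<in>pts Y. \<chi> (InR y)))"
  using Res_fixed[OF X sum_finite_gset[OF is_group X Y] inl_gmap[OF is_group X] \<chi>] Res_fixed[OF Y sum_finite_gset[OF is_group X Y] inr_gmap[OF is_group Y] \<chi>]
  by (simp add: split_map_def inclusion_simps cong: restrict_cong)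

lemma split_glue:
  assumes X: "Fin X" and Y: "Fin Y" and \<phi>: "\<phi> \<in> eqfun X" and \<psi>: "\<psi> \<in> eqfun Y"
  shows "split_map G fixed_functor X Y (enc (sum_gset X Y) (glue X Y \<phi> \<psi>)) = (enc X \<phi>, enc Y \<psi>)"
proof -
  have "(\<lambda>x\<in>pts X. glue X Y \<phi> \<psi> (InL x)) = \<phi>" "(\<lambda>y\<in>pts Y. glue X Y \<phi> \<psi> (InR y)) = \<psi>"
    using eqfunD(1)[OF \<phi>] eqfunD(1)[OF \<psi>] by (auto simp: PiE_def extensional_def fun_eq_iff)
  then show ?thesis using split_fixed[OF X Y glue_eqfun[OF assms]] by simp
qed

lemma split_fixed_bij:
  assumes X: "Fin X" and Y: "Fin Y"
  shows "bij_betw (split_map G fixed_functor X Y) (ob fixed_functor (sum_gset X Y)) (ob fixed_functor X \<times> ob fixed_functor Y)"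
proof -
  have in_l: "(\<lambda>x\<in>pts X. \<chi> (InL x)) \<in> eqfun X" if "\<chi> \<in> eqfun (sum_gset X Y)" for \<chi>
    using eqfun_res[OF X sum_finite_gset[OF is_group X Y] inl_gmap[OF is_group X] that] by (simp cong: restrict_cong)
  have in_r: "(\<lambda>x\<in>pts Y. \<chi> (InR x)) \<in> eqfun Y" if "\<chi> \<in> eqfun (sum_gset X Y)" for \<chi>
    using eqfun_res[OF Y sum_finite_gset[OF is_group X Y] inr_gmap[OF is_group Y] that] by (simp cong: restrict_cong)
  have "inj_on (split_map G fixed_functor X Y) (enc (sum_gset X Y) ` eqfun (sum_gset X Y))"
  proof (rule inj_onI)
    fix r r' assume "r \<in> enc (sum_gset X Y) ` eqfun (sum_gset X Y)" "r' \<in> enc (sum_gset X Y) ` eqfun (sum_gset X Y)"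
      and e: "split_map G fixed_functor X Y r = split_map G fixed_functor X Y r'"
    then obtain \<chi> \<chi>' where c: "r = enc (sum_gset X Y) \<chi>" "r' = enc (sum_gset X Y) \<chi>'" "\<chi> \<in> eqfun (sum_gset X Y)" "\<chi>' \<in> eqfun (sum_gset X Y)" by auto
    have "(\<lambda>x\<in>pts X. \<chi> (InL x)) = (\<lambda>x\<in>pts X. \<chi>' (InL x))"
      using e c split_fixed[OF X Y] by (intro inj_onD[OF enc_inj_eqfun[OF X] _ in_l[OF c(3)] in_l[OF c(4)]]) simp
    then have l: "\<chi> (InL x) = \<chi>' (InL x)" if "x \<in> pts X" for x using that by (metis restrict_apply')
    have "(\<lambda>x\<in>pts Y. \<chi> (InR x)) = (\<lambda>x\<in>pts Y. \<chi>' (InR x))"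
      using e c split_fixed[OF X Y] by (intro inj_onD[OF enc_inj_eqfun[OF Y] _ in_r[OF c(3)] in_r[OF c(4)]]) simp
    then have r: "\<chi> (InR x) = \<chi>' (InR x)" if "x \<in> pts Y" for x using that by (metis restrict_apply')
    have "\<chi> = \<chi>'" by (rule eqfun_eqI[OF c(3,4)]) (use l r in \<open>auto simp: sum_simps\<close>)
    then show "r = r'" using c by simp
  qed
  moreover have "split_map G fixed_functor X Y ` (enc (sum_gset X Y) ` eqfun (sum_gset X Y)) = enc X ` eqfun X \<times> enc Y ` eqfun Y"
  proof
    show "split_map G fixed_functor X Y ` (enc (sum_gset X Y) ` eqfun (sum_gset X Y)) \<subseteq> enc X ` eqfun X \<times> enc Y ` eqfun Y"
      using split_fixed[OF X Y] in_l in_r by auto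
    show "enc X ` eqfun X \<times> enc Y ` eqfun Y \<subseteq> split_map G fixed_functor X Y ` (enc (sum_gset X Y) ` eqfun (sum_gset X Y))"
    proof clarify
      fix \<phi> \<psi> assume "\<phi> \<in> eqfun X" "\<psi> \<in> eqfun Y"
      then show "(enc X \<phi>, enc Y \<psi>) \<in> split_map G fixed_functor X Y ` (enc (sum_gset X Y) ` eqfun (sum_gset X Y))"
        using split_glue[OF X Y] glue_eqfun[OF X Y] by (metis imageI)
    qed
  qed
  ultimately show ?thesis by (simp add: bij_betw_def ob_fixed)
qed

lemma eqfun_empty: "eqfun empty_gset = {\<lambda>_. undefined}"
  by (auto simp: eqfun_def)

lemma pair_fixed:
  assumes X: "Fin X" and \<phi>: "\<phi> \<in> eqfun X" and \<psi>: "\<psi> \<in> eqfun X"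
  shows "pair_elt G fixed_functor X (enc X \<phi>) (enc X \<psi>) = enc (sum_gset X X) (glue X X \<phi> \<psi>)"
  unfolding pair_elt_def split_glue[OF X X \<phi> \<psi>, symmetric]
  by (rule the_inv_into_f_f[OF bij_betw_imp_inj_on[OF split_fixed_bij[OF X X]]]) (use glue_eqfun[OF X X \<phi> \<psi>] in \<open>simp add: ob_fixed\<close>)

lemma fold_fibre: "y \<in> pts X \<Longrightarrow> {z \<in> pts (sum_gset X X). fold_map X z = y} = {InL y, InR y}"
  by (auto simp: sum_simps)

lemma level_add:
  assumes X: "Fin X" and \<phi>: "\<phi> \<in> eqfun X" and \<psi>: "\<psi> \<in> eqfun X"
  shows "(\<lambda>p\<in>pts X. \<phi> p \<oplus>\<^bsub>L\<^esub> \<psi> p) \<in> eqfun X"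
    "enc X \<phi> \<oplus>\<^bsub>level G fixed_functor X\<^esub> enc X \<psi> = enc X (\<lambda>p\<in>pts X. \<phi> p \<oplus>\<^bsub>L\<^esub> \<psi> p)"
proof -
  note g = glue_eqfun[OF X X \<phi> \<psi>] and f = fold_map_gmap[OF is_group X] and XX = sum_finite_gset[OF is_group X X]
  have e: "(\<lambda>y\<in>pts X. finsum L (glue X X \<phi> \<psi>) {z \<in> pts (sum_gset X X). fold_map X z = y}) = (\<lambda>p\<in>pts X. \<phi> p \<oplus>\<^bsub>L\<^esub> \<psi> p)"
    by (rule restrict_ext) (use eqfunD(3)[OF \<phi>] eqfunD(3)[OF \<psi>] in \<open>simp add: fold_fibre\<close>)
  show "(\<lambda>p\<in>pts X. \<phi> p \<oplus>\<^bsub>L\<^esub> \<psi> p) \<in> eqfun X" using eqfun_tr[OF XX X f g] by (simp only: e)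
  show "enc X \<phi> \<oplus>\<^bsub>level G fixed_functor X\<^esub> enc X \<psi> = enc X (\<lambda>p\<in>pts X. \<phi> p \<oplus>\<^bsub>L\<^esub> \<psi> p)"
    using Tr_fixed[OF XX X f g] unfolding e by (simp add: level_def pair_fixed[OF X \<phi> \<psi>])
qed

lemma level_mult:
  assumes X: "Fin X" and \<phi>: "\<phi> \<in> eqfun X" and \<psi>: "\<psi> \<in> eqfun X"
  shows "(\<lambda>p\<in>pts X. \<phi> p \<otimes>\<^bsub>L\<^esub> \<psi> p) \<in> eqfun X"
    "enc X \<phi> \<otimes>\<^bsub>level G fixed_functor X\<^esub> enc X \<psi> = enc X (\<lambda>p\<in>pts X. \<phi> p \<otimes>\<^bsub>L\<^esub> \<psi> p)"
proof -
  note g = glue_eqfun[OF X X \<phi> \<psi>] and f = fold_map_gmap[OF is_group X] and XX = sum_finite_gset[OF is_group X X]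
  have e: "(\<lambda>y\<in>pts X. finprod L (glue X X \<phi> \<psi>) {z \<in> pts (sum_gset X X). fold_map X z = y}) = (\<lambda>p\<in>pts X. \<phi> p \<otimes>\<^bsub>L\<^esub> \<psi> p)"
    by (rule restrict_ext) (use eqfunD(3)[OF \<phi>] eqfunD(3)[OF \<psi>] in \<open>simp add: fold_fibre\<close>)
  show "(\<lambda>p\<in>pts X. \<phi> p \<otimes>\<^bsub>L\<^esub> \<psi> p) \<in> eqfun X" using eqfun_norm[OF XX X f g] by (simp only: e)
  show "enc X \<phi> \<otimes>\<^bsub>level G fixed_functor X\<^esub> enc X \<psi> = enc X (\<lambda>p\<in>pts X. \<phi> p \<otimes>\<^bsub>L\<^esub> \<psi> p)"
    using Nm_fixed[OF XX X f g] unfolding e by (simp add: level_def pair_fixed[OF X \<phi> \<psi>])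
qed

lemma the_empty_fixed: "the_elem (ob fixed_functor empty_gset) = enc empty_gset (\<lambda>_. undefined)"
  by (simp add: ob_fixed eqfun_empty)

lemma level_zero:
  assumes X: "Fin X"
  shows "(\<lambda>p\<in>pts X. \<zero>\<^bsub>L\<^esub>) \<in> eqfun X" "\<zero>\<^bsub>level G fixed_functor X\<^esub> = enc X (\<lambda>p\<in>pts X. \<zero>\<^bsub>L\<^esub>)"
proof -
  have u: "(\<lambda>_. undefined) \<in> eqfun empty_gset" by (simp add: eqfun_empty)
  show "(\<lambda>p\<in>pts X. \<zero>\<^bsub>L\<^esub>) \<in> eqfun X" using eqfun_tr[OF empty_finite_gset[OF is_group] X empty_gmap u] by simp
  show "\<zero>\<^bsub>level G fixed_functor X\<^esub> = enc X (\<lambda>p\<in>pts X. \<zero>\<^bsub>L\<^esub>)"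
    using Tr_fixed[OF empty_finite_gset[OF is_group] X empty_gmap u] by (simp add: level_def the_empty_fixed)
qed

lemma level_one:
  assumes X: "Fin X"
  shows "(\<lambda>p\<in>pts X. \<one>\<^bsub>L\<^esub>) \<in> eqfun X" "\<one>\<^bsub>level G fixed_functor X\<^esub> = enc X (\<lambda>p\<in>pts X. \<one>\<^bsub>L\<^esub>)"
proof -
  have u: "(\<lambda>_. undefined) \<in> eqfun empty_gset" by (simp add: eqfun_empty)
  show "(\<lambda>p\<in>pts X. \<one>\<^bsub>L\<^esub>) \<in> eqfun X" using eqfun_norm[OF empty_finite_gset[OF is_group] X empty_gmap u] by simp
  show "\<one>\<^bsub>level G fixed_functor X\<^esub> = enc X (\<lambda>p\<in>pts X. \<one>\<^bsub>L\<^esub>)"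
    using Nm_fixed[OF empty_finite_gset[OF is_group] X empty_gmap u] by (simp add: level_def the_empty_fixed)
qed

lemma level_carrier: "carrier (level G fixed_functor X) = enc X ` eqfun X"
  by (simp add: level_def ob_fixed)

lemma eqfun_neg: 
  assumes X: "Fin X" and \<phi>: "\<phi> \<in> eqfun X" shows "(\<lambda>p\<in>pts X. \<ominus>\<^bsub>L\<^esub> \<phi> p) \<in> eqfun X"
  using eqfunD(3-5)[OF \<phi>] sub_neg[OF stab_subgroup[OF X]] finite_gsetD(2)[OF is_group X] ring_hom_cring.hom_a_inv[OF \<rho>_cring_hom]
  unfolding eqfun_def by simp

lemma level_add_group: assumes X: "Fin X" shows "group (add_monoid (level G fixed_functor X))"
proof (rule groupI; simp only: level_carrier partial_object.simps monoid.simps)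
  note a = level_add[OF X] and z = level_zero[OF X]
  show "\<zero>\<^bsub>level G fixed_functor X\<^esub> \<in> enc X ` eqfun X" using z by simp
  fix x assume x: "x \<in> enc X ` eqfun X"
  then obtain \<phi> where f: "x = enc X \<phi>" "\<phi> \<in> eqfun X" by auto
  have "(\<lambda>p\<in>pts X. (\<lambda>p\<in>pts X. \<zero>\<^bsub>L\<^esub>) p \<oplus>\<^bsub>L\<^esub> \<phi> p) = \<phi>"
    by (rule eqfun_eqI[OF a(1)[OF z(1) f(2)] f(2)]) (use eqfunD(3)[OF f(2)] in simp)
  then show "\<zero>\<^bsub>level G fixed_functor X\<^esub> \<oplus>\<^bsub>level G fixed_functor X\<^esub> x = x"
    unfolding z(2) f(1) a(2)[OF z(1) f(2)] by simp
  note n = eqfun_neg[OF X f(2)]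
  have "(\<lambda>p\<in>pts X. (\<lambda>p\<in>pts X. \<ominus>\<^bsub>L\<^esub> \<phi> p) p \<oplus>\<^bsub>L\<^esub> \<phi> p) = (\<lambda>p\<in>pts X. \<zero>\<^bsub>L\<^esub>)"
    by (rule restrict_ext) (use eqfunD(3)[OF f(2)] in \<open>simp add: L.l_neg\<close>)
  then show "\<exists>y\<in>enc X ` eqfun X. y \<oplus>\<^bsub>level G fixed_functor X\<^esub> x = \<zero>\<^bsub>level G fixed_functor X\<^esub>"
    unfolding z(2) f(1) using n a(2)[OF n f(2)] by (intro bexI[of _ "enc X (\<lambda>p\<in>pts X. \<ominus>\<^bsub>L\<^esub> \<phi> p)"]) simp_all
  fix y assume y: "y \<in> enc X ` eqfun X"
  then obtain \<psi> where g: "y = enc X \<psi>" "\<psi> \<in> eqfun X" by auto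
  note fg = a[OF f(2) g(2)]
  show "x \<oplus>\<^bsub>level G fixed_functor X\<^esub> y \<in> enc X ` eqfun X" unfolding f(1) g(1) fg(2) using fg(1) by simp
  fix w assume w: "w \<in> enc X ` eqfun X"
  then obtain \<chi> where h: "w = enc X \<chi>" "\<chi> \<in> eqfun X" by auto
  note gh = a[OF g(2) h(2)]
  have "(\<lambda>p\<in>pts X. (\<lambda>p\<in>pts X. \<phi> p \<oplus>\<^bsub>L\<^esub> \<psi> p) p \<oplus>\<^bsub>L\<^esub> \<chi> p) = (\<lambda>p\<in>pts X. \<phi> p \<oplus>\<^bsub>L\<^esub> (\<lambda>p\<in>pts X. \<psi> p \<oplus>\<^bsub>L\<^esub> \<chi> p) p)"
    by (rule restrict_ext) (use eqfunD(3)[OF f(2)] eqfunD(3)[OF g(2)] eqfunD(3)[OF h(2)] in \<open>simp add: L.a_assoc\<close>)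
  then show "x \<oplus>\<^bsub>level G fixed_functor X\<^esub> y \<oplus>\<^bsub>level G fixed_functor X\<^esub> w = x \<oplus>\<^bsub>level G fixed_functor X\<^esub> (y \<oplus>\<^bsub>level G fixed_functor X\<^esub> w)"
    unfolding f(1) g(1) h(1) fg(2) gh(2) a(2)[OF fg(1) h(2)] a(2)[OF f(2) gh(1)] by simp
qed

lemma fixed_tambara: "tambara_functor G fixed_functor"
  using fixed_bispan_functor split_fixed_bij level_add_group
  by (auto simp: tambara_functor_def product_preserving_def ob_fixed eqfun_empty)

abbreviation "Ge \<equiv> orbit_gset G {\<one>}"

lemma fin_Ge: "Fin Ge" by (rule orbit_finite_gset[OF finite_group trivial_subgroup])

text \<open>
  The equivariant function on G/e whose value at the coset of 1 is x.
\<close>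

definition const_orbit :: "'r \<Rightarrow> 'g point \<Rightarrow> 'r" where
  "const_orbit x = (\<lambda>z\<in>pts Ge. \<rho> (SOME a. a \<in> carrier G \<and> z = Coset (a <# {\<one>})) x)"

lemma trivial_coset_eq: "a \<in> carrier G \<Longrightarrow> b \<in> carrier G \<Longrightarrow> a <# {\<one>} = b <# {\<one>} \<longleftrightarrow> a = b"
  by (auto simp: l_coset_def)

lemma const_orbit: assumes a: "a \<in> carrier G" shows "const_orbit x (Coset (a <# {\<one>})) = \<rho> a x"
proof -
  have "(SOME b. b \<in> carrier G \<and> Coset (a <# {\<one>}) = Coset (b <# {\<one>})) = a"
    using a trivial_coset_eq by (intro some_equality) auto
  then show ?thesis using a by (simp add: const_orbit_def orbit_pts)
qed

lemma stab_trivial_orbit: "z \<in> pts Ge \<Longrightarrow> stab G Ge z = {\<one>}"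
  by (auto simp: stab_def orbit_pts orbit_act[OF trivial_subgroup] trivial_coset_eq)

lemma const_orbit_eqfun:
  assumes x: "x \<in> carrier L" shows "const_orbit x \<in> eqfun Ge"
proof -
  have e: "const_orbit x \<in> extensional (pts Ge)" by (simp add: const_orbit_def)
  have c: "const_orbit x z \<in> carrier L" if "z \<in> pts Ge" for z
    using that ring_hom_closed[OF \<rho>_hom x] by (auto simp: orbit_pts const_orbit)
  moreover have "const_orbit x z \<in> sub (stab G Ge z)" if "z \<in> pts Ge" for z
    unfolding stab_trivial_orbit[OF that] sub_trivial using c[OF that] .
  moreover have "const_orbit x (act Ge g z) = \<rho> g (const_orbit x z)" if "g \<in> carrier G" "z \<in> pts Ge" for g z
    using that x by (auto simp: orbit_pts const_orbit orbit_act[OF trivial_subgroup] \<rho>_mult)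
  ultimately show ?thesis using e unfolding eqfun_def by (simp add: PiE_def)
qed

lemma eqfun_Ge: assumes \<phi>: "\<phi> \<in> eqfun Ge" shows "\<phi> = const_orbit (\<phi> (Coset {\<one>}))"
proof (rule eqfun_eqI[OF \<phi> const_orbit_eqfun])
  show "\<phi> (Coset {\<one>}) \<in> carrier L" using eqfunD(3)[OF \<phi> orbit_base_in[OF trivial_subgroup]] .
  fix z assume "z \<in> pts Ge"
  then obtain a where a: "a \<in> carrier G" "z = Coset (a <# {\<one>})" by (auto simp: orbit_pts)
  then show "\<phi> z = const_orbit (\<phi> (Coset {\<one>})) z"
    using eqfunD(5)[OF \<phi> a(1) orbit_base_in[OF trivial_subgroup]] by (simp add: orbit_act_base[OF trivial_subgroup] const_orbit)
qed

lemma const_orbit_ring_iso: "(\<lambda>x. enc Ge (const_orbit x)) \<in> ring_iso L (level G fixed_functor Ge)"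
proof -
  have b: "const_orbit x (Coset {\<one>}) = x" if "x \<in> carrier L" for x
    using const_orbit[OF one_closed, of x] \<rho>_one[OF that] orbit_base[OF trivial_subgroup] by simp
  have op: "const_orbit x = \<psi>" if "\<psi> \<in> eqfun Ge" "\<psi> (Coset {\<one>}) = x" for x \<psi> using eqfun_Ge[OF that(1)] that(2) by simp
  note B = orbit_base_in[OF trivial_subgroup]
  have "inj_on (\<lambda>x. enc Ge (const_orbit x)) (carrier L)"
  proof (rule inj_onI)
    fix x y assume xy: "x \<in> carrier L" "y \<in> carrier L" "enc Ge (const_orbit x) = enc Ge (const_orbit y)"
    then have "const_orbit x = const_orbit y" using inj_onD[OF enc_inj_eqfun[OF fin_Ge] _ const_orbit_eqfun const_orbit_eqfun] by simp
    then show "x = y" using b xy by metis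
  qed
  moreover have "(\<lambda>x. enc Ge (const_orbit x)) ` carrier L = enc Ge ` eqfun Ge"
    using const_orbit_eqfun eqfun_Ge eqfunD(3)[OF _ B] by (auto simp: image_iff) metis
  moreover have "(\<lambda>x. enc Ge (const_orbit x)) \<in> ring_hom L (level G fixed_functor Ge)"
  proof (rule ring_hom_memI)
    fix x y assume x: "x \<in> carrier L" and y: "y \<in> carrier L"
    show "enc Ge (const_orbit x) \<in> carrier (level G fixed_functor Ge)" using const_orbit_eqfun[OF x] by (simp add: level_carrier)
    note xy = const_orbit_eqfun[OF x] const_orbit_eqfun[OF y]
    show "enc Ge (const_orbit (x \<otimes>\<^bsub>L\<^esub> y)) = enc Ge (const_orbit x) \<otimes>\<^bsub>level G fixed_functor Ge\<^esub> enc Ge (const_orbit y)"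
      unfolding level_mult(2)[OF fin_Ge xy] using op[OF level_mult(1)[OF fin_Ge xy]] B b x y by simp
    show "enc Ge (const_orbit (x \<oplus>\<^bsub>L\<^esub> y)) = enc Ge (const_orbit x) \<oplus>\<^bsub>level G fixed_functor Ge\<^esub> enc Ge (const_orbit y)"
      unfolding level_add(2)[OF fin_Ge xy] using op[OF level_add(1)[OF fin_Ge xy]] B b x y by simp
  next
    show "enc Ge (const_orbit \<one>\<^bsub>L\<^esub>) = \<one>\<^bsub>level G fixed_functor Ge\<^esub>"
      unfolding level_one(2)[OF fin_Ge] using op[OF level_one(1)[OF fin_Ge]] B by simp
  qed
  ultimately show ?thesis by (simp add: ring_iso_def bij_betw_def level_carrier)
qed

lemma const_orbit_zero: "enc Ge (const_orbit \<zero>\<^bsub>L\<^esub>) = \<zero>\<^bsub>level G fixed_functor Ge\<^esub>"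
  using eqfun_Ge[OF level_zero(1)[OF fin_Ge]] orbit_base_in[OF trivial_subgroup] by (simp add: level_zero(2)[OF fin_Ge])

end

locale field_system = subring_system G L \<rho> sub enc + L: field L
  for G :: "('g,'m) monoid_scheme" (structure) and L :: "('r,'z) ring_scheme"
    and \<rho> :: "'g \<Rightarrow> 'r \<Rightarrow> 'r" and sub :: "'g set \<Rightarrow> 'r set" and enc :: "'g objct \<Rightarrow> ('g point \<Rightarrow> 'r) \<Rightarrow> 's"
begin

lemma bottom_field: "field (level G fixed_functor Ge)"
  using L.ring_iso_imp_img_field[OF const_orbit_ring_iso] by (simp add: const_orbit_zero)

text \<open>
  The value of a Tambara ideal at G/e is an ideal of a field. If it is 0, so is the whole Tambara ideal, because a
  function on G/K is determined by its pullback to G/e. If it contains 1, the norm of 1 puts 1 into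
  the value at every G/K.
\<close>

lemma fixed_field_like: "field_like G fixed_functor"
  unfolding field_like_def
proof (intro conjI allI impI)
  show "tambara_functor G fixed_functor" by (rule fixed_tambara)
  interpret B: field "level G fixed_functor Ge" by (rule bottom_field)
  have "\<one>\<^bsub>level G fixed_functor Ge\<^esub> \<in> ob fixed_functor Ge" using B.one_closed by (simp add: level_carrier ob_fixed)
  then show "\<exists>X. Fin X \<and> ob fixed_functor X \<noteq> {\<zero>\<^bsub>level G fixed_functor X\<^esub>}"
    using fin_Ge B.one_not_zero by (intro exI[of _ Ge]) auto
  fix I assume I: "tambara_ideal G fixed_functor I"
  have id: "ideal (I K) (level G fixed_functor (orbit_gset G K))" if "subgroup K G" for K
    using I that by (simp add: tambara_ideal_def)
  have res: "Res G fixed_functor (orbit_gset G K) (orbit_gset G J) f x \<in> I K"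
    and nm: "y \<in> I K \<Longrightarrow> Nm G fixed_functor (orbit_gset G K) (orbit_gset G J) f y \<in> I J"
    if "subgroup K G" "subgroup J G" "f \<in> gmap G (orbit_gset G K) (orbit_gset G J)" "x \<in> I J" for K J f x y
    using I[unfolded tambara_ideal_def, THEN conjunct2, rule_format, OF that(1-3)] that(4) by (auto simp: image_subset_iff)
  consider "I {\<one>} = {\<zero>\<^bsub>level G fixed_functor Ge\<^esub>}" | "I {\<one>} = carrier (level G fixed_functor Ge)"
    using B.all_ideals id[OF trivial_subgroup] by blast
  then show "(\<forall>K. subgroup K G \<longrightarrow> I K = {\<zero>\<^bsub>level G fixed_functor (orbit_gset G K)\<^esub>}) \<or> (\<forall>K. subgroup K G \<longrightarrow> I K = ob fixed_functor (orbit_gset G K))"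
  proof cases
    case 1
    have "I K = {\<zero>\<^bsub>level G fixed_functor (orbit_gset G K)\<^esub>}" if K: "subgroup K G" for K
    proof -
      let ?O = "orbit_gset G K"
      note FK = orbit_finite_gset[OF finite_group K] and BK = orbit_base_in[OF K]
      note ts = trivial_stab[OF FK BK]
      note m = orbit_map_gmap[OF FK BK trivial_subgroup ts] orbit_map_simp[OF FK BK trivial_subgroup ts]
      have "x = \<zero>\<^bsub>level G fixed_functor ?O\<^esub>" if x: "x \<in> I K" for x
      proof -
        obtain \<phi> where f: "x = enc ?O \<phi>" "\<phi> \<in> eqfun ?O" using ideal.Icarr[OF id[OF K] x] by (auto simp: level_carrier)
        have "enc Ge (\<lambda>z\<in>pts Ge. \<phi> (orbit_map G {\<one>} ?O (Coset K) z)) = enc Ge (\<lambda>z\<in>pts Ge. \<zero>\<^bsub>L\<^esub>)"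
          using res[OF trivial_subgroup K m(1) x] Res_fixed[OF fin_Ge FK m(1) f(2)] 1 level_zero(2)[OF fin_Ge] f(1) by simp
        from inj_onD[OF enc_inj_eqfun[OF fin_Ge] this eqfun_res[OF fin_Ge FK m(1) f(2)] level_zero(1)[OF fin_Ge]]
        have z: "(\<lambda>z\<in>pts Ge. \<phi> (orbit_map G {\<one>} ?O (Coset K) z)) = (\<lambda>z\<in>pts Ge. \<zero>\<^bsub>L\<^esub>)" .
        have "\<phi> p = \<zero>\<^bsub>L\<^esub>" if p: "p \<in> pts ?O" for p
        proof -
          obtain a where a: "a \<in> carrier G" "p = act ?O a (Coset K)" using p by (auto simp: orbit_pts orbit_act_base[OF K])
          show ?thesis using fun_cong[OF z, of "Coset (a <# {\<one>})"] m(2)[OF a(1)] a by (simp add: orbit_point_in)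
        qed
        then have "\<phi> = (\<lambda>p\<in>pts ?O. \<zero>\<^bsub>L\<^esub>)" by (intro eqfun_eqI[OF f(2) level_zero(1)[OF FK]]) simp
        then show ?thesis using f(1) level_zero(2)[OF FK] by simp
      qed
      moreover have "\<zero>\<^bsub>level G fixed_functor ?O\<^esub> \<in> I K" using additive_subgroup.zero_closed[OF ideal.axioms(1)[OF id[OF K]]] .
      ultimately show ?thesis by blast
    qed
    then show ?thesis by blast
  next
    case 2
    have "I K = ob fixed_functor (orbit_gset G K)" if K: "subgroup K G" for K
    proof -
      let ?O = "orbit_gset G K"
      note FK = orbit_finite_gset[OF finite_group K] and BK = orbit_base_in[OF K]
      note m = orbit_map_gmap[OF FK BK trivial_subgroup trivial_stab[OF FK BK]]
      have o: "\<one>\<^bsub>level G fixed_functor Ge\<^esub> \<in> I {\<one>}" using 2 B.one_closed by simp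
      have z: "\<zero>\<^bsub>level G fixed_functor ?O\<^esub> \<in> I K" using additive_subgroup.zero_closed[OF ideal.axioms(1)[OF id[OF K]]] .
      have "(\<lambda>y\<in>pts ?O. finprod L (\<lambda>p\<in>pts Ge. \<one>\<^bsub>L\<^esub>) {x \<in> pts Ge. orbit_map G {\<one>} ?O (Coset K) x = y}) = (\<lambda>p\<in>pts ?O. \<one>\<^bsub>L\<^esub>)"
        by (rule restrict_ext) (auto intro: L.finprod_one_eqI)
      then have "Nm G fixed_functor Ge ?O (orbit_map G {\<one>} ?O (Coset K)) \<one>\<^bsub>level G fixed_functor Ge\<^esub> = \<one>\<^bsub>level G fixed_functor ?O\<^esub>"
        using Nm_fixed[OF fin_Ge FK m level_one(1)[OF fin_Ge]] level_one(2)[OF fin_Ge] level_one(2)[OF FK] by simp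
      then have "\<one>\<^bsub>level G fixed_functor ?O\<^esub> \<in> I K" using nm[OF trivial_subgroup K m z o] by simp
      then show ?thesis using ideal.one_imp_carrier[OF id[OF K]] by (simp add: level_carrier ob_fixed)
    qed
    then show ?thesis by blast
  qed
qed

end

section \<open>The factor cut out by a splitting idempotent\<close>

text \<open>
  An infinite type injects its own finite powers, because it is in bijection with its square.
\<close>

lemma infinite_type_encodes_functions:
  assumes inf: "infinite (UNIV :: 'r set)" and "finite A"
  shows "\<exists>f :: ('p \<Rightarrow> 'r) \<Rightarrow> 'r. inj_on f (A \<rightarrow>\<^sub>E UNIV)"
  using assms(2)
proof (induction A)
  case empty
  then show ?case by simp
next
  case (insert x A)
  then obtain f :: "('p \<Rightarrow> 'r) \<Rightarrow> 'r" where f: "inj_on f (A \<rightarrow>\<^sub>E UNIV)" by blast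
  obtain b :: "'r \<times> 'r \<Rightarrow> 'r" where b: "inj b"
    using card_of_Times_same_infinite[OF inf] card_of_ordIso[of "UNIV \<times> UNIV :: ('r \<times> 'r) set" "UNIV :: 'r set"]
    by (auto simp: bij_betw_def)
  have "inj_on (\<lambda>s. b (s x, f (restrict s A))) (insert x A \<rightarrow>\<^sub>E UNIV)"
  proof (rule inj_onI)
    fix s t assume s: "s \<in> insert x A \<rightarrow>\<^sub>E (UNIV :: 'r set)" and t: "t \<in> insert x A \<rightarrow>\<^sub>E (UNIV :: 'r set)"
      and e: "b (s x, f (restrict s A)) = b (t x, f (restrict t A))"
    have 1: "s x = t x" "f (restrict s A) = f (restrict t A)" using injD[OF b e] by auto
    have "restrict s A = restrict t A" by (rule inj_onD[OF f]) (use 1(2) in auto)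
    then have "s a = t a" if "a \<in> A" for a using that by (metis restrict_apply')
    then show "s = t" using s t 1(1) by (intro extensionalityI[of _ "insert x A"]) (auto simp: PiE_def)
  qed
  then show ?case by blast
qed

lemma tambara_iso_of_bijections:
  assumes \<eta>: "tambara_hom G R S \<eta>" and b: "\<And>X. finite_gset G X \<Longrightarrow> bij_betw (\<eta> X) (ob R X) (ob S X)"
    and R: "\<And>X Y c x. c \<in> bispan_hom G X Y \<Longrightarrow> x \<in> ob R X \<Longrightarrow> ar R c x \<in> ob R Y"
  shows "tambara_iso G R S"
proof -
  define \<theta> where "\<theta> X = (\<lambda>y\<in>ob S X. the_inv_into (ob R X) (\<eta> X) y)" for X
  have t1: "\<theta> X (\<eta> X x) = x" if "finite_gset G X" "x \<in> ob R X" for X x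
    using b[OF that(1)] that(2) by (auto simp: \<theta>_def bij_betw_def the_inv_into_f_f)
  have t2: "\<eta> X (\<theta> X y) = y" "\<theta> X y \<in> ob R X" if "finite_gset G X" "y \<in> ob S X" for X y
    using b[OF that(1)] that(2) f_the_inv_into_f[of "\<eta> X" "ob R X" y] the_inv_into_into[of "\<eta> X" "ob R X" y "ob R X"]
    by (auto simp: \<theta>_def bij_betw_def)
  have "tambara_hom G S R \<theta>"
    unfolding tambara_hom_def
  proof (intro conjI allI impI ballI)
    show "\<theta> X \<in> ob S X \<rightarrow>\<^sub>E ob R X" if "finite_gset G X" for X using t2(2)[OF that] by (auto simp: \<theta>_def)
    fix X Y c y assume c: "c \<in> bispan_hom G X Y" and y: "y \<in> ob S X"
    have XY: "finite_gset G X" "finite_gset G Y" using c by (auto simp: bispan_hom_def is_bispan_def)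
    have "ar S c y = \<eta> Y (ar R c (\<theta> X y))" using \<eta> c t2[OF XY(1) y] by (auto simp: tambara_hom_def)
    then show "\<theta> Y (ar S c y) = ar R c (\<theta> X y)" using t1[OF XY(2) R[OF c t2(2)[OF XY(1) y]]] by simp
  qed
  then show ?thesis using \<eta> t1 t2 unfolding tambara_iso_def by blast
qed

text \<open>
  Isomorphic bispans of G-sets are isomorphic as bispans of H-sets, so the union in res_mor is over
  a single class.
\<close>

lemma res_mor_class:
  assumes G: "group G" and H: "subgroup H G" and S: "is_bispan G (S :: ('g,'g point,'g point) bispan)"
  shows "is_bispan (sub_group G H) S" "res_mor G H (bispan_class G S) = bispan_class (sub_group G H) S"
proof -
  note GH = subgroup.subgroup_is_group[OF H G]
  have gm: "f \<in> gmap (sub_group G H) X Y" if "f \<in> gmap G X Y" for X Y :: "'g objct" and f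
    using that subgroup.mem_carrier[OF H] by (auto simp: gmap_def)
  have b: "is_bispan (sub_group G H) T" if "is_bispan G T" for T :: "('g,'g point,'g point) bispan"
    using that restrict_subgroup_gset[OF G H] subgroup.mem_carrier[OF H] by (auto simp: is_bispan_def gmap_def)
  show S': "is_bispan (sub_group G H) S" by (rule b[OF S])
  have "bispan_class (sub_group G H) T = bispan_class (sub_group G H) S" if T: "T \<in> bispan_class G S" for T
  proof (rule bispan_class_eq[OF GH])
    show "is_bispan (sub_group G H) T" using T by (intro b) (simp add: bispan_class_def)
    have "bispan_iso G T S" using T by (simp add: bispan_class_def)
    then show "bispan_iso (sub_group G H) T S" unfolding bispan_iso_def using gm by blast
  qed
  then have "res_mor G H (bispan_class G S) = (\<Union>T\<in>bispan_class G S. bispan_class (sub_group G H) S)"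
    unfolding res_mor_def by (rule SUP_cong[OF refl])
  then show "res_mor G H (bispan_class G S) = bispan_class (sub_group G H) S"
    using bispan_class_self[OF G S] by auto
qed

context tambara_field begin

text \<open>
  The value at X + X is the square of the value at X, so the values of k are unbounded in size.
  This allows functions with values in k(G/e) to be encoded in the type of the values of k.
\<close>

lemma infinite_values: "infinite (UNIV :: 'r set)"
proof
  assume fin: "finite (UNIV :: 'r set)"
  have "\<exists>X. Fin X \<and> n + 2 \<le> card (ob k X)" for n
  proof (induction n)
    case 0
    interpret F: cring F by (rule F_cring)
    have "card {\<zero>\<^bsub>F\<^esub>, \<one>\<^bsub>F\<^esub>} \<le> card (ob k Ge)"
      using F.zero_closed F.one_closed finite_subset[OF subset_UNIV fin] by (intro card_mono) auto
    then show ?case using F_nonzero fin_Ge by (intro exI[of _ Ge]) simp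
  next
    case (Suc n)
    then obtain X where X: "Fin X" "n + 2 \<le> card (ob k X)" by blast
    have "card (ob k (sum_gset X X)) = card (ob k X) * card (ob k X)"
      using bij_betw_same_card[OF split_bij[OF X(1) X(1)]] by (simp add: card_cartesian_product)
    moreover have "2 * card (ob k X) \<le> card (ob k X) * card (ob k X)" using X(2) by (intro mult_right_mono) auto
    ultimately have "Suc n + 2 \<le> card (ob k (sum_gset X X))" using X(2) by linarith
    then show ?case using X(1) by (intro exI[of _ "sum_gset X X"]) simp
  qed
  then obtain X where "Fin X" "card (UNIV :: 'r set) + 2 \<le> card (ob k X)" by blast
  moreover have "card (ob k X) \<le> card (UNIV :: 'r set)" using fin by (intro card_mono) auto
  ultimately show False by simp
qed

end

locale splitting = tambara_field G k for G :: "('g,'m) monoid_scheme" (structure) and k :: "('g,'r) bfunctor" +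
  fixes H :: "'g set" and e :: 'r
  assumes H: "subgroup H G" and e_in: "e \<in> ob k Ge" and e_nonzero: "e \<noteq> \<zero>\<^bsub>F\<^esub>" and e_idem: "e \<otimes>\<^bsub>F\<^esub> e = e"
    and e_fixed: "h \<in> H \<Longrightarrow> gact h e = e"
    and e_orth: "g \<in> carrier G \<Longrightarrow> g \<notin> H \<Longrightarrow> e \<otimes>\<^bsub>F\<^esub> gact g e = \<zero>\<^bsub>F\<^esub>"
    and e_inverse: "x \<in> ob k Ge \<Longrightarrow> e \<otimes>\<^bsub>F\<^esub> x \<noteq> \<zero>\<^bsub>F\<^esub> \<Longrightarrow> \<exists>y\<in>ob k Ge. e \<otimes>\<^bsub>F\<^esub> (x \<otimes>\<^bsub>F\<^esub> y) = e"
begin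

abbreviation "GH \<equiv> sub_group G H"

text \<open>
  The factor eF of F; its unit is e.
\<close>

definition L :: "'r ring" where
  "L = F \<lparr>carrier := {x \<in> ob k Ge. e \<otimes>\<^bsub>F\<^esub> x = x}, one := e\<rparr>"

definition Lsub :: "'g set \<Rightarrow> 'r set" where
  "Lsub K = Fsub K \<inter> carrier L"

definition enc :: "'g objct \<Rightarrow> ('g point \<Rightarrow> 'r) \<Rightarrow> 'r" where
  "enc X = (SOME f. inj_on f (pts X \<rightarrow>\<^sub>E UNIV))"

sublocale F: cring F by (rule F_cring)

lemma H_carrier: "h \<in> H \<Longrightarrow> h \<in> carrier G"
  by (rule subgroup.mem_carrier[OF H])

lemma GH_group: "group GH" by (rule subgroup.subgroup_is_group[OF H is_group])

lemma GH_subgroup: "subgroup K GH \<Longrightarrow> subgroup K G" by (rule incl_subgroup[OF H])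

lemma GH_subset: "subgroup K GH \<Longrightarrow> K \<subseteq> H" using subgroup.subset by fastforce

lemma L_simps: "x \<in> carrier L \<longleftrightarrow> x \<in> ob k Ge \<and> e \<otimes>\<^bsub>F\<^esub> x = x" "mult L = mult F" "add L = add F" "one L = e" "zero L = zero F"
  by (simp_all add: L_def)

lemma e_carrier: "e \<in> carrier F" using e_in by simp

lemma L_closed:
  "x \<in> carrier L \<Longrightarrow> y \<in> carrier L \<Longrightarrow> x \<oplus>\<^bsub>F\<^esub> y \<in> carrier L"
  "x \<in> carrier L \<Longrightarrow> y \<in> carrier F \<Longrightarrow> x \<otimes>\<^bsub>F\<^esub> y \<in> carrier L"
  "\<zero>\<^bsub>F\<^esub> \<in> carrier L" "e \<in> carrier L" "x \<in> carrier L \<Longrightarrow> \<ominus>\<^bsub>F\<^esub> x \<in> carrier L"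
  "y \<in> carrier F \<Longrightarrow> e \<otimes>\<^bsub>F\<^esub> y \<in> carrier L"
  using e_carrier e_idem F.zero_closed F.a_closed F.m_closed F.a_inv_closed
  by (auto simp: L_simps F.r_distr F.m_assoc[symmetric] F.r_minus)

lemma L_carrier_F: "x \<in> carrier L \<Longrightarrow> x \<in> carrier F" by (simp add: L_simps)

lemma L_cring: "cring L"
proof (rule cringI)
  note c = L_carrier_F
  show "abelian_group L"
  proof (rule abelian_groupI; simp only: L_simps(2-5))
    fix x y assume x: "x \<in> carrier L" and y: "y \<in> carrier L"
    show "x \<oplus>\<^bsub>F\<^esub> y \<in> carrier L" by (rule L_closed(1)[OF x y])
    show "x \<oplus>\<^bsub>F\<^esub> y = y \<oplus>\<^bsub>F\<^esub> x" by (rule F.a_comm[OF c[OF x] c[OF y]])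
    show "\<zero>\<^bsub>F\<^esub> \<oplus>\<^bsub>F\<^esub> x = x" by (rule F.l_zero[OF c[OF x]])
    show "\<exists>y\<in>carrier L. y \<oplus>\<^bsub>F\<^esub> x = \<zero>\<^bsub>F\<^esub>" using F.l_neg[OF c[OF x]] L_closed(5)[OF x] by blast
    show "x \<oplus>\<^bsub>F\<^esub> y \<oplus>\<^bsub>F\<^esub> z = x \<oplus>\<^bsub>F\<^esub> (y \<oplus>\<^bsub>F\<^esub> z)" if z: "z \<in> carrier L" for z by (rule F.a_assoc[OF c[OF x] c[OF y] c[OF z]])
  qed (rule L_closed(3))
  show "comm_monoid L"
  proof (rule comm_monoidI; simp only: L_simps(2-5))
    fix x y assume x: "x \<in> carrier L" and y: "y \<in> carrier L"
    show "x \<otimes>\<^bsub>F\<^esub> y \<in> carrier L" by (rule L_closed(2)[OF x c[OF y]])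
    show "x \<otimes>\<^bsub>F\<^esub> y = y \<otimes>\<^bsub>F\<^esub> x" by (rule F.m_comm[OF c[OF x] c[OF y]])
    show "e \<otimes>\<^bsub>F\<^esub> x = x" using x by (simp add: L_simps)
    show "x \<otimes>\<^bsub>F\<^esub> y \<otimes>\<^bsub>F\<^esub> z = x \<otimes>\<^bsub>F\<^esub> (y \<otimes>\<^bsub>F\<^esub> z)" if z: "z \<in> carrier L" for z by (rule F.m_assoc[OF c[OF x] c[OF y] c[OF z]])
  qed (rule L_closed(4))
  show "(x \<oplus>\<^bsub>L\<^esub> y) \<otimes>\<^bsub>L\<^esub> z = x \<otimes>\<^bsub>L\<^esub> z \<oplus>\<^bsub>L\<^esub> y \<otimes>\<^bsub>L\<^esub> z" if "x \<in> carrier L" "y \<in> carrier L" "z \<in> carrier L" for x y z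
    unfolding L_simps(2-5) by (rule F.l_distr) (rule L_carrier_F that)+
qed

sublocale L: cring L by (rule L_cring)

lemma L_field: "field L"
proof (rule L.cring_fieldI)
  have "x \<in> Units L" if x: "x \<in> carrier L" "x \<noteq> \<zero>\<^bsub>L\<^esub>" for x
  proof -
    have "e \<otimes>\<^bsub>F\<^esub> x \<noteq> \<zero>\<^bsub>F\<^esub>" "x \<in> ob k Ge" using x by (simp_all add: L_simps)
    then obtain y where y: "y \<in> carrier F" "e \<otimes>\<^bsub>F\<^esub> (x \<otimes>\<^bsub>F\<^esub> y) = e" using e_inverse by auto
    have "x \<otimes>\<^bsub>L\<^esub> (e \<otimes>\<^bsub>F\<^esub> y) = \<one>\<^bsub>L\<^esub>"
      using y L_carrier_F[OF x(1)] e_carrier by (simp only: L_simps(2,4) F.m_lcomm)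
    moreover from this have "(e \<otimes>\<^bsub>F\<^esub> y) \<otimes>\<^bsub>L\<^esub> x = \<one>\<^bsub>L\<^esub>" using L.m_comm[OF x(1) L_closed(6)[OF y(1)]] by simp
    ultimately show ?thesis using L_closed(6)[OF y(1)] x(1) unfolding Units_def by blast
  qed
  moreover have "\<zero>\<^bsub>L\<^esub> \<notin> Units L"
  proof
    assume "\<zero>\<^bsub>L\<^esub> \<in> Units L"
    then obtain y where "y \<in> carrier L" "\<zero>\<^bsub>L\<^esub> \<otimes>\<^bsub>L\<^esub> y = \<one>\<^bsub>L\<^esub>" by (auto simp: Units_def)
    then show False using e_nonzero L.l_null by (simp add: L_simps(4,5))
  qed
  ultimately show "Units L = carrier L - {\<zero>\<^bsub>L\<^esub>}" using L.Units_closed by blast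
qed

lemma proj_hom: "ring_hom_cring F L (\<lambda>x. e \<otimes>\<^bsub>F\<^esub> x)"
proof (unfold_locales, rule ring_hom_memI)
  fix x y assume x: "x \<in> carrier F" and y: "y \<in> carrier F"
  show "e \<otimes>\<^bsub>F\<^esub> x \<in> carrier L" by (rule L_closed(6)[OF x])
  have "(e \<otimes>\<^bsub>F\<^esub> x) \<otimes>\<^bsub>F\<^esub> (e \<otimes>\<^bsub>F\<^esub> y) = (e \<otimes>\<^bsub>F\<^esub> e) \<otimes>\<^bsub>F\<^esub> (x \<otimes>\<^bsub>F\<^esub> y)"
    using x y e_carrier by (simp only: F.m_ac F.m_closed)
  then show "e \<otimes>\<^bsub>F\<^esub> (x \<otimes>\<^bsub>F\<^esub> y) = (e \<otimes>\<^bsub>F\<^esub> x) \<otimes>\<^bsub>L\<^esub> (e \<otimes>\<^bsub>F\<^esub> y)" by (simp add: L_simps e_idem)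
  show "e \<otimes>\<^bsub>F\<^esub> (x \<oplus>\<^bsub>F\<^esub> y) = (e \<otimes>\<^bsub>F\<^esub> x) \<oplus>\<^bsub>L\<^esub> (e \<otimes>\<^bsub>F\<^esub> y)" unfolding L_simps by (rule F.r_distr[OF x y e_carrier])
next
  show "e \<otimes>\<^bsub>F\<^esub> \<one>\<^bsub>F\<^esub> = \<one>\<^bsub>L\<^esub>" unfolding L_simps by (rule F.r_one[OF e_carrier])
qed

interpretation p: ring_hom_cring F L "\<lambda>x. e \<otimes>\<^bsub>F\<^esub> x" by (rule proj_hom)

lemma L_neg: assumes x: "x \<in> carrier L" shows "\<ominus>\<^bsub>L\<^esub> x = \<ominus>\<^bsub>F\<^esub> x"
  using p.hom_a_inv[OF L_carrier_F[OF x]] L_closed(5)[OF x] x by (simp add: L_simps)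

lemma L_finprod: assumes "\<phi> \<in> A \<rightarrow> carrier L" shows "finprod L \<phi> A = e \<otimes>\<^bsub>F\<^esub> finprod F \<phi> A"
proof -
  have "e \<otimes>\<^bsub>F\<^esub> finprod F \<phi> A = finprod L ((\<lambda>x. e \<otimes>\<^bsub>F\<^esub> x) \<circ> \<phi>) A"
    by (rule p.hom_finprod) (use assms L_carrier_F in blast)
  also have "\<dots> = finprod L \<phi> A" by (rule L.finprod_cong') (use assms in \<open>auto simp: L_simps\<close>)
  finally show ?thesis ..
qed

lemma L_finsum: assumes "\<phi> \<in> A \<rightarrow> carrier L" shows "finsum L \<phi> A = e \<otimes>\<^bsub>F\<^esub> finsum F \<phi> A"
proof -
  have "e \<otimes>\<^bsub>F\<^esub> finsum F \<phi> A = finsum L ((\<lambda>x. e \<otimes>\<^bsub>F\<^esub> x) \<circ> \<phi>) A"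
    by (rule p.hom_finsum) (use assms L_carrier_F in blast)
  also have "\<dots> = finsum L \<phi> A" by (rule L.finsum_cong') (use assms in \<open>auto simp: L_simps\<close>)
  finally show ?thesis ..
qed

lemma gact_L: assumes h: "h \<in> H" shows "gact h \<in> ring_hom L L"
proof (rule ring_hom_memI)
  note g = gact_ring_hom[OF H_carrier[OF h]]
  fix x y assume x: "x \<in> carrier L" and y: "y \<in> carrier L"
  note xF = L_carrier_F[OF x] and yF = L_carrier_F[OF y]
  show "gact h x \<in> carrier L" using ring_hom_mult[OF g e_carrier xF] ring_hom_closed[OF g xF] x e_fixed[OF h] by (simp add: L_simps)
  show "gact h (x \<otimes>\<^bsub>L\<^esub> y) = gact h x \<otimes>\<^bsub>L\<^esub> gact h y" unfolding L_simps by (rule ring_hom_mult[OF g xF yF])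
  show "gact h (x \<oplus>\<^bsub>L\<^esub> y) = gact h x \<oplus>\<^bsub>L\<^esub> gact h y" unfolding L_simps by (rule ring_hom_add[OF g xF yF])
qed (use e_fixed[OF h] in \<open>simp add: L_simps\<close>)

text \<open>
  The norm of 1 - e from G/e to G/J restricts to a product of translates of 1 - e by elements of J. As J
  fixes e, this is a power of the idempotent 1 - e, that is, 1 - e itself.
\<close>

lemma e_Fsub: assumes J: "subgroup J G" "J \<subseteq> H" shows "e \<in> Fsub J"
proof -
  let ?O = "orbit_gset G J"
  define f where "f = \<one>\<^bsub>F\<^esub> \<ominus>\<^bsub>F\<^esub> e"
  have f: "f \<in> carrier F" unfolding f_def by (rule F.minus_closed[OF F.one_closed e_carrier])
  have fe: "f = \<one>\<^bsub>F\<^esub> \<oplus>\<^bsub>F\<^esub> \<ominus>\<^bsub>F\<^esub> e" by (simp only: f_def F.minus_eq)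
  have nc: "\<ominus>\<^bsub>F\<^esub> e \<in> carrier F" by (rule F.a_inv_closed[OF e_carrier])
  have "e \<otimes>\<^bsub>F\<^esub> f = \<zero>\<^bsub>F\<^esub>" unfolding fe
    using F.r_distr[OF F.one_closed nc e_carrier] F.r_minus[OF e_carrier e_carrier] F.r_neg[OF e_carrier] F.r_one[OF e_carrier] e_idem by simp
  then have ff: "f \<otimes>\<^bsub>F\<^esub> f = f"
    using F.l_distr[OF F.one_closed nc f] F.l_minus[OF e_carrier f] F.l_one[OF f] F.minus_zero F.r_zero[OF f] by (simp only: fe[symmetric])
  have hf: "gact h f = f" if h: "h \<in> J" for h
  proof -
    have hH: "h \<in> H" using h J by auto
    note g = gact_ring_hom[OF H_carrier[OF hH]]
    interpret g: ring_hom_cring F F "gact h" by unfold_locales (rule g)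
    show ?thesis unfolding fe using g.hom_add[OF F.one_closed nc] g.hom_one g.hom_a_inv[OF e_carrier] e_fixed[OF hH] by simp
  qed
  have c: "finprod F (\<lambda>_. f) A = f" if "finite A" "A \<noteq> {}" for A :: "'g point set"
    using that
  proof (induction A rule: finite_ne_induct)
    case (singleton x)
    have "finprod F (\<lambda>_. f) {x} = f \<otimes>\<^bsub>F\<^esub> finprod F (\<lambda>_. f) {}" using f F.finprod_insert[of "{}" x "\<lambda>_. f"] by simp
    then show ?case using F.r_one[OF f] by simp
  next
    case (insert x A)
    have "finprod F (\<lambda>_. f) (insert x A) = f \<otimes>\<^bsub>F\<^esub> finprod F (\<lambda>_. f) A" using f insert F.finprod_insert[of A x "\<lambda>_. f"] by simp
    then show ?case using insert ff by simp
  qed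
  note FJ = fin_orbit[OF J(1)] and BJ = orbit_base_in[OF J(1)]
  let ?m = "orbit_map G {\<one>} ?O (Coset J)"
  note m = point_map[OF FJ BJ] point_map_simp[OF FJ BJ]
  let ?A = "{q \<in> pts Ge. ?m q = Coset J}"
  have "Coset (\<one> <# {\<one>}) \<in> ?A" using m(2)[OF one_closed] orbit_point_in[OF one_closed] finite_gsetD(3)[OF is_group FJ BJ] by simp
  then have A: "finite ?A" "?A \<noteq> {}" using finite_gsetD(1)[OF is_group fin_Ge] by auto
  have fo: "f \<in> ob k Ge" using f by simp
  have "ev Ge f q = f" if q: "q \<in> ?A" for q
  proof -
    obtain a where a: "a \<in> carrier G" "q = Coset (a <# {\<one>})" using q by (auto simp: orbit_pts)
    then have "act ?O a (Coset J) = Coset J" using q m(2)[OF a(1)] by simp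
    then have "a \<in> stab G ?O (Coset J)" using a(1) by (simp add: stab_def)
    then have "a \<in> J" using stab_orbit_base[OF J(1)] by simp
    then show ?thesis using hf a(2) by (simp add: gact_def)
  qed
  then have "finprod F (ev Ge f) ?A = finprod F (\<lambda>_. f) ?A" using f by (intro F.finprod_cong') auto
  then have "ev ?O (N Ge ?O ?m f) (Coset J) = f" using nm.ev_op[OF fin_Ge FJ m(1) fo BJ] c[OF A] by simp
  then have "f \<in> Fsub J" using ops_closed(2)[OF fin_Ge FJ m(1) fo] unfolding Fsub_def by (metis imageI)
  then have "\<one>\<^bsub>F\<^esub> \<oplus>\<^bsub>F\<^esub> \<ominus>\<^bsub>F\<^esub> f \<in> Fsub J" using Fsub_ring[OF J(1)] by blast
  moreover have "\<one>\<^bsub>F\<^esub> \<oplus>\<^bsub>F\<^esub> \<ominus>\<^bsub>F\<^esub> f = e"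
    unfolding fe using F.minus_add[OF F.one_closed nc] F.minus_minus[OF e_carrier] F.r_neg1[OF F.one_closed e_carrier] F.r_neg2[OF F.one_closed e_carrier] by simp
  ultimately show ?thesis by simp
qed

lemma enc_inj: assumes "finite (pts X)" shows "inj_on (enc X) (pts X \<rightarrow>\<^sub>E carrier L)"
proof -
  have "inj_on (enc X) (pts X \<rightarrow>\<^sub>E UNIV)" unfolding enc_def
    using infinite_type_encodes_functions[OF infinite_values assms] by (rule someI_ex)
  then show ?thesis by (rule inj_on_subset) (auto simp: PiE_def)
qed

end

context splitting begin

lemma Lsub_sum_prod:
  assumes K: "subgroup K GH" and Z: "finite_gset (sub_group G K) Z"
    and eq: "\<And>g z. g \<in> K \<Longrightarrow> z \<in> pts Z \<Longrightarrow> \<phi> (act Z g z) = gact g (\<phi> z)"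
    and val: "\<And>z. z \<in> pts Z \<Longrightarrow> \<phi> z \<in> Lsub (stab (sub_group G K) Z z)"
  shows "finprod L \<phi> (pts Z) \<in> Lsub K" "finsum L \<phi> (pts Z) \<in> Lsub K"
proof -
  note KG = GH_subgroup[OF K] and eK = e_Fsub[OF GH_subgroup[OF K] GH_subset[OF K]]
  have l: "\<phi> \<in> pts Z \<rightarrow> carrier L" and v: "\<And>z. z \<in> pts Z \<Longrightarrow> \<phi> z \<in> Fsub (stab (sub_group G K) Z z)"
    using val by (auto simp: Lsub_def)
  note sp = Fsub_sum_prod[OF KG Z eq v]
  have "finprod L \<phi> (pts Z) \<in> carrier L" "finsum L \<phi> (pts Z) \<in> carrier L"
    using L.finprod_closed[OF l] L.finsum_closed[OF l] by auto
  moreover have "finprod L \<phi> (pts Z) \<in> Fsub K" unfolding L_finprod[OF l] by (rule Fsub_ring(4)[OF KG eK sp(1)])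
  moreover have "finsum L \<phi> (pts Z) \<in> Fsub K" unfolding L_finsum[OF l] by (rule Fsub_ring(4)[OF KG eK sp(2)])
  ultimately show "finprod L \<phi> (pts Z) \<in> Lsub K" "finsum L \<phi> (pts Z) \<in> Lsub K" by (auto simp: Lsub_def)
qed

end

sublocale splitting \<subseteq> ell: field_system "sub_group G H" L gact Lsub enc
proof -
  interpret h: group "sub_group G H" by (rule GH_group)
  interpret f: field L by (rule L_field)
  show "field_system (sub_group G H) L gact Lsub enc"
  proof (unfold_locales, goal_cases)
    case 1 show ?case using finite_subset[OF subgroup.subset[OF H] finite_group] by simp
  next
    case (2 g) then show ?case using gact_L by simp
  next
    case (3 x) then show ?case using gact_one by (simp add: L_simps)
  next
    case (4 g h x) then show ?case using gact_mult[OF H_carrier H_carrier] by (simp add: L_simps)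
  next
    case (5 K J) then show ?case using Fsub_mono[OF GH_subgroup GH_subgroup] by (auto simp: Lsub_def)
  next
    case 6
    have "carrier L \<subseteq> ob k Ge" by (auto simp: L_def)
    then show ?case using Fsub_trivial by (simp add: Lsub_def Int_absorb1)
  next
    case (7 K x)
    then have x: "x \<in> Fsub K" "x \<in> carrier L" by (auto simp: Lsub_def)
    show ?case unfolding L_neg[OF x(2)] Lsub_def
      by (rule IntI[OF Fsub_ring(5)[OF GH_subgroup[OF 7(1)] x(1)] L_closed(5)[OF x(2)]])
  next
    case (8 K Z \<phi>) then show ?case using Lsub_sum_prod(1)[of K Z \<phi>] by simp
  next
    case (9 K Z \<phi>) then show ?case using Lsub_sum_prod(2)[of K Z \<phi>] by simp
  next
    case (10 X) then show ?case by (rule enc_inj)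
  qed
qed

context splitting begin

section \<open>Comparison with the coinduced functor\<close>

definition comparison :: "'g objct \<Rightarrow> 'r \<Rightarrow> 'r" where
  "comparison X = (\<lambda>x\<in>ob k X. enc X (\<lambda>p\<in>pts X. e \<otimes>\<^bsub>F\<^esub> ev X x p))"

lemma GH_stab: "stab GH X p = stab G X p \<inter> H"
  using H_carrier by (auto simp: stab_def)

lemma comparison_eqfun:
  assumes X: "Fin X" and x: "x \<in> ob k X" shows "(\<lambda>p\<in>pts X. e \<otimes>\<^bsub>F\<^esub> ev X x p) \<in> ell.eqfun X"
proof -
  note XH = restrict_subgroup_gset[OF is_group H X]
  have c: "ev X x p \<in> carrier F" if "p \<in> pts X" for p using ev_closed[OF X that x] by simp
  have "e \<otimes>\<^bsub>F\<^esub> ev X x p \<in> Lsub (stab GH X p)" if p: "p \<in> pts X" for p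
  proof -
    note S = ell.stab_subgroup[OF XH p]
    have "ev X x p \<in> Fsub (stab GH X p)" by (rule ev_in_Fsub[OF X p x GH_subgroup[OF S]]) (simp add: GH_stab)
    then show ?thesis using Fsub_ring(4)[OF GH_subgroup[OF S] e_Fsub[OF GH_subgroup[OF S] GH_subset[OF S]]] L_closed(6)[OF c[OF p]]
      by (auto simp: Lsub_def)
  qed
  moreover have "e \<otimes>\<^bsub>F\<^esub> ev X x (act X g p) = gact g (e \<otimes>\<^bsub>F\<^esub> ev X x p)" if g: "g \<in> H" and p: "p \<in> pts X" for g p
    using ev_act[OF X p x H_carrier[OF g]] ring_hom_mult[OF gact_ring_hom[OF H_carrier[OF g]] e_carrier c[OF p]] e_fixed[OF g] by simp
  ultimately show ?thesis using L_closed(6)[OF c] finite_gsetD(2)[OF is_group X H_carrier] unfolding ell.eqfun_def by simp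
qed

lemma comparison_hom: "tambara_hom G k (coind G H ell.fixed_functor) comparison"
  unfolding tambara_hom_def
proof (intro conjI allI impI ballI)
  show "comparison X \<in> ob k X \<rightarrow>\<^sub>E ob (coind G H ell.fixed_functor) X" if "Fin X" for X
    using comparison_eqfun[OF that] by (auto simp: comparison_def coind_def ell.ob_fixed)
  fix X Y c x assume c: "c \<in> bispan_hom G X Y" and x: "x \<in> ob k X"
  then obtain S :: "('g,'g point,'g point) bispan" where S: "is_bispan G S" "src S = X" "tgt S = Y" "c = bispan_class G S"
    by (auto simp: bispan_hom_def)
  have X: "Fin X" and Y: "Fin Y" using S by (auto simp: is_bispan_def)
  note rm = res_mor_class[OF is_group H S(1)]
  let ?\<phi> = "\<lambda>p\<in>pts X. e \<otimes>\<^bsub>F\<^esub> ev X x p"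
  note \<phi> = comparison_eqfun[OF X x]
  interpret p: ring_hom_cring F L "\<lambda>x. e \<otimes>\<^bsub>F\<^esub> x" by (rule proj_hom)
  note sr = bispan_rules(5)[OF S(1), unfolded S(2)]
  have c1: "ev X x (rleg S a) \<in> carrier F" if "a \<in> pts (lmid S)" for a using ev_closed[OF X sr[OF that] x] by simp
  have c2: "finprod F (\<lambda>a. ev X x (rleg S a)) {a \<in> pts (lmid S). nleg S a = b} \<in> carrier F" for b
    using c1 by (intro F.finprod_closed) blast
  have "e \<otimes>\<^bsub>F\<^esub> ev Y (ar k c x) y = bispan_eval L S ?\<phi> y" if y: "y \<in> pts Y" for y
  proof -
    have "e \<otimes>\<^bsub>F\<^esub> ev Y (ar k c x) y = e \<otimes>\<^bsub>F\<^esub> finsum F (\<lambda>b. finprod F (\<lambda>a. ev X x (rleg S a)) {a \<in> pts (lmid S). nleg S a = b}) {b \<in> pts (rmid S). tleg S b = y}"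
      using ev_ar[OF S(1), of x y] x y S by simp
    also have "\<dots> = finsum L ((\<lambda>x. e \<otimes>\<^bsub>F\<^esub> x) \<circ> (\<lambda>b. finprod F (\<lambda>a. ev X x (rleg S a)) {a \<in> pts (lmid S). nleg S a = b})) {b \<in> pts (rmid S). tleg S b = y}"
      by (rule p.hom_finsum) (use c2 in blast)
    also have "\<dots> = finsum L (\<lambda>b. finprod L (\<lambda>a. ?\<phi> (rleg S a)) {a \<in> pts (lmid S). nleg S a = b}) {b \<in> pts (rmid S). tleg S b = y}"
    proof (rule L.finsum_cong'[OF refl])
      have "?\<phi> (rleg S a) \<in> carrier L" if "a \<in> pts (lmid S)" for a using ell.eqfunD(3)[OF \<phi> sr[OF that]] .
      then show "(\<lambda>b. finprod L (\<lambda>a. ?\<phi> (rleg S a)) {a \<in> pts (lmid S). nleg S a = b}) \<in> {b \<in> pts (rmid S). tleg S b = y} \<rightarrow> carrier L"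
        by (intro Pi_I L.finprod_closed) blast
      fix b
      have "((\<lambda>x. e \<otimes>\<^bsub>F\<^esub> x) \<circ> (\<lambda>b. finprod F (\<lambda>a. ev X x (rleg S a)) {a \<in> pts (lmid S). nleg S a = b})) b
        = finprod L ((\<lambda>x. e \<otimes>\<^bsub>F\<^esub> x) \<circ> (\<lambda>a. ev X x (rleg S a))) {a \<in> pts (lmid S). nleg S a = b}"
        unfolding o_apply by (subst p.hom_finprod) (use c1 in \<open>blast, simp add: o_def\<close>)
      also have "\<dots> = finprod L (\<lambda>a. ?\<phi> (rleg S a)) {a \<in> pts (lmid S). nleg S a = b}"
        by (rule L.finprod_cong'[OF refl]) (use sr L_closed(6)[OF c1] in \<open>simp_all add: Pi_def\<close>)
      finally show "((\<lambda>x. e \<otimes>\<^bsub>F\<^esub> x) \<circ> (\<lambda>b. finprod F (\<lambda>a. ev X x (rleg S a)) {a \<in> pts (lmid S). nleg S a = b})) b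
        = finprod L (\<lambda>a. ?\<phi> (rleg S a)) {a \<in> pts (lmid S). nleg S a = b}" .
    qed
    also have "\<dots> = bispan_eval L S ?\<phi> y" using y S(3) by (simp add: bispan_eval_def)
    finally show ?thesis .
  qed
  then have "(\<lambda>y\<in>pts Y. e \<otimes>\<^bsub>F\<^esub> ev Y (ar k c x) y) = bispan_eval L S ?\<phi>"
    using S(3) by (auto simp: bispan_eval_def fun_eq_iff)
  then show "comparison Y (ar k c x) = ar (coind G H ell.fixed_functor) c (comparison X x)"
    using ell.ar_fixed(2)[OF rm(1), of ?\<phi>] \<phi> S x ar_closed[OF c x] rm(2) by (simp add: comparison_def coind_def)
qed

text \<open>
  The elements y with this property form a G-stable ideal that does not contain 1.
\<close>

lemma projection_determines:
  assumes y: "y \<in> carrier F" and z: "\<And>g. g \<in> carrier G \<Longrightarrow> e \<otimes>\<^bsub>F\<^esub> gact g y = \<zero>\<^bsub>F\<^esub>"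
  shows "y = \<zero>\<^bsub>F\<^esub>"
proof -
  let ?J = "{y \<in> carrier F. \<forall>g\<in>carrier G. e \<otimes>\<^bsub>F\<^esub> gact g y = \<zero>\<^bsub>F\<^esub>}"
  note r = gact_ring_hom
  have h: "ring_hom_cring F F (gact g)" if "g \<in> carrier G" for g by unfold_locales (rule r[OF that])
  note h = ring_hom_closed[OF r] ring_hom_mult[OF r] ring_hom_add[OF r] ring_hom_one[OF r] ring_hom_cring.hom_zero[OF h] ring_hom_cring.hom_a_inv[OF h]
  have "ideal ?J F"
  proof (rule idealI[OF F.ring_axioms])
    show "subgroup ?J (add_monoid F)"
    proof (rule F.add.subgroupI)
      have "\<zero>\<^bsub>F\<^esub> \<in> ?J" using F.zero_closed by (simp add: h(5) F.r_null[OF e_carrier])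
      then show "?J \<noteq> {}" by blast
      show "\<ominus>\<^bsub>F\<^esub> a \<in> ?J" if "a \<in> ?J" for a
        using that h(1,6) F.r_minus[OF e_carrier] F.a_inv_closed F.minus_zero by simp
      show "a \<oplus>\<^bsub>F\<^esub> b \<in> ?J" if "a \<in> ?J" "b \<in> ?J" for a b
        using that h(1,3) F.r_distr[OF _ _ e_carrier] F.a_closed F.r_zero[OF F.zero_closed] by simp
    qed auto
    show "x \<otimes>\<^bsub>F\<^esub> a \<in> ?J" if a: "a \<in> ?J" and x: "x \<in> carrier F" for a x
    proof -
      have "e \<otimes>\<^bsub>F\<^esub> gact g (x \<otimes>\<^bsub>F\<^esub> a) = \<zero>\<^bsub>F\<^esub>" if g: "g \<in> carrier G" for g
        using a h(1)[OF g] h(2)[OF g x] F.m_lcomm[OF e_carrier h(1)[OF g x], of "gact g a"] F.r_null[OF h(1)[OF g x]] g by simp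
      then show ?thesis using a F.m_closed[OF x] by simp
    qed
    then show "a \<otimes>\<^bsub>F\<^esub> x \<in> ?J" if "a \<in> ?J" "x \<in> carrier F" for a x using that F.m_comm[of a x] by simp
  qed
  moreover have "gact g x \<in> ?J" if "g \<in> carrier G" "x \<in> ?J" for g x
    using that h(1) gact_mult[of _ g x] by (simp, metis m_closed)
  moreover have "\<one>\<^bsub>F\<^esub> \<notin> ?J" using h(4)[OF one_closed] F.r_one[OF e_carrier] e_nonzero one_closed by force
  ultimately have "?J = {\<zero>\<^bsub>F\<^esub>}" by (rule F_simple)
  then show ?thesis using y z by blast
qed

text \<open>
  The summand g \<psi>(inv g p) for the coset z = g H. It does not depend on the choice of g because \<psi> is
  H-equivariant (translate_simp).
\<close>

definition translate :: "('g point \<Rightarrow> 'r) \<Rightarrow> 'g objct \<Rightarrow> 'g point \<Rightarrow> 'g point \<Rightarrow> 'r" where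
  "translate \<psi> X z p = (let a = (SOME a. a \<in> carrier G \<and> z = Coset (a <# H)) in gact a (\<psi> (act X (inv a) p)))"

lemma translate_simp:
  assumes X: "Fin X" and \<psi>: "\<psi> \<in> ell.eqfun X" and p: "p \<in> pts X" and a: "a \<in> carrier G"
  shows "translate \<psi> X (Coset (a <# H)) p = gact a (\<psi> (act X (inv a) p))"
proof -
  define b where "b = (SOME b. b \<in> carrier G \<and> Coset (a <# H) = Coset (b <# H))"
  have b: "b \<in> carrier G \<and> Coset (a <# H) = Coset (b <# H)" unfolding b_def by (rule someI[of _ a]) (use a in simp)
  then have bG: "b \<in> carrier G" and h: "inv a \<otimes> b \<in> H" using l_coset_eq_iff[OF H a] by blast+
  have p': "act X (inv a) p \<in> pts X" "act X (inv b) p \<in> pts X" using finite_gsetD(2)[OF is_group X _ p] a bG by auto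
  have "act X (inv a) p = act X (inv a \<otimes> b) (act X (inv b) p)"
    using finite_gsetD(4)[OF is_group X, of "inv a \<otimes> b" "inv b" p] a bG p by (simp add: m_assoc)
  then have "\<psi> (act X (inv a) p) = gact (inv a \<otimes> b) (\<psi> (act X (inv b) p))"
    using ell.eqfunD(5)[OF \<psi>, of "inv a \<otimes> b"] h p'(2) by simp
  moreover have "\<psi> (act X (inv b) p) \<in> ob k Ge" using ell.eqfunD(3)[OF \<psi> p'(2)] by (simp add: L_simps)
  ultimately have "gact a (\<psi> (act X (inv a) p)) = gact b (\<psi> (act X (inv b) p))"
    using gact_mult[of a "inv a \<otimes> b" "\<psi> (act X (inv b) p)"] a bG by (simp add: m_assoc[symmetric])
  then show ?thesis unfolding translate_def Let_def b_def[symmetric] by simp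
qed

lemma translate_act:
  assumes X: "Fin X" and \<psi>: "\<psi> \<in> ell.eqfun X" and p: "p \<in> pts X" and g: "g \<in> carrier G" and z: "z \<in> pts (orbit_gset G H)"
  shows "translate \<psi> X (act (orbit_gset G H) g z) (act X g p) = gact g (translate \<psi> X z p)"
proof -
  obtain a where a: "a \<in> carrier G" "z = Coset (a <# H)" using z by (auto simp: orbit_pts)
  have p': "act X (inv a) p \<in> pts X" "act X g p \<in> pts X" using finite_gsetD(2)[OF is_group X _ p] a g by auto
  have "act X (inv (g \<otimes> a)) (act X g p) = act X (inv a) p"
    using finite_gsetD(4)[OF is_group X, of "inv (g \<otimes> a)" g p] a(1) g p by (simp add: inv_mult_group m_assoc)
  moreover have "\<psi> (act X (inv a) p) \<in> ob k Ge" using ell.eqfunD(3)[OF \<psi> p'(1)] by (simp add: L_simps)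
  ultimately show ?thesis
    using translate_simp[OF X \<psi> p'(2), of "g \<otimes> a"] translate_simp[OF X \<psi> p a(1)] gact_mult[OF g a(1)] a g by (simp add: orbit_act[OF H])
qed

lemma translate_closed:
  assumes X: "Fin X" and \<psi>: "\<psi> \<in> ell.eqfun X" and p: "p \<in> pts X" and z: "z \<in> pts (orbit_gset G H)"
  shows "translate \<psi> X z p \<in> carrier F"
proof -
  obtain a where a: "a \<in> carrier G" "z = Coset (a <# H)" using z by (auto simp: orbit_pts)
  have p': "act X (inv a) p \<in> pts X" using finite_gsetD(2)[OF is_group X _ p] a by auto
  then show ?thesis using translate_simp[OF X \<psi> p a(1)] gact_closed[OF a(1)] ell.eqfunD(3)[OF \<psi> p'] a(2) by (simp add: L_simps)
qed

text \<open>
  For z = g H, an element s of the stabilizer of p fixes z exactly if the conjugate inv g s g lies in H, and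
  that conjugate fixes inv g p.
\<close>

lemma translate_Fsub:
  assumes X: "Fin X" and \<psi>: "\<psi> \<in> ell.eqfun X" and p: "p \<in> pts X" and z: "z \<in> pts (orbit_gset G H)"
  shows "translate \<psi> X z p \<in> Fsub (stab (sub_group G (stab G X p)) (orbit_gset G H) z)"
proof -
  obtain a where a: "a \<in> carrier G" "z = Coset (a <# H)" using z by (auto simp: orbit_pts)
  let ?K = "stab G X p" and ?q = "act X (inv a) p"
  have q: "?q \<in> pts X" using finite_gsetD(2)[OF is_group X _ p] a by auto
  note K = stab_subgroup[OF X p]
  interpret K: group "sub_group G ?K" by (rule subgroup.subgroup_is_group[OF K is_group])
  note Z = fin_orbit[OF H]
  have S: "subgroup (stab (sub_group G ?K) (orbit_gset G H) z) G"
    by (rule incl_subgroup[OF K K.stab_subgroup[OF restrict_subgroup_gset[OF is_group K Z] z]])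
  note J = GH_subgroup[OF ell.stab_subgroup[OF restrict_subgroup_gset[OF is_group H X] q]]
  have "gact a (\<psi> ?q) \<in> Fsub (stab (sub_group G ?K) (orbit_gset G H) z)"
  proof (rule Fsub_gact[OF J S _ a(1)])
    show "\<psi> ?q \<in> Fsub (stab GH X ?q)" using ell.eqfunD(4)[OF \<psi> q] by (simp add: Lsub_def)
    fix s assume "s \<in> stab (sub_group G ?K) (orbit_gset G H) z"
    then have s: "s \<in> carrier G" "act X s p = p" "Coset ((s \<otimes> a) <# H) = Coset (a <# H)"
      using orbit_act[OF H _ a(1), of s] a(2) by (auto simp: stab_def)
    have "inv a \<otimes> (s \<otimes> a) \<in> H" using l_coset_eq_iff[OF H a(1), of "s \<otimes> a"] s a(1) by simp
    then have h: "inv a \<otimes> s \<otimes> a \<in> H" using s a by (simp add: m_assoc)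
    have "act X (inv a \<otimes> s \<otimes> a) ?q = act X (inv a) (act X s (act X a ?q))"
      using finite_gsetD(4)[OF is_group X, of "inv a \<otimes> s" a ?q] finite_gsetD(4)[OF is_group X, of "inv a" s "act X a ?q"]
        finite_gsetD(2)[OF is_group X a(1) q] q s a by simp
    then have "act X (inv a \<otimes> s \<otimes> a) ?q = ?q" using finite_gsetD(6)[OF is_group X a(1) p] s by simp
    then show "inv a \<otimes> s \<otimes> a \<in> stab GH X ?q" using h H_carrier by (simp add: stab_def)
  qed
  then show ?thesis using translate_simp[OF X \<psi> p a(1)] a(2) by simp
qed

text \<open>
  Summing the translates of \<psi> over G/H gives a G-equivariant function. Multiplication by e removes all
  summands but the one of the coset H, since \<psi> takes its values in eF and e is orthogonal to its
  translates by elements outside H.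
\<close>

lemma comparison_surjective:
  assumes X: "Fin X" and \<psi>: "\<psi> \<in> ell.eqfun X"
  shows "\<exists>x\<in>ob k X. \<forall>p\<in>pts X. e \<otimes>\<^bsub>F\<^esub> ev X x p = \<psi> p"
proof -
  let ?Z = "orbit_gset G H"
  note Z = fin_orbit[OF H]
  define \<phi> where "\<phi> p = finsum F (\<lambda>z. translate \<psi> X z p) (pts ?Z)" for p
  have "\<exists>!x. x \<in> ob k X \<and> (\<forall>p\<in>pts X. ev X x p = \<phi> p)"
  proof (rule ev_bijective[OF X])
    fix p assume p: "p \<in> pts X"
    note K = stab_subgroup[OF X p]
    show "\<phi> p \<in> Fsub (stab G X p)"
      unfolding \<phi>_def
    proof (rule Fsub_sum_prod(2)[OF K restrict_subgroup_gset[OF is_group K Z]])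
      show "translate \<psi> X (act ?Z g z) p = gact g (translate \<psi> X z p)" if "g \<in> stab G X p" "z \<in> pts ?Z" for g z
        using translate_act[OF X \<psi> p _ that(2), of g] that(1) by (simp add: stab_def)
    qed (rule translate_Fsub[OF X \<psi> p])
    fix g assume g: "g \<in> carrier G"
    interpret g: ring_hom_cring F F "gact g" by unfold_locales (rule gact_ring_hom[OF g])
    note gp = finite_gsetD(2)[OF is_group X g p]
    have im: "act ?Z g ` pts ?Z = pts ?Z"
    proof
      show "pts ?Z \<subseteq> act ?Z g ` pts ?Z"
      proof
        fix z assume z: "z \<in> pts ?Z"
        then show "z \<in> act ?Z g ` pts ?Z"
          using finite_gsetD(6)[OF is_group Z g z] finite_gsetD(2)[OF is_group Z inv_closed[OF g] z] by (metis imageI)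
      qed
    qed (use finite_gsetD(2)[OF is_group Z g] in auto)
    have inj: "inj_on (act ?Z g) (pts ?Z)"
      by (rule inj_on_inverseI[of _ "act ?Z (inv g)"]) (rule finite_gsetD(5)[OF is_group Z g])
    have "\<phi> (act X g p) = finsum F (\<lambda>z. translate \<psi> X z (act X g p)) (act ?Z g ` pts ?Z)" unfolding \<phi>_def im ..
    also have "\<dots> = finsum F (\<lambda>z. translate \<psi> X (act ?Z g z) (act X g p)) (pts ?Z)"
      by (rule F.finsum_reindex[OF _ inj]) (use translate_closed[OF X \<psi> gp] im in blast)
    also have "\<dots> = finsum F (gact g \<circ> (\<lambda>z. translate \<psi> X z p)) (pts ?Z)"
      by (rule F.finsum_cong'[OF refl]) (use translate_act[OF X \<psi> p g] ring_hom_closed[OF gact_ring_hom[OF g] translate_closed[OF X \<psi> p]] in \<open>simp_all add: Pi_def\<close>)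
    also have "\<dots> = gact g (\<phi> p)" unfolding \<phi>_def by (rule g.hom_finsum[symmetric]) (use translate_closed[OF X \<psi> p] in blast)
    finally show "\<phi> (act X g p) = gact g (\<phi> p)" .
  qed
  then obtain x where x: "x \<in> ob k X" "\<And>p. p \<in> pts X \<Longrightarrow> ev X x p = \<phi> p" by blast
  have "e \<otimes>\<^bsub>F\<^esub> \<phi> p = \<psi> p" if p: "p \<in> pts X" for p
  proof -
    have BH: "Coset H \<in> pts ?Z" by (rule orbit_base_in[OF H])
    have \<psi>p: "\<psi> p \<in> carrier L" by (rule ell.eqfunD(3)[OF \<psi> p])
    have 1: "translate \<psi> X (Coset H) p = \<psi> p"
      using translate_simp[OF X \<psi> p one_closed] orbit_base[OF H] finite_gsetD(3)[OF is_group X p] gact_one \<psi>p by (simp add: L_simps)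
    have 2: "e \<otimes>\<^bsub>F\<^esub> translate \<psi> X z p = \<zero>\<^bsub>F\<^esub>" if z: "z \<in> pts ?Z" "z \<noteq> Coset H" for z
    proof -
      obtain a where a: "a \<in> carrier G" "z = Coset (a <# H)" using z by (auto simp: orbit_pts)
      have aH: "a \<notin> H" using z(2) a l_coset_eq_iff[OF H one_closed a(1)] orbit_base[OF H] by auto
      have p': "act X (inv a) p \<in> pts X" using finite_gsetD(2)[OF is_group X _ p] a by auto
      define y where "y = \<psi> (act X (inv a) p)"
      have y: "y \<in> carrier F" "e \<otimes>\<^bsub>F\<^esub> y = y" using ell.eqfunD(3)[OF \<psi> p'] by (simp_all add: y_def L_simps)
      note r = gact_ring_hom[OF a(1)]
      have "e \<otimes>\<^bsub>F\<^esub> gact a y = (e \<otimes>\<^bsub>F\<^esub> gact a e) \<otimes>\<^bsub>F\<^esub> gact a y"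
        using ring_hom_mult[OF r e_carrier y(1)] y(2) F.m_assoc[OF e_carrier ring_hom_closed[OF r e_carrier] ring_hom_closed[OF r y(1)]] by simp
      also have "\<dots> = \<zero>\<^bsub>F\<^esub>" using e_orth[OF a(1) aH] F.l_null[OF ring_hom_closed[OF r y(1)]] by simp
      finally show ?thesis using translate_simp[OF X \<psi> p a(1)] a(2) by (simp add: y_def)
    qed
    have "e \<otimes>\<^bsub>F\<^esub> \<phi> p = finsum F (\<lambda>z. e \<otimes>\<^bsub>F\<^esub> translate \<psi> X z p) (pts ?Z)"
      unfolding \<phi>_def by (rule F.finsum_rdistr[OF finite_gsetD(1)[OF is_group Z] e_carrier]) (use translate_closed[OF X \<psi> p] in blast)
    also have "\<dots> = finsum F (\<lambda>z. if Coset H = z then \<psi> p else \<zero>\<^bsub>F\<^esub>) (pts ?Z)"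
      by (rule F.finsum_cong'[OF refl]) (use 1 2 \<psi>p L_carrier_F[OF \<psi>p] F.zero_closed in \<open>auto simp: L_simps\<close>)
    also have "\<dots> = \<psi> p"
      using F.finsum_singleton[OF BH finite_gsetD(1)[OF is_group Z], of "\<lambda>_. \<psi> p"] L_carrier_F[OF \<psi>p] by simp
    finally show ?thesis .
  qed
  then show ?thesis using x by (intro bexI[of _ x]) auto
qed

lemma comparison_bij:
  assumes X: "Fin X" shows "bij_betw (comparison X) (ob k X) (ob (coind G H ell.fixed_functor) X)"
  unfolding bij_betw_def
proof
  note XH = restrict_subgroup_gset[OF is_group H X]
  note i = ell.enc_inj_eqfun[OF XH]
  show "inj_on (comparison X) (ob k X)"
  proof (rule inj_onI)
    fix x x' assume x: "x \<in> ob k X" and x': "x' \<in> ob k X" and eq: "comparison X x = comparison X x'"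
    have ee: "(\<lambda>p\<in>pts X. e \<otimes>\<^bsub>F\<^esub> ev X x p) = (\<lambda>p\<in>pts X. e \<otimes>\<^bsub>F\<^esub> ev X x' p)"
      using eq x x' by (intro inj_onD[OF i _ comparison_eqfun[OF X x] comparison_eqfun[OF X x']]) (simp add: comparison_def)
    have e: "e \<otimes>\<^bsub>F\<^esub> ev X x p = e \<otimes>\<^bsub>F\<^esub> ev X x' p" if "p \<in> pts X" for p
      using fun_cong[OF ee, of p] that by simp
    have c: "ev X x p \<in> carrier F" "ev X x' p \<in> carrier F" if "p \<in> pts X" for p using ev_closed[OF X that] x x' by simp_all
    have ev: "ev X x p = ev X x' p" if p: "p \<in> pts X" for p
    proof -
      let ?y = "ev X x p \<oplus>\<^bsub>F\<^esub> \<ominus>\<^bsub>F\<^esub> ev X x' p"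
      have nc: "\<ominus>\<^bsub>F\<^esub> ev X x' p \<in> carrier F" by (rule F.a_inv_closed[OF c(2)[OF p]])
      have "?y = \<zero>\<^bsub>F\<^esub>"
      proof (rule projection_determines)
        show "?y \<in> carrier F" by (rule F.a_closed[OF c(1)[OF p] nc])
        fix g assume g: "g \<in> carrier G"
        interpret g: ring_hom_cring F F "gact g" by unfold_locales (rule gact_ring_hom[OF g])
        note gp = finite_gsetD(2)[OF is_group X g p]
        have "gact g ?y = ev X x (act X g p) \<oplus>\<^bsub>F\<^esub> \<ominus>\<^bsub>F\<^esub> ev X x' (act X g p)"
          using g.hom_add[OF c(1)[OF p] nc] g.hom_a_inv[OF c(2)[OF p]] ev_act[OF X p x g] ev_act[OF X p x' g] by simp
        then have "e \<otimes>\<^bsub>F\<^esub> gact g ?y = e \<otimes>\<^bsub>F\<^esub> ev X x (act X g p) \<oplus>\<^bsub>F\<^esub> \<ominus>\<^bsub>F\<^esub> (e \<otimes>\<^bsub>F\<^esub> ev X x' (act X g p))"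
          using F.r_distr[OF c(1)[OF gp] F.a_inv_closed[OF c(2)[OF gp]] e_carrier] F.r_minus[OF e_carrier c(2)[OF gp]] by simp
        then show "e \<otimes>\<^bsub>F\<^esub> gact g ?y = \<zero>\<^bsub>F\<^esub>" using e[OF gp] F.r_neg[OF F.m_closed[OF e_carrier c(2)[OF gp]]] by simp
      qed
      from F.minus_equality[OF this nc c(1)[OF p]] show ?thesis using F.minus_minus[OF c(2)[OF p]] by simp
    qed
    have "\<exists>!z. z \<in> ob k X \<and> (\<forall>p\<in>pts X. ev X z p = ev X x p)"
      by (rule ev_bijective[OF X]) (use ev_in_Fsub[OF X _ x stab_subgroup[OF X]] ev_act[OF X _ x] in auto)
    then show "x = x'" using x x' ev by metis
  qed
  show "comparison X ` ob k X = ob (coind G H ell.fixed_functor) X"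
  proof
    show "comparison X ` ob k X \<subseteq> ob (coind G H ell.fixed_functor) X"
      using comparison_eqfun[OF X] by (auto simp: comparison_def coind_def ell.ob_fixed)
    show "ob (coind G H ell.fixed_functor) X \<subseteq> comparison X ` ob k X"
    proof
      fix r assume "r \<in> ob (coind G H ell.fixed_functor) X"
      then obtain \<psi> where \<psi>: "r = enc X \<psi>" "\<psi> \<in> ell.eqfun X" by (auto simp: coind_def ell.ob_fixed)
      obtain x where x: "x \<in> ob k X" "\<And>p. p \<in> pts X \<Longrightarrow> e \<otimes>\<^bsub>F\<^esub> ev X x p = \<psi> p" using comparison_surjective[OF X \<psi>(2)] by blast
      have "(\<lambda>p\<in>pts X. e \<otimes>\<^bsub>F\<^esub> ev X x p) = \<psi>" by (rule ell.eqfun_eqI[OF comparison_eqfun[OF X x(1)] \<psi>(2)]) (simp add: x(2))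
      then show "r \<in> comparison X ` ob k X" using x(1) \<psi>(1) by (intro image_eqI[of _ _ x]) (simp_all add: comparison_def)
    qed
  qed
qed

lemma iso_coind: "tambara_iso G k (coind G H ell.fixed_functor)"
  by (rule tambara_iso_of_bijections[OF comparison_hom comparison_bij]) (auto intro: ar_closed)

end

lemma (in tambara_field) exists_splitting: "\<exists>H e. splitting G k H e"
proof -
  interpret F: cring F by (rule F_cring)
  have one: "gact \<one> x = x" if "x \<in> carrier F" for x using gact_one that by simp
  have mult: "gact (g \<otimes> h) x = gact g (gact h x)" if "g \<in> carrier G" "h \<in> carrier G" "x \<in> carrier F" for g h x
    using gact_mult that by simp
  show ?thesis
  proof (rule F.exists_splitting_idempotent[OF is_group finite_group gact_ring_hom one mult F_nonzero F_simple])
    fix H e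
    assume "subgroup H G" "e \<in> carrier F" "e \<noteq> \<zero>\<^bsub>F\<^esub>" "e \<otimes>\<^bsub>F\<^esub> e = e" "\<And>h. h \<in> H \<Longrightarrow> gact h e = e"
      "\<And>g. g \<in> carrier G \<Longrightarrow> g \<notin> H \<Longrightarrow> e \<otimes>\<^bsub>F\<^esub> gact g e = \<zero>\<^bsub>F\<^esub>"
      "\<And>x. x \<in> carrier F \<Longrightarrow> e \<otimes>\<^bsub>F\<^esub> x \<noteq> \<zero>\<^bsub>F\<^esub> \<Longrightarrow> \<exists>y\<in>carrier F. e \<otimes>\<^bsub>F\<^esub> (x \<otimes>\<^bsub>F\<^esub> y) = e"
    then have "splitting G k H e" by (intro splitting.intro splitting_axioms.intro tambara_field_axioms) simp_all
    then show ?thesis by blast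
  qed
qed

theorem corollary2:
  fixes G :: "('g, 'm) monoid_scheme" and k :: "('g, 'r) bfunctor"
  assumes "group G" and "finite (carrier G)" and "field_like G k"
  shows "\<exists>H. \<exists>l :: ('g, 'r) bfunctor.
           subgroup H G \<and>
           field_like (sub_group G H) l \<and>
           field (level (sub_group G H) l (orbit_gset (sub_group G H) {\<one>\<^bsub>G\<^esub>})) \<and>
           tambara_iso G k (coind G H l)"
proof -
  interpret group G by fact
  interpret tambara_field G k
    using assms by unfold_locales (simp_all add: field_like_def)
  obtain H e where "splitting G k H e" using exists_splitting by blast
  then interpret splitting G k H e .
  show ?thesis
    using H ell.fixed_field_like ell.bottom_field iso_coind by auto
qed

end
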